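(* Let $L,T,\lambda,\overline U_0>0$ be constants with $\overline U_0<\lambda^{-1}$, and let $f,g$ on $(0,L)\times(0,T)$ and $u_0,\psi_0$ on $(0,L)$ be given functions independent of $\varepsilon$. Assume that for each small $\varepsilon>0$ the pair $(u^\varepsilon,\psi^\varepsilon)\in\mathcal K$ is a solution of the viscous problem $(P_\varepsilon)$, and that $(u^0,\psi^0)\in\mathcal K^0$ is a solution of the limit problem $(P_0)$ with the same data $f,g,u_0,\psi_0$. Set $$U^\varepsilon=u^\varepsilon-u^0-\theta_u^\varepsilon,\qquad \Psi^\varepsilon=\psi^\varepsilon-\psi^0-\theta_\psi^\varepsilon,$$ where $\theta_u^\varepsilon,\theta_\psi^\varepsilon$ are the boundary layer correctors associated with $u^0$. Then there exist $\varepsilon_0>0$ and a constant $C$ independent of $\varepsilon$ such that for all $\varepsilon\in(0,\varepsilon_0]$ $$\|(U^\varepsilon,\Psi^\varepsilon)\|_{L^\infty(0,T;L^2(0,L))}+\varepsilon^{1/2}\|(U^\varepsilon_x,\Psi^\varepsilon_x)\|_{L^2((0,L)\times(0,T))}\le C\varepsilon,$$ $$\|(U^\varepsilon,\Psi^\varepsilon)\|_{L^\infty(0,T;L^\infty(0,L))}\le C\varepsilon^{1/2}.$$ ($\mathcal K$, $\mathcal K^0$, $(P_\varepsilon)$, $(P_0)$, $\theta_u^\varepsilon$, $\theta_\psi^\varepsilon$ are defined in the context.)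
   Context: Subscripts $x,t$ denote partial derivatives; equations hold almost everywhere in $(0,L)\times(0,T)$; the norm of a tuple is the sum of the norms of its components. Problem $(P_\varepsilon)$, in $(0,L)\times(0,T)$: $$u^\varepsilon_t+\overline U_0u^\varepsilon_x+\psi^\varepsilon_x-2\varepsilon u^\varepsilon_{xx}=f,\qquad \psi^\varepsilon_t+\overline U_0\psi^\varepsilon_x+\lambda^{-2}u^\varepsilon_x=g,$$ with $u^\varepsilon(0,t)=u^\varepsilon(L,t)=0$, $\psi^\varepsilon(0,t)=0$ for $0<t<T$, and $u^\varepsilon(x,0)=u_0(x)$, $\psi^\varepsilon(x,0)=\psi_0(x)$ for $0<x<L$. Problem $(P_0)$, in $(0,L)\times(0,T)$: $$u^0_t+\overline U_0u^0_x+\psi^0_x=f,\qquad \psi^0_t+\overline U_0\psi^0_x+\lambda^{-2}u^0_x=g,$$ with $u^0(0,t)+\overline U_0\lambda^2\psi^0(0,t)=0$, $u^0(L,t)=0$ for $0<t<T$, and $u^0(x,0)=u_0(x)$, $\psi^0(x,0)=\psi_0(x)$ for $0<x<L$. Function spaces. $H=L^2(0,L)\times L^2(0,L)$; $D(A)=\{(u,\psi)\in H : u_x,\psi_x,u_{xx}\in L^2(0,L),\ u(0)=\psi(0)=u(L)=0\}$; $D(A^0)=\{(u,\psi)\in H : u_x,\psi_x\in L^2(0,L),\ u(0)+\overline U_0\lambda^2\psi(0)=0,\ u(L)=0\}$; $\mathcal F=C([0,T];H)\cap L^\infty(0,T;D(A))$; $\mathcal F^0=C([0,T];H)\cap L^\infty(0,T;D(A^0))$;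 $\mathcal K=\{(u,\psi)\in\mathcal F : \psi_{xt},\psi_{xx}\in L^\infty(0,T;L^2(0,L)),\ (u_t,\psi_t)\in C([0,T];H)\}$; $\mathcal K^0=\{(u,\psi)\in\mathcal F^0 : \psi_{xt},u_{xx},\psi_{xx}\in L^\infty(0,T;L^2(0,L)),\ (u_t,\psi_t)\in C([0,T];H)\}$. Boundary layer correctors. Let $r=\frac{1}{2\overline U_0\lambda^2}-\frac{\overline U_0}{2}>0$ and $$\theta_u^\varepsilon(x,t)=e^{-rx/\varepsilon}A^\varepsilon(t)+C^\varepsilon(t),\qquad \theta_\psi^\varepsilon(x,t)=e^{-rx/\varepsilon}B^\varepsilon(t)+D^\varepsilon(t),$$ $$A^\varepsilon(t)=-(1-e^{-rL/\varepsilon})^{-1}u^0(0,t),\qquad B^\varepsilon(t)=\overline U_0^{-1}\lambda^{-2}(1-e^{-rL/\varepsilon})^{-1}u^0(0,t),$$ $$C^\varepsilon(t)=e^{-rL/\varepsilon}(1-e^{-rL/\varepsilon})^{-1}u^0(0,t),\qquad D^\varepsilon(t)=-\overline U_0^{-1}\lambda^{-2}e^{-rL/\varepsilon}(1-e^{-rL/\varepsilon})^{-1}u^0(0,t).$$ *)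

theory Defs
  imports "HOL-Analysis.Analysis" "HOL-Probability.Essential_Supremum"
begin

text \<open>Functions on the space-time cylinder are functions of the pair \<open>(x, t)\<close>. They stand for
  classes modulo null sets, except that an element of \<open>C([0,T]; H)\<close> has a prescribed class of
  functions of \<open>x\<close> at every time \<open>t\<close>.\<close>

definition Q :: "real \<Rightarrow> real \<Rightarrow> (real \<times> real) set" where
  "Q L T = {0<..<L} \<times> {0<..<T}"

section \<open>Norms\<close>

definition L2_norm :: "'a::euclidean_space set \<Rightarrow> ('a \<Rightarrow> real) \<Rightarrow> ennreal" where
  "L2_norm S w =
    (if w \<in> borel_measurable (lebesgue_on S) \<and> integrable (lebesgue_on S) (\<lambda>z. (w z)\<^sup>2)
     then ennreal (sqrt (LINT z|lebesgue_on S. (w z)\<^sup>2)) else \<infinity>)"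

definition L2 :: "'a::euclidean_space set \<Rightarrow> ('a \<Rightarrow> real) set" where
  "L2 S = {w. L2_norm S w < \<infinity>}"

definition Linf_L2_norm :: "real \<Rightarrow> real \<Rightarrow> (real \<times> real \<Rightarrow> real) \<Rightarrow> ennreal" where
  "Linf_L2_norm L T w =
    esssup (lebesgue_on {0<..<T}) (\<lambda>t. L2_norm {0<..<L} (\<lambda>x. w (x, t)))"

definition Linf_Linf_norm :: "real \<Rightarrow> real \<Rightarrow> (real \<times> real \<Rightarrow> real) \<Rightarrow> ennreal" where
  "Linf_Linf_norm L T w =
    esssup (lebesgue_on {0<..<T})
      (\<lambda>t. esssup (lebesgue_on {0<..<L}) (\<lambda>x. ennreal \<bar>w (x, t)\<bar>))"

text \<open>Since \<open>L\<^sup>2(0,L)\<close> is separable, strong measurability of the vector-valued map is joint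
  measurability.\<close>

definition Linf_L2 :: "real \<Rightarrow> real \<Rightarrow> (real \<times> real \<Rightarrow> real) set" where
  "Linf_L2 L T =
    {w. w \<in> borel_measurable (lebesgue_on (Q L T)) \<and> Linf_L2_norm L T w < \<infinity>}"

definition C_L2 :: "real \<Rightarrow> real \<Rightarrow> (real \<times> real \<Rightarrow> real) set" where
  "C_L2 L T =
    {w. \<forall>t\<in>{0..T}. (\<lambda>x. w (x, t)) \<in> L2 {0<..<L} \<and>
        ((\<lambda>s. L2_norm {0<..<L} (\<lambda>x. w (x, s) - w (x, t))) \<longlongrightarrow> 0) (at t within {0..T})}"

section \<open>Weak derivatives\<close>

primrec Ck :: "nat \<Rightarrow> ('a::euclidean_space \<Rightarrow> real) \<Rightarrow> bool" where
  "Ck 0 \<phi> \<longleftrightarrow> continuous_on UNIV \<phi>"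
| "Ck (Suc k) \<phi> \<longleftrightarrow>
     \<phi> differentiable_on UNIV \<and> (\<forall>e. Ck k (\<lambda>z. frechet_derivative \<phi> (at z) e))"

definition test_function :: "'a::euclidean_space set \<Rightarrow> ('a \<Rightarrow> real) \<Rightarrow> bool" where
  "test_function S \<phi> \<longleftrightarrow>
    (\<forall>k. Ck k \<phi>) \<and> compact (closure {z. \<phi> z \<noteq> 0}) \<and> closure {z. \<phi> z \<noteq> 0} \<subseteq> S"

definition loc_integrable :: "'a::euclidean_space set \<Rightarrow> ('a \<Rightarrow> real) \<Rightarrow> bool" where
  "loc_integrable S w \<longleftrightarrow> (\<forall>K. compact K \<and> K \<subseteq> S \<longrightarrow> set_integrable lebesgue K w)"

text \<open>\<open>v\<close> is the distributional derivative of \<open>w\<close> in the direction \<open>e\<close> on the open set \<open>S\<close>.\<close>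

definition has_weak_deriv ::
    "'a::euclidean_space set \<Rightarrow> 'a \<Rightarrow> ('a \<Rightarrow> real) \<Rightarrow> ('a \<Rightarrow> real) \<Rightarrow> bool" where
  "has_weak_deriv S e w v \<longleftrightarrow>
    loc_integrable S w \<and> loc_integrable S v \<and>
    (\<forall>\<phi>. test_function S \<phi> \<longrightarrow>
      (LINT z:S|lebesgue. w z * frechet_derivative \<phi> (at z) e) =
      - (LINT z:S|lebesgue. v z * \<phi> z))"

abbreviation weak_x :: "real \<Rightarrow> real \<Rightarrow> (real \<times> real \<Rightarrow> real) \<Rightarrow> (real \<times> real \<Rightarrow> real) \<Rightarrow> bool" where
  "weak_x L T \<equiv> has_weak_deriv (Q L T) (1, 0)"

abbreviation weak_t :: "real \<Rightarrow> real \<Rightarrow> (real \<times> real \<Rightarrow> real) \<Rightarrow> (real \<times> real \<Rightarrow> real) \<Rightarrow> bool" where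
  "weak_t L T \<equiv> has_weak_deriv (Q L T) (0, 1)"

section \<open>Boundary values\<close>

text \<open>The value at \<open>a \<in> [0,L]\<close> of a function in \<open>H\<^sup>1(0,L)\<close> is that of its continuous
  representative on \<open>[0,L]\<close>.\<close>

definition has_trace :: "real \<Rightarrow> (real \<Rightarrow> real) \<Rightarrow> real \<Rightarrow> real \<Rightarrow> bool" where
  "has_trace L w a c \<longleftrightarrow>
    (\<exists>v. continuous_on {0..L} v \<and> (AE x in lebesgue_on {0<..<L}. v x = w x) \<and> v a = c)"

definition trace :: "real \<Rightarrow> (real \<Rightarrow> real) \<Rightarrow> real \<Rightarrow> real" where
  "trace L w a = (THE c. has_trace L w a c)"

section \<open>Function spaces\<close>

definition DA :: "real \<Rightarrow> ((real \<Rightarrow> real) \<times> (real \<Rightarrow> real)) set" where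
  "DA L = {(u, \<psi>). u \<in> L2 {0<..<L} \<and> \<psi> \<in> L2 {0<..<L} \<and>
    (\<exists>ux\<in>L2 {0<..<L}. \<exists>\<psi>x\<in>L2 {0<..<L}. \<exists>uxx\<in>L2 {0<..<L}.
      has_weak_deriv {0<..<L} 1 u ux \<and> has_weak_deriv {0<..<L} 1 \<psi> \<psi>x \<and>
      has_weak_deriv {0<..<L} 1 ux uxx) \<and>
    has_trace L u 0 0 \<and> has_trace L \<psi> 0 0 \<and> has_trace L u L 0}"

definition DA0 :: "real \<Rightarrow> real \<Rightarrow> real \<Rightarrow> ((real \<Rightarrow> real) \<times> (real \<Rightarrow> real)) set" where
  "DA0 L lam Ubar = {(u, \<psi>). u \<in> L2 {0<..<L} \<and> \<psi> \<in> L2 {0<..<L} \<and>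
    (\<exists>ux\<in>L2 {0<..<L}. \<exists>\<psi>x\<in>L2 {0<..<L}.
      has_weak_deriv {0<..<L} 1 u ux \<and> has_weak_deriv {0<..<L} 1 \<psi> \<psi>x) \<and>
    (\<exists>a b. has_trace L u 0 a \<and> has_trace L \<psi> 0 b \<and> a + Ubar * lam\<^sup>2 * b = 0) \<and>
    has_trace L u L 0}"

text \<open>\<open>D(A)\<close> and \<open>D(A\<^sup>0)\<close> carry the graph norms, i.e. the sum of the \<open>L\<^sup>2(0,L)\<close> norms of the
  functions and of the derivatives in their definitions. Measurability and essential boundedness
  in that norm mean that these derivatives, taken on the cylinder, are in
  \<open>L\<^sup>\<infinity>(0,T; L\<^sup>2(0,L))\<close>.\<close>

definition Linf_DA ::
    "real \<Rightarrow> real \<Rightarrow> ((real \<times> real \<Rightarrow> real) \<times> (real \<times> real \<Rightarrow> real)) set" where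
  "Linf_DA L T = {(u, \<psi>). u \<in> Linf_L2 L T \<and> \<psi> \<in> Linf_L2 L T \<and>
    (AE t in lebesgue_on {0<..<T}. ((\<lambda>x. u (x, t)), (\<lambda>x. \<psi> (x, t))) \<in> DA L) \<and>
    (\<exists>ux\<in>Linf_L2 L T. \<exists>\<psi>x\<in>Linf_L2 L T. \<exists>uxx\<in>Linf_L2 L T.
      weak_x L T u ux \<and> weak_x L T \<psi> \<psi>x \<and> weak_x L T ux uxx)}"

definition Linf_DA0 ::
    "real \<Rightarrow> real \<Rightarrow> real \<Rightarrow> real \<Rightarrow> ((real \<times> real \<Rightarrow> real) \<times> (real \<times> real \<Rightarrow> real)) set" where
  "Linf_DA0 L T lam Ubar = {(u, \<psi>). u \<in> Linf_L2 L T \<and> \<psi> \<in> Linf_L2 L T \<and>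
    (AE t in lebesgue_on {0<..<T}. ((\<lambda>x. u (x, t)), (\<lambda>x. \<psi> (x, t))) \<in> DA0 L lam Ubar) \<and>
    (\<exists>ux\<in>Linf_L2 L T. \<exists>\<psi>x\<in>Linf_L2 L T. weak_x L T u ux \<and> weak_x L T \<psi> \<psi>x)}"

definition space_F ::
    "real \<Rightarrow> real \<Rightarrow> ((real \<times> real \<Rightarrow> real) \<times> (real \<times> real \<Rightarrow> real)) set" where
  "space_F L T = (C_L2 L T \<times> C_L2 L T) \<inter> Linf_DA L T"

definition space_F0 ::
    "real \<Rightarrow> real \<Rightarrow> real \<Rightarrow> real \<Rightarrow> ((real \<times> real \<Rightarrow> real) \<times> (real \<times> real \<Rightarrow> real)) set" where
  "space_F0 L T lam Ubar = (C_L2 L T \<times> C_L2 L T) \<inter> Linf_DA0 L T lam Ubar"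

definition space_K ::
    "real \<Rightarrow> real \<Rightarrow> ((real \<times> real \<Rightarrow> real) \<times> (real \<times> real \<Rightarrow> real)) set" where
  "space_K L T = {(u, \<psi>). (u, \<psi>) \<in> space_F L T \<and>
    (\<exists>\<psi>x. \<exists>\<psi>xt\<in>Linf_L2 L T. \<exists>\<psi>xx\<in>Linf_L2 L T.
      weak_x L T \<psi> \<psi>x \<and> weak_t L T \<psi>x \<psi>xt \<and> weak_x L T \<psi>x \<psi>xx) \<and>
    (\<exists>ut\<in>C_L2 L T. \<exists>\<psi>t\<in>C_L2 L T. weak_t L T u ut \<and> weak_t L T \<psi> \<psi>t)}"

definition space_K0 ::
    "real \<Rightarrow> real \<Rightarrow> real \<Rightarrow> real \<Rightarrow> ((real \<times> real \<Rightarrow> real) \<times> (real \<times> real \<Rightarrow> real)) set" where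
  "space_K0 L T lam Ubar = {(u, \<psi>). (u, \<psi>) \<in> space_F0 L T lam Ubar \<and>
    (\<exists>ux \<psi>x. \<exists>\<psi>xt\<in>Linf_L2 L T. \<exists>uxx\<in>Linf_L2 L T. \<exists>\<psi>xx\<in>Linf_L2 L T.
      weak_x L T u ux \<and> weak_x L T \<psi> \<psi>x \<and>
      weak_t L T \<psi>x \<psi>xt \<and> weak_x L T ux uxx \<and> weak_x L T \<psi>x \<psi>xx) \<and>
    (\<exists>ut\<in>C_L2 L T. \<exists>\<psi>t\<in>C_L2 L T. weak_t L T u ut \<and> weak_t L T \<psi> \<psi>t)}"

section \<open>The viscous and the limit problem\<close>

text \<open>Boundary conditions are required for almost every \<open>t\<close>, where \<open>u(\<cdot>,t)\<close> and \<open>\<psi>(\<cdot>,t)\<close> have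
  traces. For pairs in \<open>\<F>\<close> or \<open>\<F>\<^sup>0\<close> they then hold for every \<open>t\<close>, by weak compactness of
  bounded sets in the domain.\<close>

definition viscous_solution ::
    "real \<Rightarrow> real \<Rightarrow> real \<Rightarrow> real \<Rightarrow> (real \<times> real \<Rightarrow> real) \<Rightarrow> (real \<times> real \<Rightarrow> real) \<Rightarrow>
     (real \<Rightarrow> real) \<Rightarrow> (real \<Rightarrow> real) \<Rightarrow> real \<Rightarrow>
     (real \<times> real \<Rightarrow> real) \<Rightarrow> (real \<times> real \<Rightarrow> real) \<Rightarrow> bool" where
  "viscous_solution L T lam Ubar f g u_init \<psi>_init \<epsilon> u \<psi> \<longleftrightarrow>
    (\<exists>ut ux uxx \<psi>t \<psi>x.
      weak_t L T u ut \<and> weak_x L T u ux \<and> weak_x L T ux uxx \<and>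
      weak_t L T \<psi> \<psi>t \<and> weak_x L T \<psi> \<psi>x \<and>
      (AE z in lebesgue_on (Q L T). ut z + Ubar * ux z + \<psi>x z - 2 * \<epsilon> * uxx z = f z) \<and>
      (AE z in lebesgue_on (Q L T). \<psi>t z + Ubar * \<psi>x z + inverse (lam\<^sup>2) * ux z = g z)) \<and>
    (AE t in lebesgue_on {0<..<T}.
      has_trace L (\<lambda>x. u (x, t)) 0 0 \<and> has_trace L (\<lambda>x. u (x, t)) L 0 \<and>
      has_trace L (\<lambda>x. \<psi> (x, t)) 0 0) \<and>
    (AE x in lebesgue_on {0<..<L}. u (x, 0) = u_init x \<and> \<psi> (x, 0) = \<psi>_init x)"

definition limit_solution ::
    "real \<Rightarrow> real \<Rightarrow> real \<Rightarrow> real \<Rightarrow> (real \<times> real \<Rightarrow> real) \<Rightarrow> (real \<times> real \<Rightarrow> real) \<Rightarrow>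
     (real \<Rightarrow> real) \<Rightarrow> (real \<Rightarrow> real) \<Rightarrow>
     (real \<times> real \<Rightarrow> real) \<Rightarrow> (real \<times> real \<Rightarrow> real) \<Rightarrow> bool" where
  "limit_solution L T lam Ubar f g u_init \<psi>_init u \<psi> \<longleftrightarrow>
    (\<exists>ut ux \<psi>t \<psi>x.
      weak_t L T u ut \<and> weak_x L T u ux \<and> weak_t L T \<psi> \<psi>t \<and> weak_x L T \<psi> \<psi>x \<and>
      (AE z in lebesgue_on (Q L T). ut z + Ubar * ux z + \<psi>x z = f z) \<and>
      (AE z in lebesgue_on (Q L T). \<psi>t z + Ubar * \<psi>x z + inverse (lam\<^sup>2) * ux z = g z)) \<and>
    (AE t in lebesgue_on {0<..<T}.
      (\<exists>a b. has_trace L (\<lambda>x. u (x, t)) 0 a \<and> has_trace L (\<lambda>x. \<psi> (x, t)) 0 b \<and>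
             a + Ubar * lam\<^sup>2 * b = 0) \<and>
      has_trace L (\<lambda>x. u (x, t)) L 0) \<and>
    (AE x in lebesgue_on {0<..<L}. u (x, 0) = u_init x \<and> \<psi> (x, 0) = \<psi>_init x)"

section \<open>Boundary layer correctors\<close>

definition layer_rate :: "real \<Rightarrow> real \<Rightarrow> real" where
  "layer_rate lam Ubar = 1 / (2 * Ubar * lam\<^sup>2) - Ubar / 2"

text \<open>The argument \<open>h\<close> is the boundary value \<open>t \<mapsto> u\<^sup>0(0,t)\<close>.\<close>

definition corr_A :: "real \<Rightarrow> real \<Rightarrow> real \<Rightarrow> real \<Rightarrow> (real \<Rightarrow> real) \<Rightarrow> real \<Rightarrow> real" where
  "corr_A L lam Ubar \<epsilon> h t =
    - inverse (1 - exp (- layer_rate lam Ubar * L / \<epsilon>)) * h t"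

definition corr_B :: "real \<Rightarrow> real \<Rightarrow> real \<Rightarrow> real \<Rightarrow> (real \<Rightarrow> real) \<Rightarrow> real \<Rightarrow> real" where
  "corr_B L lam Ubar \<epsilon> h t =
    inverse Ubar * inverse (lam\<^sup>2) * inverse (1 - exp (- layer_rate lam Ubar * L / \<epsilon>)) * h t"

definition corr_C :: "real \<Rightarrow> real \<Rightarrow> real \<Rightarrow> real \<Rightarrow> (real \<Rightarrow> real) \<Rightarrow> real \<Rightarrow> real" where
  "corr_C L lam Ubar \<epsilon> h t =
    exp (- layer_rate lam Ubar * L / \<epsilon>) *
    inverse (1 - exp (- layer_rate lam Ubar * L / \<epsilon>)) * h t"

definition corr_D :: "real \<Rightarrow> real \<Rightarrow> real \<Rightarrow> real \<Rightarrow> (real \<Rightarrow> real) \<Rightarrow> real \<Rightarrow> real" where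
  "corr_D L lam Ubar \<epsilon> h t =
    - inverse Ubar * inverse (lam\<^sup>2) * exp (- layer_rate lam Ubar * L / \<epsilon>) *
    inverse (1 - exp (- layer_rate lam Ubar * L / \<epsilon>)) * h t"

definition theta_u ::
    "real \<Rightarrow> real \<Rightarrow> real \<Rightarrow> (real \<times> real \<Rightarrow> real) \<Rightarrow> real \<Rightarrow> real \<times> real \<Rightarrow> real" where
  "theta_u L lam Ubar u0 \<epsilon> = (\<lambda>(x, t).
    let h = (\<lambda>s. trace L (\<lambda>y. u0 (y, s)) 0)
    in exp (- layer_rate lam Ubar * x / \<epsilon>) * corr_A L lam Ubar \<epsilon> h t + corr_C L lam Ubar \<epsilon> h t)"

definition theta_psi ::
    "real \<Rightarrow> real \<Rightarrow> real \<Rightarrow> (real \<times> real \<Rightarrow> real) \<Rightarrow> real \<Rightarrow> real \<times> real \<Rightarrow> real" where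
  "theta_psi L lam Ubar u0 \<epsilon> = (\<lambda>(x, t).
    let h = (\<lambda>s. trace L (\<lambda>y. u0 (y, s)) 0)
    in exp (- layer_rate lam Ubar * x / \<epsilon>) * corr_B L lam Ubar \<epsilon> h t + corr_D L lam Ubar \<epsilon> h t)"

end

theory Submission
  imports Defs "HOL-Computational_Algebra.Polynomial"
begin

text \<open>Subtracting the limit solution and the corrector leaves a pair \<open>(u, v)\<close> with homogeneous initial and
  boundary values. The layer \<open>q(x) h(t)\<close> with \<open>h(t) = u\<^sup>0(0,t)\<close> solves the stationary viscous system exactly, so
  the remaining sources are \<open>2 \<epsilon> u\<^sup>0\<^sub>x\<^sub>x\<close> and \<open>q h'\<close>. The latter is only \<open>O(\<epsilon>\<^sup>1\<^sup>/\<^sup>2)\<close> in \<open>L\<^sup>2\<close>, but pairing it with \<open>u\<close> and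
  integrating by parts replaces \<open>q\<close> by its primitive and \<open>u\<close> by \<open>u\<^sub>x\<close>, which gains a factor \<open>\<epsilon>\<close>.

  The viscosity acts on \<open>u\<close> only. Damping for \<open>v\<^sub>x\<close> comes from the coupling \<open>\<psi>\<^sub>x\<close> in the first equation:
  the multipliers \<open>(u, \<lambda>\<^sup>2 v)\<close> are combined with \<open>\<gamma> \<epsilon> v\<^sub>x\<close> for the first equation, with \<open>\<gamma> \<epsilon>\<^sup>2 v\<^sub>x\<close> for the
  \<open>x\<close>-derivative of the second one, and with \<open>- \<gamma> \<epsilon>\<^sup>2 u\<^sub>x\<^sub>x\<close> to absorb the boundary values of \<open>u\<^sub>x\<close> and \<open>v\<^sub>x\<close> at
  \<open>x = 0\<close>. For small \<open>\<gamma>\<close> the resulting energy inequality gives the \<open>L\<^sup>2\<close> bounds and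
  \<open>\<epsilon> \<parallel>(u\<^sub>x, v\<^sub>x)\<parallel> = O(\<epsilon>)\<close> uniformly in time, whence the \<open>L\<^sup>\<infinity>\<close> bound by interpolation.\<close>

section \<open>Smooth functions and test functions\<close>

text \<open>The solution class provides \<psi>_xt but not u_xt, so the multiplier - u_xx cannot be
  used on the solutions themselves: it needs the time derivative of |u_x|^2. The energy argument is
  therefore run on a causal average in time, which respects the linear equations, the boundary
  values and the zero initial values, and which is removed afterwards at the cost of at most a
  factor 2. The existence of h' is not free either. It comes from \<psi>_xt of the difference and
  the inflow relation h = - Ubar lam^2 \<psi>^0(0,t). Since the difference of the \<psi> starts from
  zero, h(0) = 0 is a consequence of the common data. The rate r is forced: as q'' = -
  (r/\<epsilon>) q', the layer is stationary exactly when 2 r = 1/(Ubar lam^2) - Ubar, and Ubar <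
  1/lam says that r > 0. Weak derivatives are turned once and for all into identities "boundary
  value plus primitive" valid almost everywhere; each integration by parts in the energy argument is
  then one product rule for primitives. The term 2 \<epsilon> \<integral> u^0_xx u is absorbed by
  iterating a provisional bound on the supremum in time, in place of Gronwall's inequality.\<close>

lemma Ck_SucI:
  assumes "\<And>z. (\<phi> has_derivative D z) (at z)" "\<And>e. Ck k (\<lambda>z. D z e)"
  shows "Ck (Suc k) \<phi>"
proof -
  have "frechet_derivative \<phi> (at z) = D z" for z
    using frechet_derivative_at[OF assms(1)] by simp
  then show ?thesis
    using assms by (auto simp: differentiable_on_def differentiable_def intro: has_derivative_at_withinI)
qed

lemma Ck_SucD:
  assumes "Ck (Suc k) \<phi>"
  shows "(\<phi> has_derivative frechet_derivative \<phi> (at z)) (at z)" "Ck k (\<lambda>z. frechet_derivative \<phi> (at z) e)"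
  using assms by (auto simp: differentiable_on_def frechet_derivative_works)

lemma Ck_Suc_imp_Ck: "Ck (Suc k) \<phi> \<Longrightarrow> Ck k \<phi>"
proof (induction k arbitrary: \<phi>)
  case 0
  then show ?case by (auto intro: differentiable_imp_continuous_on)
next
  case (Suc k)
  then show ?case by (metis Ck.simps(2))
qed

lemma Ck_const: "Ck k (\<lambda>z. c)"
proof (induction k arbitrary: c)
  case (Suc k)
  show ?case
    by (rule Ck_SucI[where D = "\<lambda>z e. 0"]) (auto intro: Suc)
qed auto

lemma Ck_add:
  assumes "Ck k f" "Ck k g" shows "Ck k (\<lambda>z. f z + g z)"
  using assms
proof (induction k arbitrary: f g)
  case 0
  then show ?case by (auto intro: continuous_intros)
next
  case (Suc k)
  show ?case
    by (rule Ck_SucI[OF has_derivative_add[OF Ck_SucD(1)[OF Suc.prems(1)] Ck_SucD(1)[OF Suc.prems(2)]]])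
      (intro Suc.IH Ck_SucD(2) Suc.prems)
qed

lemma Ck_mult:
  assumes "Ck k f" "Ck k g" shows "Ck k (\<lambda>z. f z * g z)"
  using assms
proof (induction k arbitrary: f g)
  case 0
  then show ?case by (auto intro: continuous_intros)
next
  case (Suc k)
  show ?case
    by (rule Ck_SucI[OF has_derivative_mult[OF Ck_SucD(1)[OF Suc.prems(1)] Ck_SucD(1)[OF Suc.prems(2)]]])
      (intro Ck_add Suc.IH Ck_SucD(2) Suc.prems Ck_Suc_imp_Ck)
qed

lemma Ck_compose_linear:
  fixes f :: "'a::euclidean_space \<Rightarrow> real" and h :: "'b::euclidean_space \<Rightarrow> 'a"
  assumes h: "bounded_linear h" and "Ck k f" shows "Ck k (\<lambda>z. f (h z + c))"
  using assms(2)
proof (induction k arbitrary: f)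
  case 0
  have "continuous_on UNIV (\<lambda>z. h z + c)"
    by (intro continuous_intros linear_continuous_on h)
  with 0 show ?case
    using continuous_on_compose2[of UNIV f UNIV "\<lambda>z. h z + c"] by auto
next
  case (Suc k)
  have d: "((\<lambda>z. h z + c) has_derivative h) (at z)" for z
    by (auto intro!: derivative_eq_intros bounded_linear.has_derivative[OF h])
  show ?case
  proof (rule Ck_SucI)
    show "((\<lambda>z. f (h z + c)) has_derivative (\<lambda>e. frechet_derivative f (at (h z + c)) (h e))) (at z)" for z
      using diff_chain_at[OF d Ck_SucD(1)[OF Suc.prems]] by (simp add: o_def)
    show "Ck k (\<lambda>z. frechet_derivative f (at (h z + c)) (h e))" for e
      by (rule Suc.IH[OF Ck_SucD(2)[OF Suc.prems]])
  qed
qed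

text \<open>The polynomial in 1/x in front of exp(-1/x) makes the class closed under
  differentiation, so that smoothness of every order is one induction with \<open>p\<close>
  arbitrary.\<close>

definition flat :: "real poly \<Rightarrow> real \<Rightarrow> real" where
  "flat p x = (if x \<le> 0 then 0 else poly p (inverse x) * exp (- inverse x))"

lemma poly_exp_decay: "((\<lambda>y. poly p y * exp (- y)) \<longlongrightarrow> 0) (at_top :: real filter)"
proof -
  have "((\<lambda>y. \<Sum>i\<le>degree p. coeff p i * (y ^ i / exp y)) \<longlongrightarrow> (\<Sum>i\<le>degree p. coeff p i * 0)) at_top"
    by (intro tendsto_sum tendsto_mult tendsto_const tendsto_power_div_exp_0)
  then show ?thesis
    by (simp add: poly_altdef sum_distrib_right exp_minus divide_inverse mult.assoc)
qed

text \<open>With y = 1/x one has d/dx = - y^2 d/dy, which turns p exp(-y) into y^2 (p - p') exp(-y).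
  At 0 the difference quotient from the right is y p(y) exp(-y), which decays.\<close>

lemma flat_has_derivative:
  "(flat p has_real_derivative flat ([:0, 0, 1:] * (p - pderiv p)) x) (at x)"
proof -
  consider "x = 0" | "x < 0" | "x > 0" by linarith
  then show ?thesis
  proof cases
    case 1
    have "((\<lambda>y. flat p y / y) \<longlongrightarrow> 0) (at 0)"
    proof (rule filterlim_split_at_real)
      show "((\<lambda>y. flat p y / y) \<longlongrightarrow> 0) (at_left 0)"
        by (rule tendsto_eventually) (auto simp: eventually_at_left_field flat_def intro: exI[of _ "-1"])
      have "((\<lambda>y. poly (p * [:0,1:]) (inverse y) * exp (- inverse y)) \<longlongrightarrow> 0) (at_right 0)"
        using filterlim_compose[OF poly_exp_decay filterlim_inverse_at_top_right] .
      then show "((\<lambda>y. flat p y / y) \<longlongrightarrow> 0) (at_right 0)"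
        by (rule Lim_transform_eventually)
          (auto simp: eventually_at_right_field flat_def divide_simps intro!: exI[of _ 1])
    qed
    then show ?thesis
      using 1 by (simp add: has_field_derivative_iff flat_def)
  next
    case 2
    have "(flat p has_real_derivative 0) (at x)"
      by (rule has_field_derivative_transform_within_open[where f = "\<lambda>_. 0" and S = "{..<0}"])
        (use 2 in \<open>auto simp: flat_def\<close>)
    then show ?thesis using 2 by (simp add: flat_def)
  next
    case 3
    have "((\<lambda>y. poly p (inverse y) * exp (- inverse y)) has_real_derivative
        flat ([:0, 0, 1:] * (p - pderiv p)) x) (at x)"
      using 3 by (auto intro!: derivative_eq_intros poly_DERIV[THEN DERIV_chain2]
          simp: flat_def power2_eq_square field_simps)
    then show ?thesis
      by (rule has_field_derivative_transform_within_open[where S = "{0<..}"])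
        (use 3 in \<open>auto simp: flat_def\<close>)
  qed
qed

lemma Ck_flat: "Ck k (flat p)"
proof (induction k arbitrary: p)
  case 0
  show ?case
    by (simp add: continuous_on_eq_continuous_at) (meson DERIV_isCont flat_has_derivative)
next
  case (Suc k)
  show ?case
    by (rule Ck_SucI[OF flat_has_derivative[unfolded has_field_derivative_def]])
      (intro Ck_mult Ck_const Suc.IH)
qed

text \<open>For n > 0 the shift by 1 confines the support to [a + 1/n, b - 1/n], compact in the open
  interval. Inside the interval both factors tend to 1, because exp(-1/y) does so as y
  grows.\<close>

definition cutoff :: "nat \<Rightarrow> real \<Rightarrow> real \<Rightarrow> real \<Rightarrow> real" where
  "cutoff n a b x = flat 1 (real n * (x - a) - 1) * flat 1 (real n * (b - x) - 1)"

lemma flat_1_bounds: "0 \<le> flat 1 x" "flat 1 x \<le> 1"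
  by (auto simp: flat_def)

lemma cutoff_bounds: "0 \<le> cutoff n a b x" "cutoff n a b x \<le> 1"
  unfolding cutoff_def using flat_1_bounds by (auto intro: mult_le_one)

lemma compact_closure_subset:
  fixes K :: "'a::euclidean_space set"
  assumes "compact K" "closure S \<subseteq> K"
  shows "compact (closure S)"
proof -
  have "bounded S"
    using assms closure_subset by (metis bounded_subset compact_imp_bounded order_trans)
  then show ?thesis by simp
qed

lemma closure_support_subset:
  fixes \<phi> :: "real \<Rightarrow> real"
  assumes "\<And>x. x \<notin> {a..b} \<Longrightarrow> \<phi> x = 0"
  shows "closure {x. \<phi> x \<noteq> 0} \<subseteq> {a..b}"
  by (rule closure_minimal) (use assms in \<open>auto intro: ccontr\<close>)

lemma test_functionI:
  fixes \<phi> :: "real \<Rightarrow> real"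
  assumes "\<And>k. Ck k \<phi>" "\<And>x. x \<notin> {a..b} \<Longrightarrow> \<phi> x = 0" "{a..b} \<subseteq> S"
  shows "test_function S \<phi>"
proof -
  have "closure {x. \<phi> x \<noteq> 0} \<subseteq> {a..b}"
    by (rule closure_support_subset) (use assms in auto)
  moreover from this have "compact (closure {x. \<phi> x \<noteq> 0})"
    by (rule compact_closure_subset[OF compact_Icc])
  ultimately show ?thesis
    using assms by (auto simp: test_function_def)
qed

lemma test_function_cutoff: "test_function {a<..<b} (cutoff n a b)"
proof (cases "n = 0")
  case True
  then have "cutoff n a b = (\<lambda>_. 0)"
    by (auto simp: cutoff_def flat_def)
  then show ?thesis
    by (auto simp: test_function_def intro: Ck_const)
next
  case False
  have lin: "Ck k (\<lambda>x. flat 1 (c * x + d))" for k c d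
    by (rule Ck_compose_linear[OF bounded_linear_mult_right Ck_flat])
  have cutoff: "cutoff n a b = (\<lambda>x. flat 1 (real n * x + (- real n * a - 1)) * flat 1 (- real n * x + (real n * b - 1)))"
    by (rule ext) (simp add: cutoff_def algebra_simps)
  show ?thesis
  proof (rule test_functionI[where a = "a + 1 / n" and b = "b - 1 / n"])
    show "Ck k (cutoff n a b)" for k
      unfolding cutoff by (intro Ck_mult lin)
    show "cutoff n a b x = 0" if "x \<notin> {a + 1 / n..b - 1 / n}" for x
      using that False by (auto simp: cutoff_def flat_def field_simps)
  next
    have "1 / real n > 0" using False by simp
    then have "a < x" "x < b" if "a + 1 / n \<le> x" "x \<le> b - 1 / n" for x
      using that by linarith+
    then show "{a + 1 / n..b - 1 / n} \<subseteq> {a<..<b}" by auto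
  qed
qed

lemma cutoff_tendsto: "(\<lambda>n. cutoff n a b x) \<longlonglongrightarrow> indicator {a<..<b} x"
proof (cases "x \<in> {a<..<b}")
  case True
  have *: "(\<lambda>n. flat 1 (real n * d - 1)) \<longlonglongrightarrow> 1" if "d > 0" for d
  proof -
    have "filterlim (\<lambda>n. - 1 + real n * d) at_top sequentially"
      using that by (intro filterlim_tendsto_add_at_top[OF tendsto_const]
          filterlim_at_top_mult_tendsto_pos[where c = d] filterlim_real_sequentially) auto
    then have lim: "filterlim (\<lambda>n. real n * d - 1) at_top sequentially" by (simp add: algebra_simps)
    then have "(\<lambda>n. exp (- inverse (real n * d - 1))) \<longlonglongrightarrow> exp (- 0)"
      by (intro tendsto_intros tendsto_inverse_0_at_top)
    moreover have "\<forall>\<^sub>F n in sequentially. exp (- inverse (real n * d - 1)) = flat 1 (real n * d - 1)"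
      using lim[unfolded filterlim_at_top_dense, rule_format, of 0]
      by eventually_elim (auto simp: flat_def)
    ultimately show ?thesis
      by (auto intro: Lim_transform_eventually)
  qed
  have "(\<lambda>n. cutoff n a b x) \<longlonglongrightarrow> 1 * 1"
    unfolding cutoff_def using True by (intro tendsto_mult *) auto
  then show ?thesis using True by simp
next
  case False
  have "cutoff n a b x = 0" for n
  proof -
    have "real n * (x - a) \<le> 0 \<or> real n * (b - x) \<le> 0"
    proof (cases "x \<le> a")
      case True
      then show ?thesis by (simp add: mult_nonneg_nonpos)
    next
      case nle: False
      then have "b \<le> x" using False by simp
      then show ?thesis by (simp add: mult_nonneg_nonpos)
    qed
    then show ?thesis by (auto simp: cutoff_def flat_def)
  qed
  then show ?thesis using False by auto
qed

lemma test_function_real_deriv: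
  fixes \<phi> :: "real \<Rightarrow> real"
  assumes "test_function S \<phi>"
  shows "(\<phi> has_real_derivative deriv \<phi> x) (at x)" "continuous_on UNIV (deriv \<phi>)"
proof -
  have C: "Ck (Suc 0) \<phi>" using assms by (simp add: test_function_def)
  have d: "(\<phi> has_derivative frechet_derivative \<phi> (at x)) (at x)" for x
    using Ck_SucD(1)[OF C] .
  then have "\<phi> differentiable (at x)" for x by (auto simp: differentiable_def)
  then show D: "(\<phi> has_real_derivative deriv \<phi> x) (at x)" for x
    by (simp add: DERIV_deriv_iff_real_differentiable)
  then have "frechet_derivative \<phi> (at x) 1 = deriv \<phi> x" for x
    using frechet_derivative_at[OF D[unfolded has_field_derivative_def]]
    by (metis mult.right_neutral)
  moreover have "continuous_on UNIV (\<lambda>x. frechet_derivative \<phi> (at x) 1)"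
    using Ck_SucD(2)[OF C] by simp
  ultimately show "continuous_on UNIV (deriv \<phi>)" by simp
qed

lemma test_function_product:
  fixes a b :: "real \<Rightarrow> real"
  assumes a: "test_function A a" and b: "test_function B b"
  shows "test_function (A \<times> B) (\<lambda>z. a (fst z) * b (snd z))"
    and "frechet_derivative (\<lambda>z. a (fst z) * b (snd z)) (at z) (1, 0) = deriv a (fst z) * b (snd z)"
    and "frechet_derivative (\<lambda>z. a (fst z) * b (snd z)) (at z) (0, 1) = a (fst z) * deriv b (snd z)"
proof -
  let ?f = "\<lambda>z. a (fst z) * b (snd z)"
  have "Ck k (\<lambda>z::real\<times>real. a (fst z))" "Ck k (\<lambda>z::real\<times>real. b (snd z))" for k
    using Ck_compose_linear[OF bounded_linear_fst, of k a 0] Ck_compose_linear[OF bounded_linear_snd, of k b 0]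
      a b by (auto simp: test_function_def)
  then have "Ck k ?f" for k by (intro Ck_mult)
  moreover have sub: "closure {z. ?f z \<noteq> 0} \<subseteq> closure {x. a x \<noteq> 0} \<times> closure {x. b x \<noteq> 0}"
    unfolding closure_Times[symmetric] by (rule closure_mono) auto
  moreover have "compact (closure {x. a x \<noteq> 0} \<times> closure {x. b x \<noteq> 0})"
    using a b by (auto simp: test_function_def intro: compact_Times)
  then have "compact (closure {z. ?f z \<noteq> 0})"
    using sub by (rule compact_closure_subset)
  ultimately show "test_function (A \<times> B) ?f"
    using a b unfolding test_function_def by blast
  have "(a has_derivative (\<lambda>h. deriv a (fst z) * h)) (at (fst z))" "(b has_derivative (\<lambda>h. deriv b (snd z) * h)) (at (snd z))"
    using test_function_real_deriv(1)[OF a, of "fst z"] test_function_real_deriv(1)[OF b, of "snd z"]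
    by (auto simp: has_field_derivative_def)
  from has_derivative_mult[OF has_derivative_compose[OF has_derivative_fst[OF has_derivative_ident] this(1)]
      has_derivative_compose[OF has_derivative_snd[OF has_derivative_ident] this(2)]]
  have "(?f has_derivative (\<lambda>h. a (fst z) * (deriv b (snd z) * snd h) + deriv a (fst z) * fst h * b (snd z))) (at z)"
    by (simp add: at_within_def[symmetric])
  from frechet_derivative_at[OF this, symmetric]
  show "frechet_derivative ?f (at z) (1, 0) = deriv a (fst z) * b (snd z)"
    "frechet_derivative ?f (at z) (0, 1) = a (fst z) * deriv b (snd z)" by simp_all
qed

lemma test_function_mono: "test_function S \<phi> \<Longrightarrow> S \<subseteq> S' \<Longrightarrow> test_function S' \<phi>"
  by (auto simp: test_function_def)

lemma test_function_outside: "test_function S \<phi> \<Longrightarrow> z \<notin> S \<Longrightarrow> \<phi> z = 0"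
  using subsetD[OF closure_subset, of z "{z. \<phi> z \<noteq> 0}"] by (auto simp: test_function_def)

lemma test_function_continuous: "test_function S \<phi> \<Longrightarrow> continuous_on UNIV \<phi>"
  unfolding test_function_def using Ck.simps(1) by blast

lemma test_function_support:
  fixes \<phi> :: "real \<Rightarrow> real"
  assumes "test_function {0<..<L} \<phi>" "L > 0"
  obtains a b where "0 < a" "a \<le> b" "b < L" "\<And>x. x \<notin> {a..b} \<Longrightarrow> \<phi> x = 0"
proof (cases "{x. \<phi> x \<noteq> 0} = {}")
  case True
  then show ?thesis using that[of "L/2" "L/2"] assms(2) by auto
next
  case False
  let ?K = "closure {x. \<phi> x \<noteq> 0}"
  have K: "compact ?K" "?K \<subseteq> {0<..<L}" "?K \<noteq> {}"
    using assms False by (auto simp: test_function_def)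
  obtain a where a: "a \<in> ?K" "\<And>x. x \<in> ?K \<Longrightarrow> a \<le> x"
    using compact_attains_inf[OF K(1,3)] by blast
  obtain b where b: "b \<in> ?K" "\<And>x. x \<in> ?K \<Longrightarrow> x \<le> b"
    using compact_attains_sup[OF K(1,3)] by blast
  show ?thesis
  proof (rule that[of a b])
    show "\<phi> x = 0" if "x \<notin> {a..b}" for x
    proof (rule ccontr)
      assume "\<phi> x \<noteq> 0"
      then have "x \<in> ?K" by (intro subsetD[OF closure_subset]) simp
      with a b that show False by auto
    qed
  qed (use a b K in auto)
qed

text \<open>Vanishing mean is what makes the antiderivative from 0 vanish again to the right of the
  support. This feeds the du Bois-Reymond argument in \<open>weak_representation\<close>.\<close>

lemma test_function_antiderivative:
  fixes \<eta> :: "real \<Rightarrow> real"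
  assumes \<eta>: "test_function {0<..<L} \<eta>" and L: "L > 0" and int0: "integral {0..L} \<eta> = 0"
  obtains \<phi> where "test_function {0<..<L} \<phi>" "deriv \<phi> = \<eta>"
proof -
  obtain a b where ab: "0 < a" "a \<le> b" "b < L" "\<And>x. x \<notin> {a..b} \<Longrightarrow> \<eta> x = 0"
    using test_function_support[OF \<eta> L] by metis
  have "isCont \<eta> x" for x
    using test_function_continuous[OF \<eta>] by (simp add: continuous_on_eq_continuous_at)
  then obtain F where F: "\<And>x. (F has_real_derivative \<eta> x) (at x)"
    using einterval_antiderivative[of "-\<infinity>" "\<infinity>" \<eta>]
    by (auto simp: has_real_derivative_iff_has_vector_derivative)
  define \<phi> where "\<phi> x = F x - F 0" for x
  have D: "(\<phi> has_real_derivative \<eta> x) (at x)" for x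
    unfolding \<phi>_def by (auto intro!: derivative_eq_intros F)
  have const: "\<exists>c. \<forall>x\<in>S. F x = c" if "convex S" "S \<inter> {a..b} = {}" for S
  proof (rule has_field_derivative_zero_constant[OF that(1)])
    fix x assume "x \<in> S"
    then have "\<eta> x = 0" using that by (intro ab) auto
    then show "(F has_real_derivative 0) (at x within S)"
      using F[of x] by (auto intro: has_field_derivative_at_within)
  qed
  have "\<phi> x = 0" if "x \<notin> {a..b}" for x
  proof (cases "x < a")
    case True
    obtain c where "\<forall>x\<in>{..<a}. F x = c"
      using const[of "{..<a}"] by (auto simp: disjoint_iff)
    then show ?thesis using ab True by (simp add: \<phi>_def)
  next
    case False
    then have "x > b" using that by auto
    moreover obtain c where "\<forall>x\<in>{b<..}. F x = c"
      using const[of "{b<..}"] by (auto simp: disjoint_iff)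
    ultimately have "F x = F L" using ab by simp
    moreover have "(\<eta> has_integral (F L - F 0)) {0..L}"
      by (rule fundamental_theorem_of_calculus)
        (use L F in \<open>auto simp: has_real_derivative_iff_has_vector_derivative[symmetric] intro: has_field_derivative_at_within[OF F]\<close>)
    ultimately show ?thesis using int0 integral_unique[of \<eta> "F L - F 0" "{0..L}"] by (simp add: \<phi>_def)
  qed
  moreover have "Ck k \<phi>" for k
  proof (cases k)
    case 0
    then show ?thesis
      using D DERIV_isCont by (simp add: continuous_on_eq_continuous_at) blast
  next
    case (Suc m)
    show ?thesis unfolding Suc
      by (rule Ck_SucI[OF D[unfolded has_field_derivative_def]])
        (use \<eta> in \<open>auto simp: test_function_def intro: Ck_mult Ck_const\<close>)
  qed
  ultimately have "test_function {0<..<L} \<phi>"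
    using ab by (intro test_functionI[of \<phi> a b]) auto
  with D show ?thesis by (intro that[of \<phi>]) (auto simp: DERIV_imp_deriv)
qed

section \<open>The fundamental lemma\<close>

text \<open>Open boxes are an intersection-stable generator of the Borel sets, so vanishing
  integrals spread to all Borel sets by Dynkin's argument, and \<open>density_zero\<close>
  finishes.\<close>

lemma AE_zero_boxes:
  fixes F :: "'a::euclidean_space \<Rightarrow> real"
  assumes F: "integrable lborel F" and box: "\<And>a b. (LINT z:box a b|lborel. F z) = 0"
  shows "AE z in lborel. F z = 0"
proof (rule sigma_finite_measure.density_zero[OF sigma_finite_lborel F])
  have meas: "A \<in> sets borel \<Longrightarrow> set_integrable lborel A F" for A
    unfolding set_integrable_def using F by (intro integrable_mult_indicator) auto
  \<comment> \<open>The complement case of the induction needs the integral over the whole space; it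
    is the limit over growing boxes.\<close>
  have UN: "(LINT z|lborel. F z) = 0"
  proof -
    let ?A = "\<lambda>n::nat. box (- (real n *\<^sub>R One)) (real n *\<^sub>R One) :: 'a set"
    have "(\<lambda>n. LINT z:?A n|lborel. F z) \<longlonglongrightarrow> (LINT z:(\<Union>n. ?A n)|lborel. F z)"
      by (rule set_integral_cont_up)
        (auto simp: UN_box_eq_UNIV incseq_def mem_box dest!: bspec intro: meas less_le_trans le_less_trans)
    then show ?thesis
      using box by (simp add: UN_box_eq_UNIV LIMSEQ_const_iff set_lebesgue_integral_def)
  qed
  fix A :: "'a set" assume "A \<in> sets lborel"
  then have A: "A \<in> sigma_sets UNIV (range (\<lambda>(a, b). box a b))"
    by (simp add: borel_eq_box)
  have Int: "Int_stable (range (\<lambda>(a, b). box a b :: 'a set))"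
    by (auto simp: Int_stable_def box_Int_box)
  have "range (\<lambda>(a, b). box a b :: 'a set) \<subseteq> Pow UNIV" by simp
  from Int this A show "(LINT z:A|lborel. F z) = 0"
  proof (induction rule: sigma_sets_induct_disjoint)
    case (compl A)
    then have "A \<in> sets borel" by (simp add: borel_eq_box)
    have "(LINT z:A \<union> (UNIV - A)|lborel. F z) = (LINT z:A|lborel. F z) + (LINT z:UNIV - A|lborel. F z)"
      by (rule set_integral_Un) (use \<open>A \<in> sets borel\<close> in \<open>auto intro: meas\<close>)
    then show ?case using UN compl by (simp add: set_lebesgue_integral_def)
  next
    case (union A)
    then have "A i \<in> sets borel" for i by (auto simp: borel_eq_box)
    then show ?case
      using union.IH union.hyps lebesgue_integral_countable_add[of A lborel F] meas
      by (auto simp: disjoint_family_on_def)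
  next
    case (basic A)
    then show ?case using box by auto
  qed (auto simp: set_lebesgue_integral_def)
qed

lemma mem_box_real_prod:
  fixes a b z :: "real \<times> real"
  shows "z \<in> box a b \<longleftrightarrow> fst z \<in> {fst a<..<fst b} \<and> snd z \<in> {snd a<..<snd b}"
  by (auto simp: mem_box Basis_prod_def inner_prod_def)

lemma AE_lebesgue_on_iff:
  assumes "S \<in> sets lebesgue"
  shows "(AE z in lebesgue_on S. P z) \<longleftrightarrow> (AE z in lborel. z \<in> S \<longrightarrow> P z)"
  using assms by (simp add: AE_restrict_space_iff AE_completion_iff)

lemma Q_sets: "Q L T \<in> sets borel" "Q L T \<in> sets lebesgue"
  unfolding Q_def by (auto intro!: borel_open sets_completionI_sets open_Times)

text \<open>Product test functions suffice, because products of one-dimensional cutoffs converge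
  boundedly to indicators of boxes, and boxes determine a function by
  \<open>AE_zero_boxes\<close>.\<close>

lemma fundamental_lemma_Q:
  assumes F: "loc_integrable (Q L T) F"
    and test: "\<And>a b. test_function {0<..<L} a \<Longrightarrow> test_function {0<..<T} b \<Longrightarrow>
      (LINT z:Q L T|lebesgue. F z * (a (fst z) * b (snd z))) = 0"
  shows "AE z in lebesgue_on (Q L T). F z = 0"
proof -
  \<comment> \<open>\<open>F\<close> is only locally integrable. Each \<open>B n\<close> lies in a
    compact subset of \<open>Q L T\<close>, so \<open>F\<close> is integrable on it, and these sets
    exhaust \<open>Q L T\<close>.\<close>
  define B where "B n = {1 / real (Suc n)<..<L - 1 / real (Suc n)} \<times> {1 / real (Suc n)<..<T - 1 / real (Suc n)}" for n
  have Bm: "B n \<in> sets borel" for n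
    unfolding B_def by (intro borel_open open_Times) auto
  have "AE z in lborel. indicator (B n) z * F z = 0" for n
  proof -
    define d where "d = 1 / real (Suc n)"
    have d: "d > 0" by (simp add: d_def)
    have Bn: "B n = {d<..<L - d} \<times> {d<..<T - d}" unfolding B_def d_def ..
    have K: "compact ({d..L - d} \<times> {d..T - d})" "{d..L - d} \<times> {d..T - d} \<subseteq> Q L T"
      using d by (auto simp: Q_def intro!: compact_Times)
    with F have "set_integrable lebesgue ({d..L - d} \<times> {d..T - d}) F"
      by (simp add: loc_integrable_def)
    then have "set_integrable lebesgue (B n) F"
      by (rule set_integrable_subset) (use Bm[of n] in simp, auto simp: Bn)
    then have int: "integrable lebesgue (\<lambda>z. indicator (B n) z * F z)"
      by (simp add: set_integrable_def)
    \<comment> \<open>\<open>F\<close> is measurable only for the completed measure, whereas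
      \<open>AE_zero_boxes\<close> lives on \<open>lborel\<close>; a Borel version takes
      over.\<close>
    obtain g where g: "g \<in> borel_measurable lborel" "AE z in lborel. indicator (B n) z * F z = g z"
      using completion_ex_borel_measurable_real[of "\<lambda>z. indicator (B n) z * F z" lborel] int by auto
    have [measurable]: "(\<lambda>z. indicator (B n) z * F z) \<in> borel_measurable lebesgue"
      using int by simp
    have g_eq: "AE z in lebesgue. indicator (B n) z * F z = g z"
      using g by (simp add: AE_completion_iff)
    have gm: "g \<in> borel_measurable lebesgue" using g(1) by (simp add: measurable_completion)
    have "integrable lebesgue g"
      by (rule integrable_cong_AE_imp[OF int gm]) (use g_eq in auto)
    then have gi: "integrable lborel g" using integrable_completion[OF g(1)] by simp
    have "AE z in lborel. g z = 0"
    proof (rule AE_zero_boxes[OF gi])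
      fix a b :: "real \<times> real"
      \<comment> \<open>The box is clipped to \<open>B n\<close>, so that the approximating test
        functions vanish outside the set on which \<open>F\<close> is known to be
        integrable.\<close>
      define \<phi> where "\<phi> m z = cutoff m (max (fst a) d) (min (fst b) (L - d)) (fst z) *
        cutoff m (max (snd a) d) (min (snd b) (T - d)) (snd z)" for m and z :: "real \<times> real"
      have lim: "(\<lambda>m. \<phi> m z) \<longlonglongrightarrow> indicator (box a b \<inter> B n) z" for z
      proof -
        have "(\<lambda>m. \<phi> m z) \<longlonglongrightarrow> indicator {max (fst a) d<..<min (fst b) (L - d)} (fst z) *
          indicator {max (snd a) d<..<min (snd b) (T - d)} (snd z)"
          unfolding \<phi>_def by (intro tendsto_mult cutoff_tendsto)
        then show ?thesis
          by (auto simp: indicator_def Bn mem_box_real_prod mem_Times_iff split: if_splits)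
      qed
      have zero: "\<phi> m z = 0" if "z \<notin> B n" for m z
        using that test_function_outside[OF test_function_cutoff, of "fst z" "max (fst a) d" "min (fst b) (L - d)" m]
          test_function_outside[OF test_function_cutoff, of "snd z" "max (snd a) d" "min (snd b) (T - d)" m]
        by (auto simp: \<phi>_def Bn mem_Times_iff)
      have cont: "continuous_on UNIV (cutoff m u v)" for m u v
        using test_function_continuous[OF test_function_cutoff] .
      have [measurable]: "\<phi> m \<in> borel_measurable borel" for m
        unfolding \<phi>_def
        by (intro borel_measurable_continuous_onI continuous_on_mult continuous_on_compose2[OF cont]
            continuous_on_fst continuous_on_snd continuous_on_id) auto
      have [measurable]: "\<phi> m \<in> borel_measurable lebesgue" for m
        by (simp add: measurable_completion)
      have "(\<lambda>m. LINT z|lebesgue. (indicator (B n) z * F z) * \<phi> m z) \<longlonglongrightarrow>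
          (LINT z|lebesgue. (indicator (B n) z * F z) * indicator (box a b \<inter> B n) z)"
      proof (rule integral_dominated_convergence[where w = "\<lambda>z. \<bar>indicator (B n) z * F z\<bar>"])
        show "(\<lambda>z. (indicator (B n) z * F z) * indicator (box a b \<inter> B n) z) \<in> borel_measurable lebesgue"
          by (rule borel_measurable_times) (use Bm[of n] int in \<open>auto intro!: borel_measurable_indicator\<close>)
        show "AE z in lebesgue. (\<lambda>m. (indicator (B n) z * F z) * \<phi> m z) \<longlonglongrightarrow>
            (indicator (B n) z * F z) * indicator (box a b \<inter> B n) z"
          by (intro AE_I2 tendsto_mult tendsto_const lim)
        have "0 \<le> \<phi> m z \<and> \<phi> m z \<le> 1" for m z
          unfolding \<phi>_def using cutoff_bounds by (auto intro!: mult_le_one)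
        then show "AE z in lebesgue. norm ((indicator (B n) z * F z) * \<phi> m z) \<le> \<bar>indicator (B n) z * F z\<bar>" for m
          by (intro AE_I2) (auto simp: abs_mult intro!: mult_left_le)
      qed (use int in auto)
      moreover have "(LINT z|lebesgue. (indicator (B n) z * F z) * \<phi> m z) = 0" for m
      proof -
        have "(LINT z|lebesgue. (indicator (B n) z * F z) * \<phi> m z) = (LINT z:Q L T|lebesgue. F z * \<phi> m z)"
          unfolding set_lebesgue_integral_def
          by (intro Bochner_Integration.integral_cong refl)
            (use zero d in \<open>auto simp: indicator_def Bn Q_def\<close>)
        also have "\<dots> = 0"
          unfolding \<phi>_def using d
          by (intro test test_function_mono[OF test_function_cutoff]) auto
        finally show ?thesis .
      qed
      ultimately have 0: "(LINT z|lebesgue. (indicator (B n) z * F z) * indicator (box a b \<inter> B n) z) = 0"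
        by (simp add: LIMSEQ_const_iff)
      have "(LINT z:box a b|lborel. g z) = (LINT z|lebesgue. indicator (box a b) z * g z)"
        unfolding set_lebesgue_integral_def using g(1) by (subst integral_completion) auto
      also have "\<dots> = (LINT z|lebesgue. (indicator (B n) z * F z) * indicator (box a b \<inter> B n) z)"
      proof (rule integral_cong_AE)
        show "(\<lambda>z. indicator (box a b) z * g z) \<in> borel_measurable lebesgue"
          by (rule borel_measurable_times) (use gm in \<open>auto intro!: borel_measurable_indicator\<close>)
        show "(\<lambda>z. (indicator (B n) z * F z) * indicator (box a b \<inter> B n) z) \<in> borel_measurable lebesgue"
          by (rule borel_measurable_times) (use Bm[of n] int in \<open>auto intro!: borel_measurable_indicator\<close>)
        show "AE z in lebesgue. indicator (box a b) z * g z =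
            (indicator (B n) z * F z) * indicator (box a b \<inter> B n) z"
          using g_eq by eventually_elim (auto simp: indicator_def)
      qed
      finally show "(LINT z:box a b|lborel. g z) = 0" using 0 by simp
    qed
    with g(2) show ?thesis by eventually_elim simp
  qed
  then have "AE z in lborel. \<forall>n. indicator (B n) z * F z = 0"
    unfolding AE_all_countable by blast
  then have "AE z in lborel. z \<in> Q L T \<longrightarrow> F z = 0"
  proof eventually_elim
    case (elim z)
    show ?case
    proof
      assume z: "z \<in> Q L T"
      define m where "m = Min {fst z, L - fst z, snd z, T - snd z}"
      have "m > 0" using z by (auto simp: m_def Q_def)
      then obtain n where "inverse (real (Suc n)) < m" using reals_Archimedean by blast
      then have "z \<in> B n" using z by (auto simp: B_def m_def mem_Times_iff inverse_eq_divide)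
      with elim[rule_format, of n] show "F z = 0" by simp
    qed
  qed
  then show ?thesis by (simp add: AE_lebesgue_on_iff Q_sets)
qed

section \<open>Lebesgue measure on an interval\<close>

text \<open>The underlying space is the whole line, so that measurability does not depend on the interval.\<close>

definition seg :: "real \<Rightarrow> real measure" where
  "seg L = density lborel (\<lambda>x. ennreal (indicator {0<..<L} x))"

lemma space_seg [simp]: "space (seg L) = UNIV"
  and sets_seg [simp, measurable_cong]: "sets (seg L) = sets borel"
  by (simp_all add: seg_def)

lemma finite_measure_seg: "finite_measure (seg L)"
proof
  have "emeasure (seg L) (space (seg L)) = emeasure lborel {0<..<L}"
    by (simp add: seg_def emeasure_density ennreal_indicator)
  also have "\<dots> \<noteq> \<infinity>" by (cases "0 \<le> L") auto
  finally show "emeasure (seg L) (space (seg L)) \<noteq> \<infinity>" .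
qed

interpretation seg: finite_measure "seg L" for L
  by (rule finite_measure_seg)

interpretation seg2: pair_sigma_finite "seg L" "seg T" for L T ..

interpretation segp: finite_measure "seg L \<Otimes>\<^sub>M seg T" for L T
  by (rule finite_measure_pair_measure) (rule finite_measure_seg)+

lemma sets_seg_pair: "sets (seg L \<Otimes>\<^sub>M seg T) = sets borel"
  unfolding borel_prod[symmetric] by (rule sets_pair_measure_cong) simp_all

lemma space_seg_pair [simp]: "space (seg L \<Otimes>\<^sub>M seg T) = UNIV"
  by (simp add: space_pair_measure)

lemma measure_seg: "L \<ge> 0 \<Longrightarrow> measure (seg L) UNIV = L"
  by (simp add: seg_def measure_def emeasure_density ennreal_indicator)

lemma AE_seg: "(AE x in seg L. P x) \<longleftrightarrow> (AE x in lborel. x \<in> {0<..<L} \<longrightarrow> P x)"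
  unfolding seg_def by (subst AE_density) (auto simp: indicator_def)

lemma AE_seg_mem: "AE x in seg L. x \<in> {0<..<L}"
  by (simp add: AE_seg)

lemma integral_seg:
  fixes f :: "real \<Rightarrow> real"
  assumes "f \<in> borel_measurable borel"
  shows "integral\<^sup>L (seg L) f = (LINT x:{0<..<L}|lborel. f x)"
  unfolding seg_def set_lebesgue_integral_def using assms by (subst integral_density) auto

lemma integrable_seg:
  fixes f :: "real \<Rightarrow> real"
  assumes "f \<in> borel_measurable borel"
  shows "integrable (seg L) f \<longleftrightarrow> set_integrable lborel {0<..<L} f"
  unfolding seg_def set_integrable_def using assms by (subst integrable_density) auto

lemma seg_pair: "seg L \<Otimes>\<^sub>M seg T = density lborel (\<lambda>z. ennreal (indicator (Q L T) z))"
proof -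
  have "seg L \<Otimes>\<^sub>M seg T =
    density (lborel \<Otimes>\<^sub>M lborel) (\<lambda>(x, y). ennreal (indicator {0<..<L} x) * ennreal (indicator {0<..<T} y))"
    unfolding seg_def
    by (rule pair_measure_density)
      (use seg.sigma_finite_measure_axioms[of T] in \<open>auto simp: sigma_finite_lborel seg_def[symmetric]\<close>)
  also have "\<dots> = density lborel (\<lambda>z. ennreal (indicator (Q L T) z))"
    by (subst lborel_prod) (auto intro!: arg_cong[where f = "density lborel"] simp: Q_def indicator_def fun_eq_iff)
  finally show ?thesis .
qed

lemma AE_seg_pair: "(AE z in seg L \<Otimes>\<^sub>M seg T. P z) \<longleftrightarrow> (AE z in lborel. z \<in> Q L T \<longrightarrow> P z)"
  unfolding seg_pair using Q_sets[of L T] by (subst AE_density) (auto simp: indicator_def)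

lemma AE_seg_pair': "(AE z in seg L \<Otimes>\<^sub>M seg T. P z) \<longleftrightarrow> (AE z in lebesgue_on (Q L T). P z)"
  by (simp add: AE_seg_pair AE_lebesgue_on_iff Q_sets)

lemma AE_seg': "(AE x in seg L. P x) \<longleftrightarrow> (AE x in lebesgue_on {0<..<L}. P x)"
  by (simp add: AE_seg AE_lebesgue_on_iff)

lemma integral_seg_pair:
  fixes f :: "real \<times> real \<Rightarrow> real"
  assumes "f \<in> borel_measurable borel"
  shows "integral\<^sup>L (seg L \<Otimes>\<^sub>M seg T) f = (LINT z:Q L T|lborel. f z)"
  unfolding seg_pair set_lebesgue_integral_def using assms Q_sets[of L T] by (subst integral_density) auto

lemma integrable_seg_pair:
  fixes f :: "real \<times> real \<Rightarrow> real"
  assumes "f \<in> borel_measurable borel"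
  shows "integrable (seg L \<Otimes>\<^sub>M seg T) f \<longleftrightarrow> set_integrable lborel (Q L T) f"
  unfolding seg_pair set_integrable_def using assms Q_sets[of L T] by (subst integrable_density) auto

lemma AE_seg_slice1:
  assumes "AE z in seg L \<Otimes>\<^sub>M seg T. P z"
  shows "AE x in seg L. AE t in seg T. P (x, t)"
  using seg2.AE_pair[OF assms] .

lemma AE_seg_slice2:
  assumes "AE z in seg L \<Otimes>\<^sub>M seg T. P z"
  shows "AE t in seg T. AE x in seg L. P (x, t)"
proof -
  \<comment> \<open>Exchanging the two almost-everywhere quantifiers requires a measurable
    predicate; the arbitrary \<open>P\<close> is replaced by avoiding a measurable null set.\<close>
  obtain N where N: "{z \<in> space (seg L \<Otimes>\<^sub>M seg T). \<not> P z} \<subseteq> N" "emeasure (seg L \<Otimes>\<^sub>M seg T) N = 0"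
    "N \<in> sets (seg L \<Otimes>\<^sub>M seg T)"
    using assms by (auto elim: AE_E)
  have "AE z in seg L \<Otimes>\<^sub>M seg T. z \<notin> N"
    using N by (intro AE_not_in) auto
  from AE_seg_slice1[OF this] have "AE x in seg L. AE t in seg T. (x, t) \<notin> N" .
  then have "AE t in seg T. AE x in seg L. (x, t) \<notin> N"
    by (subst seg2.AE_commute) (use N(3) in measurable)
  then show ?thesis
    by (rule eventually_mono, elim eventually_mono) (use N(1) in auto)
qed

text \<open>Together with \<open>AE_seg_slice2\<close> this passes from "almost every x, then almost
  every t" to the opposite order. That detour is used throughout, since time calculus is done at
  fixed x and the energy at fixed t.\<close>

lemma AE_seg_pairI1:
  assumes "AE x in seg L. AE t in seg T. P (x, t)" "Measurable.pred borel P"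
  shows "AE z in seg L \<Otimes>\<^sub>M seg T. P z"
proof (rule seg2.AE_pair_measure)
  show "{z \<in> space (seg L \<Otimes>\<^sub>M seg T). P z} \<in> sets (seg L \<Otimes>\<^sub>M seg T)"
    unfolding sets_seg_pair space_seg_pair using assms(2) by (simp add: pred_def)
qed fact

lemma AE_seg_pairI2:
  assumes "AE t in seg T. AE x in seg L. P (x, t)" "Measurable.pred borel P"
  shows "AE z in seg L \<Otimes>\<^sub>M seg T. P z"
proof (rule AE_seg_pairI1)
  have "{z \<in> space (seg L \<Otimes>\<^sub>M seg T). P (fst z, snd z)} \<in> sets (seg L \<Otimes>\<^sub>M seg T)"
    unfolding sets_seg_pair space_seg_pair using assms(2) by (simp add: pred_def)
  from seg2.AE_commute[OF this] show "AE x in seg L. AE t in seg T. P (x, t)"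
    using assms(1) by simp
qed fact

section \<open>Square integrable functions\<close>

definition sq_int :: "'a measure \<Rightarrow> ('a \<Rightarrow> real) \<Rightarrow> bool" where
  "sq_int N f \<longleftrightarrow> f \<in> borel_measurable N \<and> integrable N (\<lambda>x. (f x)\<^sup>2)"

lemma sq_int_measurable [measurable_dest]: "sq_int N f \<Longrightarrow> f \<in> borel_measurable N"
  by (simp add: sq_int_def)

lemma sq_int_square: "sq_int N f \<Longrightarrow> integrable N (\<lambda>x. (f x)\<^sup>2)"
  by (simp add: sq_int_def)

lemma sq_int_mult:
  assumes "sq_int N f" "sq_int N g"
  shows "integrable N (\<lambda>x. f x * g x)"
proof (rule Bochner_Integration.integrable_bound)
  show "integrable N (\<lambda>x. (f x)\<^sup>2 + (g x)\<^sup>2)"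
    using assms by (simp add: sq_int_def)
  show "(\<lambda>x. f x * g x) \<in> borel_measurable N"
    using assms by (auto simp: sq_int_def)
  have "\<bar>a * b\<bar> \<le> a\<^sup>2 + b\<^sup>2" for a b :: real
  proof -
    have "2 * \<bar>a * b\<bar> \<le> a\<^sup>2 + b\<^sup>2"
      using sum_squares_bound[of "\<bar>a\<bar>" "\<bar>b\<bar>"] by (simp add: abs_mult)
    moreover have "\<bar>a * b\<bar> \<le> 2 * \<bar>a * b\<bar>" by simp
    ultimately show ?thesis by linarith
  qed
  then show "AE x in N. norm (f x * g x) \<le> norm ((f x)\<^sup>2 + (g x)\<^sup>2)"
    by (intro AE_I2) simp
qed

lemma sq_int_cmult: "sq_int N f \<Longrightarrow> sq_int N (\<lambda>x. c * f x)"
  by (auto simp: sq_int_def power_mult_distrib)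

lemma sq_int_add: "sq_int N f \<Longrightarrow> sq_int N g \<Longrightarrow> sq_int N (\<lambda>x. f x + g x)"
  using sq_int_mult[of N f g] by (auto simp: sq_int_def power2_sum mult.assoc)

lemma sq_int_diff: "sq_int N f \<Longrightarrow> sq_int N g \<Longrightarrow> sq_int N (\<lambda>x. f x - g x)"
  using sq_int_add[of N f "\<lambda>x. -1 * g x"] sq_int_cmult[of N g "-1"] by simp

lemma sq_int_minus: "sq_int N f \<Longrightarrow> sq_int N (\<lambda>x. - f x)"
  using sq_int_cmult[of N f "-1"] by simp

lemma sq_int_const: "finite_measure N \<Longrightarrow> sq_int N (\<lambda>x. c)"
  by (auto simp: sq_int_def intro!: finite_measure.integrable_const)

lemma sq_int_integrable: "finite_measure N \<Longrightarrow> sq_int N f \<Longrightarrow> integrable N f"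
  using sq_int_mult[OF _ sq_int_const, of N f 1] by simp

lemma sq_int_bound:
  assumes "integrable N h" "g \<in> borel_measurable N" "AE x in N. (g x)\<^sup>2 \<le> h x"
  shows "sq_int N g"
  unfolding sq_int_def using assms(2)
  by (auto intro!: Bochner_Integration.integrable_bound[OF assms(1)] eventually_mono[OF assms(3)])

lemma Cauchy_Schwarz_sq_int:
  assumes "sq_int N f" "sq_int N g"
  shows "(\<integral>x. f x * g x \<partial>N)\<^sup>2 \<le> (\<integral>x. (f x)\<^sup>2 \<partial>N) * (\<integral>x. (g x)\<^sup>2 \<partial>N)"
proof -
  define a b c where "a = (\<integral>x. (f x)\<^sup>2 \<partial>N)" and "b = (\<integral>x. f x * g x \<partial>N)" and "c = (\<integral>x. (g x)\<^sup>2 \<partial>N)"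
  \<comment> \<open>Two parameters keep the quadratic form free of divisions. The choice s = c, r =
    b gives c (a c - b^2) \<ge> 0; if c = 0 and b \<noteq> 0, then s = 1 and r = (a + 1) / (2 b)
    make the form equal to -1.\<close>
  have q: "0 \<le> a * s\<^sup>2 - 2 * b * s * r + c * r\<^sup>2" for s r
  proof -
    have "0 \<le> (\<integral>x. (s * f x - r * g x)\<^sup>2 \<partial>N)"
      by (rule Bochner_Integration.integral_nonneg) simp
    also have "\<dots> = (\<integral>x. s\<^sup>2 * (f x)\<^sup>2 - 2 * s * r * (f x * g x) + r\<^sup>2 * (g x)\<^sup>2 \<partial>N)"
      by (intro Bochner_Integration.integral_cong refl) (simp add: power2_eq_square algebra_simps)
    also have "\<dots> = s\<^sup>2 * a - 2 * s * r * b + r\<^sup>2 * c"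
      unfolding a_def b_def c_def using assms sq_int_mult[OF assms] by (simp add: sq_int_def)
    finally show ?thesis by (simp add: algebra_simps)
  qed
  have c: "c \<ge> 0" by (simp add: c_def)
  have "b\<^sup>2 \<le> a * c"
  proof (cases "c = 0")
    case True
    have "b = 0"
    proof (rule ccontr)
      assume "b \<noteq> 0"
      have "0 \<le> a - 2 * b * ((a + 1) / (2 * b))"
        using q[of 1 "(a + 1) / (2 * b)"] True by simp
      then show False using \<open>b \<noteq> 0\<close> by simp
    qed
    then show ?thesis using True by simp
  next
    case False
    have "0 \<le> c * (a * c - b\<^sup>2)"
      using q[of c b] by (simp add: power2_eq_square algebra_simps)
    then show ?thesis using c False by (simp add: zero_le_mult_iff)
  qed
  then show ?thesis by (simp add: a_def b_def c_def)
qed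

section \<open>Primitives\<close>

text \<open>The integral from 0 to x, continued by 0 to the left of 0 and by the total integral to
  the right of L. For integrable \<open>f\<close> it is thus continuous on the whole line. An
  identity \<open>w = c + prim L g\<close> almost everywhere is the working form of a weak
  derivative.\<close>

definition prim :: "real \<Rightarrow> (real \<Rightarrow> real) \<Rightarrow> real \<Rightarrow> real" where
  "prim L f x = (\<integral>y. indicator {..x} y * f y \<partial>seg L)"

lemma prim_integrable:
  fixes f :: "real \<Rightarrow> real"
  shows "integrable (seg L) f \<Longrightarrow> integrable (seg L) (\<lambda>y. indicator {..x} y * f y)"
  using integrable_mult_indicator[of "{..x}" "seg L" f] by simp

lemma prim_cong_AE:
  assumes "AE x in seg L. f x = g x" "f \<in> borel_measurable borel" "g \<in> borel_measurable borel"
  shows "prim L f x = prim L g x"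
  unfolding prim_def by (rule integral_cong_AE) (use assms in auto)

lemma prim_nonpos: "x \<le> 0 \<Longrightarrow> f \<in> borel_measurable borel \<Longrightarrow> prim L f x = 0"
  unfolding prim_def by (rule integral_eq_zero_AE) (auto intro!: eventually_mono[OF AE_seg_mem])

lemma prim_ge: "x \<ge> L \<Longrightarrow> f \<in> borel_measurable borel \<Longrightarrow> prim L f x = integral\<^sup>L (seg L) f"
  unfolding prim_def by (rule integral_cong_AE) (auto intro!: eventually_mono[OF AE_seg_mem])

lemma prim_add: "integrable (seg L) f \<Longrightarrow> integrable (seg L) g \<Longrightarrow>
    prim L (\<lambda>y. f y + g y) x = prim L f x + prim L g x"
  unfolding prim_def distrib_left by (simp add: prim_integrable)

lemma prim_cmult: "prim L (\<lambda>y. c * f y) x = c * prim L f x"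
  unfolding prim_def by (simp add: mult.left_commute)

lemma prim_diff: "integrable (seg L) f \<Longrightarrow> integrable (seg L) g \<Longrightarrow>
    prim L (\<lambda>y. f y - g y) x = prim L f x - prim L g x"
  unfolding prim_def right_diff_distrib by (simp add: prim_integrable)

lemma prim_abs_le: "integrable (seg L) f \<Longrightarrow> \<bar>prim L f x\<bar> \<le> (\<integral>y. \<bar>f y\<bar> \<partial>seg L)"
  unfolding prim_def
  by (rule order_trans[OF integral_abs_bound integral_mono])
    (use prim_integrable[of L f x] in \<open>auto simp: indicator_def intro!: integrable_abs\<close>)

lemma continuous_prim:
  assumes f: "integrable (seg L) f"
  shows "continuous_on UNIV (prim L f)"
proof -
  have [measurable]: "f \<in> borel_measurable borel" using f by (auto dest: borel_measurable_integrable)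
  have "isCont (prim L f) x" for x
  proof -
    have "\<forall>S. (\<forall>n. S n \<noteq> x) \<and> S \<longlonglongrightarrow> x \<longrightarrow> (\<lambda>n. prim L f (S n)) \<longlonglongrightarrow> prim L f x"
    proof (intro allI impI)
      fix S assume S: "(\<forall>n. S n \<noteq> x) \<and> S \<longlonglongrightarrow> x"
      show "(\<lambda>n. prim L f (S n)) \<longlonglongrightarrow> prim L f x"
        unfolding prim_def
      proof (rule integral_dominated_convergence[where w = "\<lambda>y. \<bar>f y\<bar>"])
        have "AE y in seg L. y \<noteq> x"
          using AE_lborel_singleton[of x] by (auto simp: AE_seg elim: eventually_mono)
        then show "AE y in seg L. (\<lambda>n. indicator {..S n} y * f y) \<longlonglongrightarrow> indicator {..x} y * f y"
        proof eventually_elim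
          case (elim y)
          have "\<forall>\<^sub>F n in sequentially. (y \<le> S n) = (y \<le> x)"
            using order_tendstoD[OF conjunct2[OF S], of y] elim
            by (cases "y < x") (auto elim!: eventually_mono)
          then show ?case
            by (intro tendsto_eventually) (auto elim!: eventually_mono simp: indicator_def)
        qed
      qed (use f in \<open>auto simp: abs_mult indicator_def\<close>)
    qed
    then show ?thesis by (simp add: isCont_def LIMSEQ_SEQ_conv)
  qed
  then show ?thesis by (simp add: continuous_on_eq_continuous_at)
qed

lemma prim_measurable [measurable (raw)]:
  assumes [measurable]: "case_prod f \<in> borel_measurable (N \<Otimes>\<^sub>M borel)" "g \<in> borel_measurable N"
  shows "(\<lambda>z. prim L (f z) (g z)) \<in> borel_measurable N"
  unfolding prim_def
proof -
  have *: "(\<lambda>(z, y). (if y \<le> g z then f z y else 0)) \<in> borel_measurable (N \<Otimes>\<^sub>M seg L)"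
    by measurable
  have "(\<lambda>z. \<integral>y. (if y \<le> g z then f z y else 0) \<partial>seg L) \<in> borel_measurable N"
    using seg.borel_measurable_lebesgue_integral[OF *] .
  then show "(\<lambda>z. \<integral>y. indicator {..g z} y * f z y \<partial>seg L) \<in> borel_measurable N"
    by (rule measurable_cong[THEN iffD1, rotated]) (auto intro!: Bochner_Integration.integral_cong)
qed


text \<open>The product rule for merely integrable densities, by Fubini: f(y) g(z) is integrated
  over the square [0, x]^2, which is cut along the diagonal.\<close>

lemma prim_mult:
  assumes f: "integrable (seg L) f" and g: "integrable (seg L) g"
  shows "prim L f x * prim L g x = prim L (\<lambda>y. f y * prim L g y + prim L f y * g y) x"
    and "integrable (seg L) (\<lambda>y. f y * prim L g y)" "integrable (seg L) (\<lambda>y. prim L f y * g y)"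
proof -
  have fg [measurable]: "f \<in> borel_measurable borel" "g \<in> borel_measurable borel"
    using f g by (auto dest: borel_measurable_integrable)
  have bdd: "integrable (seg L) (\<lambda>y. h y * prim L k y)" if h: "integrable (seg L) h" and k: "integrable (seg L) k" for h k
  proof (rule Bochner_Integration.integrable_bound)
    show "integrable (seg L) (\<lambda>y. (\<integral>z. \<bar>k z\<bar> \<partial>seg L) * h y)"
      using h by simp
    have [measurable]: "h \<in> borel_measurable borel" "k \<in> borel_measurable borel"
      using h k by (auto dest: borel_measurable_integrable)
    show "(\<lambda>y. h y * prim L k y) \<in> borel_measurable (seg L)" by measurable
    show "AE y in seg L. norm (h y * prim L k y) \<le> norm ((\<integral>z. \<bar>k z\<bar> \<partial>seg L) * h y)"
    proof (rule AE_I2)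
      fix y
      have "\<bar>h y\<bar> * \<bar>prim L k y\<bar> \<le> \<bar>h y\<bar> * \<bar>\<integral>z. \<bar>k z\<bar> \<partial>seg L\<bar>"
        by (rule mult_left_mono[OF order_trans[OF prim_abs_le[OF k] abs_ge_self]]) simp
      then show "norm (h y * prim L k y) \<le> norm ((\<integral>z. \<bar>k z\<bar> \<partial>seg L) * h y)"
        by (simp add: abs_mult mult.commute)
    qed
  qed
  show i: "integrable (seg L) (\<lambda>y. f y * prim L g y)" "integrable (seg L) (\<lambda>y. prim L f y * g y)"
    using bdd[OF f g] bdd[OF g f] by (auto simp: mult.commute)
  let ?P = "seg L \<Otimes>\<^sub>M seg L"
  define F where "F = (\<lambda>(y, z). (indicator {..x} y * f y) * (indicator {..x} z * g z))"
  have Fm [measurable]: "F \<in> borel_measurable ?P"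
    unfolding F_def split_beta'
    by (intro borel_measurable_times measurable_compose[OF measurable_fst, of "\<lambda>y. indicator {..x} y * f y"]
        measurable_compose[OF measurable_snd, of "\<lambda>y. indicator {..x} y * g y"]) auto
  have F: "integrable ?P F"
    unfolding F_def
    using prim_integrable[OF f] prim_integrable[OF g] prim_integrable[OF integrable_abs[OF f]]
    by (intro seg2.Fubini_integrable)
      (auto simp: abs_mult split_beta' intro!: integrable_mult_left integrable_abs)
  define D where "D = (\<lambda>(y, z). if z \<le> y then F (y, z) else 0)"
  define E where "E = (\<lambda>(y, z). if y \<le> z then F (y, z) else 0)"
  have D: "integrable ?P D"
    by (rule Bochner_Integration.integrable_bound[OF F]) (use Fm in \<open>auto simp: D_def split_beta'\<close>)
  have E: "integrable ?P E"
    by (rule Bochner_Integration.integrable_bound[OF F]) (use Fm in \<open>auto simp: E_def split_beta'\<close>)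
  have "prim L f x * prim L g x = integral\<^sup>L ?P F"
    unfolding seg2.integral_fst'[OF F, symmetric] by (simp add: F_def prim_def)
  also have "\<dots> = (\<integral>p. D p + E p \<partial>?P)"
  proof (rule integral_cong_AE)
    \<comment> \<open>\<open>D\<close> and \<open>E\<close> both contain the diagonal, which must
      therefore be a null set.\<close>
    have "AE y in seg L. AE z in seg L. y \<noteq> z"
    proof (rule AE_I2)
      fix y
      show "AE z in seg L. y \<noteq> z"
        using AE_lborel_singleton[of y] unfolding AE_seg by eventually_elim auto
    qed
    then have "AE p in ?P. fst p \<noteq> snd p"
      by (intro AE_seg_pairI1) (auto simp: pred_def borel_prod[symmetric])
    then show "AE p in ?P. F p = D p + E p"
      by eventually_elim (auto simp: D_def E_def)
  qed (use D E in auto)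
  also have "\<dots> = integral\<^sup>L ?P D + integral\<^sup>L ?P E"
    using D E by simp
  also have "integral\<^sup>L ?P D = prim L (\<lambda>y. f y * prim L g y) x"
  proof -
    have "D (y, z) = (indicator {..x} y * f y) * (indicator {..y} z * g z)" for y z
      by (auto simp: D_def F_def indicator_def)
    then show ?thesis
      unfolding seg2.integral_fst'[OF D, symmetric] by (simp add: prim_def mult.assoc)
  qed
  also have "integral\<^sup>L ?P E = prim L (\<lambda>y. prim L f y * g y) x"
  proof -
    have "E (y, z) = (indicator {..z} y * f y) * (indicator {..x} z * g z)" for y z
      by (auto simp: E_def F_def indicator_def)
    moreover have "integral\<^sup>L ?P E = (\<integral>z. (\<integral>y. E (y, z) \<partial>seg L) \<partial>seg L)"
      using seg2.integral_snd[of L L "\<lambda>y z. E (y, z)"] E by simp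
    ultimately show ?thesis by (simp add: prim_def mult.left_commute)
  qed
  finally show "prim L f x * prim L g x = prim L (\<lambda>y. f y * prim L g y + prim L f y * g y) x"
    by (simp add: prim_add i)
qed

text \<open>\<open>prim_mult\<close> at the right end point, with the boundary values
  \<open>c\<close> and \<open>d\<close> at 0 put back in. All boundary terms of the energy argument
  originate here.\<close>

lemma integration_by_parts_prim:
  assumes f: "integrable (seg L) f" and g: "integrable (seg L) g"
  shows "(\<integral>y. f y * (d + prim L g y) + (c + prim L f y) * g y \<partial>seg L) =
      (c + integral\<^sup>L (seg L) f) * (d + integral\<^sup>L (seg L) g) - c * d"
proof -
  have [measurable]: "f \<in> borel_measurable borel" "g \<in> borel_measurable borel"
    using f g by (auto dest: borel_measurable_integrable)
  note i = prim_mult(2,3)[OF f g]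
  have "(\<integral>y. f y * (d + prim L g y) + (c + prim L f y) * g y \<partial>seg L) =
      (\<integral>y. (f y * prim L g y + prim L f y * g y) + (d * f y + c * g y) \<partial>seg L)"
    by (intro Bochner_Integration.integral_cong refl) (simp add: algebra_simps)
  also have "\<dots> = (\<integral>y. f y * prim L g y + prim L f y * g y \<partial>seg L) + (d * integral\<^sup>L (seg L) f + c * integral\<^sup>L (seg L) g)"
    using i f g by simp
  also have "(\<integral>y. f y * prim L g y + prim L f y * g y \<partial>seg L) = prim L f L * prim L g L"
    unfolding prim_mult(1)[OF f g] by (rule prim_ge[symmetric]) auto
  also have "\<dots> = integral\<^sup>L (seg L) f * integral\<^sup>L (seg L) g"
    by (simp add: prim_ge)
  finally show ?thesis by (simp add: algebra_simps)
qed

lemma AE_eq_continuous_imp_eq: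
  fixes f g :: "real \<Rightarrow> real"
  assumes "AE x in seg L. f x = g x" "continuous_on {0..L} f" "continuous_on {0..L} g" "L > 0" "x \<in> {0..L}"
  shows "f x = g x"
proof (rule ccontr)
  assume ne: "f x \<noteq> g x"
  have c: "continuous_on {0..L} (\<lambda>x. f x - g x)" using assms by (intro continuous_intros)
  then obtain d where d: "d > 0" "\<And>y. y \<in> {0..L} \<Longrightarrow> dist y x < d \<Longrightarrow> dist (f y - g y) (f x - g x) < \<bar>f x - g x\<bar>"
    using ne assms(5) unfolding continuous_on_iff by (metis right_minus_eq zero_less_abs_iff)
  define a b where "a = max 0 (x - d)" and "b = min L (x + d)"
  have "a < b" using d assms by (auto simp: a_def b_def)
  have ne': "f y \<noteq> g y" if "y \<in> {a<..<b}" for y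
  proof -
    have "dist y x < d" "y \<in> {0..L}" using that by (auto simp: a_def b_def dist_real_def abs_less_iff)
    with d(2)[of y] show ?thesis by (auto simp: dist_real_def abs_minus_commute)
  qed
  from assms(1) have "AE y in lborel. y \<notin> {a<..<b}"
    unfolding AE_seg by eventually_elim (use ne' in \<open>auto simp: a_def b_def\<close>)
  then have "emeasure lborel {a<..<b} = 0"
    using AE_iff_null_sets[of "{a<..<b}" lborel] by (auto dest: null_setsD1)
  with \<open>a < b\<close> show False by simp
qed

text \<open>By continuity the identity holds at every point of [0, L]; at 0 it yields
  \<open>c = 0\<close>, and differences of primitives are integrals over intervals, so
  \<open>AE_zero_boxes\<close> applies. This is the standard way below to separate a boundary
  identity from a differentiated equation.\<close>

lemma prim_eq_zero:
  assumes f: "integrable (seg L) f" and L: "L > 0" and AE: "AE x in seg L. c + prim L f x = 0"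
  shows "c = 0" "AE x in seg L. f x = 0"
proof -
  have [measurable]: "f \<in> borel_measurable borel"
    using f by (auto dest: borel_measurable_integrable)
  have zero: "c + prim L f x = 0" if "x \<in> {0..L}" for x
    using AE by (rule AE_eq_continuous_imp_eq)
      (use that L continuous_on_subset[OF continuous_prim[OF f]] in \<open>auto intro!: continuous_intros\<close>)
  from zero[of 0] L show c: "c = 0" by (simp add: prim_nonpos)
  have zero': "prim L f x = 0" for x
  proof -
    consider "x \<le> 0" | "x \<in> {0..L}" | "x \<ge> L" by fastforce
    then show ?thesis
      by cases (use zero[of x] zero[of L] L c in \<open>auto simp: prim_nonpos prim_ge\<close>)
  qed
  have "AE x in lborel. indicator {0<..<L} x * f x = 0"
  proof (rule AE_zero_boxes)
    show F: "integrable lborel (\<lambda>x. indicator {0<..<L} x * f x)"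
      using f integrable_seg[of f L] by (simp add: set_integrable_def)
    fix a b :: real
    have *: "(\<integral>x. indicator {0<..<L} x * (indicator A x * f x) \<partial>lborel) = (\<integral>x. indicator A x * f x \<partial>seg L)" 
      if "A \<in> sets borel" for A
      using that by (subst integral_seg) (auto simp: set_lebesgue_integral_def)
    show "(LINT x:box a b|lborel. indicator {0<..<L} x * f x) = 0"
    proof (cases "a < b")
      case True
      have "AE x in seg L. x \<noteq> b"
        using AE_lborel_singleton[of b] by (auto simp: AE_seg elim: eventually_mono)
      then have "(\<integral>x. indicator (box a b) x * f x \<partial>seg L) =
          (\<integral>x. indicator {..b} x * f x - indicator {..a} x * f x \<partial>seg L)"
        using True by (intro integral_cong_AE) (auto simp: indicator_def elim!: eventually_mono)
      also have "\<dots> = prim L f b - prim L f a"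
        unfolding prim_def using f by (simp add: prim_integrable)
      finally show ?thesis
        using *[of "box a b"] zero' by (simp add: set_lebesgue_integral_def mult.left_commute)
    qed (simp add: set_lebesgue_integral_def)
  qed
  then show "AE x in seg L. f x = 0"
    unfolding AE_seg by eventually_elim (auto simp: indicator_def split: if_splits)
qed

lemma prim_deriv:
  assumes d: "\<And>x. x \<in> {0..L} \<Longrightarrow> (F has_real_derivative f x) (at x within {0..L})" 
    and c: "continuous_on {0..L} f" and fm: "f \<in> borel_measurable borel" and x: "x \<in> {0..L}"
  shows "F x = F 0 + prim L f x" "integrable (seg L) f"
proof -
  have si: "set_integrable lborel {0..L} f"
    by (rule borel_integrable_atLeastAtMost') fact
  then have "set_integrable lborel {0<..<L} f"
    by (rule set_integrable_subset) auto
  then show "integrable (seg L) f" using fm by (simp add: integrable_seg)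
  have hi: "(f has_integral (F x - F 0)) {0..x}"
    by (rule fundamental_theorem_of_calculus)
      (use x in \<open>auto simp: has_real_derivative_iff_has_vector_derivative[symmetric] intro!: DERIV_subset[OF d]\<close>)
  have "set_integrable lborel {0..x} f"
    by (rule set_integrable_subset[OF si]) (use x in auto)
  from set_borel_integral_eq_integral(2)[OF this] integral_unique[OF hi]
  have "(\<integral>y. f y * indicator {0..x} y \<partial>lborel) = F x - F 0"
    by (simp add: set_lebesgue_integral_def mult.commute)
  moreover have "prim L f x = (\<integral>y. indicator {0<..<L} y * (indicator {..x} y * f y) \<partial>lborel)"
    unfolding prim_def using fm by (subst integral_seg) (auto simp: set_lebesgue_integral_def)
  moreover have "\<dots> = (\<integral>y. f y * indicator {0..x} y \<partial>lborel)"
  proof (rule integral_cong_AE)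
    show "AE y in lborel. indicator {0<..<L} y * (indicator {..x} y * f y) = f y * indicator {0..x} y"
      using AE_lborel_singleton[of 0] AE_lborel_singleton[of L]
      by eventually_elim (use x in \<open>auto simp: indicator_def\<close>)
  qed (use fm in auto)
  ultimately show "F x = F 0 + prim L f x" by simp
qed

section \<open>Weak derivatives and integral representations\<close>

lemma measurable_ae_eq_lebesgue:
  fixes w :: "'a::euclidean_space \<Rightarrow> real"
  assumes W: "W \<in> borel_measurable borel" and S: "S \<in> sets borel" and ae: "AE z in lborel. z \<in> S \<longrightarrow> w z = W z"
  shows "(\<lambda>z. indicator S z * w z) \<in> borel_measurable lebesgue"
proof (rule borel_measurable_AE)
  show "AE z in lebesgue. indicator S z * W z = indicator S z * w z"
    using AE_completion[OF ae] by eventually_elim (auto simp: indicator_def)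
  have "(\<lambda>z. indicator S z * W z) \<in> borel_measurable borel" using W S by measurable
  then show "(\<lambda>z. indicator S z * W z) \<in> borel_measurable lebesgue"
    by (simp add: measurable_completion)
qed

text \<open>The definitions use completed Lebesgue measure, while Fubini and parametrised primitives
  are available for Borel functions; this is the bridge between the two.\<close>

lemma set_integral_lebesgue_eq:
  fixes w :: "'a::euclidean_space \<Rightarrow> real"
  assumes W: "W \<in> borel_measurable borel" and S: "S \<in> sets borel" and ae: "AE z in lborel. z \<in> S \<longrightarrow> w z = W z"
  shows "(LINT z:S|lebesgue. w z) = (LINT z:S|lborel. W z)"
    and "set_integrable lebesgue S w \<longleftrightarrow> set_integrable lborel S W"
proof -
  have m: "(\<lambda>z. indicator S z * W z) \<in> borel_measurable borel" using W S by measurable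
  then have m': "(\<lambda>z. indicator S z * W z) \<in> borel_measurable lebesgue"
    by (simp add: measurable_completion)
  have ae': "AE z in lebesgue. indicator S z * w z = indicator S z * W z"
    using AE_completion[OF ae] by eventually_elim (auto simp: indicator_def)
  show "(LINT z:S|lebesgue. w z) = (LINT z:S|lborel. W z)"
    unfolding set_lebesgue_integral_def
    using integral_cong_AE[OF measurable_ae_eq_lebesgue[OF assms] m' ae'] m
    by (simp add: integral_completion)
  show "set_integrable lebesgue S w \<longleftrightarrow> set_integrable lborel S W"
    unfolding set_integrable_def
    using integrable_cong_AE[OF measurable_ae_eq_lebesgue[OF assms] m' ae'] m
    by (simp add: integrable_completion)
qed

text \<open>Local integrability gives measurability on compact sets only. The compact rectangles
  \<open>K n\<close> exhaust \<open>Q L T\<close>, and the cut-off functions converge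
  pointwise.\<close>

lemma loc_integrable_borel_rep:
  assumes w: "loc_integrable (Q L T) w"
  obtains W where "W \<in> borel_measurable borel" "AE z in seg L \<Otimes>\<^sub>M seg T. w z = W z"
proof -
  define K where "K n = {1 / real (Suc n)..L - 1 / real (Suc n)} \<times> {1 / real (Suc n)..T - 1 / real (Suc n)}" for n
  have K: "compact (K n)" "K n \<subseteq> Q L T" for n
  proof -
    have "1 / real (Suc n) > 0" by simp
    moreover define d where "d = 1 / real (Suc n)"
    ultimately have "d > 0" by simp
    then show "K n \<subseteq> Q L T" unfolding K_def Q_def d_def[symmetric] by auto
  qed (auto simp: K_def intro: compact_Times)
  have "(\<lambda>z. indicator (Q L T) z * w z) \<in> borel_measurable lebesgue"
  proof (rule borel_measurable_LIMSEQ_real)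
    show "(\<lambda>z. indicator (K n) z * w z) \<in> borel_measurable lebesgue" for n
      using w K[of n] by (auto simp: loc_integrable_def set_integrable_def)
    show "(\<lambda>n. indicator (K n) z * w z) \<longlonglongrightarrow> indicator (Q L T) z * w z" for z
    proof (cases "z \<in> Q L T")
      case z: True
      define m where "m = Min {fst z, L - fst z, snd z, T - snd z}"
      have "m > 0" using z by (auto simp: m_def Q_def)
      then obtain n where n: "inverse (real (Suc n)) < m" using reals_Archimedean by blast
      have "z \<in> K k" if "k \<ge> n" for k
      proof -
        have "1 / real (Suc k) \<le> 1 / real (Suc n)" using that by (intro divide_left_mono) auto
        then have "1 / real (Suc k) \<le> m" using n by (simp add: inverse_eq_divide)
        then show ?thesis unfolding K_def m_def using z by (auto simp: mem_Times_iff simp del: of_nat_Suc)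
      qed
      then have "\<forall>\<^sub>F k in sequentially. indicator (K k) z * w z = indicator (Q L T) z * w z"
        using z by (auto simp: eventually_sequentially intro!: exI[of _ n])
      then show ?thesis by (rule tendsto_eventually)
    next
      case False
      then have "z \<notin> K n" for n using K by blast
      then show ?thesis using False by simp
    qed
  qed
  then obtain W where W: "W \<in> borel_measurable lborel" "AE z in lborel. indicator (Q L T) z * w z = W z"
    using completion_ex_borel_measurable_real[of "\<lambda>z. indicator (Q L T) z * w z" lborel] by auto
  show ?thesis
  proof
    show "AE z in seg L \<Otimes>\<^sub>M seg T. w z = W z"
      unfolding AE_seg_pair using W(2) by eventually_elim auto
  qed (use W in auto)
qed

text \<open>The function spaces and the equations each assert the existence of derivatives of their
  own; uniqueness allows them to be identified.\<close>

lemma weak_deriv_unique: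
  assumes v: "has_weak_deriv (Q L T) e w v" and v': "has_weak_deriv (Q L T) e w v'"
  shows "AE z in seg L \<Otimes>\<^sub>M seg T. v z = v' z"
proof -
  have "AE z in lebesgue_on (Q L T). v z - v' z = 0"
  proof (rule fundamental_lemma_Q)
    show "loc_integrable (Q L T) (\<lambda>z. v z - v' z)"
      using v v' by (auto simp: has_weak_deriv_def loc_integrable_def)
    fix a b assume ab: "test_function {0<..<L} a" "test_function {0<..<T} b"
    let ?\<phi> = "\<lambda>z. a (fst z) * b (snd z)"
    have \<phi>: "test_function (Q L T) ?\<phi>"
      unfolding Q_def by (rule test_function_product(1)[OF ab])
    let ?K = "closure {z. ?\<phi> z \<noteq> 0}"
    have K: "compact ?K" "?K \<subseteq> Q L T" using \<phi> unfolding test_function_def by blast+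
    have cont: "continuous_on UNIV ?\<phi>" using test_function_continuous[OF \<phi>] .
    have int: "set_integrable lebesgue (Q L T) (\<lambda>z. g z * ?\<phi> z)" if "loc_integrable (Q L T) g" for g
    proof -
      have "set_integrable lebesgue ?K g" using that K unfolding loc_integrable_def by blast
      then have gK: "integrable lebesgue (\<lambda>z. indicator ?K z * g z)" by (simp add: set_integrable_def)
      obtain B where B: "\<And>z. z \<in> ?K \<Longrightarrow> \<bar>?\<phi> z\<bar> \<le> B"
        using compact_imp_bounded[OF compact_continuous_image[OF continuous_on_subset[OF cont] K(1)]]
        by (auto simp: bounded_iff)
      have eq: "indicator (Q L T) z * (g z * ?\<phi> z) = (indicator ?K z * g z) * ?\<phi> z" for z
        using subsetD[OF closure_subset, of z "{z. ?\<phi> z \<noteq> 0}"] K(2) by (auto simp: indicator_def)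
      have "integrable lebesgue (\<lambda>z. (indicator ?K z * g z) * ?\<phi> z)"
      proof (rule Bochner_Integration.integrable_bound)
        show "integrable lebesgue (\<lambda>z. B * (indicator ?K z * g z))" using gK by simp
        have "?\<phi> \<in> borel_measurable lebesgue"
          using borel_measurable_continuous_onI[OF cont] by (simp add: measurable_completion)
        then show "(\<lambda>z. (indicator ?K z * g z) * ?\<phi> z) \<in> borel_measurable lebesgue"
          using borel_measurable_times[OF borel_measurable_integrable[OF gK]] by blast
        show "AE z in lebesgue. norm ((indicator ?K z * g z) * ?\<phi> z) \<le> norm (B * (indicator ?K z * g z))"
        proof (rule AE_I2)
          fix z
          show "norm ((indicator ?K z * g z) * ?\<phi> z) \<le> norm (B * (indicator ?K z * g z))"
          proof (cases "z \<in> ?K")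
            case True
            then have "\<bar>?\<phi> z\<bar> \<le> \<bar>B\<bar>" using B[OF True] by linarith
            then show ?thesis using True
              by (simp add: abs_mult[of "g z"] abs_mult[of B] mult.commute[of "\<bar>g z\<bar>"] mult_right_mono del: abs_mult)
          qed simp
        qed
      qed
      then show ?thesis by (simp add: set_integrable_def eq)
    qed
    have "(LINT z:Q L T|lebesgue. v z * ?\<phi> z) = (LINT z:Q L T|lebesgue. v' z * ?\<phi> z)"
    proof -
      have "(LINT z:Q L T|lebesgue. w z * frechet_derivative ?\<phi> (at z) e) = - (LINT z:Q L T|lebesgue. g z * ?\<phi> z)"
        if "has_weak_deriv (Q L T) e w g" for g
        using that \<phi> unfolding has_weak_deriv_def by blast
      from this[OF v] this[OF v'] show ?thesis by simp
    qed
    moreover have "set_integrable lebesgue (Q L T) (\<lambda>z. v z * ?\<phi> z)" "set_integrable lebesgue (Q L T) (\<lambda>z. v' z * ?\<phi> z)"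
      using v v' by (auto simp: has_weak_deriv_def intro!: int)
    ultimately show "(LINT z:Q L T|lebesgue. (v z - v' z) * ?\<phi> z) = 0"
      by (simp add: left_diff_distrib set_integral_diff)
  qed
  then show ?thesis by (simp add: AE_seg_pair')
qed

lemma test_function_bounded:
  fixes a :: "real \<Rightarrow> real"
  assumes "test_function {0<..<L} a" "L > 0"
  obtains B where "\<And>x. \<bar>a x\<bar> \<le> B"
proof -
  obtain l r where lr: "0 < l" "l \<le> r" "r < L" "\<And>x. x \<notin> {l..r} \<Longrightarrow> a x = 0"
    using test_function_support[OF assms] by metis
  have "compact (a ` {l..r})"
    by (intro compact_continuous_image continuous_on_subset[OF test_function_continuous[OF assms(1)]]) auto
  then obtain B where B: "\<And>x. x \<in> {l..r} \<Longrightarrow> \<bar>a x\<bar> \<le> B"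
    using compact_imp_bounded[of "a ` {l..r}"] unfolding bounded_iff by fastforce
  have "\<bar>a x\<bar> \<le> \<bar>B\<bar>" for x
  proof (cases "x \<in> {l..r}")
    case True
    then show ?thesis using B[OF True] by linarith
  qed (simp add: lr)
  then show ?thesis using that by blast
qed

lemma test_function_deriv:
  fixes a :: "real \<Rightarrow> real"
  assumes a: "test_function {0<..<L} a" and L: "L > 0"
  shows "test_function {0<..<L} (deriv a)"
proof -
  obtain l r where lr: "0 < l" "l \<le> r" "r < L" "\<And>x. x \<notin> {l..r} \<Longrightarrow> a x = 0"
    using test_function_support[OF a L] by metis
  have fd: "frechet_derivative a (at x) 1 = deriv a x" for x
    using frechet_derivative_at[OF test_function_real_deriv(1)[OF a, unfolded has_field_derivative_def], of x]
    by (metis mult.right_neutral)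
  show ?thesis
  proof (rule test_functionI)
    show "Ck k (deriv a)" for k
    proof -
      have "Ck (Suc k) a" using a unfolding test_function_def by blast
      from Ck_SucD(2)[OF this, of 1] show ?thesis by (simp add: fd)
    qed
    show "deriv a x = 0" if "x \<notin> {l..r}" for x
    proof -
      have "open (- {l..r})" by (simp add: open_Compl)
      then have "(a has_real_derivative 0) (at x)"
        by (rule has_field_derivative_transform_within_open[where f = "\<lambda>_. 0", rotated]) (use that lr in auto)
      then show ?thesis by (rule DERIV_imp_deriv)
    qed
  qed (use lr in auto)
qed

lemma test_function_borel [measurable_dest]:
  fixes a :: "real \<Rightarrow> real"
  shows "test_function {0<..<L} a \<Longrightarrow> a \<in> borel_measurable borel"
  by (intro borel_measurable_continuous_onI test_function_continuous)

lemma integrable_mult_bounded: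
  fixes f g :: "'a \<Rightarrow> real"
  assumes f: "integrable N f" and g: "g \<in> borel_measurable N" "\<And>x. \<bar>g x\<bar> \<le> B"
  shows "integrable N (\<lambda>x. f x * g x)"
proof (rule Bochner_Integration.integrable_bound)
  show "integrable N (\<lambda>x. B * f x)" using f by simp
  show "(\<lambda>x. f x * g x) \<in> borel_measurable N" using f g by measurable
  show "AE x in N. norm (f x * g x) \<le> norm (B * f x)"
  proof (rule AE_I2)
    fix x
    have "\<bar>f x\<bar> * \<bar>g x\<bar> \<le> \<bar>f x\<bar> * \<bar>B\<bar>"
      by (rule mult_left_mono[OF order_trans[OF g(2) abs_ge_self]]) simp
    then show "norm (f x * g x) \<le> norm (B * f x)" by (simp add: abs_mult mult.commute)
  qed
qed

lemma integrable_test_function: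
  fixes a :: "real \<Rightarrow> real"
  assumes "test_function {0<..<L} a" "L > 0"
  shows "integrable (seg L) a"
proof -
  obtain B where "\<And>x. \<bar>a x\<bar> \<le> B" using test_function_bounded[OF assms] by blast
  from integrable_mult_bounded[of "seg L" "\<lambda>_. 1" a B, OF _ _ this] show ?thesis
    using assms by auto
qed

lemma test_function_prim_deriv:
  fixes a :: "real \<Rightarrow> real"
  assumes a: "test_function {0<..<L} a" and L: "L > 0"
  shows "x \<in> {0..L} \<Longrightarrow> prim L (deriv a) x = a x" "integral\<^sup>L (seg L) (deriv a) = 0"
proof -
  have d: "deriv a \<in> borel_measurable borel"
    using test_function_deriv[OF a L] by measurable
  show *: "prim L (deriv a) x = a x" if "x \<in> {0..L}" for x
  proof -
    have "a x = a 0 + prim L (deriv a) x"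
      by (rule prim_deriv(1)[OF _ _ d that])
        (auto intro: has_field_derivative_at_within[OF test_function_real_deriv(1)[OF a]]
          continuous_on_subset[OF test_function_real_deriv(2)[OF a]])
    then show ?thesis using test_function_outside[OF a, of 0] by simp
  qed
  show "integral\<^sup>L (seg L) (deriv a) = 0"
    using *[of L] L test_function_outside[OF a, of L] d by (simp add: prim_ge)
qed

lemma ex_test_function_integral_1:
  assumes "L > 0"
  obtains \<omega> :: "real \<Rightarrow> real" where "test_function {0<..<L} \<omega>" "integral\<^sup>L (seg L) \<omega> = 1"
proof -
  have "(\<lambda>n. \<integral>x. cutoff n 0 L x \<partial>seg L) \<longlonglongrightarrow> (\<integral>x. indicator {0<..<L} x \<partial>seg L)"
  proof (rule integral_dominated_convergence[where w = "\<lambda>_. 1"])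
    show "cutoff n 0 L \<in> borel_measurable (seg L)" for n
      using test_function_borel[OF test_function_cutoff[of 0 L n]] by simp
  qed (auto simp: cutoff_tendsto cutoff_bounds)
  moreover have "(\<integral>x. indicator {0<..<L} x \<partial>seg L) = L"
  proof -
    have "(\<integral>x. indicator {0<..<L} x \<partial>seg L) = (\<integral>x. 1 \<partial>seg L)"
      by (rule integral_cong_AE) (auto intro!: eventually_mono[OF AE_seg_mem])
    also have "\<dots> = L" using assms by (simp add: measure_seg)
    finally show ?thesis .
  qed
  ultimately have "(\<lambda>n. \<integral>x. cutoff n 0 L x \<partial>seg L) \<longlonglongrightarrow> L"
    by (simp only:)
  from order_tendstoD(1)[OF this assms]
  obtain n where n: "(\<integral>x. cutoff n 0 L x \<partial>seg L) > 0"
    by (auto simp: eventually_sequentially)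
  let ?c = "inverse (\<integral>x. cutoff n 0 L x \<partial>seg L)"
  show ?thesis
  proof (rule that[of "\<lambda>x. ?c * cutoff n 0 L x"])
    obtain a b where ab: "0 < a" "a \<le> b" "b < L" "\<And>x. x \<notin> {a..b} \<Longrightarrow> cutoff n 0 L x = 0"
      using test_function_support[OF test_function_cutoff assms] by metis
    show "test_function {0<..<L} (\<lambda>x. ?c * cutoff n 0 L x)"
      by (rule test_functionI[of _ a b])
        (use ab test_function_cutoff[of 0 L n] in \<open>auto simp: test_function_def intro: Ck_mult Ck_const\<close>)
  qed (use n in simp)
qed

section \<open>Integration over the cylinder and the du Bois-Reymond lemma with a parameter\<close>

abbreviation rect :: "real \<Rightarrow> real \<Rightarrow> (real \<times> real) measure" where
  "rect L T \<equiv> seg L \<Otimes>\<^sub>M seg T"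

lemma integrable_rect_snd:
  assumes "integrable (seg T) c" shows "integrable (rect L T) (\<lambda>z. c (snd z) :: real)"
proof -
  have [measurable]: "c \<in> borel_measurable borel" using assms by (auto dest: borel_measurable_integrable)
  have "integrable (rect L T) (\<lambda>(x, t). c t)"
    by (rule seg2.Fubini_integrable) (use assms in \<open>auto simp: abs_mult\<close>)
  then show ?thesis by (simp add: split_beta')
qed

lemma integrable_rect_fst:
  assumes "integrable (seg L) c" shows "integrable (rect L T) (\<lambda>z. c (fst z) :: real)"
proof -
  have [measurable]: "c \<in> borel_measurable borel" using assms by (auto dest: borel_measurable_integrable)
  have "integrable (rect L T) (\<lambda>(x, t). c x)"
    by (rule seg2.Fubini_integrable) (use assms in \<open>auto simp: abs_mult\<close>)
  then show ?thesis by (simp add: split_beta')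
qed

lemma integrable_rect_slices:
  assumes V: "integrable (rect L T) V"
  shows "AE x in seg L. integrable (seg T) (\<lambda>t. V (x, t) :: real)" "AE t in seg T. integrable (seg L) (\<lambda>x. V (x, t))"
    "integrable (seg L) (\<lambda>x. \<integral>t. V (x, t) \<partial>seg T)" "integrable (seg T) (\<lambda>t. \<integral>x. V (x, t) \<partial>seg L)"
    "(\<integral>x. \<integral>t. V (x, t) \<partial>seg T \<partial>seg L) = integral\<^sup>L (rect L T) V"
    "(\<integral>t. \<integral>x. V (x, t) \<partial>seg L \<partial>seg T) = integral\<^sup>L (rect L T) V"
  using seg2.AE_integrable_fst'[OF V] seg2.integrable_fst'[OF V] seg2.integral_fst'[OF V]
    seg2.AE_integrable_snd[of L T "\<lambda>x t. V (x, t)"] seg2.integrable_snd[of L T "\<lambda>x t. V (x, t)"]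
    seg2.integral_snd[of L T "\<lambda>x t. V (x, t)"] V
  by simp_all

lemma prim_rect_measurable [measurable (raw)]:
  assumes [measurable]: "V \<in> borel_measurable (borel \<Otimes>\<^sub>M borel)" "f \<in> borel_measurable N" "g \<in> borel_measurable N"
  shows "(\<lambda>z. prim L (\<lambda>y. V (y, f z)) (g z)) \<in> borel_measurable N"
  by measurable

lemma prim_rect_measurable2 [measurable (raw)]:
  assumes [measurable]: "V \<in> borel_measurable (borel \<Otimes>\<^sub>M borel)" "f \<in> borel_measurable N" "g \<in> borel_measurable N"
  shows "(\<lambda>z. prim L (\<lambda>y. V (f z, y)) (g z)) \<in> borel_measurable N"
  by measurable

lemma rect_measurable: "f \<in> borel_measurable (rect L T) \<longleftrightarrow> f \<in> borel_measurable (borel \<Otimes>\<^sub>M borel)"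
  by (simp cong: measurable_cong_sets)

lemma integrable_rect_measurable [measurable_dest]:
  "integrable (rect L T) f \<Longrightarrow> f \<in> borel_measurable (borel \<Otimes>\<^sub>M borel)"
  by (auto dest: borel_measurable_integrable simp: rect_measurable)

lemma integrable_prim_rect:
  assumes V: "integrable (rect L T) V"
  shows "integrable (rect L T) (\<lambda>z. prim L (\<lambda>y. V (y, snd z)) (fst z))"
proof (rule Bochner_Integration.integrable_bound)
  have "integrable (rect L T) (\<lambda>z. \<bar>V z\<bar>)" using V by simp
  from integrable_rect_slices(4)[OF this]
  show "integrable (rect L T) (\<lambda>z. \<integral>y. \<bar>V (y, snd z)\<bar> \<partial>seg L)"
    by (rule integrable_rect_snd)
  note [measurable] = integrable_rect_measurable[OF V]
  show "(\<lambda>z. prim L (\<lambda>y. V (y, snd z)) (fst z)) \<in> borel_measurable (rect L T)" by measurable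
  have "AE t in seg T. AE x in seg L. norm (prim L (\<lambda>y. V (y, t)) x) \<le> norm (\<integral>y. \<bar>V (y, t)\<bar> \<partial>seg L)"
    using integrable_rect_slices(2)[OF V]
    by eventually_elim (auto intro!: AE_I2 prim_abs_le)
  then show "AE z in rect L T. norm (prim L (\<lambda>y. V (y, snd z)) (fst z)) \<le> norm (\<integral>y. \<bar>V (y, snd z)\<bar> \<partial>seg L)"
    by (intro AE_seg_pairI2) (simp_all add: borel_prod[symmetric])
qed

lemma loc_integrable_rect:
  fixes W :: "real \<times> real \<Rightarrow> real"
  assumes W: "integrable (rect L T) W"
  shows "loc_integrable (Q L T) W"
proof -
  have m: "W \<in> borel_measurable borel" using integrable_rect_measurable[OF W] by (simp add: borel_prod)
  have "set_integrable lborel (Q L T) W" using W by (simp add: integrable_seg_pair m)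
  then have "set_integrable lebesgue (Q L T) W"
    using set_integral_lebesgue_eq(2)[OF m Q_sets(1), of L T W] by simp
  then show ?thesis
    unfolding loc_integrable_def by (auto intro: set_integrable_subset dest: fmeasurable_compact)
qed

lemma set_integral_Q_eq:
  fixes W :: "real \<times> real \<Rightarrow> real"
  assumes W: "W \<in> borel_measurable (borel \<Otimes>\<^sub>M borel)" and "AE z in rect L T. w z = W z"
  shows "(LINT z:Q L T|lebesgue. w z) = integral\<^sup>L (rect L T) W"
  using assms set_integral_lebesgue_eq(1)[OF _ Q_sets(1), of W L T w]
  by (simp add: AE_seg_pair integral_seg_pair borel_prod)

text \<open>Du Bois-Reymond's lemma with t as a parameter: subtracting the primitive of
  \<open>V\<close> leaves a \<open>G\<close> with weak x-derivative zero, and such a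
  \<open>G\<close> coincides with its weighted mean in x.\<close>

lemma weak_representation:
  assumes L: "L > 0" and W: "integrable (rect L T) W" and V: "integrable (rect L T) V"
    and weak: "\<And>a b. test_function {0<..<L} a \<Longrightarrow> test_function {0<..<T} b \<Longrightarrow>
      (\<integral>z. W z * (deriv a (fst z) * b (snd z)) \<partial>rect L T) = - (\<integral>z. V z * (a (fst z) * b (snd z)) \<partial>rect L T)"
    and T: "T > 0"
  obtains c where "integrable (seg T) c"
    "AE z in rect L T. W z = c (snd z) + prim L (\<lambda>y. V (y, snd z)) (fst z)"
proof -
  note [measurable] = integrable_rect_measurable[OF W] integrable_rect_measurable[OF V]
  define N where "N z = prim L (\<lambda>y. V (y, snd z)) (fst z)" for z
  have N: "integrable (rect L T) N" unfolding N_def by (rule integrable_prim_rect[OF V])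
  define G where "G z = W z - N z" for z
  have G: "integrable (rect L T) G" unfolding G_def using W N by simp
  note [measurable] = integrable_rect_measurable[OF N] integrable_rect_measurable[OF G]
  have test: "integrable (rect L T) (\<lambda>z. h z * (a (fst z) * b (snd z)))"
    if h: "integrable (rect L T) h" and a: "test_function {0<..<L} a" and b: "test_function {0<..<T} b" for h a b
  proof -
    obtain A where A: "\<And>x. \<bar>a x\<bar> \<le> A" using test_function_bounded[OF a L] by blast
    obtain B where B: "\<And>x. \<bar>b x\<bar> \<le> B" using test_function_bounded[OF b T] by blast
    have [measurable]: "a \<in> borel_measurable borel" "b \<in> borel_measurable borel"
      using a b test_function_borel by blast+
    have AB: "\<bar>a (fst z) * b (snd z)\<bar> \<le> A * B" for z
      unfolding abs_mult by (intro mult_mono A B order_trans[OF abs_ge_zero A]) auto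
    show ?thesis
      by (rule integrable_mult_bounded[OF h _ AB]) measurable
  qed
  \<comment> \<open>The primitive satisfies the same weak identity as \<open>W\<close>, slice by
    slice, since test functions vanish at both ends.\<close>
  have N': "(\<integral>z. N z * (deriv a (fst z) * b (snd z)) \<partial>rect L T) = - (\<integral>z. V z * (a (fst z) * b (snd z)) \<partial>rect L T)"
    if a: "test_function {0<..<L} a" and b: "test_function {0<..<T} b" for a b
  proof -
    note a' = test_function_deriv[OF a L]
    have [measurable]: "a \<in> borel_measurable borel" "b \<in> borel_measurable borel" "deriv a \<in> borel_measurable borel"
      using a b a' test_function_borel by blast+
    have "AE t in seg T. (\<integral>x. N (x, t) * (deriv a x * b t) \<partial>seg L) = (\<integral>x. - (V (x, t) * (a x * b t)) \<partial>seg L)"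
      using integrable_rect_slices(2)[OF V]
    proof eventually_elim
      case (elim t)
      note ia = integrable_test_function[OF a' L]
      have ip: "integrable (seg L) (\<lambda>x. prim L (\<lambda>y. V (y, t)) x * deriv a x)" "integrable (seg L) (\<lambda>x. V (x, t) * prim L (deriv a) x)"
        by (rule prim_mult[OF elim ia])+
      have "(\<integral>x. V (x, t) * (0 + prim L (deriv a) x) + (0 + prim L (\<lambda>y. V (y, t)) x) * deriv a x \<partial>seg L) = 0"
        by (subst integration_by_parts_prim[OF elim ia]) (simp add: test_function_prim_deriv[OF a L])
      then have "(\<integral>x. prim L (\<lambda>y. V (y, t)) x * deriv a x \<partial>seg L) = - (\<integral>x. V (x, t) * prim L (deriv a) x \<partial>seg L)"
        using ip by simp
      also have "(\<integral>x. V (x, t) * prim L (deriv a) x \<partial>seg L) = (\<integral>x. V (x, t) * a x \<partial>seg L)"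
        by (rule integral_cong_AE) (auto intro!: eventually_mono[OF AE_seg_mem] simp: test_function_prim_deriv[OF a L])
      finally have "(\<integral>x. prim L (\<lambda>y. V (y, t)) x * deriv a x \<partial>seg L) * b t = - (\<integral>x. V (x, t) * a x \<partial>seg L) * b t" by simp
      then show ?case by (simp add: N_def mult.assoc[symmetric])
    qed
    then have "(\<integral>t. \<integral>x. N (x, t) * (deriv a x * b t) \<partial>seg L \<partial>seg T) = (\<integral>t. \<integral>x. - (V (x, t) * (a x * b t)) \<partial>seg L \<partial>seg T)"
      by (intro integral_cong_AE) measurable
    then show ?thesis
      using integrable_rect_slices(6)[OF test[OF N a' b]] integrable_rect_slices(6)[OF test[OF V a b]] by simp
  qed
  have G': "(\<integral>z. G z * (deriv a (fst z) * b (snd z)) \<partial>rect L T) = 0"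
    if "test_function {0<..<L} a" "test_function {0<..<T} b" for a b
    using weak[OF that] N'[OF that] test[OF W test_function_deriv[OF that(1) L] that(2)]
      test[OF N test_function_deriv[OF that(1) L] that(2)]
    by (simp add: G_def left_diff_distrib)
  obtain \<omega> :: "real \<Rightarrow> real" where \<omega>: "test_function {0<..<L} \<omega>" "integral\<^sup>L (seg L) \<omega> = 1"
    using ex_test_function_integral_1[OF L] by blast
  \<comment> \<open>The candidate for the boundary value: the mean of \<open>G\<close> against a
    fixed weight of integral 1. It is automatically measurable and integrable in t.\<close>
  define c where "c t = (\<integral>x. G (x, t) * \<omega> x \<partial>seg L)" for t
  have \<omega>m [measurable]: "\<omega> \<in> borel_measurable borel" using \<omega>(1) test_function_borel by blast
  obtain B\<omega> where "\<And>x. \<bar>\<omega> x\<bar> \<le> B\<omega>" using test_function_bounded[OF \<omega>(1) L] by blast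
  then have "integrable (rect L T) (\<lambda>z. G z * \<omega> (fst z))"
    by (intro integrable_mult_bounded[OF G]) auto
  from integrable_rect_slices(4)[OF this] have c: "integrable (seg T) c" by (simp add: c_def[abs_def])
  have cr: "integrable (rect L T) (\<lambda>z. c (snd z))" by (rule integrable_rect_snd[OF c])
  have cm [measurable]: "c \<in> borel_measurable borel" using c by (auto dest: borel_measurable_integrable)
  have "AE z in lebesgue_on (Q L T). G z - c (snd z) = 0"
  proof (rule fundamental_lemma_Q)
    show "loc_integrable (Q L T) (\<lambda>z. G z - c (snd z))"
      by (rule loc_integrable_rect) (use G cr in simp)
    fix \<eta> b assume \<eta>: "test_function {0<..<L} \<eta>" and b: "test_function {0<..<T} b"
    define \<alpha> where "\<alpha> = integral\<^sup>L (seg L) \<eta>"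
    have [measurable]: "\<eta> \<in> borel_measurable borel" "b \<in> borel_measurable borel"
      using \<eta> b test_function_borel by blast+
    \<comment> \<open>Removing the mean of \<eta> along \<omega> makes \<zeta> the derivative of a
      test function, and \<open>G'\<close> annihilates such derivatives.\<close>
    define \<zeta> where "\<zeta> x = \<eta> x + (- \<alpha>) * \<omega> x" for x
    have \<zeta>: "test_function {0<..<L} \<zeta>"
    proof -
      obtain l1 r1 where 1: "0 < l1" "l1 \<le> r1" "r1 < L" "\<And>x. x \<notin> {l1..r1} \<Longrightarrow> \<eta> x = 0"
        using test_function_support[OF \<eta> L] by metis
      obtain l2 r2 where 2: "0 < l2" "l2 \<le> r2" "r2 < L" "\<And>x. x \<notin> {l2..r2} \<Longrightarrow> \<omega> x = 0"
        using test_function_support[OF \<omega>(1) L] by metis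
      show ?thesis
      proof (rule test_functionI)
        have "Ck k \<eta>" "Ck k \<omega>" for k using \<eta> \<omega>(1) unfolding test_function_def by blast+
        then show "Ck k \<zeta>" for k unfolding \<zeta>_def by (intro Ck_add Ck_mult Ck_const)
        show "\<zeta> x = 0" if "x \<notin> {min l1 l2..max r1 r2}" for x
        proof -
          have "x \<notin> {l1..r1}" "x \<notin> {l2..r2}" using that by auto
          then show ?thesis using 1(4) 2(4) by (simp add: \<zeta>_def)
        qed
        show "{min l1 l2..max r1 r2} \<subseteq> {0<..<L}" using 1 2 by auto
      qed
    qed
    have "integral\<^sup>L (seg L) \<zeta> = 0"
      unfolding \<zeta>_def using integrable_test_function[OF \<eta> L] integrable_test_function[OF \<omega>(1) L] \<omega>(2)
      by (simp add: \<alpha>_def)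
    moreover have "integral {0..L} \<zeta> = integral\<^sup>L (seg L) \<zeta>"
    proof -
      have "continuous_on {0..L} \<zeta>" using test_function_continuous[OF \<zeta>] continuous_on_subset by blast
      then have si: "set_integrable lborel {0..L} \<zeta>" by (rule borel_integrable_atLeastAtMost')
      have "integral\<^sup>L (seg L) \<zeta> = (LINT x:{0<..<L}|lborel. \<zeta> x)"
        by (rule integral_seg) (use \<zeta> test_function_borel in blast)
      also have "\<dots> = (LINT x:{0..L}|lborel. \<zeta> x)"
        unfolding set_lebesgue_integral_def
        by (rule Bochner_Integration.integral_cong) (use test_function_outside[OF \<zeta>] in \<open>auto simp: indicator_def\<close>)
      also have "\<dots> = integral {0..L} \<zeta>"
        using set_borel_integral_eq_integral(2)[OF si] .
      finally show ?thesis ..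
    qed
    ultimately obtain \<phi> where \<phi>: "test_function {0<..<L} \<phi>" "deriv \<phi> = \<zeta>"
      using test_function_antiderivative[OF \<zeta> L] by metis
    have iG: "integrable (rect L T) (\<lambda>z. G z * (\<eta> (fst z) * b (snd z)))" "integrable (rect L T) (\<lambda>z. G z * (\<omega> (fst z) * b (snd z)))"
      "integrable (rect L T) (\<lambda>z. c (snd z) * (\<eta> (fst z) * b (snd z)))"
      using test[OF G \<eta> b] test[OF G \<omega>(1) b] test[OF cr \<eta> b] by auto
    have "0 = (\<integral>z. G z * (\<zeta> (fst z) * b (snd z)) \<partial>rect L T)"
      using G'[OF \<phi>(1) b] \<phi>(2) by simp
    also have "\<dots> = (\<integral>z. G z * (\<eta> (fst z) * b (snd z)) - \<alpha> * (G z * (\<omega> (fst z) * b (snd z))) \<partial>rect L T)"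
      by (intro Bochner_Integration.integral_cong refl) (simp add: \<zeta>_def algebra_simps)
    also have "\<dots> = (\<integral>z. G z * (\<eta> (fst z) * b (snd z)) \<partial>rect L T) - \<alpha> * (\<integral>z. G z * (\<omega> (fst z) * b (snd z)) \<partial>rect L T)"
      using iG by simp
    also have "(\<integral>z. G z * (\<omega> (fst z) * b (snd z)) \<partial>rect L T) = (\<integral>t. c t * b t \<partial>seg T)"
      unfolding integrable_rect_slices(6)[OF iG(2), symmetric] by (simp add: c_def mult.assoc[symmetric])
    also have "\<alpha> * (\<integral>t. c t * b t \<partial>seg T) = (\<integral>z. c (snd z) * (\<eta> (fst z) * b (snd z)) \<partial>rect L T)"
      unfolding integrable_rect_slices(6)[OF iG(3), symmetric]
      by (simp add: \<alpha>_def mult.left_commute[of _ "\<eta> _"])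
    finally have 0: "(\<integral>z. G z * (\<eta> (fst z) * b (snd z)) \<partial>rect L T) - (\<integral>z. c (snd z) * (\<eta> (fst z) * b (snd z)) \<partial>rect L T) = 0" ..
    have "(LINT z:Q L T|lebesgue. (G z - c (snd z)) * (\<eta> (fst z) * b (snd z))) = (\<integral>z. (G z - c (snd z)) * (\<eta> (fst z) * b (snd z)) \<partial>rect L T)"
      by (rule set_integral_Q_eq) auto
    also have "\<dots> = 0" using 0 iG by (simp add: left_diff_distrib)
    finally show "(LINT z:Q L T|lebesgue. (G z - c (snd z)) * (\<eta> (fst z) * b (snd z))) = 0" .
  qed
  then have "AE z in rect L T. W z = c (snd z) + prim L (\<lambda>y. V (y, snd z)) (fst z)"
    unfolding AE_seg_pair'[symmetric] by eventually_elim (simp add: G_def N_def)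
  then show ?thesis using that c by blast
qed

lemma measurable_seg_eq: "measurable (seg L) N = measurable borel N"
  by (rule measurable_cong_sets) simp_all

section \<open>The energy inequality at a fixed time\<close>

text \<open>a^2 equals w(x)^2 minus the integral of 2 f w up to x; averaging over x gives the first
  term, Young's inequality the other two. The free weight \<theta> sits on \<epsilon>^2 times the
  highest-order norm, so that it can be chosen small enough for absorption.\<close>

lemma boundary_value_bound:
  assumes f: "sq_int (seg L) f" and L: "L > 0" and \<theta>: "\<theta> > 0" and \<epsilon>: "\<epsilon> \<ge> 0" and w: "sq_int (seg L) w"
    and rep: "AE x in seg L. w x = a + prim L f x"
  shows "\<epsilon> * a\<^sup>2 \<le> \<epsilon> / L * (\<integral>x. (w x)\<^sup>2 \<partial>seg L) + \<theta> * (\<epsilon>\<^sup>2 * (\<integral>x. (f x)\<^sup>2 \<partial>seg L)) + (\<integral>x. (w x)\<^sup>2 \<partial>seg L) / \<theta>"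
proof -
  have fi: "integrable (seg L) f" using sq_int_integrable[OF finite_measure_seg f] .
  have [measurable]: "f \<in> borel_measurable borel" "w \<in> borel_measurable borel"
    using sq_int_measurable[OF f] sq_int_measurable[OF w] by auto
  define g where "g y = 2 * (f y * (a + prim L f y))" for y
  have g: "integrable (seg L) g"
    unfolding g_def using prim_mult(2)[OF fi fi] fi by (simp add: distrib_left)
  have sq: "(a + prim L f x)\<^sup>2 = a\<^sup>2 + prim L g x" for x
  proof -
    have "prim L g x = prim L (\<lambda>y. (2 * a) * f y + (f y * prim L f y + prim L f y * f y)) x"
      by (intro arg_cong[where f = "\<lambda>h. prim L h x"]) (auto simp: g_def algebra_simps)
    also have "\<dots> = 2 * a * prim L f x + prim L f x * prim L f x"
      unfolding prim_mult(1)[OF fi fi] using prim_mult(2,3)[OF fi fi] fi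
      by (subst prim_add) (auto simp: prim_cmult)
    finally show ?thesis by (simp add: power2_eq_square algebra_simps)
  qed
  have W: "integrable (seg L) (\<lambda>x. (w x)\<^sup>2)" "integrable (seg L) (\<lambda>x. (f x)\<^sup>2)" using f w by (auto dest: sq_int_square)
  have wf: "integrable (seg L) (\<lambda>x. \<bar>f x * w x\<bar>)" using sq_int_mult[OF f w] by simp
  have gw: "(\<integral>y. \<bar>g y\<bar> \<partial>seg L) = (\<integral>y. 2 * \<bar>f y * w y\<bar> \<partial>seg L)"
    by (rule integral_cong_AE) (use rep in \<open>auto simp: g_def abs_mult elim!: eventually_mono\<close>)
  define N where "N = (\<integral>y. 2 * \<bar>f y * w y\<bar> \<partial>seg L)"
  have "AE x in seg L. a\<^sup>2 \<le> (w x)\<^sup>2 + N"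
    using rep
  proof eventually_elim
    case (elim x)
    then show ?case using sq[of x] prim_abs_le[OF g, of x] gw by (simp add: N_def)
  qed
  then have "(\<integral>x. a\<^sup>2 \<partial>seg L) \<le> (\<integral>x. (w x)\<^sup>2 + N \<partial>seg L)"
    using W by (intro integral_mono_AE) auto
  then have "L * a\<^sup>2 \<le> (\<integral>x. (w x)\<^sup>2 \<partial>seg L) + L * N"
    using W L by (simp add: measure_seg)
  then have 1: "a\<^sup>2 \<le> (\<integral>x. (w x)\<^sup>2 \<partial>seg L) / L + N"
    using L by (simp add: field_simps)
  have "\<epsilon> * N = (\<integral>x. 2 * \<epsilon> * \<bar>f x * w x\<bar> \<partial>seg L)"
    by (simp add: N_def mult.commute)
  also have "\<dots> \<le> (\<integral>x. \<theta> * \<epsilon>\<^sup>2 * (f x)\<^sup>2 + (w x)\<^sup>2 / \<theta> \<partial>seg L)"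
  proof (rule integral_mono)
    fix x
    have "0 \<le> (\<theta> * \<epsilon> * \<bar>f x\<bar> - \<bar>w x\<bar>)\<^sup>2 / \<theta>" using \<theta> by simp
    also have "\<dots> = \<theta> * \<epsilon>\<^sup>2 * (f x)\<^sup>2 + (w x)\<^sup>2 / \<theta> - 2 * \<epsilon> * \<bar>f x * w x\<bar>"
      using \<theta> by (simp add: power2_diff power_mult_distrib abs_mult field_simps) (simp add: power2_eq_square)
    finally show "2 * \<epsilon> * \<bar>f x * w x\<bar> \<le> \<theta> * \<epsilon>\<^sup>2 * (f x)\<^sup>2 + (w x)\<^sup>2 / \<theta>" by simp
  qed (use W wf in auto)
  also have "\<dots> = \<theta> * (\<epsilon>\<^sup>2 * (\<integral>x. (f x)\<^sup>2 \<partial>seg L)) + (\<integral>x. (w x)\<^sup>2 \<partial>seg L) / \<theta>"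
    using W by simp
  finally show ?thesis
    using mult_left_mono[OF 1 \<epsilon>] by (simp add: distrib_left mult.assoc)
qed

lemma Young_mult:
  fixes a b c :: real assumes "c > 0" shows "a * b \<le> c * a\<^sup>2 + b\<^sup>2 / (4 * c)"
proof -
  have "0 \<le> (2 * c * a - b)\<^sup>2 / (4 * c)" using assms by simp
  also have "\<dots> = c * a\<^sup>2 + b\<^sup>2 / (4 * c) - a * b"
    using assms by (simp add: power2_diff power_mult_distrib field_simps) (simp add: power2_eq_square)
  finally show ?thesis by simp
qed

text \<open>Here \<open>(u, v)\<close> is the difference of the two solutions with the boundary layer \<open>q(x) h(t)\<close>,
  \<open>h(t) = u\<^sup>0(0,t)\<close>, removed. Moreover \<open>\<mu> = \<lambda>\<^sup>2\<close>, \<open>p = h'(t)\<close>, \<open>k = u\<^sup>0\<^sub>x\<^sub>x\<close>, \<open>a\<close> and \<open>b\<close> are the traces of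
  \<open>u\<^sub>x\<close> and \<open>v\<^sub>x\<close> at \<open>x = 0\<close>, and \<open>Qh\<close> is the integral of \<open>q\<close> from \<open>x\<close> to \<open>L\<close>.\<close>

locale energy_slice =
  fixes L \<mu> Ub \<epsilon> c1 p a b Q0 :: real
    and q q' Qh u ux uxx ut uxt v vx vxx vt vxt k :: "real \<Rightarrow> real"
  assumes pos: "L > 0" "\<mu> > 0" "Ub > 0" "0 < \<epsilon>" "\<epsilon> \<le> 1"
    and sq [intro]: "sq_int (seg L) ux" "sq_int (seg L) uxx" "sq_int (seg L) uxt" "sq_int (seg L) vx"
      "sq_int (seg L) vxx" "sq_int (seg L) vxt" "sq_int (seg L) k" "sq_int (seg L) q" "sq_int (seg L) q'" "sq_int (seg L) Qh"
      "sq_int (seg L) u" "sq_int (seg L) ut" "sq_int (seg L) v" "sq_int (seg L) vt"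
    and rep_u: "AE x in seg L. u x = prim L ux x" "integral\<^sup>L (seg L) ux = 0"
    and rep_ux: "AE x in seg L. ux x = a + prim L uxx x"
    and rep_ut: "AE x in seg L. ut x = prim L uxt x" "integral\<^sup>L (seg L) uxt = 0"
    and rep_v: "AE x in seg L. v x = prim L vx x"
    and rep_vx: "AE x in seg L. vx x = b + prim L vxx x"
    and rep_vt: "AE x in seg L. vt x = prim L vxt x"
    and rep_q: "AE x in seg L. q x = 1 + prim L q' x"
    and rep_Qh: "AE x in seg L. Qh x = Q0 + prim L (\<lambda>y. - q y) x" "Q0 = integral\<^sup>L (seg L) q"
    and layer: "(\<integral>x. (q x)\<^sup>2 \<partial>seg L) \<le> c1 * \<epsilon>" "(\<integral>x. (\<epsilon> * q' x)\<^sup>2 \<partial>seg L) \<le> c1 * \<epsilon>" "(\<integral>x. (Qh x)\<^sup>2 \<partial>seg L) \<le> c1 * \<epsilon> ^ 3"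
    and eq1: "AE x in seg L. ut x + Ub * ux x + vx x - 2 * \<epsilon> * uxx x = 2 * \<epsilon> * k x + q x * p"
    and eq2: "AE x in seg L. \<mu> * vt x + Ub * \<mu> * vx x + ux x = - (q x * p / Ub)"
begin

abbreviation I :: "(real \<Rightarrow> real) \<Rightarrow> real" where "I f \<equiv> integral\<^sup>L (seg L) f"

lemma int [intro, simp]: "sq_int (seg L) f \<Longrightarrow> integrable (seg L) f"
  by (rule sq_int_integrable[OF finite_measure_seg])

lemma borel: "sq_int (seg L) f \<Longrightarrow> f \<in> borel_measurable borel"
  using sq_int_measurable[of "seg L" f] by (simp add: measurable_seg_eq)

lemma parts:
  assumes "sq_int (seg L) f" "sq_int (seg L) g" "sq_int (seg L) F" "sq_int (seg L) G"
    "AE x in seg L. F x = c + prim L f x" "AE x in seg L. G x = d + prim L g x"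
  shows "I (\<lambda>x. f x * G x) + I (\<lambda>x. F x * g x) = (c + I f) * (d + I g) - c * d"
proof -
  have [measurable]: "f \<in> borel_measurable borel" "g \<in> borel_measurable borel" "F \<in> borel_measurable borel" "G \<in> borel_measurable borel"
    using assms borel by auto
  have "I (\<lambda>x. f x * G x) + I (\<lambda>x. F x * g x) = I (\<lambda>x. f x * G x + F x * g x)"
    using sq_int_mult[OF assms(1,4)] sq_int_mult[OF assms(3,2)] by simp
  also have "\<dots> = I (\<lambda>x. f x * (d + prim L g x) + (c + prim L f x) * g x)"
  proof (rule integral_cong_AE)
    show "AE x in seg L. f x * G x + F x * g x = f x * (d + prim L g x) + (c + prim L f x) * g x"
      using assms(5,6) by eventually_elim simp
  qed measurable
  also have "\<dots> = (c + I f) * (d + I g) - c * d"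
    by (rule integration_by_parts_prim) (use assms in auto)
  finally show ?thesis .
qed

lemma products [intro, simp]: "sq_int (seg L) f \<Longrightarrow> sq_int (seg L) g \<Longrightarrow> integrable (seg L) (\<lambda>x. f x * g x)"
  by (rule sq_int_mult)

lemma test_u_v:
  assumes \<delta>: "\<delta> > 0"
  shows "I (\<lambda>x. u x * ut x) + \<mu> * I (\<lambda>x. v x * vt x) \<le>
    - \<epsilon> * I (\<lambda>x. (ux x)\<^sup>2) + \<delta> * \<epsilon> * I (\<lambda>x. (vx x)\<^sup>2) + 2 * \<epsilon> * I (\<lambda>x. k x * u x)
      + c1 * (1 / 4 + 1 / (4 * \<delta> * Ub\<^sup>2)) * (\<epsilon>\<^sup>2 * p\<^sup>2)"
proof -
  note [measurable] = borel[OF sq(1)] borel[OF sq(2)] borel[OF sq(3)] borel[OF sq(4)] borel[OF sq(7)] borel[OF sq(8)]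
    borel[OF sq(10)] borel[OF sq(11)] borel[OF sq(12)] borel[OF sq(13)] borel[OF sq(14)]
  have rq: "sq_int (seg L) (\<lambda>y. - q y)" using sq(8) by (rule sq_int_minus)
  have uux: "I (\<lambda>x. ux x * u x) = 0"
    using parts[OF sq(1,1,11,11), of 0 0] rep_u by (simp add: mult.commute)
  have uvx: "I (\<lambda>x. ux x * v x) + I (\<lambda>x. u x * vx x) = 0"
    using parts[OF sq(1,4,11,13), of 0 0] rep_u rep_v by simp
  have uuxx: "I (\<lambda>x. (ux x)\<^sup>2) + I (\<lambda>x. u x * uxx x) = 0"
    using parts[OF sq(1,2,11,1), of 0 a] rep_u rep_ux by (simp add: power2_eq_square)
  \<comment> \<open>Transport to the right: v vanishes at the inflow end, so only the nonnegative
    outflow term at L remains.\<close>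
  have vvx: "I (\<lambda>x. vx x * v x) \<ge> 0"
    using parts[OF sq(4,4,13,13), of 0 0] rep_v zero_le_square[of "I vx"]
    by (simp add: mult.commute[of "v _"] del: zero_le_square)
  have qu: "I (\<lambda>x. q x * u x) = I (\<lambda>x. ux x * Qh x)"
    using parts[OF sq(1) rq sq(11,10), of 0 Q0] rep_u rep_Qh by (simp add: mult.commute)
  \<comment> \<open>v need not vanish at L. The boundary term drops because \<open>Qh\<close> does:
    \<open>Q0\<close> is the full integral of \<open>q\<close>.\<close>
  have qv: "I (\<lambda>x. q x * v x) = I (\<lambda>x. vx x * Qh x)"
    using parts[OF sq(4) rq sq(13,10), of 0 Q0] rep_v rep_Qh by (simp add: mult.commute)
  have "I (\<lambda>x. u x * ut x) + \<mu> * I (\<lambda>x. v x * vt x) = I (\<lambda>x. u x * ut x + \<mu> * (v x * vt x))"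
    using sq by simp
  also have "\<dots> = I (\<lambda>x. - Ub * (ux x * u x) - (ux x * v x) - (u x * vx x) + 2 * \<epsilon> * (u x * uxx x) + 2 * \<epsilon> * (k x * u x)
     + p * (q x * u x) - Ub * \<mu> * (vx x * v x) - p / Ub * (q x * v x))"
  proof (rule integral_cong_AE)
    show "AE x in seg L. u x * ut x + \<mu> * (v x * vt x) = - Ub * (ux x * u x) - (ux x * v x) - (u x * vx x) + 2 * \<epsilon> * (u x * uxx x)
      + 2 * \<epsilon> * (k x * u x) + p * (q x * u x) - Ub * \<mu> * (vx x * v x) - p / Ub * (q x * v x)"
      using eq1 eq2
    proof eventually_elim
      case (elim x)
      have "ut x = 2 * \<epsilon> * uxx x + 2 * \<epsilon> * k x + q x * p - Ub * ux x - vx x"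
        and "\<mu> * vt x = - (q x * p / Ub) - Ub * \<mu> * vx x - ux x"
        using elim by simp_all
      then have "u x * ut x + v x * (\<mu> * vt x) = u x * (2 * \<epsilon> * uxx x + 2 * \<epsilon> * k x + q x * p - Ub * ux x - vx x)
        + v x * (- (q x * p / Ub) - Ub * \<mu> * vx x - ux x)" by simp
      then show ?case by (simp add: algebra_simps)
    qed
  qed measurable
  also have "\<dots> = - Ub * I (\<lambda>x. ux x * u x) - I (\<lambda>x. ux x * v x) - I (\<lambda>x. u x * vx x) + 2 * \<epsilon> * I (\<lambda>x. u x * uxx x)
     + 2 * \<epsilon> * I (\<lambda>x. k x * u x)
     + p * I (\<lambda>x. q x * u x) - Ub * \<mu> * I (\<lambda>x. vx x * v x) - p / Ub * I (\<lambda>x. q x * v x)"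
    using sq by simp
  also have "\<dots> = - 2 * \<epsilon> * I (\<lambda>x. (ux x)\<^sup>2) + 2 * \<epsilon> * I (\<lambda>x. k x * u x) + p * I (\<lambda>x. ux x * Qh x)
     - Ub * \<mu> * I (\<lambda>x. vx x * v x) - p / Ub * I (\<lambda>x. vx x * Qh x)"
  proof -
    have e: "I (\<lambda>x. u x * uxx x) = - I (\<lambda>x. (ux x)\<^sup>2)" "I (\<lambda>x. u x * vx x) = - I (\<lambda>x. ux x * v x)"
      using uuxx uvx by linarith+
    show ?thesis unfolding e qu qv uux by simp
  qed
  finally have main: "I (\<lambda>x. u x * ut x) + \<mu> * I (\<lambda>x. v x * vt x) = - 2 * \<epsilon> * I (\<lambda>x. (ux x)\<^sup>2)
     + 2 * \<epsilon> * I (\<lambda>x. k x * u x) + p * I (\<lambda>x. ux x * Qh x)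
     - Ub * \<mu> * I (\<lambda>x. vx x * v x) - p / Ub * I (\<lambda>x. vx x * Qh x)" .
  have Qu: "p * I (\<lambda>x. ux x * Qh x) \<le> \<epsilon> * I (\<lambda>x. (ux x)\<^sup>2) + c1 / 4 * (\<epsilon>\<^sup>2 * p\<^sup>2)"
  proof -
    have "p * I (\<lambda>x. ux x * Qh x) = I (\<lambda>x. ux x * (p * Qh x))" by (simp add: mult.left_commute)
    also have "\<dots> \<le> I (\<lambda>x. \<epsilon> * (ux x)\<^sup>2 + p\<^sup>2 / (4 * \<epsilon>) * (Qh x)\<^sup>2)"
    proof (rule integral_mono)
      show "ux x * (p * Qh x) \<le> \<epsilon> * (ux x)\<^sup>2 + p\<^sup>2 / (4 * \<epsilon>) * (Qh x)\<^sup>2" for x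
        using Young_mult[OF pos(4), of "ux x" "p * Qh x"] by (simp add: power_mult_distrib)
    qed (use sq_int_square[OF sq(1)] sq_int_square[OF sq(10)] sq_int_mult[OF sq(1) sq_int_cmult[OF sq(10), of p]] in simp_all)
    also have "\<dots> = \<epsilon> * I (\<lambda>x. (ux x)\<^sup>2) + p\<^sup>2 / (4 * \<epsilon>) * I (\<lambda>x. (Qh x)\<^sup>2)"
      using sq by (simp add: sq_int_square)
    also have "p\<^sup>2 / (4 * \<epsilon>) * I (\<lambda>x. (Qh x)\<^sup>2) \<le> p\<^sup>2 / (4 * \<epsilon>) * (c1 * \<epsilon> ^ 3)"
      by (rule mult_left_mono[OF layer(3)]) (use pos in simp)
    also have "p\<^sup>2 / (4 * \<epsilon>) * (c1 * \<epsilon> ^ 3) = c1 / 4 * (\<epsilon>\<^sup>2 * p\<^sup>2)"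
      using pos by (simp add: field_simps power2_eq_square power3_eq_cube)
    finally show ?thesis by simp
  qed
  have Qv: "- p / Ub * I (\<lambda>x. vx x * Qh x) \<le> \<delta> * \<epsilon> * I (\<lambda>x. (vx x)\<^sup>2) + c1 / (4 * \<delta> * Ub\<^sup>2) * (\<epsilon>\<^sup>2 * p\<^sup>2)"
  proof -
    have de: "\<delta> * \<epsilon> > 0" using \<delta> pos by simp
    have "- p / Ub * I (\<lambda>x. vx x * Qh x) = I (\<lambda>x. vx x * ((- p / Ub) * Qh x))"
      unfolding mult.left_commute[of "vx _"] by (rule integral_mult_right_zero[symmetric])
    also have "\<dots> \<le> I (\<lambda>x. \<delta> * \<epsilon> * (vx x)\<^sup>2 + p\<^sup>2 / (Ub\<^sup>2 * (4 * (\<delta> * \<epsilon>))) * (Qh x)\<^sup>2)"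
    proof (rule integral_mono)
      show "vx x * ((- p / Ub) * Qh x) \<le> \<delta> * \<epsilon> * (vx x)\<^sup>2 + p\<^sup>2 / (Ub\<^sup>2 * (4 * (\<delta> * \<epsilon>))) * (Qh x)\<^sup>2" for x
        using Young_mult[OF de, of "vx x" "(- p / Ub) * Qh x"] by (simp add: power_mult_distrib power_divide)
    qed (use sq_int_square[OF sq(4)] sq_int_square[OF sq(10)] sq_int_mult[OF sq(4) sq_int_cmult[OF sq(10), of "- p / Ub"]] in simp_all)
    also have "\<dots> = \<delta> * \<epsilon> * I (\<lambda>x. (vx x)\<^sup>2) + p\<^sup>2 / (Ub\<^sup>2 * (4 * (\<delta> * \<epsilon>))) * I (\<lambda>x. (Qh x)\<^sup>2)"
      using sq by (simp add: sq_int_square)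
    also have "p\<^sup>2 / (Ub\<^sup>2 * (4 * (\<delta> * \<epsilon>))) * I (\<lambda>x. (Qh x)\<^sup>2) \<le> p\<^sup>2 / (Ub\<^sup>2 * (4 * (\<delta> * \<epsilon>))) * (c1 * \<epsilon> ^ 3)"
      by (rule mult_left_mono[OF layer(3)]) (use pos \<delta> in simp)
    also have "p\<^sup>2 / (Ub\<^sup>2 * (4 * (\<delta> * \<epsilon>))) * (c1 * \<epsilon> ^ 3) = c1 / (4 * \<delta> * Ub\<^sup>2) * (\<epsilon>\<^sup>2 * p\<^sup>2)"
      using pos \<delta> by (simp add: field_simps power2_eq_square power3_eq_cube)
    finally show ?thesis by simp
  qed
  show ?thesis
    using main Qu Qv mult_nonneg_nonneg[OF _ vvx, of "Ub * \<mu>"] pos by (simp add: algebra_simps)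
qed


text \<open>The second equation, written as a constant plus a primitive, vanishes almost everywhere;
  \<open>prim_eq_zero\<close> then gives its value at x = 0, where v_t is zero and q is one, and its
  x-derivative at the same time.\<close>

lemma boundary: "Ub * \<mu> * b + a + p / Ub = 0"
  and eq2_x: "AE x in seg L. \<mu> * vxt x + Ub * \<mu> * vxx x + uxx x = - (p / Ub * q' x)"
proof -
  note [measurable] = borel[OF sq(2)] borel[OF sq(5)] borel[OF sq(6)] borel[OF sq(9)]
  let ?f = "\<lambda>x. (\<mu> * vxt x + Ub * \<mu> * vxx x) + (uxx x + p / Ub * q' x)"
  have f: "integrable (seg L) ?f" using sq by simp
  have prim_f: "prim L ?f x = \<mu> * prim L vxt x + Ub * \<mu> * prim L vxx x + (prim L uxx x + p / Ub * prim L q' x)" for x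
  proof -
    have "prim L ?f x = prim L (\<lambda>x. \<mu> * vxt x + Ub * \<mu> * vxx x) x + prim L (\<lambda>x. uxx x + p / Ub * q' x) x"
      by (rule prim_add) (use sq in auto)
    also have "prim L (\<lambda>x. \<mu> * vxt x + Ub * \<mu> * vxx x) x = prim L (\<lambda>x. \<mu> * vxt x) x + prim L (\<lambda>x. Ub * \<mu> * vxx x) x"
      by (rule prim_add) (use sq in auto)
    also have "prim L (\<lambda>x. uxx x + p / Ub * q' x) x = prim L uxx x + prim L (\<lambda>x. p / Ub * q' x) x"
      by (rule prim_add) (use sq in auto)
    finally show ?thesis by (simp only: prim_cmult)
  qed
  have "AE x in seg L. (Ub * \<mu> * b + a + p / Ub) + prim L ?f x = 0"
    using eq2 rep_vt rep_vx rep_ux rep_q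
  proof eventually_elim
    case (elim x)
    have "\<mu> * prim L vxt x + Ub * \<mu> * (b + prim L vxx x) + (a + prim L uxx x) + (1 + prim L q' x) * p / Ub = 0"
      using elim(1) unfolding elim(2,3,4,5) by simp
    then show ?case unfolding prim_f by (simp add: algebra_simps add_divide_distrib)
  qed
  from prim_eq_zero[OF f pos(1) this]
  show "Ub * \<mu> * b + a + p / Ub = 0" "AE x in seg L. \<mu> * vxt x + Ub * \<mu> * vxx x + uxx x = - (p / Ub * q' x)"
    by (auto elim!: eventually_mono)
qed

text \<open>\<open>boundary\<close> trades b for a, and \<open>boundary_value_bound\<close> controls
  a. Its weight \<open>Ub * \<mu> / 8\<close> is tuned to leave exactly 1/4 of \<epsilon>^2
  |u_xx|^2, the amount that one eighth of \<open>test_uxx\<close> removes.\<close>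

lemma boundary_term:
  "\<epsilon> * Ub * \<mu> * b\<^sup>2 \<le> 2 / (Ub * \<mu>) * (1 / L + 8 / (Ub * \<mu>)) * I (\<lambda>x. (ux x)\<^sup>2)
    + 1 / 4 * (\<epsilon>\<^sup>2 * I (\<lambda>x. (uxx x)\<^sup>2)) + 2 / (Ub ^ 3 * \<mu>) * (\<epsilon> * p\<^sup>2)"
proof -
  define X where "X = I (\<lambda>x. (ux x)\<^sup>2)"
  define Z where "Z = \<epsilon>\<^sup>2 * I (\<lambda>x. (uxx x)\<^sup>2)"
  have X: "X \<ge> 0" by (simp add: X_def)
  have "\<epsilon> * a\<^sup>2 \<le> \<epsilon> / L * X + Ub * \<mu> / 8 * Z + X / (Ub * \<mu> / 8)"
    unfolding X_def Z_def by (rule boundary_value_bound[OF sq(2) pos(1) _ _ sq(1) rep_ux]) (use pos in auto)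
  moreover have "\<epsilon> / L * X \<le> 1 / L * X"
    using pos X by (intro mult_right_mono divide_right_mono) auto
  ultimately have a: "\<epsilon> * a\<^sup>2 \<le> (1 / L + 8 / (Ub * \<mu>)) * X + Ub * \<mu> / 8 * Z"
    using pos by (simp add: algebra_simps)
  have b: "Ub * \<mu> * b = - (a + p / Ub)" using boundary by linarith
  have "(Ub * \<mu>) * (\<epsilon> * Ub * \<mu> * b\<^sup>2) = \<epsilon> * (Ub * \<mu> * b)\<^sup>2" by (simp add: power2_eq_square)
  also have "\<dots> = \<epsilon> * (a + p / Ub)\<^sup>2" unfolding b power2_minus ..
  also have "\<dots> \<le> \<epsilon> * (2 * a\<^sup>2 + 2 * (p / Ub)\<^sup>2)"
    using sum_squares_bound[of a "p / Ub"] pos by (intro mult_left_mono) (auto simp: power2_sum)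
  also have "\<dots> \<le> 2 * ((1 / L + 8 / (Ub * \<mu>)) * X + Ub * \<mu> / 8 * Z) + 2 * \<epsilon> * (p / Ub)\<^sup>2"
    using a by (simp add: algebra_simps)
  finally have "\<epsilon> * Ub * \<mu> * b\<^sup>2 \<le> (2 * ((1 / L + 8 / (Ub * \<mu>)) * X + Ub * \<mu> / 8 * Z) + 2 * \<epsilon> * (p / Ub)\<^sup>2) / (Ub * \<mu>)"
    using pos by (simp add: pos_le_divide_eq mult.commute)
  also have "\<dots> = 2 / (Ub * \<mu>) * (1 / L + 8 / (Ub * \<mu>)) * X + 1 / 4 * Z + 2 / (Ub ^ 3 * \<mu>) * (\<epsilon> * p\<^sup>2)"
  proof -
    have "Ub * \<mu> \<noteq> 0" using pos by simp
    have "(2 * (A * X + Ub * \<mu> / 8 * Z) + 2 * \<epsilon> * (p / Ub)\<^sup>2) / (Ub * \<mu>)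
      = 2 / (Ub * \<mu>) * A * X + 1 / 4 * Z + 2 / (Ub ^ 3 * \<mu>) * (\<epsilon> * p\<^sup>2)" for A
      using pos by (simp add: field_simps power2_eq_square power3_eq_cube)
    then show ?thesis .
  qed
  finally show ?thesis by (simp add: X_def Z_def)
qed

text \<open>The second equation is differentiated in \<open>x\<close> and tested with \<open>v\<^sub>x\<close>; testing the first equation with \<open>v\<^sub>x\<close>
  as well cancels \<open>u\<^sub>x\<^sub>x v\<^sub>x\<close> and leaves the damping term \<open>- v\<^sub>x\<^sup>2\<close>.\<close>

lemma test_vx:
  "2 * \<epsilon> * \<mu> * I (\<lambda>x. vx x * vxt x) + I (\<lambda>x. ut x * vx x) + I (\<lambda>x. u x * vxt x) \<le>
    - 1 / 2 * I (\<lambda>x. (vx x)\<^sup>2) + (2 / (Ub * \<mu>) * (1 / L + 8 / (Ub * \<mu>)) + 1 / \<mu> + 1 / 2) * I (\<lambda>x. (ux x)\<^sup>2)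
    + 1 / 4 * (\<epsilon>\<^sup>2 * I (\<lambda>x. (uxx x)\<^sup>2)) + 4 * (\<epsilon>\<^sup>2 * I (\<lambda>x. (k x)\<^sup>2))
    + (2 / (Ub ^ 3 * \<mu>) + 2 * c1 + 8 * c1 / Ub\<^sup>2 + c1 / (2 * Ub\<^sup>2 * \<mu>\<^sup>2)) * (\<epsilon> * p\<^sup>2)"
proof -
  note [measurable] = borel[OF sq(1)] borel[OF sq(2)] borel[OF sq(4)] borel[OF sq(5)] borel[OF sq(6)] borel[OF sq(7)] borel[OF sq(8)]
    borel[OF sq(9)] borel[OF sq(11)] borel[OF sq(12)] borel[OF sq(13)] borel[OF sq(14)]
  \<comment> \<open>All sources met by the multiplier v_x: those of the first equation together with
    2 \<epsilon> times the one of the differentiated second equation.\<close>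
  define w where "w x = 2 * \<epsilon> * k x + p * (q x - 2 / Ub * (\<epsilon> * q' x))" for x
  have wsq: "sq_int (seg L) w" unfolding w_def using sq by (intro sq_int_add sq_int_cmult sq_int_diff) auto
  note [measurable] = borel[OF wsq]
  have vxvxx: "I (\<lambda>x. vxx x * vx x) = ((b + I vxx)\<^sup>2 - b\<^sup>2) / 2"
    using parts[OF sq(5,5,4,4) rep_vx rep_vx] by (simp add: mult.commute[of "vx _"] power2_eq_square)
  \<comment> \<open>This term completes the time derivative of \<integral> u v_x. Moved onto u_x it
    contains v_t, which the second equation eliminates.\<close>
  have uvxt: "I (\<lambda>x. u x * vxt x) = - I (\<lambda>x. ux x * vt x)"
    using parts[OF sq(1,6,11,14), of 0 0] rep_u rep_vt by simp
  have uxvt: "\<mu> * I (\<lambda>x. ux x * vt x) = - (1 / Ub) * p * I (\<lambda>x. ux x * q x) - Ub * \<mu> * I (\<lambda>x. ux x * vx x) - I (\<lambda>x. (ux x)\<^sup>2)"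
  proof -
    have "\<mu> * I (\<lambda>x. ux x * vt x) = I (\<lambda>x. - (1 / Ub) * p * (ux x * q x) - Ub * \<mu> * (ux x * vx x) - (ux x)\<^sup>2)"
      unfolding integral_mult_right_zero[symmetric]
    proof (rule integral_cong_AE)
      show "AE x in seg L. \<mu> * (ux x * vt x) = - (1 / Ub) * p * (ux x * q x) - Ub * \<mu> * (ux x * vx x) - (ux x)\<^sup>2"
        using eq2
      proof eventually_elim
        case (elim x)
        have "\<mu> * vt x = - (q x * p / Ub) - Ub * \<mu> * vx x - ux x" using elim by simp
        then have "ux x * (\<mu> * vt x) = ux x * (- (q x * p / Ub) - Ub * \<mu> * vx x - ux x)" by simp
        then show ?case by (simp add: algebra_simps power2_eq_square)
      qed
    qed measurable
    also have "\<dots> = - (1 / Ub) * p * I (\<lambda>x. ux x * q x) - Ub * \<mu> * I (\<lambda>x. ux x * vx x) - I (\<lambda>x. (ux x)\<^sup>2)"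
      using sq by (simp add: sq_int_square)
    finally show ?thesis .
  qed
  have "2 * \<epsilon> * \<mu> * I (\<lambda>x. vx x * vxt x) + I (\<lambda>x. ut x * vx x) = I (\<lambda>x. 2 * \<epsilon> * \<mu> * (vx x * vxt x) + ut x * vx x)"
    using sq by simp
  also have "\<dots> = I (\<lambda>x. - 2 * \<epsilon> * Ub * \<mu> * (vxx x * vx x) - Ub * (ux x * vx x) - (vx x)\<^sup>2 + w x * vx x)"
  proof (rule integral_cong_AE)
    show "AE x in seg L. 2 * \<epsilon> * \<mu> * (vx x * vxt x) + ut x * vx x =
      - 2 * \<epsilon> * Ub * \<mu> * (vxx x * vx x) - Ub * (ux x * vx x) - (vx x)\<^sup>2 + w x * vx x"
      using eq1 eq2_x
    proof eventually_elim
      case (elim x)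
      have 1: "\<mu> * vxt x = - (p / Ub * q' x) - Ub * \<mu> * vxx x - uxx x"
        and 2: "ut x = 2 * \<epsilon> * k x + q x * p - Ub * ux x - vx x + 2 * \<epsilon> * uxx x" using elim by simp_all
      have "2 * \<epsilon> * \<mu> * (vx x * vxt x) + ut x * vx x = 2 * \<epsilon> * vx x * (\<mu> * vxt x) + ut x * vx x" by simp
      also have "\<dots> = 2 * \<epsilon> * vx x * (- (p / Ub * q' x) - Ub * \<mu> * vxx x - uxx x)
        + (2 * \<epsilon> * k x + q x * p - Ub * ux x - vx x + 2 * \<epsilon> * uxx x) * vx x" unfolding 1 2 ..
      finally show ?case unfolding w_def using pos by (simp add: field_simps power2_eq_square)
    qed
  qed measurable
  also have "\<dots> = - 2 * \<epsilon> * Ub * \<mu> * I (\<lambda>x. vxx x * vx x) - Ub * I (\<lambda>x. ux x * vx x) - I (\<lambda>x. (vx x)\<^sup>2) + I (\<lambda>x. w x * vx x)"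
    using sq wsq by (simp add: sq_int_square)
  finally have A: "2 * \<epsilon> * \<mu> * I (\<lambda>x. vx x * vxt x) + I (\<lambda>x. ut x * vx x) =
    - 2 * \<epsilon> * Ub * \<mu> * I (\<lambda>x. vxx x * vx x) - Ub * I (\<lambda>x. ux x * vx x) - I (\<lambda>x. (vx x)\<^sup>2) + I (\<lambda>x. w x * vx x)" .
  \<comment> \<open>The value of v_x at the outflow end has the favourable sign; the inflow value b
    is left to \<open>boundary_term\<close>.\<close>
  have B: "- 2 * \<epsilon> * Ub * \<mu> * I (\<lambda>x. vxx x * vx x) \<le> \<epsilon> * Ub * \<mu> * b\<^sup>2"
  proof -
    have "- 2 * \<epsilon> * Ub * \<mu> * I (\<lambda>x. vxx x * vx x) = \<epsilon> * Ub * \<mu> * b\<^sup>2 - \<epsilon> * Ub * \<mu> * (b + I vxx)\<^sup>2"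
      unfolding vxvxx by (simp add: diff_divide_distrib) (simp add: algebra_simps)
    moreover have "\<epsilon> * Ub * \<mu> * (b + I vxx)\<^sup>2 \<ge> 0" using pos by simp
    ultimately show ?thesis by linarith
  qed
  \<comment> \<open>The term Ub \<integral> u_x v_x obtained here cancels the one with the opposite
    sign in \<open>A\<close>.\<close>
  have C: "I (\<lambda>x. u x * vxt x) = p / (Ub * \<mu>) * I (\<lambda>x. ux x * q x) + Ub * I (\<lambda>x. ux x * vx x) + 1 / \<mu> * I (\<lambda>x. (ux x)\<^sup>2)"
  proof -
    have "I (\<lambda>x. ux x * vt x) = (- (1 / Ub) * p * I (\<lambda>x. ux x * q x) - Ub * \<mu> * I (\<lambda>x. ux x * vx x) - I (\<lambda>x. (ux x)\<^sup>2)) / \<mu>"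
      using uxvt pos by (simp add: field_simps)
    then show ?thesis unfolding uvxt using pos by (simp add: field_simps)
  qed
  have D: "I (\<lambda>x. w x * vx x) \<le> 1 / 2 * I (\<lambda>x. (vx x)\<^sup>2) + 4 * (\<epsilon>\<^sup>2 * I (\<lambda>x. (k x)\<^sup>2)) + (2 * c1 + 8 * c1 / Ub\<^sup>2) * (\<epsilon> * p\<^sup>2)"
  proof -
    have "I (\<lambda>x. w x * vx x) \<le> I (\<lambda>x. 1 / 2 * (vx x)\<^sup>2 + 4 * \<epsilon>\<^sup>2 * (k x)\<^sup>2 + (2 * p\<^sup>2 * (q x)\<^sup>2 + 8 * p\<^sup>2 / Ub\<^sup>2 * (\<epsilon> * q' x)\<^sup>2))"
    proof (rule integral_mono)
      fix x
      have "w x * vx x \<le> 1 / 2 * (vx x)\<^sup>2 + 1 / 2 * (w x)\<^sup>2"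
        using Young_mult[of "1/2" "vx x" "w x"] by (simp add: mult.commute)
      also have "(w x)\<^sup>2 \<le> 2 * (2 * \<epsilon> * k x)\<^sup>2 + 2 * (p * (q x - 2 / Ub * (\<epsilon> * q' x)))\<^sup>2"
        unfolding w_def using sum_squares_bound[of "2 * \<epsilon> * k x" "p * (q x - 2 / Ub * (\<epsilon> * q' x))"]
        by (simp only: power2_sum)
      also have "(p * (q x - 2 / Ub * (\<epsilon> * q' x)))\<^sup>2 \<le> p\<^sup>2 * (2 * (q x)\<^sup>2 + 2 * (2 / Ub * (\<epsilon> * q' x))\<^sup>2)"
        unfolding power_mult_distrib[of p]
        using sum_squares_bound[of "q x" "- (2 / Ub * (\<epsilon> * q' x))"] by (intro mult_left_mono) (auto simp: power2_diff)
      finally have "w x * vx x \<le> 1 / 2 * (vx x)\<^sup>2 + 1 / 2 * (2 * (2 * \<epsilon> * k x)\<^sup>2 + 2 * (p\<^sup>2 * (2 * (q x)\<^sup>2 + 2 * (2 / Ub * (\<epsilon> * q' x))\<^sup>2)))"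
        by simp
      also have "\<dots> = 1 / 2 * (vx x)\<^sup>2 + 4 * \<epsilon>\<^sup>2 * (k x)\<^sup>2 + (2 * p\<^sup>2 * (q x)\<^sup>2 + 8 * p\<^sup>2 / Ub\<^sup>2 * (\<epsilon> * q' x)\<^sup>2)"
        by (simp add: power_mult_distrib power_divide algebra_simps)
      finally show "w x * vx x \<le> 1 / 2 * (vx x)\<^sup>2 + 4 * \<epsilon>\<^sup>2 * (k x)\<^sup>2 + (2 * p\<^sup>2 * (q x)\<^sup>2 + 8 * p\<^sup>2 / Ub\<^sup>2 * (\<epsilon> * q' x)\<^sup>2)" .
    qed (use sq wsq sq_int_cmult[OF sq(9), of \<epsilon>] in \<open>auto dest!: sq_int_square simp del: power_mult_distrib\<close>)
    also have "\<dots> = 1 / 2 * I (\<lambda>x. (vx x)\<^sup>2) + 4 * \<epsilon>\<^sup>2 * I (\<lambda>x. (k x)\<^sup>2) + (2 * p\<^sup>2 * I (\<lambda>x. (q x)\<^sup>2) + 8 * p\<^sup>2 / Ub\<^sup>2 * I (\<lambda>x. (\<epsilon> * q' x)\<^sup>2))"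
      using sq_int_square[OF sq(4)] sq_int_square[OF sq(7)] sq_int_square[OF sq(8)] sq_int_square[OF sq_int_cmult[OF sq(9), of \<epsilon>]] by simp
    also have "2 * p\<^sup>2 * I (\<lambda>x. (q x)\<^sup>2) + 8 * p\<^sup>2 / Ub\<^sup>2 * I (\<lambda>x. (\<epsilon> * q' x)\<^sup>2) \<le> 2 * p\<^sup>2 * (c1 * \<epsilon>) + 8 * p\<^sup>2 / Ub\<^sup>2 * (c1 * \<epsilon>)"
      by (intro add_mono mult_left_mono layer) auto
    finally show ?thesis by (simp add: algebra_simps)
  qed
  have F: "p / (Ub * \<mu>) * I (\<lambda>x. ux x * q x) \<le> 1 / 2 * I (\<lambda>x. (ux x)\<^sup>2) + c1 / (2 * Ub\<^sup>2 * \<mu>\<^sup>2) * (\<epsilon> * p\<^sup>2)"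
  proof -
    let ?s = "p / (Ub * \<mu>)"
    have "?s * I (\<lambda>x. ux x * q x) = I (\<lambda>x. ?s * (ux x * q x))" by simp
    also have "\<dots> \<le> I (\<lambda>x. 1 / 2 * (ux x)\<^sup>2 + ?s\<^sup>2 / 2 * (q x)\<^sup>2)"
    proof (rule integral_mono)
      show "?s * (ux x * q x) \<le> 1 / 2 * (ux x)\<^sup>2 + ?s\<^sup>2 / 2 * (q x)\<^sup>2" for x
        using Young_mult[of "1/2" "ux x" "?s * q x"] by (simp add: power_mult_distrib power_divide mult_ac)
    qed (use sq_int_square[OF sq(1)] sq_int_square[OF sq(8)] sq_int_mult[OF sq(1) sq(8)] in simp_all)
    also have "\<dots> = 1 / 2 * I (\<lambda>x. (ux x)\<^sup>2) + ?s\<^sup>2 / 2 * I (\<lambda>x. (q x)\<^sup>2)"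
      using sq_int_square[OF sq(1)] sq_int_square[OF sq(8)] by simp
    also have "?s\<^sup>2 / 2 * I (\<lambda>x. (q x)\<^sup>2) \<le> ?s\<^sup>2 / 2 * (c1 * \<epsilon>)"
      by (rule mult_left_mono[OF layer(1)]) simp
    finally show ?thesis by (simp add: power_divide power_mult_distrib algebra_simps)
  qed
  show ?thesis
    using A B C D F boundary_term by (simp add: algebra_simps)
qed

text \<open>u_t vanishes at both ends, so \<integral> u_x u_xt = - \<integral> u_xx u_t without
  boundary terms, although u_x satisfies no boundary condition. The first equation replaces
  u_t.\<close>

lemma test_uxx:
  "2 * \<epsilon> * I (\<lambda>x. ux x * uxt x) \<le> - 2 * (\<epsilon>\<^sup>2 * I (\<lambda>x. (uxx x)\<^sup>2)) + 2 * Ub\<^sup>2 * I (\<lambda>x. (ux x)\<^sup>2)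
    + 2 * I (\<lambda>x. (vx x)\<^sup>2) + 8 * (\<epsilon>\<^sup>2 * I (\<lambda>x. (k x)\<^sup>2)) + 2 * c1 * (\<epsilon> * p\<^sup>2)"
proof -
  note [measurable] = borel[OF sq(1)] borel[OF sq(2)] borel[OF sq(4)] borel[OF sq(7)] borel[OF sq(8)] borel[OF sq(12)]
  have "I (\<lambda>x. ux x * uxt x) = - I (\<lambda>x. uxx x * ut x)"
    using parts[OF sq(2,3,1,12) rep_ux, of 0] rep_ut by simp
  then have "2 * \<epsilon> * I (\<lambda>x. ux x * uxt x) = I (\<lambda>x. - 2 * \<epsilon> * (uxx x * ut x))" by simp
  also have "\<dots> \<le> I (\<lambda>x. - 2 * \<epsilon>\<^sup>2 * (uxx x)\<^sup>2 + 2 * Ub\<^sup>2 * (ux x)\<^sup>2 + 2 * (vx x)\<^sup>2 + 8 * \<epsilon>\<^sup>2 * (k x)\<^sup>2 + 2 * p\<^sup>2 * (q x)\<^sup>2)"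
  proof (rule integral_mono_AE)
    show "AE x in seg L. - 2 * \<epsilon> * (uxx x * ut x) \<le>
      - 2 * \<epsilon>\<^sup>2 * (uxx x)\<^sup>2 + 2 * Ub\<^sup>2 * (ux x)\<^sup>2 + 2 * (vx x)\<^sup>2 + 8 * \<epsilon>\<^sup>2 * (k x)\<^sup>2 + 2 * p\<^sup>2 * (q x)\<^sup>2"
      using eq1
    proof eventually_elim
      case (elim x)
      define A B C D where "A = 2 * \<epsilon> * k x" and "B = q x * p" and "C = Ub * ux x" and "D = vx x"
      have ut: "ut x = 2 * \<epsilon> * uxx x + (A + B - C - D)" using elim by (simp add: A_def B_def C_def D_def)
      define S where "S = A + B - C - D"
      have "S\<^sup>2 \<le> 4 * (A\<^sup>2 + B\<^sup>2 + C\<^sup>2 + D\<^sup>2)"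
      proof -
        \<comment> \<open>The six squares add up to 4 (A^2 + B^2 + C^2 + D^2) - S^2.\<close>
        have "0 \<le> (A - B)\<^sup>2 + (A + C)\<^sup>2 + (A + D)\<^sup>2 + (B + C)\<^sup>2 + (B + D)\<^sup>2 + (C - D)\<^sup>2" by simp
        then show ?thesis unfolding S_def by (simp add: power2_eq_square algebra_simps)
      qed
      moreover have "- 2 * \<epsilon> * (uxx x * S) \<le> 2 * \<epsilon>\<^sup>2 * (uxx x)\<^sup>2 + S\<^sup>2 / 2"
      proof -
        have "0 \<le> (2 * \<epsilon> * uxx x + S)\<^sup>2 / 2" by simp
        then show ?thesis by (simp add: power2_eq_square algebra_simps)
      qed
      moreover have "- 2 * \<epsilon> * (uxx x * ut x) = - 4 * \<epsilon>\<^sup>2 * (uxx x)\<^sup>2 - 2 * \<epsilon> * (uxx x * S)"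
        unfolding ut S_def[symmetric] by (simp add: power2_eq_square algebra_simps)
      ultimately have "- 2 * \<epsilon> * (uxx x * ut x) \<le> - 2 * \<epsilon>\<^sup>2 * (uxx x)\<^sup>2 + 2 * (A\<^sup>2 + B\<^sup>2 + C\<^sup>2 + D\<^sup>2)" by simp
      then show ?case unfolding A_def B_def C_def D_def by (simp add: power_mult_distrib mult_ac)
    qed
  qed (use sq_int_mult[OF sq(2) sq(12)] sq_int_square[OF sq(1)] sq_int_square[OF sq(2)] sq_int_square[OF sq(4)]
      sq_int_square[OF sq(7)] sq_int_square[OF sq(8)] in \<open>simp_all del: power_mult_distrib\<close>)
  also have "\<dots> = - 2 * \<epsilon>\<^sup>2 * I (\<lambda>x. (uxx x)\<^sup>2) + 2 * Ub\<^sup>2 * I (\<lambda>x. (ux x)\<^sup>2) + 2 * I (\<lambda>x. (vx x)\<^sup>2) + 8 * \<epsilon>\<^sup>2 * I (\<lambda>x. (k x)\<^sup>2) + 2 * p\<^sup>2 * I (\<lambda>x. (q x)\<^sup>2)"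
    using sq_int_square[OF sq(1)] sq_int_square[OF sq(2)] sq_int_square[OF sq(4)] sq_int_square[OF sq(7)] sq_int_square[OF sq(8)] by simp
  also have "2 * p\<^sup>2 * I (\<lambda>x. (q x)\<^sup>2) \<le> 2 * p\<^sup>2 * (c1 * \<epsilon>)"
    by (rule mult_left_mono[OF layer(1)]) simp
  finally show ?thesis by (simp add: algebra_simps)
qed

text \<open>\<open>test_u_v\<close> is used with \<delta> = \<gamma> / 8, half of the v_x-damping
  \<gamma> / 4 produced by the other two tests. The condition on \<gamma> lets the u_x-terms of
  those tests consume at most half of the viscous dissipation.\<close>

theorem energy:
  assumes \<gamma>: "\<gamma> > 0" "\<gamma> * (2 / (Ub * \<mu>) * (1 / L + 8 / (Ub * \<mu>)) + 1 / \<mu> + 1 / 2 + Ub\<^sup>2 / 4) \<le> 1 / 2"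
  shows "I (\<lambda>x. u x * ut x) + \<mu> * I (\<lambda>x. v x * vt x)
      + \<gamma> * \<epsilon> * (2 * \<epsilon> * \<mu> * I (\<lambda>x. vx x * vxt x) + I (\<lambda>x. ut x * vx x) + I (\<lambda>x. u x * vxt x))
      + \<gamma> / 4 * \<epsilon>\<^sup>2 * I (\<lambda>x. ux x * uxt x)
      + \<epsilon> * (1 / 2 * I (\<lambda>x. (ux x)\<^sup>2) + \<gamma> / 8 * I (\<lambda>x. (vx x)\<^sup>2))
    \<le> 2 * \<epsilon> * I (\<lambda>x. k x * u x)
      + (c1 * (1 / 4 + 2 / (\<gamma> * Ub\<^sup>2)) + \<gamma> * (2 / (Ub ^ 3 * \<mu>) + 2 * c1 + 8 * c1 / Ub\<^sup>2 + c1 / (2 * Ub\<^sup>2 * \<mu>\<^sup>2) + c1 / 4)) * (\<epsilon>\<^sup>2 * p\<^sup>2)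
      + 5 * \<gamma> * \<epsilon>\<^sup>2 * I (\<lambda>x. (k x)\<^sup>2)"
proof -
  define X Y Z K where "X = I (\<lambda>x. (ux x)\<^sup>2)" and "Y = I (\<lambda>x. (vx x)\<^sup>2)" and "Z = \<epsilon>\<^sup>2 * I (\<lambda>x. (uxx x)\<^sup>2)"
    and "K = \<epsilon>\<^sup>2 * I (\<lambda>x. (k x)\<^sup>2)"
  have nn: "X \<ge> 0" "Y \<ge> 0" "Z \<ge> 0" "K \<ge> 0" by (auto simp: X_def Y_def Z_def K_def)
  define c2 where "c2 = 2 / (Ub * \<mu>) * (1 / L + 8 / (Ub * \<mu>)) + 1 / \<mu> + 1 / 2"
  define c3 where "c3 = 2 / (Ub ^ 3 * \<mu>) + 2 * c1 + 8 * c1 / Ub\<^sup>2 + c1 / (2 * Ub\<^sup>2 * \<mu>\<^sup>2)"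
  define S2 where "S2 = 2 * \<epsilon> * \<mu> * I (\<lambda>x. vx x * vxt x) + I (\<lambda>x. ut x * vx x) + I (\<lambda>x. u x * vxt x)"
  define S3 where "S3 = I (\<lambda>x. ux x * uxt x)"
  define S1 where "S1 = I (\<lambda>x. u x * ut x) + \<mu> * I (\<lambda>x. v x * vt x)"
  have 1: "S1 \<le> - \<epsilon> * X + \<gamma> / 8 * \<epsilon> * Y + 2 * \<epsilon> * I (\<lambda>x. k x * u x) + c1 * (1 / 4 + 1 / (4 * (\<gamma> / 8) * Ub\<^sup>2)) * (\<epsilon>\<^sup>2 * p\<^sup>2)"
    unfolding X_def Y_def S1_def using \<gamma> by (intro test_u_v) simp
  have 2: "S2 \<le> - 1 / 2 * Y + c2 * X + 1 / 4 * Z + 4 * K + c3 * (\<epsilon> * p\<^sup>2)"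
    using test_vx unfolding X_def Y_def Z_def K_def c2_def c3_def S2_def .
  have 3: "2 * \<epsilon> * S3 \<le> - 2 * Z + 2 * Ub\<^sup>2 * X + 2 * Y + 8 * K + 2 * c1 * (\<epsilon> * p\<^sup>2)"
    using test_uxx unfolding X_def Y_def Z_def K_def S3_def .
  \<comment> \<open>The weight 1/4 makes \<open>Z\<close> cancel exactly, while the + Y / 4 it
    introduces still leaves - Y / 4 of the damping.\<close>
  have "S2 + 1 / 4 * \<epsilon> * S3 \<le> - 1 / 4 * Y + (c2 + Ub\<^sup>2 / 4) * X + 5 * K + (c3 + c1 / 4) * (\<epsilon> * p\<^sup>2)"
    using 2 3 by (simp add: algebra_simps)
  then have "\<gamma> * \<epsilon> * (S2 + 1 / 4 * \<epsilon> * S3) \<le> \<gamma> * \<epsilon> * (- 1 / 4 * Y + (c2 + Ub\<^sup>2 / 4) * X + 5 * K + (c3 + c1 / 4) * (\<epsilon> * p\<^sup>2))"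
    using pos \<gamma> by (intro mult_left_mono) auto
  also have "\<dots> = - \<gamma> / 4 * \<epsilon> * Y + \<gamma> * (c2 + Ub\<^sup>2 / 4) * (\<epsilon> * X) + 5 * \<gamma> * (\<epsilon> * K) + \<gamma> * (c3 + c1 / 4) * (\<epsilon>\<^sup>2 * p\<^sup>2)"
    by (simp add: algebra_simps power2_eq_square)
  also have "\<gamma> * (c2 + Ub\<^sup>2 / 4) * (\<epsilon> * X) \<le> 1 / 2 * (\<epsilon> * X)"
    using \<gamma>(2) pos nn by (intro mult_right_mono) (auto simp: c2_def)
  also have "5 * \<gamma> * (\<epsilon> * K) \<le> 5 * \<gamma> * K"
    using pos nn \<gamma> mult_right_mono[of \<epsilon> 1 K] by (intro mult_left_mono) auto
  finally have 4: "\<gamma> * \<epsilon> * (S2 + 1 / 4 * \<epsilon> * S3) \<le> - \<gamma> / 4 * \<epsilon> * Y + 1 / 2 * (\<epsilon> * X) + 5 * \<gamma> * K + \<gamma> * (c3 + c1 / 4) * (\<epsilon>\<^sup>2 * p\<^sup>2)"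
    by simp
  have e: "1 / (4 * (\<gamma> / 8) * Ub\<^sup>2) = 2 / (\<gamma> * Ub\<^sup>2)" using \<gamma> pos by (simp add: field_simps)
  have "S1 + \<gamma> * \<epsilon> * S2 + \<gamma> / 4 * \<epsilon>\<^sup>2 * S3 + \<epsilon> * (1 / 2 * X + \<gamma> / 8 * Y) \<le>
    2 * \<epsilon> * I (\<lambda>x. k x * u x) + (c1 * (1 / 4 + 2 / (\<gamma> * Ub\<^sup>2)) + \<gamma> * (c3 + c1 / 4)) * (\<epsilon>\<^sup>2 * p\<^sup>2) + 5 * \<gamma> * K"
    using 1 4 unfolding e by (simp add: algebra_simps power2_eq_square)
  then show ?thesis unfolding S1_def S2_def S3_def X_def Y_def K_def c3_def by (simp add: mult.assoc)
qed

end

section \<open>Smoothing in time\<close>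

text \<open>On \<open>[0, T]\<close> this is the solution \<open>g\<close> of \<open>g + \<eta> g' = f\<close>, \<open>g(0) = 0\<close>. Being linear and translation invariant it
  respects the equations, and it supplies the time derivative of \<open>u\<^sub>x\<close>, which the solution need not have.\<close>

definition tavg :: "real \<Rightarrow> real \<Rightarrow> (real \<Rightarrow> real) \<Rightarrow> real \<Rightarrow> real" where
  "tavg T \<eta> f t = prim T (\<lambda>s. exp ((s - t) / \<eta>) / \<eta> * f s) t"

lemma seg_borel: "integrable (seg T) f \<Longrightarrow> f \<in> borel_measurable borel"
  using borel_measurable_integrable[of "seg T" f] by (simp add: measurable_seg_eq)

lemma prim_cong_AE':
  assumes "integrable (seg T) f" "integrable (seg T) g" "AE x in seg T. f x = g x"
  shows "prim T f x = prim T g x"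
  by (rule prim_cong_AE) (use assms seg_borel in auto)

lemma tavg_measurable [measurable]:
  assumes [measurable]: "f \<in> borel_measurable borel"
  shows "tavg T \<eta> f \<in> borel_measurable borel"
  unfolding tavg_def[abs_def] by measurable

text \<open>With the factor \<open>exp (- t / \<eta>)\<close> pulled out of the kernel, the
  integrand no longer depends on t and the calculus of primitives applies.\<close>

lemma tavg_exp:
  assumes f: "integrable (seg T) f" and \<eta>: "\<eta> > 0"
  shows "integrable (seg T) (\<lambda>s. exp (s / \<eta>) / \<eta> * f s)"
    and "tavg T \<eta> f t = exp (- t / \<eta>) * prim T (\<lambda>s. exp (s / \<eta>) / \<eta> * f s) t"
proof -
  have [measurable]: "f \<in> borel_measurable borel" using f by (rule seg_borel)
  show "integrable (seg T) (\<lambda>s. exp (s / \<eta>) / \<eta> * f s)"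
  proof (rule Bochner_Integration.integrable_bound)
    show "integrable (seg T) (\<lambda>s. exp (T / \<eta>) / \<eta> * f s)" using f by simp
    show "AE s in seg T. norm (exp (s / \<eta>) / \<eta> * f s) \<le> norm (exp (T / \<eta>) / \<eta> * f s)"
      using AE_seg_mem
    proof eventually_elim
      case (elim s)
      have "exp (s / \<eta>) / \<eta> \<le> exp (T / \<eta>) / \<eta>"
        using elim \<eta> by (intro divide_right_mono) (auto simp: divide_right_mono)
      then have "\<bar>exp (s / \<eta>) / \<eta>\<bar> * \<bar>f s\<bar> \<le> \<bar>exp (T / \<eta>) / \<eta>\<bar> * \<bar>f s\<bar>"
        using \<eta> by (intro mult_right_mono) auto
      then show ?case by (simp only: real_norm_def abs_mult)
    qed
  qed measurable
  show "tavg T \<eta> f t = exp (- t / \<eta>) * prim T (\<lambda>s. exp (s / \<eta>) / \<eta> * f s) t"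
    unfolding tavg_def prim_cmult[symmetric]
    by (intro arg_cong[where f = "\<lambda>h. prim T h t"] ext) (simp add: exp_add[symmetric] add_divide_distrib[symmetric] diff_divide_distrib mult.assoc[symmetric])
qed

lemma tavg_bounded:
  assumes f: "integrable (seg T) f" and \<eta>: "\<eta> > 0"
  shows "\<exists>B. AE t in seg T. \<bar>tavg T \<eta> f t\<bar> \<le> B"
proof (intro exI)
  let ?g = "\<lambda>s. exp (s / \<eta>) / \<eta> * f s"
  show "AE t in seg T. \<bar>tavg T \<eta> f t\<bar> \<le> (\<integral>s. \<bar>?g s\<bar> \<partial>seg T)"
    using AE_seg_mem
  proof eventually_elim
    case (elim t)
    have "exp (- t / \<eta>) * \<bar>prim T ?g t\<bar> \<le> 1 * (\<integral>s. \<bar>?g s\<bar> \<partial>seg T)"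
      by (rule mult_mono) (use elim \<eta> prim_abs_le[OF tavg_exp(1)[OF f \<eta>], of t] in auto)
    then show ?case unfolding tavg_exp(2)[OF f \<eta>] by (simp add: abs_mult)
  qed
qed

lemma sq_int_tavg:
  assumes f: "integrable (seg T) f" and \<eta>: "\<eta> > 0"
  shows "sq_int (seg T) (tavg T \<eta> f)"
proof -
  have [measurable]: "f \<in> borel_measurable borel" using f by (rule seg_borel)
  obtain B where B: "AE t in seg T. \<bar>tavg T \<eta> f t\<bar> \<le> B" using tavg_bounded[OF assms] by blast
  show ?thesis
  proof (rule sq_int_bound)
    show "integrable (seg T) (\<lambda>t. B\<^sup>2)" by simp
    show "AE t in seg T. (tavg T \<eta> f t)\<^sup>2 \<le> B\<^sup>2"
      using B by eventually_elim (use abs_le_square_iff order_trans[OF _ abs_ge_self] in blast)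
  qed measurable
qed

lemma integrable_tavg: "integrable (seg T) f \<Longrightarrow> \<eta> > 0 \<Longrightarrow> integrable (seg T) (tavg T \<eta> f)"
  by (rule sq_int_integrable[OF finite_measure_seg sq_int_tavg])

text \<open>The product rule applied to the two factors in \<open>tavg_exp\<close>, the exponential
  being itself one plus a primitive.\<close>

lemma tavg_ode:
  assumes f: "integrable (seg T) f" and \<eta>: "\<eta> > 0" and t: "t \<in> {0..T}"
  shows "tavg T \<eta> f t = prim T (\<lambda>s. (f s - tavg T \<eta> f s) / \<eta>) t"
proof -
  let ?g = "\<lambda>s. exp (s / \<eta>) / \<eta> * f s" and ?e = "\<lambda>s. exp (- s / \<eta>)" and ?e' = "\<lambda>s. - (exp (- s / \<eta>) / \<eta>)"
  note g = tavg_exp(1)[OF f \<eta>]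
  have e: "?e s = 1 + prim T ?e' s" "integrable (seg T) ?e'" if s: "s \<in> {0..T}" for s
  proof -
    have d: "(?e has_real_derivative ?e' x) (at x within {0..T})" for x
      using \<eta> by (auto intro!: derivative_eq_intros)
    have c: "continuous_on {0..T} ?e'" using \<eta> by (intro continuous_intros) auto
    have m: "?e' \<in> borel_measurable borel" by measurable
    show "?e s = 1 + prim T ?e' s" using prim_deriv(1)[OF d c m s] by simp
    show "integrable (seg T) ?e'" by (rule prim_deriv(2)[OF d c m s])
  qed
  note e' = e(2)[OF t] and i = prim_mult(2,3)[OF e(2)[OF t] g]
  have "tavg T \<eta> f t = (1 + prim T ?e' t) * prim T ?g t"
    unfolding tavg_exp(2)[OF f \<eta>] e(1)[OF t] ..
  also have "\<dots> = prim T ?g t + prim T (\<lambda>s. ?e' s * prim T ?g s + prim T ?e' s * ?g s) t"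
    unfolding distrib_right prim_mult(1)[OF e' g] by simp
  also have "\<dots> = prim T (\<lambda>s. ?g s + (?e' s * prim T ?g s + prim T ?e' s * ?g s)) t"
    by (rule prim_add[symmetric]) (use i g in auto)
  also have "\<dots> = prim T (\<lambda>s. (f s - tavg T \<eta> f s) / \<eta>) t"
  proof (rule prim_cong_AE')
    show "AE s in seg T. ?g s + (?e' s * prim T ?g s + prim T ?e' s * ?g s) = (f s - tavg T \<eta> f s) / \<eta>"
      using AE_seg_mem
    proof eventually_elim
      case (elim s)
      then have s: "s \<in> {0..T}" by simp
      have "?g s + (?e' s * prim T ?g s + prim T ?e' s * ?g s) = (1 + prim T ?e' s) * ?g s + ?e' s * prim T ?g s"
        by (simp add: algebra_simps)
      also have "\<dots> = ?e s * ?g s - tavg T \<eta> f s / \<eta>"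
        unfolding e(1)[OF s, symmetric] tavg_exp(2)[OF f \<eta>] by simp
      also have "?e s * ?g s = f s / \<eta>" by (simp add: mult.assoc[symmetric] exp_add[symmetric])
      finally show ?case by (simp add: diff_divide_distrib)
    qed
  qed (use i g f integrable_tavg[OF f \<eta>] in auto)
  finally show ?thesis .
qed

lemma prim_mono:
  assumes "integrable (seg T) f" "integrable (seg T) g" "AE s in seg T. f s \<le> g s"
  shows "prim T f t \<le> prim T g t"
  unfolding prim_def
  by (rule integral_mono_AE) (use assms prim_integrable in \<open>auto elim!: eventually_mono simp: indicator_def\<close>)

lemma prim_square:
  assumes h: "integrable (seg T) h" and y: "AE s in seg T. y s = prim T h s" and ym: "y \<in> borel_measurable borel"
  shows "(prim T h t)\<^sup>2 = prim T (\<lambda>s. 2 * (h s * y s)) t" "integrable (seg T) (\<lambda>s. 2 * (h s * y s))"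
proof -
  have [measurable]: "h \<in> borel_measurable borel" "y \<in> borel_measurable borel" using h ym by (auto dest: seg_borel)
  have ae: "AE s in seg T. h s * prim T h s + prim T h s * h s = 2 * (h s * y s)"
    using y by eventually_elim (simp add: mult.commute)
  have i: "integrable (seg T) (\<lambda>s. h s * prim T h s + prim T h s * h s)" using prim_mult(2,3)[OF h h] by simp
  show 2: "integrable (seg T) (\<lambda>s. 2 * (h s * y s))"
    by (rule integrable_cong_AE_imp[OF i _ ae]) measurable
  show "(prim T h t)\<^sup>2 = prim T (\<lambda>s. 2 * (h s * y s)) t"
    unfolding power2_eq_square prim_mult(1)[OF h h] by (rule prim_cong_AE'[OF i 2 ae])
qed

lemma tavg_rate:
  assumes f: "integrable (seg T) f" and \<eta>: "\<eta> > 0"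
  defines "h \<equiv> \<lambda>s. (f s - tavg T \<eta> f s) / \<eta>"
  shows "integrable (seg T) h" "AE s in seg T. tavg T \<eta> f s = prim T h s"
    and "t \<in> {0..T} \<Longrightarrow> (tavg T \<eta> f t)\<^sup>2 = prim T (\<lambda>s. 2 * (h s * tavg T \<eta> f s)) t"
    and "integrable (seg T) (\<lambda>s. 2 * (h s * tavg T \<eta> f s))"
proof -
  have [measurable]: "f \<in> borel_measurable borel" using f by (rule seg_borel)
  show h: "integrable (seg T) h" unfolding h_def using f integrable_tavg[OF f \<eta>] by simp
  show ae: "AE s in seg T. tavg T \<eta> f s = prim T h s"
    using AE_seg_mem by eventually_elim (use tavg_ode[OF f \<eta>] in \<open>auto simp: h_def\<close>)
  show "integrable (seg T) (\<lambda>s. 2 * (h s * tavg T \<eta> f s))"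
    by (rule prim_square(2)[OF h ae]) measurable
  show "(tavg T \<eta> f t)\<^sup>2 = prim T (\<lambda>s. 2 * (h s * tavg T \<eta> f s)) t" if "t \<in> {0..T}"
    unfolding prim_square(1)[OF h ae tavg_measurable[OF seg_borel[OF f]], symmetric]
    using tavg_ode[OF f \<eta> that] by (simp add: h_def)
qed

text \<open>Multiplying \<eta> y' = f - y by 2 y gives \<eta> (y^2)' \<le> f^2 - y^2. Integration
  over [0, T] from y(0) = 0 shows that averaging is a contraction.\<close>

lemma tavg_norm_le:
  assumes f: "sq_int (seg T) f" and \<eta>: "\<eta> > 0" and T: "T > 0"
  shows "(\<integral>t. (tavg T \<eta> f t)\<^sup>2 \<partial>seg T) \<le> (\<integral>t. (f t)\<^sup>2 \<partial>seg T)"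
proof -
  note fi = sq_int_integrable[OF finite_measure_seg f]
  let ?y = "tavg T \<eta> f"
  note y = sq_int_tavg[OF fi \<eta>]
  note h = tavg_rate[OF fi \<eta>]
  have [measurable]: "f \<in> borel_measurable borel" using fi by (rule seg_borel)
  have sqs: "integrable (seg T) (\<lambda>t. (f t)\<^sup>2)" "integrable (seg T) (\<lambda>t. (?y t)\<^sup>2)"
    using f y by (auto dest: sq_int_square)
  have "0 \<le> (?y T)\<^sup>2" by simp
  also have "(?y T)\<^sup>2 = prim T (\<lambda>s. 2 * ((f s - ?y s) / \<eta> * ?y s)) T" using h(3)[of T] T by simp
  also have "\<dots> \<le> prim T (\<lambda>s. (f s)\<^sup>2 / \<eta> - (?y s)\<^sup>2 / \<eta>) T"
  proof (rule prim_mono[OF h(4)], goal_cases)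
    case 2
    show ?case
    proof (rule AE_I2)
      fix s
      have "2 * ((f s - ?y s) * ?y s) \<le> (f s)\<^sup>2 - (?y s)\<^sup>2"
        using sum_squares_bound[of "f s" "?y s"] by (simp add: power2_eq_square algebra_simps)
      then have "2 * ((f s - ?y s) * ?y s) / \<eta> \<le> ((f s)\<^sup>2 - (?y s)\<^sup>2) / \<eta>"
        using \<eta> by (intro divide_right_mono) auto
      then show "2 * ((f s - ?y s) / \<eta> * ?y s) \<le> (f s)\<^sup>2 / \<eta> - (?y s)\<^sup>2 / \<eta>"
        unfolding diff_divide_distrib[of "(f s)\<^sup>2", symmetric] by (simp only: times_divide_eq_left times_divide_eq_right)
    qed
  qed (use sqs in simp)
  also have "\<dots> = ((\<integral>t. (f t)\<^sup>2 \<partial>seg T) - (\<integral>t. (?y t)\<^sup>2 \<partial>seg T)) / \<eta>"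
    using sqs by (subst prim_ge) (auto simp: diff_divide_distrib)
  finally show ?thesis using \<eta> by (simp add: zero_le_divide_iff)
qed

text \<open>Averaging commutes with d/dt because f(0) = 0: the primitive of the averaged
  \<open>g\<close> and the average of \<open>f\<close> solve the same equation from zero. Their
  difference satisfies \<eta> d' = - d, so d^2 cannot grow.\<close>

lemma tavg_prim:
  assumes g: "integrable (seg T) g" and \<eta>: "\<eta> > 0" and f: "AE t in seg T. f t = prim T g t" and fi: "integrable (seg T) f"
  shows "AE t in seg T. tavg T \<eta> f t = prim T (tavg T \<eta> g) t"
    and "AE t in seg T. tavg T \<eta> g t = (f t - tavg T \<eta> f t) / \<eta>"
proof -
  have [measurable]: "f \<in> borel_measurable borel" "g \<in> borel_measurable borel" using fi g by (auto dest: seg_borel)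
  note ig = integrable_tavg[OF g \<eta>] and if' = integrable_tavg[OF fi \<eta>]
  have 1: "tavg T \<eta> g t = (prim T g t - prim T (tavg T \<eta> g) t) / \<eta>" if "t \<in> {0..T}" for t
  proof -
    have "tavg T \<eta> g t = prim T (\<lambda>s. inverse \<eta> * (g s - tavg T \<eta> g s)) t"
      using tavg_ode[OF g \<eta> that] by (simp add: divide_inverse mult.commute)
    also have "\<dots> = inverse \<eta> * (prim T g t - prim T (tavg T \<eta> g) t)"
      unfolding prim_cmult by (subst prim_diff[OF g ig]) simp
    finally show ?thesis by (simp add: divide_inverse mult.commute)
  qed
  define d where "d t = prim T (tavg T \<eta> g) t - tavg T \<eta> f t" for t
  have pint: "integrable (seg T) (prim T (tavg T \<eta> g))"
    using prim_mult(3)[OF ig, of "\<lambda>_. 1"] by simp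
  have di: "integrable (seg T) d" unfolding d_def using pint if' by simp
  have dm: "d \<in> borel_measurable borel" by (rule seg_borel[OF di])
  let ?h = "\<lambda>s. - inverse \<eta> * d s"
  have hi: "integrable (seg T) ?h" using di by simp
  have "AE t in seg T. d t = prim T ?h t"
    using AE_seg_mem
  proof eventually_elim
    case (elim t)
    then have t: "t \<in> {0..T}" by simp
    have "prim T (tavg T \<eta> g) t = prim T (\<lambda>s. inverse \<eta> * (f s - prim T (tavg T \<eta> g) s)) t"
    proof (rule prim_cong_AE'[OF ig])
      show "AE s in seg T. tavg T \<eta> g s = inverse \<eta> * (f s - prim T (tavg T \<eta> g) s)"
        using f AE_seg_mem by eventually_elim (use 1 in \<open>auto simp: divide_inverse mult.commute\<close>)
    qed (use fi pint in simp)
    moreover have "tavg T \<eta> f t = prim T (\<lambda>s. inverse \<eta> * (f s - tavg T \<eta> f s)) t"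
      using tavg_ode[OF fi \<eta> t] by (simp add: divide_inverse mult.commute)
    ultimately have "d t = prim T (\<lambda>s. inverse \<eta> * (f s - prim T (tavg T \<eta> g) s)) t - prim T (\<lambda>s. inverse \<eta> * (f s - tavg T \<eta> f s)) t"
      unfolding d_def by simp
    also have "\<dots> = prim T (\<lambda>s. inverse \<eta> * (f s - prim T (tavg T \<eta> g) s) - inverse \<eta> * (f s - tavg T \<eta> f s)) t"
      by (rule prim_diff[symmetric]) (use fi pint if' in auto)
    also have "\<dots> = prim T ?h t"
      by (intro arg_cong[where f = "\<lambda>h. prim T h t"] ext) (simp add: d_def algebra_simps)
    finally show ?case .
  qed
  note ps = prim_square[OF hi this dm]
  have "prim T ?h t = 0" for t
  proof -
    have "(prim T ?h t)\<^sup>2 \<le> prim T (\<lambda>s. 0) t"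
      unfolding ps(1) by (rule prim_mono[OF ps(2)]) (use \<eta> in \<open>auto simp: mult_le_0_iff zero_le_mult_iff\<close>)
    then show ?thesis by (simp add: prim_def)
  qed
  then have "AE t in seg T. d t = 0" using \<open>AE t in seg T. d t = prim T ?h t\<close> by simp
  then show A: "AE t in seg T. tavg T \<eta> f t = prim T (tavg T \<eta> g) t"
    by eventually_elim (simp add: d_def)
  show "AE t in seg T. tavg T \<eta> g t = (f t - tavg T \<eta> f t) / \<eta>"
    using A f AE_seg_mem by eventually_elim (use 1 in auto)
qed

text \<open>The error is \<eta> times the average y of f'. From \<eta> y' = g - y follows (y^2)'
  \<le> g^2 / (2 \<eta>), hence y^2 is at most 1 / (2 \<eta>) times the integral of g^2.\<close>

lemma tavg_close:
  assumes g: "sq_int (seg T) g" and \<eta>: "\<eta> > 0" and f: "AE t in seg T. f t = prim T g t" and fi: "integrable (seg T) f"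
  shows "AE t in seg T. (f t - tavg T \<eta> f t)\<^sup>2 \<le> \<eta> / 2 * (\<integral>s. (g s)\<^sup>2 \<partial>seg T)"
proof -
  note gi = sq_int_integrable[OF finite_measure_seg g]
  note gs = sq_int_square[OF g]
  have gm: "g \<in> borel_measurable borel" by (rule seg_borel[OF gi])
  note h = tavg_rate[OF gi \<eta>]
  let ?y = "tavg T \<eta> g"
  show ?thesis
    using tavg_prim(2)[OF gi \<eta> f fi] AE_seg_mem
  proof eventually_elim
    case (elim t)
    have "(?y t)\<^sup>2 = prim T (\<lambda>s. 2 * ((g s - ?y s) / \<eta> * ?y s)) t" using h(3)[of t] elim(2) by simp
    also have "\<dots> \<le> prim T (\<lambda>s. (g s)\<^sup>2 / (2 * \<eta>)) t"
    proof (rule prim_mono[OF h(4)], goal_cases)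
      case 2
      show ?case
      proof (rule AE_I2)
        fix s
        have "0 \<le> (g s - 2 * ?y s)\<^sup>2 / (2 * \<eta>)" using \<eta> by simp
        also have "\<dots> = (g s)\<^sup>2 / (2 * \<eta>) - 2 * ((g s - ?y s) / \<eta> * ?y s)"
          using \<eta> by (simp add: power2_eq_square field_simps)
        finally show "2 * ((g s - ?y s) / \<eta> * ?y s) \<le> (g s)\<^sup>2 / (2 * \<eta>)" by simp
      qed
    qed (use gs in simp)
    also have "\<dots> \<le> (\<integral>s. (g s)\<^sup>2 / (2 * \<eta>) \<partial>seg T)"
      using prim_abs_le[of T "\<lambda>s. (g s)\<^sup>2 / (2 * \<eta>)" t] gs \<eta> by simp
    also have "\<dots> = (\<integral>s. (g s)\<^sup>2 \<partial>seg T) / (2 * \<eta>)" by simp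
    finally have "\<eta>\<^sup>2 * (?y t)\<^sup>2 \<le> \<eta>\<^sup>2 * ((\<integral>s. (g s)\<^sup>2 \<partial>seg T) / (2 * \<eta>))" by (intro mult_left_mono) auto
    also have "\<dots> = \<eta> / 2 * (\<integral>s. (g s)\<^sup>2 \<partial>seg T)" using \<eta> by (simp add: power2_eq_square)
    also have "\<eta>\<^sup>2 * (?y t)\<^sup>2 = (f t - tavg T \<eta> f t)\<^sup>2" using elim(1) \<eta> by (simp add: power_divide)
    finally show ?case .
  qed
qed

lemma tavg_add:
  assumes "integrable (seg T) f" "integrable (seg T) g" "\<eta> > 0"
  shows "tavg T \<eta> (\<lambda>s. f s + g s) t = tavg T \<eta> f t + tavg T \<eta> g t"
proof -
  have "integrable (seg T) (\<lambda>s. f s + g s)" using assms by simp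
  then show ?thesis
    using prim_add[OF tavg_exp(1)[OF assms(1,3)] tavg_exp(1)[OF assms(2,3)], of t] assms
    by (simp add: tavg_exp(2) distrib_left)
qed

lemma tavg_cmult: "tavg T \<eta> (\<lambda>s. c * f s) t = c * tavg T \<eta> f t"
  unfolding tavg_def prim_cmult[symmetric] by (simp add: mult.left_commute)

lemma tavg_cong_AE:
  assumes "AE s in seg T. f s = g s" "f \<in> borel_measurable borel" "g \<in> borel_measurable borel"
  shows "tavg T \<eta> f t = tavg T \<eta> g t"
  unfolding tavg_def by (rule prim_cong_AE) (use assms in \<open>auto elim: eventually_mono\<close>)

section \<open>Time averages of functions on the cylinder\<close>

definition smooth :: "real \<Rightarrow> real \<Rightarrow> (real \<times> real \<Rightarrow> real) \<Rightarrow> real \<times> real \<Rightarrow> real" where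
  "smooth T \<eta> f z = tavg T \<eta> (\<lambda>s. f (fst z, s)) (snd z)"

lemma smooth_measurable [measurable]:
  assumes [measurable]: "f \<in> borel_measurable (borel \<Otimes>\<^sub>M borel)"
  shows "smooth T \<eta> f \<in> borel_measurable (borel \<Otimes>\<^sub>M borel)"
  unfolding smooth_def[abs_def] tavg_def by measurable

lemma sq_int_rect_borel: "sq_int (rect L T) f \<Longrightarrow> f \<in> borel_measurable (borel \<Otimes>\<^sub>M borel)"
  using sq_int_measurable[of "rect L T" f] by (simp add: rect_measurable)

lemma sq_int_rect_integrable: "sq_int (rect L T) f \<Longrightarrow> integrable (rect L T) f"
  by (rule sq_int_integrable) (rule segp.finite_measure_axioms)

lemma sq_int_slices:
  assumes f: "sq_int (rect L T) f"
  shows "AE x in seg L. sq_int (seg T) (\<lambda>t. f (x, t))" "AE t in seg T. sq_int (seg L) (\<lambda>x. f (x, t))"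
proof -
  note [measurable] = sq_int_rect_borel[OF f]
  have "(\<lambda>t. f (x, t)) \<in> borel_measurable (seg T)" "(\<lambda>x. f (x, t)) \<in> borel_measurable (seg L)" for x t
    by measurable
  then show "AE x in seg L. sq_int (seg T) (\<lambda>t. f (x, t))" "AE t in seg T. sq_int (seg L) (\<lambda>x. f (x, t))"
    using integrable_rect_slices(1,2)[OF sq_int_square[OF f]] by (simp_all add: sq_int_def)
qed

lemma sq_int_smooth:
  assumes f: "sq_int (rect L T) f" and \<eta>: "\<eta> > 0" and T: "T > 0"
  shows "sq_int (rect L T) (smooth T \<eta> f)"
    "(\<integral>z. (smooth T \<eta> f z)\<^sup>2 \<partial>rect L T) \<le> (\<integral>z. (f z)\<^sup>2 \<partial>rect L T)"
proof -
  note [measurable] = sq_int_rect_borel[OF f]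
  note fs = integrable_rect_slices[OF sq_int_square[OF f]]
  have ae: "AE x in seg L. (\<integral>t. (smooth T \<eta> f (x, t))\<^sup>2 \<partial>seg T) \<le> (\<integral>t. (f (x, t))\<^sup>2 \<partial>seg T)"
    using sq_int_slices(1)[OF f] by eventually_elim (use tavg_norm_le[OF _ \<eta> T] in \<open>auto simp: smooth_def\<close>)
  have ae': "AE x in seg L. integrable (seg T) (\<lambda>t. (smooth T \<eta> f (x, t))\<^sup>2)"
    using sq_int_slices(1)[OF f]
    by eventually_elim (use sq_int_square[OF sq_int_tavg[OF sq_int_integrable[OF finite_measure_seg] \<eta>]] in \<open>auto simp: smooth_def\<close>)
  have i: "integrable (seg L) (\<lambda>x. \<integral>t. (smooth T \<eta> f (x, t))\<^sup>2 \<partial>seg T)"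
    by (rule Bochner_Integration.integrable_bound[OF fs(3)]) (use ae in auto)
  have I: "integrable (rect L T) (\<lambda>z. (smooth T \<eta> f z)\<^sup>2)"
  proof (rule seg2.Fubini_integrable)
    show "integrable (seg L) (\<lambda>x. \<integral>y. norm ((smooth T \<eta> f (x, y))\<^sup>2) \<partial>seg T)" using i by simp
  qed (use ae' in \<open>auto simp: rect_measurable\<close>)
  then show "sq_int (rect L T) (smooth T \<eta> f)"
    unfolding sq_int_def by (simp add: rect_measurable)
  show "(\<integral>z. (smooth T \<eta> f z)\<^sup>2 \<partial>rect L T) \<le> (\<integral>z. (f z)\<^sup>2 \<partial>rect L T)"
    unfolding integrable_rect_slices(5)[OF I, symmetric] integrable_rect_slices(5)[OF sq_int_square[OF f], symmetric]
    by (rule integral_mono_AE[OF i fs(3) ae])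
qed

lemma integral_prim_swap:
  assumes H: "integrable (rect L T) H"
  shows "(\<integral>x. prim T (\<lambda>s. H (x, s)) t \<partial>seg L) = prim T (\<lambda>s. \<integral>x. H (x, s) \<partial>seg L) t"
    and "integrable (rect L T) (\<lambda>z. indicator {..t} (snd z) * H z)"
proof -
  note [measurable] = integrable_rect_measurable[OF H]
  have "integrable (rect L T) (\<lambda>z. H z * indicator {..t} (snd z))"
    by (rule integrable_mult_bounded[OF H, where B = 1]) (auto split: split_indicator)
  then show i: "integrable (rect L T) (\<lambda>z. indicator {..t} (snd z) * H z)" by (simp add: mult.commute)
  from seg2.Fubini_integral[of L T "\<lambda>x s. indicator {..t} s * H (x, s)"] i
  have "(\<integral>x. \<integral>s. indicator {..t} s * H (x, s) \<partial>seg T \<partial>seg L) = (\<integral>s. \<integral>x. indicator {..t} s * H (x, s) \<partial>seg L \<partial>seg T)"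
    by (simp add: split_beta')
  then show "(\<integral>x. prim T (\<lambda>s. H (x, s)) t \<partial>seg L) = prim T (\<lambda>s. \<integral>x. H (x, s) \<partial>seg L) t"
    by (simp add: prim_def)
qed

lemma tavg_prim_swap:
  assumes g: "integrable (rect L T) g" and \<eta>: "\<eta> > 0"
  shows "tavg T \<eta> (\<lambda>s. prim L (\<lambda>y. g (y, s)) x) t = prim L (\<lambda>y. smooth T \<eta> g (y, t)) x"
    and "tavg T \<eta> (\<lambda>s. \<integral>y. g (y, s) \<partial>seg L) t = (\<integral>y. smooth T \<eta> g (y, t) \<partial>seg L)"
proof -
  note [measurable] = integrable_rect_measurable[OF g]
  have main: "tavg T \<eta> (\<lambda>s. \<integral>y. g' (y, s) \<partial>seg L) t = (\<integral>y. smooth T \<eta> g' (y, t) \<partial>seg L)"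
    if g': "integrable (rect L T) g'" for g'
  proof -
    note [measurable] = integrable_rect_measurable[OF g']
    let ?k = "\<lambda>s. indicator {..t} s * (exp ((s - t) / \<eta>) / \<eta>)"
    have "\<bar>?k s\<bar> \<le> 1 / \<eta>" for s
      using \<eta> by (auto simp: indicator_def abs_mult divide_right_mono divide_nonpos_pos)
    then have "integrable (rect L T) (\<lambda>z. g' z * ?k (snd z))"
      by (intro integrable_mult_bounded[OF g']) measurable
    from seg2.Fubini_integral[of L T "\<lambda>y s. g' (y, s) * ?k s"] this
    have "(\<integral>s. \<integral>y. g' (y, s) * ?k s \<partial>seg L \<partial>seg T) = (\<integral>y. \<integral>s. g' (y, s) * ?k s \<partial>seg T \<partial>seg L)"
      by (simp add: split_beta')
    note eq = this
    have "tavg T \<eta> (\<lambda>s. \<integral>y. g' (y, s) \<partial>seg L) t = (\<integral>s. \<integral>y. g' (y, s) * ?k s \<partial>seg L \<partial>seg T)"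
      by (simp add: tavg_def prim_def mult_ac)
    also have "\<dots> = (\<integral>y. smooth T \<eta> g' (y, t) \<partial>seg L)"
      unfolding eq by (simp add: tavg_def smooth_def prim_def mult_ac)
    finally show ?thesis .
  qed
  from main[OF g] show "tavg T \<eta> (\<lambda>s. \<integral>y. g (y, s) \<partial>seg L) t = (\<integral>y. smooth T \<eta> g (y, t) \<partial>seg L)" .
  \<comment> \<open>A primitive in x is the full integral of \<open>g\<close> cut off at x, so the
    case already proved covers it.\<close>
  have "integrable (rect L T) (\<lambda>z. g z * indicator {..x} (fst z))"
    by (rule integrable_mult_bounded[OF g, where B = 1]) (auto split: split_indicator)
  from main[OF this] show "tavg T \<eta> (\<lambda>s. prim L (\<lambda>y. g (y, s)) x) t = prim L (\<lambda>y. smooth T \<eta> g (y, t)) x"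
    by (simp add: prim_def smooth_def mult.commute[of "g _"] tavg_cmult)
qed

text \<open>In words of traces: \<open>g\<close> is the x-derivative of \<open>f\<close> and
  \<open>c\<close> its trace at x = 0.\<close>

definition xrep :: "real \<Rightarrow> real \<Rightarrow> (real \<times> real \<Rightarrow> real) \<Rightarrow> (real \<Rightarrow> real) \<Rightarrow> (real \<times> real \<Rightarrow> real) \<Rightarrow> bool" where
  "xrep L T f c g \<longleftrightarrow> (AE z in rect L T. f z = c (snd z) + prim L (\<lambda>y. g (y, snd z)) (fst z))"

text \<open>A time derivative together with zero initial value; compare \<open>hast\<close>, which
  leaves the initial value open.\<close>

definition trep :: "real \<Rightarrow> real \<Rightarrow> (real \<times> real \<Rightarrow> real) \<Rightarrow> (real \<times> real \<Rightarrow> real) \<Rightarrow> bool" where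
  "trep L T f g \<longleftrightarrow> (AE z in rect L T. f z = prim T (\<lambda>s. g (fst z, s)) (snd z))"

lemma xrep_slice: "xrep L T f c g \<Longrightarrow> AE t in seg T. AE x in seg L. f (x, t) = c t + prim L (\<lambda>y. g (y, t)) x"
  unfolding xrep_def using AE_seg_slice2 by fastforce

lemma trep_slice: "trep L T f g \<Longrightarrow> AE x in seg L. AE t in seg T. f (x, t) = prim T (\<lambda>s. g (x, s)) t"
  unfolding trep_def using AE_seg_slice1 by fastforce

lemma smooth_xrep:
  assumes rep: "xrep L T f c g" and g: "sq_int (rect L T) g" and c: "integrable (seg T) c" and f: "sq_int (rect L T) f" and \<eta>: "\<eta> > 0"
  shows "xrep L T (smooth T \<eta> f) (tavg T \<eta> c) (smooth T \<eta> g)"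
proof -
  note gi = sq_int_rect_integrable[OF g]
  note [measurable] = sq_int_rect_borel[OF f] sq_int_rect_borel[OF g] seg_borel[OF c]
  have "AE x in seg L. AE t in seg T. f (x, t) = c t + prim L (\<lambda>y. g (y, t)) x"
    using rep unfolding xrep_def using AE_seg_slice1 by fastforce
  moreover have "AE x in seg L. integrable (seg T) (\<lambda>t. prim L (\<lambda>y. g (y, t)) x)"
    using integrable_rect_slices(1)[OF integrable_prim_rect[OF gi]] by simp
  ultimately have "AE x in seg L. AE t in seg T. smooth T \<eta> f (x, t) = tavg T \<eta> c t + prim L (\<lambda>y. smooth T \<eta> g (y, t)) x"
  proof eventually_elim
    case (elim x)
    show ?case
    proof (rule AE_I2)
      fix t
      have "smooth T \<eta> f (x, t) = tavg T \<eta> (\<lambda>s. c s + prim L (\<lambda>y. g (y, s)) x) t"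
        unfolding smooth_def fst_conv snd_conv by (rule tavg_cong_AE) (use elim in measurable)
      also have "\<dots> = tavg T \<eta> c t + prim L (\<lambda>y. smooth T \<eta> g (y, t)) x"
        by (subst tavg_add[OF c elim(2) \<eta>]) (simp add: tavg_prim_swap[OF gi \<eta>])
      finally show "smooth T \<eta> f (x, t) = tavg T \<eta> c t + prim L (\<lambda>y. smooth T \<eta> g (y, t)) x" .
    qed
  qed
  then show ?thesis
    unfolding xrep_def by (intro AE_seg_pairI1) (simp_all add: borel_prod[symmetric])
qed

lemma smooth_int0:
  assumes "AE t in seg T. (\<integral>x. g (x, t) \<partial>seg L) = 0" and g: "sq_int (rect L T) g" and \<eta>: "\<eta> > 0"
  shows "(\<integral>x. smooth T \<eta> g (x, t) \<partial>seg L) = 0"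
proof -
  note [measurable] = sq_int_rect_borel[OF g]
  have "(\<integral>x. smooth T \<eta> g (x, t) \<partial>seg L) = tavg T \<eta> (\<lambda>s. \<integral>y. g (y, s) \<partial>seg L) t"
    by (rule tavg_prim_swap(2)[OF sq_int_rect_integrable[OF g] \<eta>, symmetric])
  also have "\<dots> = tavg T \<eta> (\<lambda>s. 0) t"
    by (rule tavg_cong_AE) (use assms(1) in measurable)
  finally show ?thesis by (simp add: tavg_def prim_def)
qed

lemma smooth_trep:
  assumes rep: "trep L T f g" and f: "sq_int (rect L T) f" and g: "sq_int (rect L T) g" and \<eta>: "\<eta> > 0"
  shows "trep L T (smooth T \<eta> f) (smooth T \<eta> g)"
    and "AE z in rect L T. smooth T \<eta> g z = (f z - smooth T \<eta> f z) / \<eta>"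
    and "AE z in rect L T. (f z - smooth T \<eta> f z)\<^sup>2 \<le> \<eta> / 2 * (\<integral>s. (g (fst z, s))\<^sup>2 \<partial>seg T)"
proof -
  note [measurable] = sq_int_rect_borel[OF f] sq_int_rect_borel[OF g]
  have sl: "AE x in seg L. sq_int (seg T) (\<lambda>t. g (x, t)) \<and> integrable (seg T) (\<lambda>t. f (x, t)) \<and>
      (AE t in seg T. f (x, t) = prim T (\<lambda>s. g (x, s)) t)"
    using sq_int_slices(1)[OF g] sq_int_slices(1)[OF f] trep_slice[OF rep]
    by eventually_elim (auto intro: sq_int_integrable[OF finite_measure_seg])
  have "AE x in seg L. AE t in seg T. smooth T \<eta> f (x, t) = prim T (\<lambda>s. smooth T \<eta> g (x, s)) t"
    using sl by eventually_elim (use tavg_prim(1)[OF sq_int_integrable[OF finite_measure_seg] \<eta>] in \<open>auto simp: smooth_def\<close>)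
  then show "trep L T (smooth T \<eta> f) (smooth T \<eta> g)"
    unfolding trep_def by (intro AE_seg_pairI1) (simp_all add: borel_prod[symmetric])
  have "AE x in seg L. AE t in seg T. smooth T \<eta> g (x, t) = (f (x, t) - smooth T \<eta> f (x, t)) / \<eta>"
    using sl by eventually_elim (use tavg_prim(2)[OF sq_int_integrable[OF finite_measure_seg] \<eta>] in \<open>auto simp: smooth_def\<close>)
  then show "AE z in rect L T. smooth T \<eta> g z = (f z - smooth T \<eta> f z) / \<eta>"
    by (intro AE_seg_pairI1) (simp_all add: borel_prod[symmetric])
  have "AE x in seg L. AE t in seg T. (f (x, t) - smooth T \<eta> f (x, t))\<^sup>2 \<le> \<eta> / 2 * (\<integral>s. (g (x, s))\<^sup>2 \<partial>seg T)"
    using sl by eventually_elim (use tavg_close[OF _ \<eta>] in \<open>auto simp: smooth_def\<close>)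
  then show "AE z in rect L T. (f z - smooth T \<eta> f z)\<^sup>2 \<le> \<eta> / 2 * (\<integral>s. (g (fst z, s))\<^sup>2 \<partial>seg T)"
    by (intro AE_seg_pairI1) (simp_all add: borel_prod[symmetric])
qed

text \<open>No regularity of \<open>f\<close> in time enters: the defining equation of the average
  supplies its derivative. The case in view is \<open>ux\<close>.\<close>

lemma smooth_rate:
  assumes f: "sq_int (rect L T) f" and \<eta>: "\<eta> > 0"
  shows "trep L T (smooth T \<eta> f) (\<lambda>z. (f z - smooth T \<eta> f z) / \<eta>)"
proof -
  note [measurable] = sq_int_rect_borel[OF f]
  have "AE x in seg L. AE t in seg T. smooth T \<eta> f (x, t) = prim T (\<lambda>s. (f (x, s) - smooth T \<eta> f (x, s)) / \<eta>) t"
    using sq_int_slices(1)[OF f]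
  proof eventually_elim
    case (elim x)
    show ?case
      using AE_seg_mem
      by eventually_elim (use tavg_ode[OF sq_int_integrable[OF finite_measure_seg elim] \<eta>] in \<open>auto simp: smooth_def\<close>)
  qed
  then show ?thesis
    unfolding trep_def by (intro AE_seg_pairI1) (simp_all add: borel_prod[symmetric])
qed

text \<open>The product rule in t holds for almost every x; Fubini moves the x-integral inside the
  primitive. This replaces differentiation of the energy in time.\<close>

lemma time_energy:
  assumes F: "sq_int (rect L T) F" "sq_int (rect L T) Ft" "trep L T F Ft"
    and G: "sq_int (rect L T) G" "sq_int (rect L T) Gt" "trep L T G Gt"
  shows "AE t in seg T. (\<integral>x. F (x, t) * G (x, t) \<partial>seg L) =
    prim T (\<lambda>s. (\<integral>x. Ft (x, s) * G (x, s) \<partial>seg L) + (\<integral>x. F (x, s) * Gt (x, s) \<partial>seg L)) t"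
proof -
  note [measurable] = sq_int_rect_borel[OF F(1)] sq_int_rect_borel[OF F(2)] sq_int_rect_borel[OF G(1)] sq_int_rect_borel[OF G(2)]
  define H where "H z = Ft z * G z + F z * Gt z" for z
  have [measurable]: "H \<in> borel_measurable (borel \<Otimes>\<^sub>M borel)" unfolding H_def by measurable
  have Hi: "integrable (rect L T) H" unfolding H_def using sq_int_mult[OF F(2) G(1)] sq_int_mult[OF F(1) G(2)] by simp
  have "AE x in seg L. AE t in seg T. F (x, t) * G (x, t) = prim T (\<lambda>s. H (x, s)) t"
    using sq_int_slices(1)[OF F(2)] sq_int_slices(1)[OF G(2)] trep_slice[OF F(3)] trep_slice[OF G(3)]
      integrable_rect_slices(1)[OF Hi]
  proof eventually_elim
    case (elim x)
    note i = sq_int_integrable[OF finite_measure_seg elim(1)] sq_int_integrable[OF finite_measure_seg elim(2)]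
    show ?case
      using elim(3,4)
    proof eventually_elim
      case (elim t)
      have "F (x, t) * G (x, t) = prim T (\<lambda>s. Ft (x, s) * prim T (\<lambda>s. Gt (x, s)) s + prim T (\<lambda>s. Ft (x, s)) s * Gt (x, s)) t"
        unfolding elim by (rule prim_mult(1)[OF i])
      also have "\<dots> = prim T (\<lambda>s. H (x, s)) t"
      proof (rule prim_cong_AE')
        show "AE s in seg T. Ft (x, s) * prim T (\<lambda>s. Gt (x, s)) s + prim T (\<lambda>s. Ft (x, s)) s * Gt (x, s) = H (x, s)"
          using \<open>AE t in seg T. F (x, t) = prim T (\<lambda>s. Ft (x, s)) t\<close> \<open>AE t in seg T. G (x, t) = prim T (\<lambda>s. Gt (x, s)) t\<close>
          by eventually_elim (simp add: H_def)
        show "integrable (seg T) (\<lambda>s. H (x, s))" by fact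
      qed (use prim_mult(2,3)[OF i] in simp)
      finally show ?case .
    qed
  qed
  then have "AE z in rect L T. F z * G z = prim T (\<lambda>s. H (fst z, s)) (snd z)"
    by (intro AE_seg_pairI1) (simp_all add: borel_prod[symmetric])
  from AE_seg_slice2[OF this]
  have A: "AE t in seg T. AE x in seg L. F (x, t) * G (x, t) = prim T (\<lambda>s. H (x, s)) t" by simp
  have B: "AE s in seg T. (\<integral>x. H (x, s) \<partial>seg L) = (\<integral>x. Ft (x, s) * G (x, s) \<partial>seg L) + (\<integral>x. F (x, s) * Gt (x, s) \<partial>seg L)"
    using integrable_rect_slices(2)[OF sq_int_mult[OF F(2) G(1)]] integrable_rect_slices(2)[OF sq_int_mult[OF F(1) G(2)]]
    by eventually_elim (simp add: H_def)
  have i: "integrable (seg T) (\<lambda>s. (\<integral>x. Ft (x, s) * G (x, s) \<partial>seg L) + (\<integral>x. F (x, s) * Gt (x, s) \<partial>seg L))"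
    using integrable_rect_slices(4)[OF sq_int_mult[OF F(2) G(1)]] integrable_rect_slices(4)[OF sq_int_mult[OF F(1) G(2)]] by simp
  show ?thesis
    using A
  proof eventually_elim
    case (elim t)
    have "(\<integral>x. F (x, t) * G (x, t) \<partial>seg L) = (\<integral>x. prim T (\<lambda>s. H (x, s)) t \<partial>seg L)"
      by (rule integral_cong_AE) (use elim in measurable)
    also have "\<dots> = prim T (\<lambda>s. \<integral>x. H (x, s) \<partial>seg L) t" by (rule integral_prim_swap(1)[OF Hi])
    also have "\<dots> = prim T (\<lambda>s. (\<integral>x. Ft (x, s) * G (x, s) \<partial>seg L) + (\<integral>x. F (x, s) * Gt (x, s) \<partial>seg L)) t"
      by (rule prim_cong_AE'[OF integrable_rect_slices(4)[OF Hi] i B])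
    finally show ?case .
  qed
qed

section \<open>A priori estimates\<close>

lemma prim_le_of_AE:
  assumes f: "integrable (seg T) f" and T: "T > 0" and le: "AE t in seg T. prim T f t \<le> B"
  shows "integral\<^sup>L (seg T) f \<le> B"
proof -
  have "max (prim T f T) B = B"
  proof (rule AE_eq_continuous_imp_eq[where f = "\<lambda>t. max (prim T f t) B" and g = "\<lambda>_. B"])
    show "AE t in seg T. max (prim T f t) B = B" using le by eventually_elim simp
    show "continuous_on {0..T} (\<lambda>t. max (prim T f t) B)"
      by (intro continuous_intros continuous_on_subset[OF continuous_prim[OF f]]) auto
  qed (use T in auto)
  moreover have "prim T f T = integral\<^sup>L (seg T) f" by (rule prim_ge) (use seg_borel[OF f] in auto)
  ultimately show ?thesis by simp
qed

text \<open>The map S \<mapsto> S / 2 + 4 R has the fixed point 8 R and halves the distance to it,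
  so any finite initial bound, however poor, improves to 8 R.\<close>

lemma absorb_half:
  fixes N :: "real \<Rightarrow> real"
  assumes step: "\<And>S. S \<ge> 0 \<Longrightarrow> AE t in M. N t \<le> S \<Longrightarrow> AE t in M. N t \<le> S / 2 + 4 * R"
    and start: "AE t in M. N t \<le> S0" "S0 \<ge> 0" and R: "R \<ge> 0"
  shows "AE t in M. N t \<le> 8 * R"
proof -
  have "AE t in M. N t \<le> 8 * R + S0 / 2 ^ n" for n
  proof (induction n)
    case 0
    show ?case using start R by (auto elim!: eventually_mono)
  next
    case (Suc n)
    have "AE t in M. N t \<le> (8 * R + S0 / 2 ^ n) / 2 + 4 * R"
      by (rule step[OF _ Suc]) (use R start in simp)
    then show ?case by eventually_elim (simp add: field_simps)
  qed
  then have "AE t in M. \<forall>n. N t \<le> 8 * R + S0 / 2 ^ n" unfolding AE_all_countable by blast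
  then show ?thesis
  proof eventually_elim
    case (elim t)
    have "(\<lambda>n. 8 * R + S0 * (1 / 2) ^ n) \<longlonglongrightarrow> 8 * R + S0 * 0"
      by (intro tendsto_intros LIMSEQ_power_zero) simp
    then show ?case
      by (intro LIMSEQ_le_const[where X = "\<lambda>n. 8 * R + S0 * (1 / 2) ^ n"])
        (use elim in \<open>auto simp: power_divide\<close>)
  qed
qed

text \<open>The coefficient with which \<open>\<epsilon>\<^sup>2 * p\<^sup>2\<close> enters the
  right-hand side of \<open>energy\<close>.\<close>

definition energy_const :: "real \<Rightarrow> real \<Rightarrow> real \<Rightarrow> real \<Rightarrow> real" where
  "energy_const \<mu> Ub c1 \<gamma> = c1 * (1 / 4 + 2 / (\<gamma> * Ub\<^sup>2)) +
    \<gamma> * (2 / (Ub ^ 3 * \<mu>) + 2 * c1 + 8 * c1 / Ub\<^sup>2 + c1 / (2 * Ub\<^sup>2 * \<mu>\<^sup>2) + c1 / 4)"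

text \<open>The setting of \<open>energy_slice\<close> over the whole time interval, but without
  u_xt and without an x-derivative of u_t, which the solution class does not supply. The
  \<open>trep\<close> assumptions encode the zero initial values.\<close>

locale evolution =
  fixes L T \<mu> Ub \<epsilon> c1 \<gamma> Q0 :: real and p a b q q' Qh :: "real \<Rightarrow> real"
    and u ux uxx ut v vx vxx vt vxt k :: "real \<times> real \<Rightarrow> real"
  assumes pos: "L > 0" "T > 0" "\<mu> > 0" "Ub > 0" "0 < \<epsilon>" "\<epsilon> \<le> 1" "c1 \<ge> 0"
    and \<gamma>: "\<gamma> > 0" "\<gamma> \<le> \<mu> / 2"
      "\<gamma> * (2 / (Ub * \<mu>) * (1 / L + 8 / (Ub * \<mu>)) + 1 / \<mu> + 1 / 2 + Ub\<^sup>2 / 4) \<le> 1 / 2"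
    and sq: "sq_int (rect L T) u" "sq_int (rect L T) ux" "sq_int (rect L T) uxx" "sq_int (rect L T) ut"
      "sq_int (rect L T) v" "sq_int (rect L T) vx" "sq_int (rect L T) vxx" "sq_int (rect L T) vt"
      "sq_int (rect L T) vxt" "sq_int (rect L T) k"
    and sqt: "sq_int (seg T) p" "integrable (seg T) a" "integrable (seg T) b"
    and sqx: "sq_int (seg L) q" "sq_int (seg L) q'" "sq_int (seg L) Qh"
    and rep_u: "xrep L T u (\<lambda>_. 0) ux" "AE t in seg T. (\<integral>x. ux (x, t) \<partial>seg L) = 0"
    and rep_ux: "xrep L T ux a uxx"
    and rep_v: "xrep L T v (\<lambda>_. 0) vx"
    and rep_vx: "xrep L T vx b vxx"
    and rep_vt: "xrep L T vt (\<lambda>_. 0) vxt"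
    and trep: "trep L T u ut" "trep L T v vt" "trep L T vx vxt"
    and rep_q: "AE x in seg L. q x = 1 + prim L q' x"
    and rep_Qh: "AE x in seg L. Qh x = Q0 + prim L (\<lambda>y. - q y) x" "Q0 = integral\<^sup>L (seg L) q"
    and layer: "(\<integral>x. (q x)\<^sup>2 \<partial>seg L) \<le> c1 * \<epsilon>" "(\<integral>x. (\<epsilon> * q' x)\<^sup>2 \<partial>seg L) \<le> c1 * \<epsilon>" "(\<integral>x. (Qh x)\<^sup>2 \<partial>seg L) \<le> c1 * \<epsilon> ^ 3"
    and eq1: "AE z in rect L T. ut z + Ub * ux z + vx z - 2 * \<epsilon> * uxx z = 2 * \<epsilon> * k z + q (fst z) * p (snd z)"
    and eq2: "AE z in rect L T. \<mu> * vt z + Ub * \<mu> * vx z + ux z = - (q (fst z) * p (snd z) / Ub)"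
begin

text \<open>The sources over the whole cylinder. The term \<open>8 * T\<close> is the price of
  absorbing 2 \<epsilon> \<integral> k u in \<open>energy_bound\<close>. Averaging does not increase
  norms, so \<eta> does not occur.\<close>

definition R :: real where
  "R = \<epsilon>\<^sup>2 * (energy_const \<mu> Ub c1 \<gamma> * (\<integral>t. (p t)\<^sup>2 \<partial>seg T) + (5 * \<gamma> + 8 * T) * (\<integral>z. (k z)\<^sup>2 \<partial>rect L T))"

lemma energy_const_nonneg: "energy_const \<mu> Ub c1 \<gamma> \<ge> 0"
  unfolding energy_const_def using pos \<gamma> by (intro add_nonneg_nonneg mult_nonneg_nonneg) auto

lemma R_nonneg: "R \<ge> 0"
  unfolding R_def using energy_const_nonneg pos \<gamma> by (intro mult_nonneg_nonneg add_nonneg_nonneg) auto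

context
  fixes \<eta> :: real
  assumes \<eta>: "\<eta> > 0"
begin

abbreviation (input) "s \<equiv> smooth T \<eta>"

text \<open>The time derivative of the averaged u_x by \<open>smooth_rate\<close>. It serves at the
  same time as the x-derivative of the averaged u_t.\<close>

definition "uxt = (\<lambda>z. (ux z - smooth T \<eta> ux z) / \<eta>)"

lemmas sm = sq_int_smooth(1)[OF sq(1) \<eta> pos(2)] sq_int_smooth(1)[OF sq(2) \<eta> pos(2)] sq_int_smooth(1)[OF sq(3) \<eta> pos(2)]
  sq_int_smooth(1)[OF sq(4) \<eta> pos(2)] sq_int_smooth(1)[OF sq(5) \<eta> pos(2)] sq_int_smooth(1)[OF sq(6) \<eta> pos(2)]
  sq_int_smooth(1)[OF sq(7) \<eta> pos(2)] sq_int_smooth(1)[OF sq(8) \<eta> pos(2)] sq_int_smooth(1)[OF sq(9) \<eta> pos(2)]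
  sq_int_smooth(1)[OF sq(10) \<eta> pos(2)]

lemma sq_uxt: "sq_int (rect L T) uxt"
  unfolding uxt_def using sq_int_cmult[OF sq_int_diff[OF sq(2) sm(2)], of "1 / \<eta>"] by simp

lemma p_int: "integrable (seg T) p" by (rule sq_int_integrable[OF finite_measure_seg sqt(1)])

lemma tavg_0: "tavg T \<eta> (\<lambda>_. 0) t = 0" by (simp add: tavg_def prim_def)

lemma smooth_linear:
  assumes F: "sq_int (rect L T) F1" "sq_int (rect L T) F2" "sq_int (rect L T) F3" "sq_int (rect L T) F4" "sq_int (rect L T) F5"
    and eq: "AE z in rect L T. c1' * F1 z + c2 * F2 z + c3 * F3 z + c4 * F4 z + c5 * F5 z = c6 * (q (fst z) * p (snd z))"
  shows "AE z in rect L T. c1' * s F1 z + c2 * s F2 z + c3 * s F3 z + c4 * s F4 z + c5 * s F5 z = c6 * (q (fst z) * tavg T \<eta> p (snd z))"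
proof -
  note [measurable] = sq_int_rect_borel[OF F(1)] sq_int_rect_borel[OF F(2)] sq_int_rect_borel[OF F(3)] sq_int_rect_borel[OF F(4)] sq_int_rect_borel[OF F(5)]
    seg_borel[OF p_int] seg_borel[OF sq_int_integrable[OF finite_measure_seg sqx(1)]]
  have "AE x in seg L. AE t in seg T. c1' * F1 (x, t) + c2 * F2 (x, t) + c3 * F3 (x, t) + c4 * F4 (x, t) + c5 * F5 (x, t) = c6 * (q x * p t)"
    using AE_seg_slice1[OF eq] by simp
  then have "AE x in seg L. AE t in seg T. c1' * s F1 (x, t) + c2 * s F2 (x, t) + c3 * s F3 (x, t) + c4 * s F4 (x, t) + c5 * s F5 (x, t) = c6 * (q x * tavg T \<eta> p t)"
    using integrable_rect_slices(1)[OF sq_int_rect_integrable[OF F(1)]] integrable_rect_slices(1)[OF sq_int_rect_integrable[OF F(2)]]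
      integrable_rect_slices(1)[OF sq_int_rect_integrable[OF F(3)]] integrable_rect_slices(1)[OF sq_int_rect_integrable[OF F(4)]]
      integrable_rect_slices(1)[OF sq_int_rect_integrable[OF F(5)]]
  proof eventually_elim
    case (elim x)
    show ?case
    proof (rule AE_I2)
      fix t
      have "c1' * s F1 (x, t) + c2 * s F2 (x, t) + c3 * s F3 (x, t) + c4 * s F4 (x, t) + c5 * s F5 (x, t) =
        tavg T \<eta> (\<lambda>t. c1' * F1 (x, t) + c2 * F2 (x, t) + c3 * F3 (x, t) + c4 * F4 (x, t) + c5 * F5 (x, t)) t"
        unfolding smooth_def fst_conv snd_conv using elim(2-6) by (simp add: tavg_add[OF _ _ \<eta>] tavg_cmult)
      also have "\<dots> = tavg T \<eta> (\<lambda>t. c6 * (q x * p t)) t"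
        by (rule tavg_cong_AE) (use elim(1) in measurable)
      finally show "c1' * s F1 (x, t) + c2 * s F2 (x, t) + c3 * s F3 (x, t) + c4 * s F4 (x, t) + c5 * s F5 (x, t) = c6 * (q x * tavg T \<eta> p t)"
        by (simp add: tavg_cmult)
    qed
  qed
  then show ?thesis
    by (intro AE_seg_pairI1) (simp_all add: borel_prod[symmetric])
qed

text \<open>Averaging in time acts on each ingredient separately: it commutes with x-primitives, and
  in the layer term it falls on \<open>p\<close> alone, since \<open>q\<close> depends on x
  only.\<close>

lemma slice:
  "AE t in seg T. energy_slice L \<mu> Ub \<epsilon> c1 (tavg T \<eta> p t) (tavg T \<eta> a t) (tavg T \<eta> b t) Q0 q q' Qh
    (\<lambda>x. s u (x, t)) (\<lambda>x. s ux (x, t)) (\<lambda>x. s uxx (x, t)) (\<lambda>x. s ut (x, t)) (\<lambda>x. uxt (x, t))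
    (\<lambda>x. s v (x, t)) (\<lambda>x. s vx (x, t)) (\<lambda>x. s vxx (x, t)) (\<lambda>x. s vt (x, t)) (\<lambda>x. s vxt (x, t)) (\<lambda>x. s k (x, t))"
proof -
  have 1: "AE t in seg T. AE x in seg L. s u (x, t) = prim L (\<lambda>y. s ux (y, t)) x"
    using xrep_slice[OF smooth_xrep[OF rep_u(1) sq(2) _ sq(1) \<eta>]] by (simp add: tavg_0)
  have 2: "AE t in seg T. AE x in seg L. s ux (x, t) = tavg T \<eta> a t + prim L (\<lambda>y. s uxx (y, t)) x"
    by (rule xrep_slice[OF smooth_xrep[OF rep_ux sq(3) sqt(2) sq(2) \<eta>]])
  have 3: "AE t in seg T. AE x in seg L. s v (x, t) = prim L (\<lambda>y. s vx (y, t)) x"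
    using xrep_slice[OF smooth_xrep[OF rep_v sq(6) _ sq(5) \<eta>]] by (simp add: tavg_0)
  have 4: "AE t in seg T. AE x in seg L. s vx (x, t) = tavg T \<eta> b t + prim L (\<lambda>y. s vxx (y, t)) x"
    by (rule xrep_slice[OF smooth_xrep[OF rep_vx sq(7) sqt(3) sq(6) \<eta>]])
  have 5: "AE t in seg T. AE x in seg L. s vt (x, t) = prim L (\<lambda>y. s vxt (y, t)) x"
    using xrep_slice[OF smooth_xrep[OF rep_vt sq(9) _ sq(8) \<eta>]] by (simp add: tavg_0)
  have 6: "AE t in seg T. AE x in seg L. s ut (x, t) = (u (x, t) - s u (x, t)) / \<eta>"
    using AE_seg_slice2[OF smooth_trep(2)[OF trep(1) sq(1) sq(4) \<eta>]] by simp
  have 7: "AE t in seg T. AE x in seg L. u (x, t) = prim L (\<lambda>y. ux (y, t)) x"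
    using xrep_slice[OF rep_u(1)] by simp
  have 8: "(\<integral>x. s ux (x, t) \<partial>seg L) = 0" for t by (rule smooth_int0[OF rep_u(2) sq(2) \<eta>])
  have e1: "AE z in rect L T. 1 * s ut z + Ub * s ux z + 1 * s vx z + (- 2 * \<epsilon>) * s uxx z + (- 2 * \<epsilon>) * s k z = 1 * (q (fst z) * tavg T \<eta> p (snd z))"
    by (rule smooth_linear[OF sq(4) sq(2) sq(6) sq(3) sq(10)]) (use eq1 in \<open>auto elim!: eventually_mono\<close>)
  have e2: "AE z in rect L T. \<mu> * s vt z + (Ub * \<mu>) * s vx z + 1 * s ux z + 0 * s ux z + 0 * s ux z = (- 1 / Ub) * (q (fst z) * tavg T \<eta> p (snd z))"
    by (rule smooth_linear[OF sq(8) sq(6) sq(2) sq(2) sq(2)]) (use eq2 in \<open>auto elim!: eventually_mono\<close>)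
  show ?thesis
    using 1 2 3 4 5 6 7 AE_seg_slice2[OF e1] AE_seg_slice2[OF e2] rep_u(2)
      sq_int_slices(2)[OF sm(1)] sq_int_slices(2)[OF sm(2)] sq_int_slices(2)[OF sm(3)] sq_int_slices(2)[OF sm(4)]
      sq_int_slices(2)[OF sm(5)] sq_int_slices(2)[OF sm(6)] sq_int_slices(2)[OF sm(7)] sq_int_slices(2)[OF sm(8)]
      sq_int_slices(2)[OF sm(9)] sq_int_slices(2)[OF sm(10)] sq_int_slices(2)[OF sq_uxt] sq_int_slices(2)[OF sq(2)]
  proof eventually_elim
    case (elim t)
    have i: "integrable (seg L) (\<lambda>x. ux (x, t))" "integrable (seg L) (\<lambda>x. s ux (x, t))"
      by (rule sq_int_integrable[OF finite_measure_seg], fact)+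
    show ?case
    proof
      have uxt_eq: "(\<lambda>x. uxt (x, t)) = (\<lambda>x. inverse \<eta> * (ux (x, t) - s ux (x, t)))"
        by (auto simp: uxt_def divide_inverse mult.commute)
      \<comment> \<open>The average of u_t is (u - average of u) / \<eta>, and both functions in the
        bracket are primitives in x of known densities.\<close>
      show "AE x in seg L. s ut (x, t) = prim L (\<lambda>x. uxt (x, t)) x"
        using elim(1,6,7) by eventually_elim
          (simp add: uxt_eq prim_cmult prim_diff[OF i] divide_inverse mult.commute)
      show "(\<integral>x. uxt (x, t) \<partial>seg L) = 0"
        unfolding uxt_eq using i elim(10) 8 by simp
      show "AE x in seg L. s ut (x, t) + Ub * s ux (x, t) + s vx (x, t) - 2 * \<epsilon> * s uxx (x, t) = 2 * \<epsilon> * s k (x, t) + q x * tavg T \<eta> p t"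
        using elim(8) by eventually_elim simp
      show "AE x in seg L. \<mu> * s vt (x, t) + Ub * \<mu> * s vx (x, t) + s ux (x, t) = - (q x * tavg T \<eta> p t / Ub)"
        using elim(9) by eventually_elim simp
    qed (rule pos sqx rep_q rep_Qh layer 8 elim)+
  qed
qed


text \<open>\<open>S\<close> is a provisional bound. It is used only to control the source 2
  \<epsilon> \<integral> k u, so it returns with the small factor 1/8 and can be absorbed.\<close>

lemma energy_bound:
  assumes S: "S \<ge> 0" "AE t in seg T. (\<integral>x. (s u (x, t))\<^sup>2 \<partial>seg L) \<le> S"
  shows "AE t in seg T. 1 / 4 * (\<integral>x. (s u (x, t))\<^sup>2 \<partial>seg L) + \<mu> / 2 * (\<integral>x. (s v (x, t))\<^sup>2 \<partial>seg L)
      + \<gamma> * \<mu> / 2 * \<epsilon>\<^sup>2 * (\<integral>x. (s vx (x, t))\<^sup>2 \<partial>seg L) + \<gamma> / 8 * \<epsilon>\<^sup>2 * (\<integral>x. (s ux (x, t))\<^sup>2 \<partial>seg L)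
      + \<epsilon> * prim T (\<lambda>t. 1 / 2 * (\<integral>x. (s ux (x, t))\<^sup>2 \<partial>seg L) + \<gamma> / 8 * (\<integral>x. (s vx (x, t))\<^sup>2 \<partial>seg L)) t
      \<le> S / 8 + R"
proof -
  define N where "N t = (\<integral>x. (s u (x, t))\<^sup>2 \<partial>seg L)" for t
  define V where "V t = (\<integral>x. (s v (x, t))\<^sup>2 \<partial>seg L)" for t
  define X where "X t = (\<integral>x. (s ux (x, t))\<^sup>2 \<partial>seg L)" for t
  define Y where "Y t = (\<integral>x. (s vx (x, t))\<^sup>2 \<partial>seg L)" for t
  define K where "K t = (\<integral>x. (s k (x, t))\<^sup>2 \<partial>seg L)" for t
  define W where "W t = (\<integral>x. s k (x, t) * s u (x, t) \<partial>seg L)" for t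
  define UV where "UV t = (\<integral>x. s u (x, t) * s vx (x, t) \<partial>seg L)" for t
  define a1 where "a1 t = (\<integral>x. s u (x, t) * s ut (x, t) \<partial>seg L)" for t
  define a2 where "a2 t = (\<integral>x. s v (x, t) * s vt (x, t) \<partial>seg L)" for t
  define a3 where "a3 t = (\<integral>x. s vx (x, t) * s vxt (x, t) \<partial>seg L)" for t
  define a4 where "a4 t = (\<integral>x. s ut (x, t) * s vx (x, t) \<partial>seg L)" for t
  define a5 where "a5 t = (\<integral>x. s u (x, t) * s vxt (x, t) \<partial>seg L)" for t
  define a6 where "a6 t = (\<integral>x. s ux (x, t) * uxt (x, t) \<partial>seg L)" for t
  define Ce where "Ce = energy_const \<mu> Ub c1 \<gamma>"
  note mi = integrable_rect_slices(4)[OF sq_int_mult]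
  note si = integrable_rect_slices(4)[OF sq_int_square]
  have i: "integrable (seg T) N" "integrable (seg T) V" "integrable (seg T) X" "integrable (seg T) Y" "integrable (seg T) K"
    "integrable (seg T) W" "integrable (seg T) UV" "integrable (seg T) a1" "integrable (seg T) a2" "integrable (seg T) a3"
    "integrable (seg T) a4" "integrable (seg T) a5" "integrable (seg T) a6"
    unfolding N_def[abs_def] V_def[abs_def] X_def[abs_def] Y_def[abs_def] K_def[abs_def] W_def[abs_def] UV_def[abs_def]
      a1_def[abs_def] a2_def[abs_def] a3_def[abs_def] a4_def[abs_def] a5_def[abs_def] a6_def[abs_def]
    by (intro mi si sm sq_uxt)+
  have pi: "integrable (seg T) (\<lambda>t. (tavg T \<eta> p t)\<^sup>2)"
    by (rule sq_int_square[OF sq_int_tavg[OF p_int \<eta>]])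
  have te: "AE t in seg T. N t = 2 * prim T a1 t" "AE t in seg T. V t = 2 * prim T a2 t"
    "AE t in seg T. Y t = 2 * prim T a3 t" "AE t in seg T. UV t = prim T a4 t + prim T a5 t" "AE t in seg T. X t = 2 * prim T a6 t"
  proof -
    have dbl: "AE t in seg T. (\<integral>x. (F (x, t))\<^sup>2 \<partial>seg L) = 2 * prim T (\<lambda>t. \<integral>x. F (x, t) * Ft (x, t) \<partial>seg L) t"
      if "sq_int (rect L T) F" "sq_int (rect L T) Ft" "trep L T F Ft" for F Ft
      using time_energy[OF that that]
    proof eventually_elim
      case (elim t)
      have "prim T (\<lambda>s. (\<integral>x. Ft (x, s) * F (x, s) \<partial>seg L) + (\<integral>x. F (x, s) * Ft (x, s) \<partial>seg L)) t
        = prim T (\<lambda>s. 2 * (\<integral>x. F (x, s) * Ft (x, s) \<partial>seg L)) t"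
        by (simp add: mult.commute)
      also have "\<dots> = 2 * prim T (\<lambda>s. \<integral>x. F (x, s) * Ft (x, s) \<partial>seg L) t" by (rule prim_cmult)
      finally show ?case using elim by (simp add: power2_eq_square)
    qed
    note tr = smooth_trep(1)[OF trep(1) sq(1) sq(4) \<eta>] smooth_trep(1)[OF trep(2) sq(5) sq(8) \<eta>] smooth_trep(1)[OF trep(3) sq(6) sq(9) \<eta>]
    show "AE t in seg T. N t = 2 * prim T a1 t" "AE t in seg T. V t = 2 * prim T a2 t" "AE t in seg T. Y t = 2 * prim T a3 t"
      using dbl[OF sm(1) sm(4) tr(1)] dbl[OF sm(5) sm(8) tr(2)] dbl[OF sm(6) sm(9) tr(3)]
      by (simp_all add: N_def V_def Y_def a1_def[abs_def] a2_def[abs_def] a3_def[abs_def])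
    show "AE t in seg T. X t = 2 * prim T a6 t"
      using dbl[OF sm(2) sq_uxt] smooth_rate[OF sq(2) \<eta>] by (simp add: X_def a6_def[abs_def] uxt_def[symmetric])
    have "AE t in seg T. UV t = prim T (\<lambda>s. a4 s + a5 s) t"
      using time_energy[OF sm(1) sm(4) tr(1) sm(6) sm(9) tr(3)] by (simp add: UV_def a4_def a5_def)
    then show "AE t in seg T. UV t = prim T a4 t + prim T a5 t" using i by (simp add: prim_add)
  qed
  let ?G = "\<lambda>t. a1 t + \<mu> * a2 t + \<gamma> * \<epsilon> * (2 * \<epsilon> * \<mu> * a3 t + a4 t + a5 t) + \<gamma> / 4 * \<epsilon>\<^sup>2 * a6 t + \<epsilon> * (1 / 2 * X t + \<gamma> / 8 * Y t)"
  \<comment> \<open>The weight 1 / (8 T) is chosen so that integrating N \<le> S over an interval of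
    length T costs S / 8.\<close>
  let ?H = "\<lambda>t. 1 / (8 * T) * N t + Ce * \<epsilon>\<^sup>2 * (tavg T \<eta> p t)\<^sup>2 + (5 * \<gamma> + 8 * T) * \<epsilon>\<^sup>2 * K t"
  have GH: "AE t in seg T. ?G t \<le> ?H t"
    using slice sq_int_slices(2)[OF sm(1)] sq_int_slices(2)[OF sm(10)]
  proof eventually_elim
    case (elim t)
    have Tpos: "T > 0" by (rule pos)
    interpret energy_slice L \<mu> Ub \<epsilon> c1 "tavg T \<eta> p t" "tavg T \<eta> a t" "tavg T \<eta> b t" Q0 q q' Qh
      "\<lambda>x. s u (x, t)" "\<lambda>x. s ux (x, t)" "\<lambda>x. s uxx (x, t)" "\<lambda>x. s ut (x, t)" "\<lambda>x. uxt (x, t)"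
      "\<lambda>x. s v (x, t)" "\<lambda>x. s vx (x, t)" "\<lambda>x. s vxx (x, t)" "\<lambda>x. s vt (x, t)" "\<lambda>x. s vxt (x, t)" "\<lambda>x. s k (x, t)"
      by fact
    have "?G t \<le> 2 * \<epsilon> * W t + Ce * (\<epsilon>\<^sup>2 * (tavg T \<eta> p t)\<^sup>2) + 5 * \<gamma> * \<epsilon>\<^sup>2 * K t"
      using energy[OF \<gamma>(1,3)] unfolding a1_def a2_def a3_def a4_def a5_def a6_def X_def Y_def W_def K_def Ce_def energy_const_def .
    moreover have "2 * \<epsilon> * W t \<le> 1 / (8 * T) * N t + 8 * T * \<epsilon>\<^sup>2 * K t"
    proof -
      have "2 * \<epsilon> * W t = (\<integral>x. 2 * \<epsilon> * (s k (x, t) * s u (x, t)) \<partial>seg L)" by (simp add: W_def)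
      also have "\<dots> \<le> (\<integral>x. 1 / (8 * T) * (s u (x, t))\<^sup>2 + 8 * T * \<epsilon>\<^sup>2 * (s k (x, t))\<^sup>2 \<partial>seg L)"
      proof (rule integral_mono)
        fix x
        have "2 * \<epsilon> * (s k (x, t) * s u (x, t)) = s u (x, t) * (2 * \<epsilon> * s k (x, t))" by simp
        also have "\<dots> \<le> 1 / (8 * T) * (s u (x, t))\<^sup>2 + (2 * \<epsilon> * s k (x, t))\<^sup>2 / (4 * (1 / (8 * T)))"
          by (rule Young_mult) (use Tpos in simp)
        also have "(2 * \<epsilon> * s k (x, t))\<^sup>2 / (4 * (1 / (8 * T))) = 8 * T * \<epsilon>\<^sup>2 * (s k (x, t))\<^sup>2"
          using Tpos by (simp add: power_mult_distrib)
        finally show "2 * \<epsilon> * (s k (x, t) * s u (x, t)) \<le> 1 / (8 * T) * (s u (x, t))\<^sup>2 + 8 * T * \<epsilon>\<^sup>2 * (s k (x, t))\<^sup>2" .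
      qed (use sq_int_square[OF elim(2)] sq_int_square[OF elim(3)] sq_int_mult[OF elim(3) elim(2)] in simp_all)
      also have "\<dots> = 1 / (8 * T) * N t + 8 * T * \<epsilon>\<^sup>2 * K t"
        unfolding N_def K_def using sq_int_square[OF elim(2)] sq_int_square[OF elim(3)] by simp
      finally show ?thesis .
    qed
    ultimately show ?case by (simp add: algebra_simps)
  qed
  have Gi: "integrable (seg T) ?G" and Hi: "integrable (seg T) ?H" using i pi by simp_all
  have Hle: "prim T ?H t \<le> S / 8 + R" for t
  proof -
    have nn: "0 \<le> ?H t" for t
      unfolding N_def K_def Ce_def using pos \<gamma> energy_const_nonneg by (intro add_nonneg_nonneg mult_nonneg_nonneg) auto
    have "prim T ?H t \<le> (\<integral>t. ?H t \<partial>seg T)"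
      using prim_abs_le[OF Hi, of t] by (simp only: abs_of_nonneg[OF nn])
    also have "\<dots> = 1 / (8 * T) * integral\<^sup>L (seg T) N + Ce * \<epsilon>\<^sup>2 * (\<integral>t. (tavg T \<eta> p t)\<^sup>2 \<partial>seg T) + (5 * \<gamma> + 8 * T) * \<epsilon>\<^sup>2 * integral\<^sup>L (seg T) K"
      using i pi by simp
    also have "\<dots> \<le> 1 / (8 * T) * (S * T) + Ce * \<epsilon>\<^sup>2 * (\<integral>t. (p t)\<^sup>2 \<partial>seg T) + (5 * \<gamma> + 8 * T) * \<epsilon>\<^sup>2 * (\<integral>z. (k z)\<^sup>2 \<partial>rect L T)"
    proof (intro add_mono mult_left_mono)
      have "integral\<^sup>L (seg T) N \<le> (\<integral>t. S \<partial>seg T)"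
        by (rule integral_mono_AE) (use i S in \<open>auto simp: N_def\<close>)
      then show "integral\<^sup>L (seg T) N \<le> S * T" using pos by (simp add: measure_seg mult.commute)
      show "(\<integral>t. (tavg T \<eta> p t)\<^sup>2 \<partial>seg T) \<le> (\<integral>t. (p t)\<^sup>2 \<partial>seg T)" by (rule tavg_norm_le[OF sqt(1) \<eta> pos(2)])
      have "integral\<^sup>L (seg T) K = (\<integral>z. (s k z)\<^sup>2 \<partial>rect L T)"
        unfolding K_def[abs_def] by (rule integrable_rect_slices(6)[OF sq_int_square[OF sm(10)]])
      then show "integral\<^sup>L (seg T) K \<le> (\<integral>z. (k z)\<^sup>2 \<partial>rect L T)"
        using sq_int_smooth(2)[OF sq(10) \<eta> pos(2)] by simp
    qed (use pos \<gamma> energy_const_nonneg in \<open>auto simp: Ce_def\<close>)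
    also have "\<dots> = S / 8 + R" using pos by (simp add: R_def Ce_def field_simps)
    finally show ?thesis .
  qed
  show ?thesis
    using te sq_int_slices(2)[OF sm(1)] sq_int_slices(2)[OF sm(6)]
  proof eventually_elim
    case (elim t)
    have "prim T ?G t = prim T a1 t + \<mu> * prim T a2 t + \<gamma> * \<epsilon> * (2 * \<epsilon> * \<mu> * prim T a3 t + prim T a4 t + prim T a5 t) + \<gamma> / 4 * \<epsilon>\<^sup>2 * prim T a6 t
      + \<epsilon> * prim T (\<lambda>t. 1 / 2 * X t + \<gamma> / 8 * Y t) t"
      using i by (simp add: prim_add prim_cmult del: times_divide_eq_left times_divide_eq_right)
    moreover have "prim T ?G t \<le> S / 8 + R"
      using prim_mono[OF Gi Hi GH, of t] Hle[of t] by linarith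
    ultimately have A: "1 / 2 * N t + \<mu> / 2 * V t + \<gamma> * \<epsilon> * (\<epsilon> * \<mu> * Y t + UV t) + \<gamma> / 8 * \<epsilon>\<^sup>2 * X t
      + \<epsilon> * prim T (\<lambda>t. 1 / 2 * X t + \<gamma> / 8 * Y t) t \<le> S / 8 + R"
      using elim(1-5) by (simp add: algebra_simps)
    \<comment> \<open>The energy contains the indefinite term \<gamma> \<epsilon> \<integral> u v_x.
      By \<gamma> \<le> \<mu> / 2 it is dominated by half of the u-part and half of the
      v_x-part.\<close>
    have B: "- (\<gamma> * \<epsilon> * UV t) \<le> 1 / 4 * N t + \<gamma> * \<mu> / 2 * \<epsilon>\<^sup>2 * Y t"
    proof -
      have "- (\<gamma> * \<epsilon> * UV t) = (\<integral>x. - (\<gamma> * \<epsilon>) * (s u (x, t) * s vx (x, t)) \<partial>seg L)" by (simp add: UV_def)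
      also have "\<dots> \<le> (\<integral>x. 1 / 4 * (s u (x, t))\<^sup>2 + \<gamma> * \<mu> / 2 * \<epsilon>\<^sup>2 * (s vx (x, t))\<^sup>2 \<partial>seg L)"
      proof (rule integral_mono)
        fix x
        have "- (\<gamma> * \<epsilon>) * (s u (x, t) * s vx (x, t)) = s u (x, t) * (- (\<gamma> * \<epsilon>) * s vx (x, t))" by simp
        also have "\<dots> \<le> 1 / 4 * (s u (x, t))\<^sup>2 + (- (\<gamma> * \<epsilon>) * s vx (x, t))\<^sup>2 / (4 * (1 / 4))"
          by (rule Young_mult) simp
        also have "(- (\<gamma> * \<epsilon>) * s vx (x, t))\<^sup>2 / (4 * (1 / 4)) = \<gamma> * \<gamma> * (\<epsilon>\<^sup>2 * (s vx (x, t))\<^sup>2)"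
          by (simp add: power_mult_distrib power2_eq_square)
        also have "\<dots> \<le> \<gamma> * (\<mu> / 2) * (\<epsilon>\<^sup>2 * (s vx (x, t))\<^sup>2)"
          using \<gamma> by (intro mult_right_mono mult_left_mono) auto
        finally show "- (\<gamma> * \<epsilon>) * (s u (x, t) * s vx (x, t)) \<le> 1 / 4 * (s u (x, t))\<^sup>2 + \<gamma> * \<mu> / 2 * \<epsilon>\<^sup>2 * (s vx (x, t))\<^sup>2"
          by (simp add: mult.assoc)
      qed (use sq_int_square[OF elim(6)] sq_int_square[OF elim(7)] sq_int_mult[OF elim(6) elim(7)] in simp_all)
      also have "\<dots> = 1 / 4 * N t + \<gamma> * \<mu> / 2 * \<epsilon>\<^sup>2 * Y t"
        unfolding N_def Y_def using sq_int_square[OF elim(6)] sq_int_square[OF elim(7)] by simp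
      finally show ?thesis .
    qed
    have "1 / 4 * N t + \<mu> / 2 * V t + \<gamma> * \<mu> / 2 * \<epsilon>\<^sup>2 * Y t + \<gamma> / 8 * \<epsilon>\<^sup>2 * X t
      + \<epsilon> * prim T (\<lambda>t. 1 / 2 * X t + \<gamma> / 8 * Y t) t \<le> S / 8 + R"
      using A B by (simp add: algebra_simps power2_eq_square)
    then show ?case unfolding N_def V_def X_def[abs_def] Y_def[abs_def] .
  qed
qed

text \<open>\<open>energy_bound\<close> gives N / 4 \<le> S / 8 + R, the hypothesis of
  \<open>absorb_half\<close>. Reinserting S = 8 R bounds each of the nonnegative terms on the left
  by 2 R, from which all six constants are read off.\<close>

lemma smooth_estimates:
  shows "AE t in seg T. (\<integral>x. (s u (x, t))\<^sup>2 \<partial>seg L) \<le> 8 * R"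
    and "AE t in seg T. (\<integral>x. (s v (x, t))\<^sup>2 \<partial>seg L) \<le> 4 * R / \<mu>"
    and "AE t in seg T. \<epsilon>\<^sup>2 * (\<integral>x. (s ux (x, t))\<^sup>2 \<partial>seg L) \<le> 16 * R / \<gamma>"
    and "AE t in seg T. \<epsilon>\<^sup>2 * (\<integral>x. (s vx (x, t))\<^sup>2 \<partial>seg L) \<le> 4 * R / (\<gamma> * \<mu>)"
    and "\<epsilon> * (\<integral>z. (s ux z)\<^sup>2 \<partial>rect L T) \<le> 4 * R"
    and "\<epsilon> * (\<integral>z. (s vx z)\<^sup>2 \<partial>rect L T) \<le> 16 * R / \<gamma>"
proof -
  define X where "X t = (\<integral>x. (s ux (x, t))\<^sup>2 \<partial>seg L)" for t
  define Y where "Y t = (\<integral>x. (s vx (x, t))\<^sup>2 \<partial>seg L)" for t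
  have XY: "integrable (seg T) X" "integrable (seg T) Y"
    unfolding X_def[abs_def] Y_def[abs_def] by (intro integrable_rect_slices(4)[OF sq_int_square] sm)+
  have nn: "X t \<ge> 0" "Y t \<ge> 0" for t by (simp_all add: X_def Y_def)
  have pXY: "prim T (\<lambda>t. 1 / 2 * X t + \<gamma> / 8 * Y t) t \<ge> 0" for t
    unfolding prim_def using nn \<gamma> by (intro Bochner_Integration.integral_nonneg) auto
  show N: "AE t in seg T. (\<integral>x. (s u (x, t))\<^sup>2 \<partial>seg L) \<le> 8 * R"
  proof (rule absorb_half[OF _ _ _ R_nonneg])
    fix S assume S: "S \<ge> 0" "AE t in seg T. (\<integral>x. (s u (x, t))\<^sup>2 \<partial>seg L) \<le> S"
    show "AE t in seg T. (\<integral>x. (s u (x, t))\<^sup>2 \<partial>seg L) \<le> S / 2 + 4 * R"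
      using energy_bound[OF S]
    proof eventually_elim
      case (elim t)
      have "0 \<le> \<mu> / 2 * (\<integral>x. (s v (x, t))\<^sup>2 \<partial>seg L) + \<gamma> * \<mu> / 2 * \<epsilon>\<^sup>2 * (\<integral>x. (s vx (x, t))\<^sup>2 \<partial>seg L) + \<gamma> / 8 * \<epsilon>\<^sup>2 * (\<integral>x. (s ux (x, t))\<^sup>2 \<partial>seg L)
        + \<epsilon> * prim T (\<lambda>t. 1 / 2 * (\<integral>x. (s ux (x, t))\<^sup>2 \<partial>seg L) + \<gamma> / 8 * (\<integral>x. (s vx (x, t))\<^sup>2 \<partial>seg L)) t"
        using pos \<gamma> pXY[of t] unfolding X_def Y_def by (intro add_nonneg_nonneg mult_nonneg_nonneg) auto
      with elim show ?case by linarith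
    qed
  next
    \<comment> \<open>A finite starting value for the iteration: the averaged norm is a primitive in
      time, hence bounded by the integral of the absolute rate. Its size is irrelevant.\<close>
    have tr: "trep L T (s u) (s ut)" by (rule smooth_trep(1)[OF trep(1) sq(1) sq(4) \<eta>])
    let ?h = "\<lambda>r. (\<integral>x. s ut (x, r) * s u (x, r) \<partial>seg L) + (\<integral>x. s u (x, r) * s ut (x, r) \<partial>seg L)"
    have h: "integrable (seg T) ?h"
      using integrable_rect_slices(4)[OF sq_int_mult[OF sm(1) sm(4)]] integrable_rect_slices(4)[OF sq_int_mult[OF sm(4) sm(1)]] by simp
    show "AE t in seg T. (\<integral>x. (s u (x, t))\<^sup>2 \<partial>seg L) \<le> (\<integral>r. \<bar>?h r\<bar> \<partial>seg T)"
      using time_energy[OF sm(1) sm(4) tr sm(1) sm(4) tr]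
    proof eventually_elim
      case (elim t)
      then show ?case using prim_abs_le[OF h, of t] by (simp add: power2_eq_square)
    qed
  qed simp
  have E: "AE t in seg T. 1 / 4 * (\<integral>x. (s u (x, t))\<^sup>2 \<partial>seg L) + \<mu> / 2 * (\<integral>x. (s v (x, t))\<^sup>2 \<partial>seg L)
      + \<gamma> * \<mu> / 2 * \<epsilon>\<^sup>2 * Y t + \<gamma> / 8 * \<epsilon>\<^sup>2 * X t
      + \<epsilon> * prim T (\<lambda>t. 1 / 2 * X t + \<gamma> / 8 * Y t) t \<le> 2 * R"
    using energy_bound[OF _ N] R_nonneg unfolding X_def[abs_def] Y_def[abs_def] by simp
  have parts: "AE t in seg T. \<mu> / 2 * (\<integral>x. (s v (x, t))\<^sup>2 \<partial>seg L) \<le> 2 * R \<and> \<gamma> * \<mu> / 2 * (\<epsilon>\<^sup>2 * Y t) \<le> 2 * R \<and>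
      \<gamma> / 8 * (\<epsilon>\<^sup>2 * X t) \<le> 2 * R \<and> \<epsilon> * prim T (\<lambda>t. 1 / 2 * X t + \<gamma> / 8 * Y t) t \<le> 2 * R"
    using E
  proof eventually_elim
    case (elim t)
    have n: "0 \<le> 1 / 4 * (\<integral>x. (s u (x, t))\<^sup>2 \<partial>seg L)" "0 \<le> \<mu> / 2 * (\<integral>x. (s v (x, t))\<^sup>2 \<partial>seg L)" "0 \<le> \<gamma> * \<mu> / 2 * (\<epsilon>\<^sup>2 * Y t)"
      "0 \<le> \<gamma> / 8 * (\<epsilon>\<^sup>2 * X t)" "0 \<le> \<epsilon> * prim T (\<lambda>t. 1 / 2 * X t + \<gamma> / 8 * Y t) t"
      using pos \<gamma> nn pXY[of t] by (auto intro!: mult_nonneg_nonneg)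
    with elim show ?case unfolding mult.assoc[of _ "\<epsilon>\<^sup>2"] by linarith
  qed
  show "AE t in seg T. (\<integral>x. (s v (x, t))\<^sup>2 \<partial>seg L) \<le> 4 * R / \<mu>"
    using parts by eventually_elim (use pos in \<open>simp add: field_simps\<close>)
  show "AE t in seg T. \<epsilon>\<^sup>2 * (\<integral>x. (s ux (x, t))\<^sup>2 \<partial>seg L) \<le> 16 * R / \<gamma>"
    using parts by eventually_elim (use \<gamma> in \<open>simp add: field_simps X_def\<close>)
  show "AE t in seg T. \<epsilon>\<^sup>2 * (\<integral>x. (s vx (x, t))\<^sup>2 \<partial>seg L) \<le> 4 * R / (\<gamma> * \<mu>)"
    using parts by eventually_elim (use \<gamma> pos in \<open>simp add: field_simps Y_def\<close>)
  have "AE t in seg T. prim T (\<lambda>t. 1 / 2 * X t + \<gamma> / 8 * Y t) t \<le> 2 * R / \<epsilon>"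
    using parts by eventually_elim (use pos in \<open>simp add: field_simps\<close>)
  from prim_le_of_AE[OF _ pos(2) this] XY
  have XYle: "1 / 2 * integral\<^sup>L (seg T) X + \<gamma> / 8 * integral\<^sup>L (seg T) Y \<le> 2 * R / \<epsilon>" by simp
  have XYeq: "integral\<^sup>L (seg T) X = (\<integral>z. (s ux z)\<^sup>2 \<partial>rect L T)" "integral\<^sup>L (seg T) Y = (\<integral>z. (s vx z)\<^sup>2 \<partial>rect L T)"
    unfolding X_def[abs_def] Y_def[abs_def] by (intro integrable_rect_slices(6) sq_int_square sm)+
  have "(\<integral>z. (s ux z)\<^sup>2 \<partial>rect L T) \<ge> 0" "\<gamma> / 8 * (\<integral>z. (s vx z)\<^sup>2 \<partial>rect L T) \<ge> 0" using \<gamma> by auto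
  then have "1 / 2 * (\<integral>z. (s ux z)\<^sup>2 \<partial>rect L T) \<le> 2 * R / \<epsilon>" "\<gamma> / 8 * (\<integral>z. (s vx z)\<^sup>2 \<partial>rect L T) \<le> 2 * R / \<epsilon>"
    using XYle unfolding XYeq by linarith+
  then show "\<epsilon> * (\<integral>z. (s ux z)\<^sup>2 \<partial>rect L T) \<le> 4 * R" "\<epsilon> * (\<integral>z. (s vx z)\<^sup>2 \<partial>rect L T) \<le> 16 * R / \<gamma>"
    using pos \<gamma> by (simp_all add: field_simps)
qed

end

end

section \<open>Removal of the time average\<close>

lemma le_of_le_add_inverse:
  fixes x B M :: real
  assumes "\<And>n. x \<le> B + inverse (real (Suc n)) * M"
  shows "x \<le> B"
proof -
  have "(\<lambda>n. B + inverse (real (Suc n)) * M) \<longlonglongrightarrow> B + 0 * M"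
    by (intro tendsto_intros LIMSEQ_inverse_real_of_nat)
  then show ?thesis
    by (intro LIMSEQ_le_const[where X = "\<lambda>n. B + inverse (real (Suc n)) * M"]) (use assms in auto)
qed

text \<open>By \<open>smooth_trep\<close> the squared error is at most \<eta> / 2 times the integral
  of Ft^2 in time, a bound that is integrable in x and uniform in t. Hence each type of bound
  survives \<eta> \<rightarrow> 0, up to the 2 from squaring a sum.\<close>

lemma smooth_limit:
  assumes F: "sq_int (rect L T) F" "sq_int (rect L T) Ft" "trep L T F Ft" and T: "T > 0"
  shows "(\<And>\<eta>. \<eta> > 0 \<Longrightarrow> AE z in rect L T. (smooth T \<eta> F z)\<^sup>2 \<le> B) \<Longrightarrow> AE z in rect L T. (F z)\<^sup>2 \<le> 2 * B"
    and "(\<And>\<eta>. \<eta> > 0 \<Longrightarrow> AE t in seg T. (\<integral>x. (smooth T \<eta> F (x, t))\<^sup>2 \<partial>seg L) \<le> B) \<Longrightarrow>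
      AE t in seg T. (\<integral>x. (F (x, t))\<^sup>2 \<partial>seg L) \<le> 2 * B"
    and "(\<And>\<eta>. \<eta> > 0 \<Longrightarrow> (\<integral>z. (smooth T \<eta> F z)\<^sup>2 \<partial>rect L T) \<le> B) \<Longrightarrow> (\<integral>z. (F z)\<^sup>2 \<partial>rect L T) \<le> 2 * B"
proof -
  define m where "m x = (\<integral>s. (Ft (x, s))\<^sup>2 \<partial>seg T)" for x
  have m: "integrable (seg L) m" unfolding m_def[abs_def] by (rule integrable_rect_slices(3)[OF sq_int_square[OF F(2)]])
  have mr: "integrable (rect L T) (\<lambda>z. m (fst z))" by (rule integrable_rect_fst[OF m])
  define e where "e n = inverse (real (Suc n))" for n
  have e: "e n > 0" for n by (simp add: e_def)
  have close: "AE z in rect L T. (F z)\<^sup>2 \<le> 2 * (smooth T (e n) F z)\<^sup>2 + e n * m (fst z)" for n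
    using smooth_trep(3)[OF F(3,1,2) e[of n]]
  proof eventually_elim
    case (elim z)
    \<comment> \<open>With s the average, the right side minus the left side is (F - 2 s)^2.\<close>
    have "(F z)\<^sup>2 \<le> 2 * (smooth T (e n) F z)\<^sup>2 + 2 * (F z - smooth T (e n) F z)\<^sup>2"
      using zero_le_power2[of "F z - 2 * smooth T (e n) F z"] by (simp add: power2_eq_square algebra_simps)
    then show ?case using elim by (simp add: m_def)
  qed
  show "AE z in rect L T. (F z)\<^sup>2 \<le> 2 * B" if "\<And>\<eta>. \<eta> > 0 \<Longrightarrow> AE z in rect L T. (smooth T \<eta> F z)\<^sup>2 \<le> B"
  proof -
    have "AE z in rect L T. (F z)\<^sup>2 \<le> 2 * B + e n * m (fst z)" for n
      using close[of n] that[OF e[of n]] by eventually_elim simp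
    then have "AE z in rect L T. \<forall>n. (F z)\<^sup>2 \<le> 2 * B + e n * m (fst z)" unfolding AE_all_countable by blast
    then show ?thesis
    proof eventually_elim
      case (elim z)
      show ?case by (rule le_of_le_add_inverse[where M = "m (fst z)"]) (use elim in \<open>simp add: e_def\<close>)
    qed
  qed
  show "AE t in seg T. (\<integral>x. (F (x, t))\<^sup>2 \<partial>seg L) \<le> 2 * B"
    if "\<And>\<eta>. \<eta> > 0 \<Longrightarrow> AE t in seg T. (\<integral>x. (smooth T \<eta> F (x, t))\<^sup>2 \<partial>seg L) \<le> B"
  proof -
    have "AE t in seg T. (\<integral>x. (F (x, t))\<^sup>2 \<partial>seg L) \<le> 2 * B + e n * integral\<^sup>L (seg L) m" for n
      using AE_seg_slice2[OF close[of n]] that[OF e[of n]] sq_int_slices(2)[OF F(1)]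
        sq_int_slices(2)[OF sq_int_smooth(1)[OF F(1) e[of n] T]]
    proof eventually_elim
      case (elim t)
      have "(\<integral>x. (F (x, t))\<^sup>2 \<partial>seg L) \<le> (\<integral>x. 2 * (smooth T (e n) F (x, t))\<^sup>2 + e n * m x \<partial>seg L)"
        by (rule integral_mono_AE) (use elim(1) m sq_int_square[OF elim(3)] sq_int_square[OF elim(4)] in simp_all)
      also have "\<dots> = 2 * (\<integral>x. (smooth T (e n) F (x, t))\<^sup>2 \<partial>seg L) + e n * integral\<^sup>L (seg L) m"
        using sq_int_square[OF elim(4)] m by simp
      finally show ?case using elim(2) by simp
    qed
    then have "AE t in seg T. \<forall>n. (\<integral>x. (F (x, t))\<^sup>2 \<partial>seg L) \<le> 2 * B + e n * integral\<^sup>L (seg L) m"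
      unfolding AE_all_countable by blast
    then show ?thesis
    proof eventually_elim
      case (elim t)
      show ?case by (rule le_of_le_add_inverse[where M = "integral\<^sup>L (seg L) m"]) (use elim in \<open>simp add: e_def\<close>)
    qed
  qed
  show "(\<integral>z. (F z)\<^sup>2 \<partial>rect L T) \<le> 2 * B" if "\<And>\<eta>. \<eta> > 0 \<Longrightarrow> (\<integral>z. (smooth T \<eta> F z)\<^sup>2 \<partial>rect L T) \<le> B"
  proof (rule le_of_le_add_inverse[where M = "\<integral>z. m (fst z) \<partial>rect L T"])
    fix n
    have sm: "sq_int (rect L T) (smooth T (e n) F)" by (rule sq_int_smooth(1)[OF F(1) e T])
    have "(\<integral>z. (F z)\<^sup>2 \<partial>rect L T) \<le> (\<integral>z. 2 * (smooth T (e n) F z)\<^sup>2 + e n * m (fst z) \<partial>rect L T)"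
      by (rule integral_mono_AE[OF _ _ close]) (use sq_int_square[OF F(1)] sq_int_square[OF sm] mr in simp_all)
    also have "\<dots> = 2 * (\<integral>z. (smooth T (e n) F z)\<^sup>2 \<partial>rect L T) + e n * (\<integral>z. m (fst z) \<partial>rect L T)"
      using sq_int_square[OF sm] mr by simp
    finally show "(\<integral>z. (F z)\<^sup>2 \<partial>rect L T) \<le> 2 * B + inverse (real (Suc n)) * (\<integral>z. m (fst z) \<partial>rect L T)"
      using that[OF e[of n]] by (simp add: e_def)
  qed
qed

text \<open>y vanishes at 0, so y^2 is the primitive of 2 h y; Young's inequality then distributes
  the factor \<epsilon>.\<close>

lemma sup_bound_H1:
  assumes h: "sq_int (seg L) h" and y: "sq_int (seg L) y" and rep: "AE x in seg L. y x = prim L h x" and \<epsilon>: "\<epsilon> > 0"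
  shows "AE x in seg L. \<epsilon> * (y x)\<^sup>2 \<le> (\<integral>x. (y x)\<^sup>2 \<partial>seg L) + \<epsilon>\<^sup>2 * (\<integral>x. (h x)\<^sup>2 \<partial>seg L)"
proof -
  have hi: "integrable (seg L) h" "integrable (seg L) y"
    using sq_int_integrable[OF finite_measure_seg h] sq_int_integrable[OF finite_measure_seg y] .
  note ps = prim_square[OF hi(1) rep seg_borel[OF hi(2)]]
  show ?thesis
    using rep
  proof eventually_elim
    case (elim x)
    have "(y x)\<^sup>2 = prim L (\<lambda>s. 2 * (h s * y s)) x" unfolding elim by (rule ps(1))
    also have "\<dots> \<le> (\<integral>s. \<bar>2 * (h s * y s)\<bar> \<partial>seg L)" using prim_abs_le[OF ps(2), of x] by simp
    finally have "\<epsilon> * (y x)\<^sup>2 \<le> (\<integral>s. \<epsilon> * \<bar>2 * (h s * y s)\<bar> \<partial>seg L)" using \<epsilon> by simp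
    also have "\<dots> \<le> (\<integral>s. (y s)\<^sup>2 + \<epsilon>\<^sup>2 * (h s)\<^sup>2 \<partial>seg L)"
    proof (rule integral_mono)
      fix s
      have "0 \<le> (\<bar>y s\<bar> - \<epsilon> * \<bar>h s\<bar>)\<^sup>2" by simp
      also have "\<dots> = (y s)\<^sup>2 + \<epsilon>\<^sup>2 * (h s)\<^sup>2 - \<epsilon> * \<bar>2 * (h s * y s)\<bar>"
        by (simp add: power2_diff power_mult_distrib abs_mult)
      finally show "\<epsilon> * \<bar>2 * (h s * y s)\<bar> \<le> (y s)\<^sup>2 + \<epsilon>\<^sup>2 * (h s)\<^sup>2" by simp
    qed (use ps(2) sq_int_square[OF h] sq_int_square[OF y] in auto)
    also have "\<dots> = (\<integral>x. (y x)\<^sup>2 \<partial>seg L) + \<epsilon>\<^sup>2 * (\<integral>x. (h x)\<^sup>2 \<partial>seg L)"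
      using sq_int_square[OF h] sq_int_square[OF y] by simp
    finally show ?case .
  qed
qed

context evolution
begin

text \<open>\<open>smooth_limit\<close> would need a time derivative of u_x. Instead the error u_x -
  s(u_x), where s is the average, is paired with u_x; integrating by parts moves the x-derivative
  away, and u - s(u) is small because u_t exists.\<close>

lemma ux_limit:
  assumes B: "\<And>\<eta>. \<eta> > 0 \<Longrightarrow> (\<integral>z. (smooth T \<eta> ux z)\<^sup>2 \<partial>rect L T) \<le> B"
  shows "(\<integral>z. (ux z)\<^sup>2 \<partial>rect L T) \<le> B"
proof -
  define m where "m x = (\<integral>s. (ut (x, s))\<^sup>2 \<partial>seg T)" for x
  have m: "integrable (seg L) m" unfolding m_def[abs_def] by (rule integrable_rect_slices(3)[OF sq_int_square[OF sq(4)]])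
  have mr: "integrable (rect L T) (\<lambda>z. m (fst z))" by (rule integrable_rect_fst[OF m])
  let ?M = "2 * (\<integral>z. (uxx z)\<^sup>2 \<partial>rect L T) + 1 / 4 * (\<integral>z. m (fst z) \<partial>rect L T)"
  show ?thesis
  proof (rule le_of_le_add_inverse[where M = ?M])
    fix n
    \<comment> \<open>The averaging parameter is e^2: then (u - s(u))^2 is of order e^2, and Young's
      inequality with weight e leaves an error of order e.\<close>
    define e where "e = inverse (real (Suc n))"
    have e: "e > 0" by (simp add: e_def)
    then have e2: "e\<^sup>2 > 0" by simp
    let ?s = "smooth T (e\<^sup>2)"
    have su: "sq_int (rect L T) (?s u)" and sux: "sq_int (rect L T) (?s ux)"
      by (rule sq_int_smooth(1)[OF _ e2 pos(2)], rule sq)+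
    note [measurable] = sq_int_rect_borel[OF sq(1)] sq_int_rect_borel[OF sq(2)] sq_int_rect_borel[OF sq(3)]
    define G where "G z = (ux z)\<^sup>2 - ?s ux z * ux z + (u z - ?s u z) * uxx z" for z
    have Gi: "integrable (rect L T) G"
      unfolding G_def using sq_int_square[OF sq(2)] sq_int_mult[OF sux sq(2)] sq_int_mult[OF sq_int_diff[OF sq(1) su] sq(3)] by simp
    have "AE t in seg T. AE x in seg L. u (x, t) = prim L (\<lambda>y. ux (y, t)) x" using xrep_slice[OF rep_u(1)] by simp
    moreover have "AE t in seg T. AE x in seg L. ?s u (x, t) = prim L (\<lambda>y. ?s ux (y, t)) x"
      using xrep_slice[OF smooth_xrep[OF rep_u(1) sq(2) _ sq(1) e2]] by (simp add: tavg_def prim_def)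
    ultimately have "AE t in seg T. (\<integral>x. G (x, t) \<partial>seg L) = 0"
      using xrep_slice[OF rep_ux] rep_u(2) sq_int_slices(2)[OF sq(2)] sq_int_slices(2)[OF sq(3)] sq_int_slices(2)[OF sux]
    proof eventually_elim
      case (elim t)
      let ?d = "\<lambda>x. ux (x, t) - ?s ux (x, t)"
      have d: "integrable (seg L) (\<lambda>x. ux (x, t))" "integrable (seg L) (\<lambda>x. ?s ux (x, t))" "integrable (seg L) (\<lambda>x. uxx (x, t))"
        using elim by (auto intro: sq_int_integrable[OF finite_measure_seg])
      then have di: "integrable (seg L) ?d" by simp
      have "(\<integral>x. G (x, t) \<partial>seg L) = (\<integral>x. ?d x * (a t + prim L (\<lambda>y. uxx (y, t)) x) + (0 + prim L ?d x) * uxx (x, t) \<partial>seg L)"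
      proof (rule integral_cong_AE)
        show "AE x in seg L. G (x, t) = ?d x * (a t + prim L (\<lambda>y. uxx (y, t)) x) + (0 + prim L ?d x) * uxx (x, t)"
          using elim(1,2,3)
        proof eventually_elim
          case (elim x)
          have "?d x * ux (x, t) + (u (x, t) - ?s u (x, t)) * uxx (x, t) = G (x, t)"
            by (simp add: G_def power2_eq_square algebra_simps)
          then show ?case unfolding prim_diff[OF d(1,2)] using elim by simp
        qed
      qed (unfold G_def, measurable)
      also have "\<dots> = 0"
        by (subst integration_by_parts_prim[OF di d(3)])
          (use d elim(4) smooth_int0[OF rep_u(2) sq(2) e2] in simp)
      finally show ?case .
    qed
    then have "(\<integral>t. \<integral>x. G (x, t) \<partial>seg L \<partial>seg T) = 0" by (rule integral_eq_zero_AE)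
    then have G0: "integral\<^sup>L (rect L T) G = 0" using integrable_rect_slices(6)[OF Gi] by simp
    \<comment> \<open>\<open>G\<close> has integral zero, so it may be subtracted at will; 2 u_x^2 -
      2 G is the product 2 s(u_x) u_x plus the small pairing of u_xx with u - s(u).\<close>
    have "(\<integral>z. (ux z)\<^sup>2 \<partial>rect L T) = (\<integral>z. 2 * (ux z)\<^sup>2 - 2 * G z \<partial>rect L T) - (\<integral>z. (ux z)\<^sup>2 \<partial>rect L T)"
      using Gi G0 sq_int_square[OF sq(2)] by simp
    also have "(\<integral>z. 2 * (ux z)\<^sup>2 - 2 * G z \<partial>rect L T) \<le>
      (\<integral>z. (ux z)\<^sup>2 + (?s ux z)\<^sup>2 + e * (2 * (uxx z)\<^sup>2 + 1 / 4 * m (fst z)) \<partial>rect L T)"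
    proof (rule integral_mono_AE)
      show "AE z in rect L T. 2 * (ux z)\<^sup>2 - 2 * G z \<le> (ux z)\<^sup>2 + (?s ux z)\<^sup>2 + e * (2 * (uxx z)\<^sup>2 + 1 / 4 * m (fst z))"
        using smooth_trep(3)[OF trep(1) sq(1) sq(4) e2]
      proof eventually_elim
        case (elim z)
        have 1: "2 * (?s ux z * ux z) \<le> (ux z)\<^sup>2 + (?s ux z)\<^sup>2"
          using sum_squares_bound[of "?s ux z" "ux z"] by (simp add: mult.assoc)
        have "uxx z * (- (u z - ?s u z)) \<le> e * (uxx z)\<^sup>2 + (- (u z - ?s u z))\<^sup>2 / (4 * e)" by (rule Young_mult[OF e])
        also have "(- (u z - ?s u z))\<^sup>2 / (4 * e) \<le> (e\<^sup>2 / 2 * m (fst z)) / (4 * e)"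
          using elim e by (intro divide_right_mono) (auto simp: m_def power2_commute)
        also have "\<dots> = e * (1 / 8 * m (fst z))" using e by (simp add: power2_eq_square)
        finally have 2: "- ((u z - ?s u z) * uxx z) \<le> e * (uxx z)\<^sup>2 + e * (1 / 8 * m (fst z))" by (simp add: algebra_simps)
        have "2 * (ux z)\<^sup>2 - 2 * G z = 2 * (?s ux z * ux z) + 2 * (- ((u z - ?s u z) * uxx z))"
          by (simp add: G_def algebra_simps)
        then show ?case using 1 2 by (simp add: algebra_simps)
      qed
    qed (use Gi sq_int_square[OF sq(2)] sq_int_square[OF sux] sq_int_square[OF sq(3)] mr in simp_all)
    also have "\<dots> = (\<integral>z. (ux z)\<^sup>2 \<partial>rect L T) + (\<integral>z. (?s ux z)\<^sup>2 \<partial>rect L T) + e * ?M"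
      using sq_int_square[OF sq(2)] sq_int_square[OF sux] sq_int_square[OF sq(3)] mr by simp
    finally show "(\<integral>z. (ux z)\<^sup>2 \<partial>rect L T) \<le> B + inverse (real (Suc n)) * ?M"
      using B[OF e2] by (simp add: e_def)
  qed
qed

theorem estimates:
  shows "AE t in seg T. (\<integral>x. (u (x, t))\<^sup>2 \<partial>seg L) \<le> 16 * R"
    and "AE t in seg T. (\<integral>x. (v (x, t))\<^sup>2 \<partial>seg L) \<le> 8 * R / \<mu>"
    and "\<epsilon> * (\<integral>z. (ux z)\<^sup>2 \<partial>rect L T) \<le> 4 * R"
    and "\<epsilon> * (\<integral>z. (vx z)\<^sup>2 \<partial>rect L T) \<le> 32 * R / \<gamma>"
    and "AE z in rect L T. \<epsilon> * (u z)\<^sup>2 \<le> 2 * (8 * R + 16 * R / \<gamma>)"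
    and "AE z in rect L T. \<epsilon> * (v z)\<^sup>2 \<le> 2 * (4 * R / \<mu> + 4 * R / (\<gamma> * \<mu>))"
proof -
  note \<epsilon> = pos(5)
  show "AE t in seg T. (\<integral>x. (u (x, t))\<^sup>2 \<partial>seg L) \<le> 16 * R"
    using smooth_limit(2)[OF sq(1) sq(4) trep(1) pos(2) smooth_estimates(1)] by simp
  show "AE t in seg T. (\<integral>x. (v (x, t))\<^sup>2 \<partial>seg L) \<le> 8 * R / \<mu>"
    using smooth_limit(2)[OF sq(5) sq(8) trep(2) pos(2) smooth_estimates(2)] by simp
  have "(\<integral>z. (ux z)\<^sup>2 \<partial>rect L T) \<le> 4 * R / \<epsilon>"
    by (rule ux_limit) (use smooth_estimates(5) \<epsilon> in \<open>simp add: field_simps\<close>)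
  then show "\<epsilon> * (\<integral>z. (ux z)\<^sup>2 \<partial>rect L T) \<le> 4 * R" using \<epsilon> by (simp add: field_simps)
  have "(\<integral>z. (vx z)\<^sup>2 \<partial>rect L T) \<le> 2 * (16 * R / \<gamma> / \<epsilon>)"
  proof (rule smooth_limit(3)[OF sq(6) sq(9) trep(3) pos(2)])
    show "(\<integral>z. (smooth T \<eta> vx z)\<^sup>2 \<partial>rect L T) \<le> 16 * R / \<gamma> / \<epsilon>" if "\<eta> > 0" for \<eta>
      by (subst pos_le_divide_eq[OF \<epsilon>]) (use smooth_estimates(6)[OF that] in \<open>simp add: mult.commute\<close>)
  qed
  also have "2 * (16 * R / \<gamma> / \<epsilon>) = (32 * R / \<gamma>) / \<epsilon>" by simp
  finally have "(\<integral>z. (vx z)\<^sup>2 \<partial>rect L T) * \<epsilon> \<le> 32 * R / \<gamma>" unfolding pos_le_divide_eq[OF \<epsilon>] .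
  then show "\<epsilon> * (\<integral>z. (vx z)\<^sup>2 \<partial>rect L T) \<le> 32 * R / \<gamma>" by (simp only: mult.commute)
  \<comment> \<open>The interpolation is carried out on the averaged functions, since bounds on
    \<epsilon> |u_x| and \<epsilon> |v_x| uniform in time are available only there.\<close>
  have sup: "AE z in rect L T. (smooth T \<eta> F z)\<^sup>2 \<le> (A + C) / \<epsilon>"
    if \<eta>: "\<eta> > 0" and F: "sq_int (rect L T) F" "sq_int (rect L T) Fx" and rep: "xrep L T F (\<lambda>_. 0) Fx"
      and A: "AE t in seg T. (\<integral>x. (smooth T \<eta> F (x, t))\<^sup>2 \<partial>seg L) \<le> A"
      and C: "AE t in seg T. \<epsilon>\<^sup>2 * (\<integral>x. (smooth T \<eta> Fx (x, t))\<^sup>2 \<partial>seg L) \<le> C" for F Fx A C \<eta>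
  proof -
    note [measurable] = sq_int_rect_borel[OF F(1)]
    have "AE t in seg T. AE x in seg L. smooth T \<eta> F (x, t) = prim L (\<lambda>y. smooth T \<eta> Fx (y, t)) x"
      using xrep_slice[OF smooth_xrep[OF rep F(2) _ F(1) \<eta>]] by (simp add: tavg_def prim_def)
    then have "AE t in seg T. AE x in seg L. (smooth T \<eta> F (x, t))\<^sup>2 \<le> (A + C) / \<epsilon>"
      using A C sq_int_slices(2)[OF sq_int_smooth(1)[OF F(1) \<eta> pos(2)]] sq_int_slices(2)[OF sq_int_smooth(1)[OF F(2) \<eta> pos(2)]]
    proof eventually_elim
      case (elim t)
      show ?case
        using sup_bound_H1[OF elim(5,4,1) \<epsilon>]
      proof eventually_elim
        case (elim x)
        then have "\<epsilon> * (smooth T \<eta> F (x, t))\<^sup>2 \<le> A + C" using \<open>_ \<le> A\<close> \<open>_ \<le> C\<close> by linarith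
        then show ?case using \<epsilon> by (simp add: pos_le_divide_eq mult.commute)
      qed
    qed
    then show ?thesis by (intro AE_seg_pairI2) (simp_all add: borel_prod[symmetric])
  qed
  have "AE z in rect L T. (u z)\<^sup>2 \<le> 2 * ((8 * R + 16 * R / \<gamma>) / \<epsilon>)"
    by (rule smooth_limit(1)[OF sq(1) sq(4) trep(1) pos(2)])
      (rule sup[OF _ sq(1,2) rep_u(1) smooth_estimates(1) smooth_estimates(3)])
  then show "AE z in rect L T. \<epsilon> * (u z)\<^sup>2 \<le> 2 * (8 * R + 16 * R / \<gamma>)"
    by eventually_elim (use \<epsilon> in \<open>simp add: pos_le_divide_eq mult.commute\<close>)
  have "AE z in rect L T. (v z)\<^sup>2 \<le> 2 * ((4 * R / \<mu> + 4 * R / (\<gamma> * \<mu>)) / \<epsilon>)"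
    by (rule smooth_limit(1)[OF sq(5) sq(8) trep(2) pos(2)])
      (rule sup[OF _ sq(5,6) rep_v smooth_estimates(2) smooth_estimates(4)])
  then show "AE z in rect L T. \<epsilon> * (v z)\<^sup>2 \<le> 2 * (4 * R / \<mu> + 4 * R / (\<gamma> * \<mu>))"
    by eventually_elim (use \<epsilon> in \<open>simp add: pos_le_divide_eq mult.commute\<close>)
qed

end

section \<open>The boundary layer profile\<close>

lemma sq_int_continuous:
  assumes "continuous_on UNIV (f :: real \<Rightarrow> real)"
  shows "sq_int (seg L) f"
proof -
  have [measurable]: "f \<in> borel_measurable borel" using assms by (rule borel_measurable_continuous_onI)
  have "compact (f ` {0..L})" by (intro compact_continuous_image continuous_on_subset[OF assms]) auto
  then obtain B where B: "\<And>x. x \<in> {0..L} \<Longrightarrow> \<bar>f x\<bar> \<le> B"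
    using compact_imp_bounded[of "f ` {0..L}"] unfolding bounded_iff by fastforce
  show ?thesis
  proof (rule sq_int_bound)
    show "integrable (seg L) (\<lambda>x. B\<^sup>2)" by simp
    show "AE x in seg L. (f x)\<^sup>2 \<le> B\<^sup>2"
      using AE_seg_mem
    proof eventually_elim
      case (elim x)
      have "\<bar>f x\<bar>\<^sup>2 \<le> B\<^sup>2" by (rule power_mono) (use B[of x] elim in auto)
      then show ?case by simp
    qed
  qed measurable
qed

text \<open>The profile common to both correctors: the exponential, shifted and scaled to be 1 at x
  = 0 and 0 at x = L.\<close>

definition layer_q :: "real \<Rightarrow> real \<Rightarrow> real \<Rightarrow> real \<Rightarrow> real" where
  "layer_q L r \<epsilon> x = (exp (- r * x / \<epsilon>) - exp (- r * L / \<epsilon>)) / (1 - exp (- r * L / \<epsilon>))"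

definition layer_q' :: "real \<Rightarrow> real \<Rightarrow> real \<Rightarrow> real \<Rightarrow> real" where
  "layer_q' L r \<epsilon> x = - (r / \<epsilon> * exp (- r * x / \<epsilon>)) / (1 - exp (- r * L / \<epsilon>))"

text \<open>The antiderivative of - q that vanishes at L, i.e. the integral of q from x to
  L.\<close>

definition layer_Q :: "real \<Rightarrow> real \<Rightarrow> real \<Rightarrow> real \<Rightarrow> real" where
  "layer_Q L r \<epsilon> x = (\<epsilon> / r * (exp (- r * x / \<epsilon>) - exp (- r * L / \<epsilon>)) - exp (- r * L / \<epsilon>) * (L - x)) / (1 - exp (- r * L / \<epsilon>))"

context
  fixes L r \<epsilon> :: real
  assumes pos: "L > 0" "r > 0" "\<epsilon> > 0" and small: "exp (- r * L / \<epsilon>) \<le> 1 / 2"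
begin

lemma layer_deriv:
  "(layer_q L r \<epsilon> has_real_derivative layer_q' L r \<epsilon> x) (at x within S)"
  "(layer_Q L r \<epsilon> has_real_derivative - layer_q L r \<epsilon> x) (at x within S)"
proof -
  define E c where "E = exp (- r * L / \<epsilon>)" and "c = inverse (1 - E)"
  have q: "layer_q L r \<epsilon> = (\<lambda>x. c * (exp (- r * x / \<epsilon>) - E))" "layer_q' L r \<epsilon> x = - c * (r / \<epsilon> * exp (- r * x / \<epsilon>))"
    "layer_Q L r \<epsilon> = (\<lambda>x. c * (\<epsilon> / r * (exp (- r * x / \<epsilon>) - E) - E * (L - x)))"
    by (simp_all add: layer_q_def[abs_def] layer_q'_def layer_Q_def[abs_def] E_def c_def divide_inverse mult.commute)
  show "(layer_q L r \<epsilon> has_real_derivative layer_q' L r \<epsilon> x) (at x within S)"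
    "(layer_Q L r \<epsilon> has_real_derivative - layer_q L r \<epsilon> x) (at x within S)"
    unfolding q using pos by (auto intro!: derivative_eq_intros simp: field_simps)
qed

lemma layer_continuous:
  "continuous_on S (layer_q L r \<epsilon>)" "continuous_on S (layer_q' L r \<epsilon>)" "continuous_on S (layer_Q L r \<epsilon>)"
  unfolding layer_q_def[abs_def] layer_q'_def[abs_def] layer_Q_def[abs_def]
  using pos small by (auto intro!: continuous_intros)

lemma layer_sq_int: "sq_int (seg L) (layer_q L r \<epsilon>)" "sq_int (seg L) (layer_q' L r \<epsilon>)" "sq_int (seg L) (layer_Q L r \<epsilon>)"
  by (rule sq_int_continuous, rule layer_continuous)+

lemma layer_rep:
  "x \<in> {0..L} \<Longrightarrow> layer_q L r \<epsilon> x = 1 + prim L (layer_q' L r \<epsilon>) x"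
  "x \<in> {0..L} \<Longrightarrow> layer_Q L r \<epsilon> x = layer_Q L r \<epsilon> 0 + prim L (\<lambda>y. - layer_q L r \<epsilon> y) x"
  "layer_Q L r \<epsilon> 0 = integral\<^sup>L (seg L) (layer_q L r \<epsilon>)" "layer_q L r \<epsilon> L = 0"
proof -
  have m: "layer_q' L r \<epsilon> \<in> borel_measurable borel" "(\<lambda>y. - layer_q L r \<epsilon> y) \<in> borel_measurable borel"
    by (intro borel_measurable_continuous_onI layer_continuous continuous_on_minus)+
  have "layer_q L r \<epsilon> 0 = 1" using small pos by (simp add: layer_q_def)
  then show "x \<in> {0..L} \<Longrightarrow> layer_q L r \<epsilon> x = 1 + prim L (layer_q' L r \<epsilon>) x"
    using prim_deriv(1)[OF layer_deriv(1) layer_continuous(2) m(1)] by metis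
  show rep: "layer_Q L r \<epsilon> x = layer_Q L r \<epsilon> 0 + prim L (\<lambda>y. - layer_q L r \<epsilon> y) x" if "x \<in> {0..L}" for x
    using prim_deriv(1)[OF layer_deriv(2) continuous_on_minus[OF layer_continuous(1)] m(2) that] .
  have "layer_Q L r \<epsilon> L = 0" by (simp add: layer_Q_def)
  with rep[of L] show "layer_Q L r \<epsilon> 0 = integral\<^sup>L (seg L) (layer_q L r \<epsilon>)"
    using pos m(2) by (simp add: prim_ge)
  show "layer_q L r \<epsilon> L = 0" by (simp add: layer_q_def)
qed

text \<open>Each function is at most a constant times exp(- r x / \<epsilon>), with factors 2, 2 r
  and 2 \<epsilon> / r; the 2 bounds the reciprocal of 1 - exp(- r L / \<epsilon>). The square of
  the exponential integrates to at most \<epsilon> / (2 r). The constant \<open>c1\<close> is a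
  common upper bound.\<close>

lemma layer_bounds:
  defines "c1 \<equiv> 2 / r + 2 * r + 2 / r ^ 3"
  shows "(\<integral>x. (layer_q L r \<epsilon> x)\<^sup>2 \<partial>seg L) \<le> c1 * \<epsilon>"
    "(\<integral>x. (\<epsilon> * layer_q' L r \<epsilon> x)\<^sup>2 \<partial>seg L) \<le> c1 * \<epsilon>"
    "(\<integral>x. (layer_Q L r \<epsilon> x)\<^sup>2 \<partial>seg L) \<le> c1 * \<epsilon> ^ 3"
proof -
  define m where "m x = exp (- r * x / \<epsilon>)" for x
  define E where "E = exp (- r * L / \<epsilon>)"
  have E: "0 < E" "E \<le> 1 / 2" using small by (auto simp: E_def)
  then have E': "1 / (1 - E) \<le> 2" by (simp add: field_simps)
  have mL: "m L = E" by (simp add: m_def E_def)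
  have m0: "m 0 = 1" by (simp add: m_def)
  have mc: "continuous_on S m" for S unfolding m_def[abs_def] using pos by (auto intro!: continuous_intros)
  have msq: "integrable (seg L) (\<lambda>x. (m x)\<^sup>2)" using sq_int_square[OF sq_int_continuous[OF mc]] .
  have mint: "(\<integral>x. (m x)\<^sup>2 \<partial>seg L) \<le> \<epsilon> / (2 * r)"
  proof -
    let ?F = "\<lambda>x. - (\<epsilon> / (2 * r)) * (m x)\<^sup>2"
    have d: "(?F has_real_derivative (m x)\<^sup>2) (at x within {0..L})" for x
      unfolding m_def using pos by (auto intro!: derivative_eq_intros simp: power2_eq_square field_simps)
    have c: "continuous_on S (\<lambda>x. (m x)\<^sup>2)" for S by (intro continuous_intros mc)
    have mm: "(\<lambda>x. (m x)\<^sup>2) \<in> borel_measurable borel" by (rule borel_measurable_continuous_onI[OF c])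
    have "?F L = ?F 0 + prim L (\<lambda>x. (m x)\<^sup>2) L"
      by (rule prim_deriv(1)[OF d c mm]) (use pos in simp)
    moreover have "prim L (\<lambda>x. (m x)\<^sup>2) L = (\<integral>x. (m x)\<^sup>2 \<partial>seg L)" by (rule prim_ge[OF order_refl mm])
    ultimately have "(\<integral>x. (m x)\<^sup>2 \<partial>seg L) = \<epsilon> / (2 * r) * (1 - (m L)\<^sup>2)"
      unfolding m0 right_diff_distrib by simp
    also have "\<dots> \<le> \<epsilon> / (2 * r) * 1" using pos by (intro mult_left_mono) auto
    finally show ?thesis by simp
  qed
  have main: "(\<integral>x. (f x)\<^sup>2 \<partial>seg L) \<le> A\<^sup>2 * (\<epsilon> / (2 * r))"
    if f: "sq_int (seg L) f" and b: "\<And>x. x \<in> {0..L} \<Longrightarrow> \<bar>f x\<bar> \<le> A * m x" for f A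
  proof -
    have "(\<integral>x. (f x)\<^sup>2 \<partial>seg L) \<le> (\<integral>x. A\<^sup>2 * (m x)\<^sup>2 \<partial>seg L)"
    proof (rule integral_mono_AE)
      show "AE x in seg L. (f x)\<^sup>2 \<le> A\<^sup>2 * (m x)\<^sup>2"
        using AE_seg_mem
      proof eventually_elim
        case (elim x)
        have "\<bar>f x\<bar>\<^sup>2 \<le> (A * m x)\<^sup>2" by (rule power_mono) (use b[of x] elim in auto)
        then show ?case by (simp add: power_mult_distrib)
      qed
    qed (use f msq in \<open>auto dest: sq_int_square\<close>)
    also have "\<dots> = A\<^sup>2 * (\<integral>x. (m x)\<^sup>2 \<partial>seg L)" by simp
    also have "\<dots> \<le> A\<^sup>2 * (\<epsilon> / (2 * r))" by (rule mult_left_mono[OF mint]) simp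
    finally show ?thesis .
  qed
  have mE: "E \<le> m x" "m x - E \<le> m x" if "x \<in> {0..L}" for x
    using that pos E by (auto simp: E_def m_def divide_right_mono mult_left_mono)
  have "(\<integral>x. (layer_q L r \<epsilon> x)\<^sup>2 \<partial>seg L) \<le> 2\<^sup>2 * (\<epsilon> / (2 * r))"
  proof (rule main[OF layer_sq_int(1)])
    fix x assume x: "x \<in> {0..L}"
    have "\<bar>layer_q L r \<epsilon> x\<bar> = 1 / (1 - E) * (m x - E)"
      unfolding layer_q_def m_def[symmetric] mL using mE[OF x] E by simp
    also have "\<dots> \<le> 2 * m x" by (rule mult_mono[OF E']) (use mE[OF x] E in auto)
    finally show "\<bar>layer_q L r \<epsilon> x\<bar> \<le> 2 * m x" .
  qed
  also have "\<dots> \<le> c1 * \<epsilon>" using pos by (simp add: c1_def field_simps)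
  finally show "(\<integral>x. (layer_q L r \<epsilon> x)\<^sup>2 \<partial>seg L) \<le> c1 * \<epsilon>" .
  have "(\<integral>x. (\<epsilon> * layer_q' L r \<epsilon> x)\<^sup>2 \<partial>seg L) \<le> (2 * r)\<^sup>2 * (\<epsilon> / (2 * r))"
  proof (rule main[OF sq_int_cmult[OF layer_sq_int(2)]])
    fix x assume x: "x \<in> {0..L}"
    have "\<bar>\<epsilon> * layer_q' L r \<epsilon> x\<bar> = 1 / (1 - E) * (r * m x)"
      unfolding layer_q'_def m_def[symmetric] mL using E pos by (simp add: abs_mult m_def)
    also have "\<dots> \<le> 2 * (r * m x)" by (rule mult_right_mono[OF E']) (use pos in \<open>simp add: m_def\<close>)
    finally show "\<bar>\<epsilon> * layer_q' L r \<epsilon> x\<bar> \<le> 2 * r * m x" by simp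
  qed
  also have "\<dots> = 2 * r * \<epsilon>" using pos by (simp add: power2_eq_square)
  also have "\<dots> \<le> c1 * \<epsilon>" unfolding c1_def by (rule mult_right_mono) (use pos in auto)
  finally show "(\<integral>x. (\<epsilon> * layer_q' L r \<epsilon> x)\<^sup>2 \<partial>seg L) \<le> c1 * \<epsilon>" .
  have "(\<integral>x. (layer_Q L r \<epsilon> x)\<^sup>2 \<partial>seg L) \<le> (2 * (\<epsilon> / r))\<^sup>2 * (\<epsilon> / (2 * r))"
  proof (rule main[OF layer_sq_int(3)])
    fix x assume x: "x \<in> {0..L}"
    \<comment> \<open>The inequality 1 + s \<le> exp s gives nonnegativity of
      \<open>layer_Q\<close>; then only the positive part matters for the upper bound.\<close>
    have "E * (1 + r * (L - x) / \<epsilon>) \<le> E * exp (r * (L - x) / \<epsilon>)"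
      using E by (intro mult_left_mono exp_ge_add_one_self) auto
    also have "\<dots> = m x" unfolding E_def m_def exp_add[symmetric] using pos by (simp add: field_simps)
    finally have "r / \<epsilon> * (E * (L - x)) \<le> m x - E" by (simp add: algebra_simps diff_divide_distrib)
    then have "\<epsilon> / r * (r / \<epsilon> * (E * (L - x))) \<le> \<epsilon> / r * (m x - E)" using pos by (intro mult_left_mono) auto
    then have n: "0 \<le> \<epsilon> / r * (m x - E) - E * (L - x)" using pos by simp
    have "\<bar>layer_Q L r \<epsilon> x\<bar> = 1 / (1 - E) * (\<epsilon> / r * (m x - E) - E * (L - x))"
      unfolding layer_Q_def m_def[symmetric] mL using n E by simp
    also have "\<dots> \<le> 2 * (\<epsilon> / r * m x)"
    proof (rule mult_mono[OF E'])
      have "\<epsilon> / r * (m x - E) \<le> \<epsilon> / r * m x" using pos mE[OF x] by (intro mult_left_mono) auto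
      moreover have "0 \<le> E * (L - x)" using E x by simp
      ultimately show "\<epsilon> / r * (m x - E) - E * (L - x) \<le> \<epsilon> / r * m x" by linarith
    qed (use n in auto)
    finally show "\<bar>layer_Q L r \<epsilon> x\<bar> \<le> 2 * (\<epsilon> / r) * m x" by simp
  qed
  also have "\<dots> = 2 / r ^ 3 * \<epsilon> ^ 3" using pos by (simp add: power2_eq_square power3_eq_cube field_simps)
  also have "\<dots> \<le> c1 * \<epsilon> ^ 3" unfolding c1_def by (rule mult_right_mono) (use pos in auto)
  finally show "(\<integral>x. (layer_Q L r \<epsilon> x)\<^sup>2 \<partial>seg L) \<le> c1 * \<epsilon> ^ 3" .
qed

end

section \<open>From function spaces to square integrable representatives\<close>

lemma set_integrable_restrict:
  fixes w :: "'a::euclidean_space \<Rightarrow> real"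
  assumes "S \<in> sets borel"
  shows "integrable (lebesgue_on S) w \<longleftrightarrow> set_integrable lebesgue S w" "integral\<^sup>L (lebesgue_on S) w = (LINT z:S|lebesgue. w z)"
  using assms by (simp_all add: integrable_restrict_space integral_restrict_space set_integrable_def set_lebesgue_integral_def)

lemma L2_norm_sq_int: "L2_norm S w = (if sq_int (lebesgue_on S) w then ennreal (sqrt (LINT z|lebesgue_on S. (w z)\<^sup>2)) else \<infinity>)"
  by (simp add: L2_norm_def sq_int_def)

lemma measurable_lebesgue_on_AE:
  fixes w :: "'a::euclidean_space \<Rightarrow> real"
  assumes W: "W \<in> borel_measurable borel" and S: "S \<in> sets borel" and ae: "AE z in lborel. z \<in> S \<longrightarrow> w z = W z"
  shows "w \<in> borel_measurable (lebesgue_on S)"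
  using measurable_ae_eq_lebesgue[OF assms] S by (simp add: borel_measurable_restrict_space_iff mult.commute)

lemma L2_norm_eq:
  fixes w :: "'a::euclidean_space \<Rightarrow> real"
  assumes W: "W \<in> borel_measurable borel" and S: "S \<in> sets borel" and ae: "AE z in lborel. z \<in> S \<longrightarrow> w z = W z"
  shows "L2_norm S w = (if set_integrable lborel S (\<lambda>z. (W z)\<^sup>2) then ennreal (sqrt (LINT z:S|lborel. (W z)\<^sup>2)) else \<infinity>)"
proof -
  have W2: "(\<lambda>z. (W z)\<^sup>2) \<in> borel_measurable borel" using W by measurable
  have ae2: "AE z in lborel. z \<in> S \<longrightarrow> (w z)\<^sup>2 = (W z)\<^sup>2" using ae by eventually_elim simp
  show ?thesis
    using measurable_lebesgue_on_AE[OF assms] set_integral_lebesgue_eq[OF W2 S ae2]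
    by (simp add: L2_norm_def set_integrable_restrict[OF S])
qed

lemma L2_norm_seg:
  assumes W: "W \<in> borel_measurable borel" and ae: "AE x in seg L. w x = W x"
  shows "L2_norm {0<..<L} w = (if integrable (seg L) (\<lambda>x. (W x)\<^sup>2) then ennreal (sqrt (\<integral>x. (W x)\<^sup>2 \<partial>seg L)) else \<infinity>)"
proof -
  have W2: "(\<lambda>z. (W z)\<^sup>2) \<in> borel_measurable borel" using W by measurable
  show ?thesis
    using L2_norm_eq[OF W, of "{0<..<L}" w] ae by (simp add: AE_seg integrable_seg[OF W2] integral_seg[OF W2])
qed

lemma L2_norm_rect:
  assumes W: "sq_int (rect L T) W" and ae: "AE z in rect L T. w z = W z"
  shows "L2_norm (Q L T) w = ennreal (sqrt (\<integral>z. (W z)\<^sup>2 \<partial>rect L T))"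
proof -
  have Wm: "W \<in> borel_measurable borel" using sq_int_rect_borel[OF W] by (simp add: borel_prod)
  then have W2: "(\<lambda>z. (W z)\<^sup>2) \<in> borel_measurable borel" by measurable
  show ?thesis
    using L2_norm_eq[OF Wm Q_sets(1), of L T w] ae sq_int_square[OF W]
    by (simp add: AE_seg_pair integrable_seg_pair[OF W2] integral_seg_pair[OF W2])
qed

lemma sq_int_rect_of_slices:
  assumes W: "W \<in> borel_measurable (borel \<Otimes>\<^sub>M borel)"
    and b: "AE t in seg T. integrable (seg L) (\<lambda>x. (W (x, t))\<^sup>2) \<and> (\<integral>x. (W (x, t))\<^sup>2 \<partial>seg L) \<le> B"
  shows "sq_int (rect L T) W"
  unfolding sq_int_def
proof
  note [measurable] = W
  show "integrable (rect L T) (\<lambda>z. (W z)\<^sup>2)"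
  proof (rule integrableI_bounded)
    have "(\<integral>\<^sup>+ z. ennreal (norm ((W z)\<^sup>2)) \<partial>rect L T) = (\<integral>\<^sup>+ t. \<integral>\<^sup>+ x. ennreal ((W (x, t))\<^sup>2) \<partial>seg L \<partial>seg T)"
      by (subst seg2.nn_integral_snd[symmetric]) simp_all
    also have "\<dots> \<le> (\<integral>\<^sup>+ t. ennreal B \<partial>seg T)"
    proof (rule nn_integral_mono_AE)
      show "AE t in seg T. (\<integral>\<^sup>+ x. ennreal ((W (x, t))\<^sup>2) \<partial>seg L) \<le> ennreal B"
        using b by eventually_elim (auto simp: nn_integral_eq_integral intro!: ennreal_leI)
    qed
    also have "\<dots> < \<infinity>"
    proof -
      have "emeasure (seg T) UNIV < top" using seg.emeasure_finite[of T UNIV] less_top by metis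
      then show ?thesis by (simp add: ennreal_mult_less_top)
    qed
    finally show "(\<integral>\<^sup>+ z. ennreal (norm ((W z)\<^sup>2)) \<partial>rect L T) < \<infinity>" .
  qed measurable
qed (use W in \<open>simp add: rect_measurable\<close>)

text \<open>Elements of the function spaces are Lebesgue measurable only. A Borel representative
  makes slices, Fubini and \<open>prim\<close> applicable.\<close>

definition L2Q :: "real \<Rightarrow> real \<Rightarrow> (real \<times> real \<Rightarrow> real) \<Rightarrow> bool" where
  "L2Q L T w \<longleftrightarrow> (\<exists>W. sq_int (rect L T) W \<and> (AE z in rect L T. w z = W z))"

lemma L2Q_of_bound:
  assumes W: "W \<in> borel_measurable borel" "AE z in rect L T. w z = W z"
    and b: "AE t in seg T. L2_norm {0<..<L} (\<lambda>x. w (x, t)) \<le> ennreal N"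
  shows "L2Q L T w"
proof -
  have Wm [measurable]: "W \<in> borel_measurable (borel \<Otimes>\<^sub>M borel)" using W by (simp add: borel_prod)
  have "sq_int (rect L T) W"
  proof (rule sq_int_rect_of_slices[OF Wm])
    show "AE t in seg T. integrable (seg L) (\<lambda>x. (W (x, t))\<^sup>2) \<and> (\<integral>x. (W (x, t))\<^sup>2 \<partial>seg L) \<le> (max N 0)\<^sup>2"
      using b AE_seg_slice2[OF W(2)]
    proof eventually_elim
      case (elim t)
      have m: "(\<lambda>x. W (x, t)) \<in> borel_measurable borel" by measurable
      have i: "integrable (seg L) (\<lambda>x. (W (x, t))\<^sup>2)"
        using elim(1) unfolding L2_norm_seg[OF m elim(2)] by (auto split: if_splits simp: top_unique)
      then have "ennreal (sqrt (\<integral>x. (W (x, t))\<^sup>2 \<partial>seg L)) \<le> ennreal (max N 0)"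
        using elim(1) unfolding L2_norm_seg[OF m elim(2)] by (cases "N \<ge> 0") (auto simp: ennreal_neg max_def)
      then have "sqrt (\<integral>x. (W (x, t))\<^sup>2 \<partial>seg L) \<le> max N 0" by (subst (asm) ennreal_le_iff) auto
      then have "(sqrt (\<integral>x. (W (x, t))\<^sup>2 \<partial>seg L))\<^sup>2 \<le> (max N 0)\<^sup>2" by (rule power_mono) simp
      with i show ?case by simp
    qed
  qed
  then show ?thesis using W(2) unfolding L2Q_def by blast
qed

lemma Linf_L2_L2Q:
  assumes w: "w \<in> Linf_L2 L T"
  shows "L2Q L T w"
proof -
  have m: "w \<in> borel_measurable (lebesgue_on (Q L T))" and f: "Linf_L2_norm L T w < \<infinity>"
    using w by (auto simp: Linf_L2_def)
  have "(\<lambda>z. w z * indicator (Q L T) z) \<in> borel_measurable (completion lborel)"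
    using m Q_sets(2)[of L T] by (simp add: borel_measurable_restrict_space_iff mult.commute)
  then obtain W where W: "W \<in> borel_measurable lborel" "AE z in lborel. w z * indicator (Q L T) z = W z"
    using completion_ex_borel_measurable_real by blast
  have eq: "AE z in rect L T. w z = W z"
    unfolding AE_seg_pair using W(2) by eventually_elim auto
  obtain N where "Linf_L2_norm L T w = ennreal N" using f by (cases "Linf_L2_norm L T w") auto
  then have "AE t in seg T. L2_norm {0<..<L} (\<lambda>x. w (x, t)) \<le> ennreal N"
    using esssup_AE[where M = "lebesgue_on {0<..<T}" and f = "\<lambda>t. L2_norm {0<..<L} (\<lambda>x. w (x, t))"]
    unfolding AE_seg' Linf_L2_norm_def by simp
  then show ?thesis using L2Q_of_bound[OF _ eq] W(1) by simp
qed

lemma sq_int_diff_bound: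
  assumes "sq_int M f" "sq_int M g"
  shows "(\<integral>x. (f x + g x)\<^sup>2 \<partial>M) \<le> 2 * (\<integral>x. (f x)\<^sup>2 \<partial>M) + 2 * (\<integral>x. (g x)\<^sup>2 \<partial>M)"
proof -
  have "(\<integral>x. (f x + g x)\<^sup>2 \<partial>M) \<le> (\<integral>x. 2 * (f x)\<^sup>2 + 2 * (g x)\<^sup>2 \<partial>M)"
  proof (rule integral_mono)
    show "(f x + g x)\<^sup>2 \<le> 2 * (f x)\<^sup>2 + 2 * (g x)\<^sup>2" for x
      using sum_squares_bound[of "f x" "g x"] by (simp add: power2_sum)
  qed (use sq_int_square[OF assms(1)] sq_int_square[OF assms(2)] sq_int_square[OF sq_int_add[OF assms]] in simp_all)
  then show ?thesis using assms by (simp add: sq_int_square)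
qed

lemma L2_norm_le_real:
  assumes "L2_norm S w \<le> ennreal \<delta>" "\<delta> \<ge> 0"
  shows "sq_int (lebesgue_on S) w" "(LINT z|lebesgue_on S. (w z)\<^sup>2) \<le> \<delta>\<^sup>2"
proof -
  show s: "sq_int (lebesgue_on S) w" using assms unfolding L2_norm_sq_int by (auto split: if_splits simp: top_unique)
  have "sqrt (LINT z|lebesgue_on S. (w z)\<^sup>2) \<le> \<delta>"
    using assms s unfolding L2_norm_sq_int by (simp add: ennreal_le_iff)
  then have "(sqrt (LINT z|lebesgue_on S. (w z)\<^sup>2))\<^sup>2 \<le> \<delta>\<^sup>2" by (rule power_mono) simp
  then show "(LINT z|lebesgue_on S. (w z)\<^sup>2) \<le> \<delta>\<^sup>2" by simp
qed

lemma C_L2_near: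
  assumes w: "w \<in> C_L2 L T" and t: "t \<in> {0..T}" and \<delta>: "\<delta> > 0"
  obtains \<tau> where "\<tau> > 0" "\<And>s. s \<in> {0..T} \<Longrightarrow> \<bar>s - t\<bar> < \<tau> \<Longrightarrow>
    sq_int (lebesgue_on {0<..<L}) (\<lambda>x. w (x, s) - w (x, t)) \<and> (LINT x|lebesgue_on {0<..<L}. (w (x, s) - w (x, t))\<^sup>2) \<le> \<delta>"
proof -
  have "((\<lambda>s. L2_norm {0<..<L} (\<lambda>x. w (x, s) - w (x, t))) \<longlongrightarrow> 0) (at t within {0..T})"
    using w t by (auto simp: C_L2_def)
  from order_tendstoD(2)[OF this, of "ennreal (sqrt \<delta>)"] \<delta>
  have "\<forall>\<^sub>F s in at t within {0..T}. L2_norm {0<..<L} (\<lambda>x. w (x, s) - w (x, t)) < ennreal (sqrt \<delta>)" by simp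
  then obtain \<tau> where \<tau>: "\<tau> > 0" "\<And>s. s \<in> {0..T} \<Longrightarrow> s \<noteq> t \<Longrightarrow> dist s t < \<tau> \<Longrightarrow>
      L2_norm {0<..<L} (\<lambda>x. w (x, s) - w (x, t)) < ennreal (sqrt \<delta>)"
    unfolding eventually_at by auto
  show ?thesis
  proof (rule that[OF \<tau>(1)])
    fix s assume s: "s \<in> {0..T}" "\<bar>s - t\<bar> < \<tau>"
    show "sq_int (lebesgue_on {0<..<L}) (\<lambda>x. w (x, s) - w (x, t)) \<and> (LINT x|lebesgue_on {0<..<L}. (w (x, s) - w (x, t))\<^sup>2) \<le> \<delta>"
    proof (cases "s = t")
      case True
      then show ?thesis using \<delta> by (simp add: sq_int_def)
    next
      case False
      then have "L2_norm {0<..<L} (\<lambda>x. w (x, s) - w (x, t)) \<le> ennreal (sqrt \<delta>)"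
        using \<tau>(2)[OF s(1)] s(2) by (simp add: dist_real_def less_imp_le)
      from L2_norm_le_real[OF this] \<delta> show ?thesis by simp
    qed
  qed
qed

lemma C_L2_slice: "w \<in> C_L2 L T \<Longrightarrow> t \<in> {0..T} \<Longrightarrow> sq_int (lebesgue_on {0<..<L}) (\<lambda>x. w (x, t))"
  by (auto simp: C_L2_def L2_def L2_norm_sq_int split: if_splits)

text \<open>Near each t the squared norm is at most 2 plus twice its value at t; finitely many such
  neighbourhoods cover the compact interval.\<close>

lemma C_L2_bounded:
  assumes w: "w \<in> C_L2 L T"
  obtains N where "\<And>t. t \<in> {0..T} \<Longrightarrow> L2_norm {0<..<L} (\<lambda>x. w (x, t)) \<le> ennreal N"
proof -
  define I where "I t = (LINT x|lebesgue_on {0<..<L}. (w (x, t))\<^sup>2)" for t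
  have "\<forall>t\<in>{0..T}. \<exists>\<tau>>0. \<forall>s\<in>{0..T}. \<bar>s - t\<bar> < \<tau> \<longrightarrow> I s \<le> 2 * 1 + 2 * I t"
  proof
    fix t assume t: "t \<in> {0..T}"
    obtain \<tau> where \<tau>: "\<tau> > 0" "\<And>s. s \<in> {0..T} \<Longrightarrow> \<bar>s - t\<bar> < \<tau> \<Longrightarrow>
      sq_int (lebesgue_on {0<..<L}) (\<lambda>x. w (x, s) - w (x, t)) \<and> (LINT x|lebesgue_on {0<..<L}. (w (x, s) - w (x, t))\<^sup>2) \<le> 1"
      using C_L2_near[OF w t zero_less_one] by blast
    have "I s \<le> 2 * 1 + 2 * I t" if "s \<in> {0..T}" "\<bar>s - t\<bar> < \<tau>" for s
      using sq_int_diff_bound[OF conjunct1[OF \<tau>(2)[OF that]] C_L2_slice[OF w t]] \<tau>(2)[OF that] by (simp add: I_def)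
    then show "\<exists>\<tau>>0. \<forall>s\<in>{0..T}. \<bar>s - t\<bar> < \<tau> \<longrightarrow> I s \<le> 2 * 1 + 2 * I t" using \<tau>(1) by blast
  qed
  then obtain \<tau> where \<tau>: "\<And>t. t \<in> {0..T} \<Longrightarrow> \<tau> t > 0"
    "\<And>t s. t \<in> {0..T} \<Longrightarrow> s \<in> {0..T} \<Longrightarrow> \<bar>s - t\<bar> < \<tau> t \<Longrightarrow> I s \<le> 2 * 1 + 2 * I t" by metis
  have "{0..T} \<subseteq> (\<Union>t\<in>{0..T}. ball t (\<tau> t))" using \<tau>(1) by force
  then obtain C where C: "C \<subseteq> {0..T}" "finite C" "{0..T} \<subseteq> (\<Union>t\<in>C. ball t (\<tau> t))"
    using compactE_image[of "{0..T}" "{0..T}" "\<lambda>t. ball t (\<tau> t)"] by auto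
  have Inn: "I t \<ge> 0" for t by (simp add: I_def)
  show ?thesis
  proof (rule that[of "sqrt (2 + 2 * (\<Sum>t\<in>C. I t))"])
    fix s assume s: "s \<in> {0..T}"
    then obtain t where t: "t \<in> C" "\<bar>s - t\<bar> < \<tau> t" using C(3) by (auto simp: dist_real_def abs_minus_commute)
    have "I s \<le> 2 * 1 + 2 * I t" using \<tau>(2)[of t s] t s C by auto
    also have "I t \<le> (\<Sum>t\<in>C. I t)" by (rule member_le_sum) (use t C Inn in auto)
    finally have "I s \<le> 2 + 2 * (\<Sum>t\<in>C. I t)" by simp
    then show "L2_norm {0<..<L} (\<lambda>x. w (x, s)) \<le> ennreal (sqrt (2 + 2 * (\<Sum>t\<in>C. I t)))"
      using C_L2_slice[OF w s] by (simp add: L2_norm_sq_int I_def ennreal_leI)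
  qed
qed

text \<open>\<open>C_L2\<close> speaks about single slices and contains no joint measurability. That
  comes from local integrability, which a weak derivative has by definition.\<close>

lemma C_L2_L2Q:
  assumes w: "w \<in> C_L2 L T" and l: "loc_integrable (Q L T) w"
  shows "L2Q L T w"
proof -
  obtain W where W: "W \<in> borel_measurable borel" "AE z in rect L T. w z = W z"
    using loc_integrable_borel_rep[OF l] by blast
  obtain N where N: "\<And>t. t \<in> {0..T} \<Longrightarrow> L2_norm {0<..<L} (\<lambda>x. w (x, t)) \<le> ennreal N"
    using C_L2_bounded[OF w] by blast
  have "AE t in seg T. L2_norm {0<..<L} (\<lambda>x. w (x, t)) \<le> ennreal N"
    using AE_seg_mem by eventually_elim (use N in auto)
  then show ?thesis by (rule L2Q_of_bound[OF W])
qed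

lemma Ck_1_frechet_borel:
  assumes "test_function S \<phi>"
  shows "(\<lambda>z. frechet_derivative \<phi> (at z) e) \<in> borel_measurable borel" "continuous_on UNIV (\<lambda>z. frechet_derivative \<phi> (at z) e)"
proof -
  have "Ck (Suc 0) \<phi>" using assms unfolding test_function_def by blast
  from Ck_SucD(2)[OF this, of e] show "continuous_on UNIV (\<lambda>z. frechet_derivative \<phi> (at z) e)" by simp
  then show "(\<lambda>z. frechet_derivative \<phi> (at z) e) \<in> borel_measurable borel" by (rule borel_measurable_continuous_onI)
qed

lemma weak_deriv_cong:
  assumes w: "has_weak_deriv (Q L T) e w v" and ae: "AE z in rect L T. w z = w' z"
  shows "has_weak_deriv (Q L T) e w' v"
proof -
  have lw: "loc_integrable (Q L T) w" using w by (simp add: has_weak_deriv_def)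
  obtain W where W: "W \<in> borel_measurable borel" "AE z in rect L T. w z = W z"
    using loc_integrable_borel_rep[OF lw] by blast
  have W': "AE z in rect L T. w' z = W z" using W(2) ae by eventually_elim simp
  have "loc_integrable (Q L T) w'"
    unfolding loc_integrable_def
  proof (intro allI impI)
    fix K :: "(real \<times> real) set" assume K: "compact K \<and> K \<subseteq> Q L T"
    then have Kb: "K \<in> sets borel" by (auto intro: borel_compact)
    have "AE z in lborel. z \<in> K \<longrightarrow> w z = W z" "AE z in lborel. z \<in> K \<longrightarrow> w' z = W z"
      using W(2) W' unfolding AE_seg_pair by (eventually_elim, use K in auto)+
    then show "set_integrable lebesgue K w'"
      using set_integral_lebesgue_eq(2)[OF W(1) Kb, of w] set_integral_lebesgue_eq(2)[OF W(1) Kb, of w'] lw K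
      unfolding loc_integrable_def by blast
  qed
  moreover have "(LINT z:Q L T|lebesgue. w' z * frechet_derivative \<phi> (at z) e) = (LINT z:Q L T|lebesgue. w z * frechet_derivative \<phi> (at z) e)"
    if "test_function (Q L T) \<phi>" for \<phi>
  proof -
    have m: "(\<lambda>z. W z * frechet_derivative \<phi> (at z) e) \<in> borel_measurable (borel \<Otimes>\<^sub>M borel)"
      using W(1) Ck_1_frechet_borel(1)[OF that] by (simp add: borel_prod)
    show ?thesis
      using set_integral_Q_eq[OF m eventually_mono[OF W(2)], of "\<lambda>z. w z * frechet_derivative \<phi> (at z) e"]
        set_integral_Q_eq[OF m eventually_mono[OF W'], of "\<lambda>z. w' z * frechet_derivative \<phi> (at z) e"] by simp
  qed
  ultimately show ?thesis using w unfolding has_weak_deriv_def by auto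
qed

text \<open>Existence of an integrable trace at x = 0 is part of the notion; its value is left open
  until the boundary conditions are evaluated.\<close>

definition hasx :: "real \<Rightarrow> real \<Rightarrow> (real \<times> real \<Rightarrow> real) \<Rightarrow> (real \<times> real \<Rightarrow> real) \<Rightarrow> bool" where
  "hasx L T W V \<longleftrightarrow> (\<exists>c. integrable (seg T) c \<and> xrep L T W c V)"

definition hast :: "real \<Rightarrow> real \<Rightarrow> (real \<times> real \<Rightarrow> real) \<Rightarrow> (real \<times> real \<Rightarrow> real) \<Rightarrow> bool" where
  "hast L T W V \<longleftrightarrow> (\<exists>d. integrable (seg L) d \<and> (AE z in rect L T. W z = d (fst z) + prim T (\<lambda>s. V (fst z, s)) (snd z)))"

lemma weak_test:
  assumes w: "has_weak_deriv (Q L T) e w v" and W: "sq_int (rect L T) W" "AE z in rect L T. w z = W z"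
    and V: "sq_int (rect L T) V" "AE z in rect L T. v z = V z" and \<phi>: "test_function (Q L T) \<phi>"
  shows "(\<integral>z. W z * frechet_derivative \<phi> (at z) e \<partial>rect L T) = - (\<integral>z. V z * \<phi> z \<partial>rect L T)"
proof -
  have [measurable]: "W \<in> borel_measurable borel" "V \<in> borel_measurable borel"
    using sq_int_rect_borel[OF W(1)] sq_int_rect_borel[OF V(1)] by (simp_all add: borel_prod)
  have [measurable]: "(\<lambda>z. frechet_derivative \<phi> (at z) e) \<in> borel_measurable borel" "\<phi> \<in> borel_measurable borel"
    using Ck_1_frechet_borel(1)[OF \<phi>] borel_measurable_continuous_onI[OF test_function_continuous[OF \<phi>]] by auto
  have "(LINT z:Q L T|lebesgue. w z * frechet_derivative \<phi> (at z) e) = (\<integral>z. W z * frechet_derivative \<phi> (at z) e \<partial>rect L T)"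
    by (rule set_integral_Q_eq) (use W(2) in \<open>auto elim!: eventually_mono simp: borel_prod\<close>)
  moreover have "(LINT z:Q L T|lebesgue. v z * \<phi> z) = (\<integral>z. V z * \<phi> z \<partial>rect L T)"
    by (rule set_integral_Q_eq) (use V(2) in \<open>auto elim!: eventually_mono simp: borel_prod\<close>)
  moreover have "(LINT z:Q L T|lebesgue. w z * frechet_derivative \<phi> (at z) e) = - (LINT z:Q L T|lebesgue. v z * \<phi> z)"
    using w \<phi> unfolding has_weak_deriv_def by blast
  ultimately show ?thesis by simp
qed

lemma weak_x_hasx:
  assumes w: "weak_x L T w v" and W: "sq_int (rect L T) W" "AE z in rect L T. w z = W z"
    and V: "sq_int (rect L T) V" "AE z in rect L T. v z = V z" and pos: "L > 0" "T > 0"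
  shows "hasx L T W V"
proof -
  have "(\<integral>z. W z * (deriv a (fst z) * b (snd z)) \<partial>rect L T) = - (\<integral>z. V z * (a (fst z) * b (snd z)) \<partial>rect L T)"
    if ab: "test_function {0<..<L} a" "test_function {0<..<T} b" for a b
    using weak_test[OF w W V] test_function_product(1)[OF ab] unfolding Q_def[symmetric] test_function_product(2)[OF ab, symmetric] by blast
  from weak_representation[OF pos(1) sq_int_rect_integrable[OF W(1)] sq_int_rect_integrable[OF V(1)] this pos(2)]
  show ?thesis unfolding hasx_def xrep_def by blast
qed

lemma weak_t_hast:
  assumes w: "weak_t L T w v" and W: "sq_int (rect L T) W" "AE z in rect L T. w z = W z"
    and V: "sq_int (rect L T) V" "AE z in rect L T. v z = V z" and pos: "L > 0" "T > 0"
  shows "hast L T W V"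
proof -
  note [measurable] = sq_int_rect_borel[OF W(1)] sq_int_rect_borel[OF V(1)]
  \<comment> \<open>The representation in t is \<open>weak_representation\<close> with the two
    variables exchanged.\<close>
  have swap: "(\<integral>z. f (snd z, fst z) \<partial>rect T L) = (\<integral>z. f z \<partial>rect L T)" "integrable (rect L T) f \<Longrightarrow> integrable (rect T L) (\<lambda>z. f (snd z, fst z))"
    if "f \<in> borel_measurable (borel \<Otimes>\<^sub>M borel)" for f :: "real \<times> real \<Rightarrow> real"
    using seg2.integral_product_swap[of f L T] seg2.integrable_product_swap[of L T f] that
    by (simp_all add: rect_measurable split_beta')
  have "(\<integral>z. W (snd z, fst z) * (deriv b (fst z) * a (snd z)) \<partial>rect T L) = - (\<integral>z. V (snd z, fst z) * (b (fst z) * a (snd z)) \<partial>rect T L)"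
    if b: "test_function {0<..<T} b" and a: "test_function {0<..<L} a" for a b
  proof -
    have [measurable]: "a \<in> borel_measurable borel" "b \<in> borel_measurable borel" "deriv b \<in> borel_measurable borel"
      using test_function_borel[OF a] test_function_borel[OF b] test_function_borel[OF test_function_deriv[OF b pos(2)]] by auto
    have "(\<integral>z. W z * (a (fst z) * deriv b (snd z)) \<partial>rect L T) = - (\<integral>z. V z * (a (fst z) * b (snd z)) \<partial>rect L T)"
      using weak_test[OF w W V] test_function_product(1)[OF a b] unfolding Q_def[symmetric] test_function_product(3)[OF a b, symmetric] by blast
    then show ?thesis
      using swap(1)[of "\<lambda>z. W z * (a (fst z) * deriv b (snd z))"] swap(1)[of "\<lambda>z. V z * (a (fst z) * b (snd z))"]
      by (simp add: mult.commute)
  qed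
  from weak_representation[OF pos(2) swap(2)[OF _ sq_int_rect_integrable[OF W(1)]] swap(2)[OF _ sq_int_rect_integrable[OF V(1)]] this pos(1)]
  obtain d where d: "integrable (seg L) d" "AE z in rect T L. W (snd z, fst z) = d (snd z) + prim T (\<lambda>y. V (snd z, y)) (fst z)"
    by (auto simp: sq_int_rect_borel[OF W(1)] sq_int_rect_borel[OF V(1)])
  have [measurable]: "d \<in> borel_measurable borel" using d by (auto dest: seg_borel)
  have "AE z in rect L T. W z = d (fst z) + prim T (\<lambda>s. V (fst z, s)) (snd z)"
    using AE_seg_slice2[OF d(2)] by (intro AE_seg_pairI1) (simp_all add: borel_prod[symmetric])
  then show ?thesis unfolding hast_def using d(1) by blast
qed

text \<open>The converse of \<open>weak_x_hasx\<close>. It exhibits the weak derivatives of the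
  corrected differences whose existence the final statement claims.\<close>

lemma xrep_imp_weak_x:
  assumes rep: "xrep L T W c V" and c: "integrable (seg T) c" and W: "sq_int (rect L T) W" "AE z in rect L T. w z = W z"
    and V: "sq_int (rect L T) V" and pos: "L > 0" "T > 0"
  shows "weak_x L T w V"
proof -
  note [measurable] = sq_int_rect_borel[OF W(1)] sq_int_rect_borel[OF V(1)]
  have lV: "loc_integrable (Q L T) V" by (rule loc_integrable_rect[OF sq_int_rect_integrable[OF V]])
  have lW: "loc_integrable (Q L T) W" by (rule loc_integrable_rect[OF sq_int_rect_integrable[OF W(1)]])
  have "weak_x L T W V"
    unfolding has_weak_deriv_def
  proof (intro conjI allI impI lV lW)
    fix \<phi> :: "real \<times> real \<Rightarrow> real" assume \<phi>: "test_function (Q L T) \<phi>"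
    define D where "D z = frechet_derivative \<phi> (at z) (1, 0)" for z
    note Db = Ck_1_frechet_borel[OF \<phi>, of "(1, 0)", folded D_def[abs_def]]
    note \<phi>c = test_function_continuous[OF \<phi>]
    have [measurable]: "D \<in> borel_measurable (borel \<Otimes>\<^sub>M borel)" "\<phi> \<in> borel_measurable (borel \<Otimes>\<^sub>M borel)"
      using Db(1) borel_measurable_continuous_onI[OF \<phi>c] by (simp_all add: borel_prod)
    \<comment> \<open>Only values on the cylinder count for \<open>rect L T\<close>, and there a
      continuous function is bounded, by compactness of the closed rectangle.\<close>
    have bdd: "\<exists>B. \<forall>z. \<bar>indicator (Q L T) z * f z\<bar> \<le> B" if f: "continuous_on UNIV f" for f :: "real \<times> real \<Rightarrow> real"
    proof -
      have "compact (f ` ({0..L} \<times> {0..T}))"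
        by (intro compact_continuous_image continuous_on_subset[OF f] compact_Times) auto
      then obtain B where B: "\<And>z. z \<in> {0..L} \<times> {0..T} \<Longrightarrow> \<bar>f z\<bar> \<le> B"
        using compact_imp_bounded[of "f ` ({0..L} \<times> {0..T})"] unfolding bounded_iff by fastforce
      have "\<bar>indicator (Q L T) z * f z\<bar> \<le> \<bar>B\<bar>" for z
        using B[of z] by (auto simp: indicator_def Q_def abs_mult)
      then show ?thesis by blast
    qed
    have int: "integrable (rect L T) (\<lambda>z. g z * f z)" if g: "sq_int (rect L T) g" and f: "continuous_on UNIV f" for f g :: "real \<times> real \<Rightarrow> real"
    proof -
      have [measurable]: "f \<in> borel_measurable (borel \<Otimes>\<^sub>M borel)" using borel_measurable_continuous_onI[OF f] by (simp add: borel_prod)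
      have [measurable]: "Q L T \<in> sets (borel \<Otimes>\<^sub>M borel)" unfolding Q_def by (rule pair_measureI) auto
      note [measurable] = sq_int_rect_borel[OF g]
      obtain B where "\<And>z. \<bar>indicator (Q L T) z * f z\<bar> \<le> B" using bdd[OF f] by blast
      then have "integrable (rect L T) (\<lambda>z. g z * (indicator (Q L T) z * f z))"
        by (intro integrable_mult_bounded[OF sq_int_rect_integrable[OF g]]) auto
      then show ?thesis
        by (rule integrable_cong_AE_imp) (auto simp: AE_seg_pair)
    qed
    have "AE t in seg T. (\<integral>x. W (x, t) * D (x, t) \<partial>seg L) = (\<integral>x. - (V (x, t) * \<phi> (x, t)) \<partial>seg L)"
      using xrep_slice[OF rep] sq_int_slices(2)[OF V] sq_int_slices(2)[OF W(1)]
        integrable_rect_slices(2)[OF int[OF W(1) Db(2)]] integrable_rect_slices(2)[OF int[OF V \<phi>c]]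
    proof eventually_elim
      case (elim t)
      have Vi: "integrable (seg L) (\<lambda>x. V (x, t))" by (rule sq_int_integrable[OF finite_measure_seg elim(2)])
      have d: "((\<lambda>x. \<phi> (x, t)) has_real_derivative D (x, t)) (at x within S)" for x S
      proof -
        have "(\<phi> has_derivative frechet_derivative \<phi> (at (x, t))) (at (x, t))"
          by (rule Ck_SucD(1)[of 0]) (use \<phi> in \<open>unfold test_function_def, blast\<close>)
        moreover have "((\<lambda>x. (x, t)) has_derivative (\<lambda>h. (h, 0))) (at x)"
          by (auto intro!: derivative_eq_intros)
        ultimately have "((\<lambda>x. \<phi> (x, t)) has_derivative (\<lambda>h. frechet_derivative \<phi> (at (x, t)) (h, 0))) (at x)"
          using diff_chain_at[of "\<lambda>x. (x, t)" "\<lambda>h. (h, 0)" x \<phi>] by (simp add: o_def)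
        moreover have "frechet_derivative \<phi> (at (x, t)) (h, 0) = D (x, t) * h" for h
        proof -
          have "linear (frechet_derivative \<phi> (at (x, t)))"
            using \<open>(\<phi> has_derivative frechet_derivative \<phi> (at (x, t))) (at (x, t))\<close> by (rule has_derivative_linear)
          from linear_scale[OF this, of h "(1, 0)"] show ?thesis by (simp add: D_def mult.commute)
        qed
        ultimately show ?thesis
          by (simp add: has_field_derivative_def has_derivative_at_withinI)
      qed
      have Dc: "continuous_on UNIV (\<lambda>x. D (x, t))"
        by (rule continuous_on_compose2[OF Db(2)]) (auto intro!: continuous_intros)
      have Dm: "(\<lambda>x. D (x, t)) \<in> borel_measurable borel" by (rule borel_measurable_continuous_onI[OF Dc])
      have out: "\<phi> (x, t) = 0" if "x \<notin> {0<..<L}" for x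
        by (rule test_function_outside[OF \<phi>]) (use that in \<open>auto simp: Q_def\<close>)
      have p: "\<phi> (x, t) = 0 + prim L (\<lambda>x. D (x, t)) x" if "x \<in> {0..L}" for x
        using prim_deriv(1)[OF d continuous_on_subset[OF Dc subset_UNIV] Dm that] out[of 0] by simp
      have Di: "integrable (seg L) (\<lambda>x. D (x, t))"
        by (rule sq_int_integrable[OF finite_measure_seg sq_int_continuous[OF Dc]])
      have "(\<integral>x. V (x, t) * \<phi> (x, t) + W (x, t) * D (x, t) \<partial>seg L) =
        (\<integral>x. V (x, t) * (0 + prim L (\<lambda>x. D (x, t)) x) + (c t + prim L (\<lambda>x. V (x, t)) x) * D (x, t) \<partial>seg L)"
      proof (rule integral_cong_AE)
        show "AE x in seg L. V (x, t) * \<phi> (x, t) + W (x, t) * D (x, t) =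
          V (x, t) * (0 + prim L (\<lambda>x. D (x, t)) x) + (c t + prim L (\<lambda>x. V (x, t)) x) * D (x, t)"
          using elim(1) AE_seg_mem by eventually_elim (use p in auto)
      qed measurable
      also have "\<dots> = (c t + integral\<^sup>L (seg L) (\<lambda>x. V (x, t))) * (0 + integral\<^sup>L (seg L) (\<lambda>x. D (x, t))) - c t * 0"
        by (rule integration_by_parts_prim[OF Vi Di])
      also have "integral\<^sup>L (seg L) (\<lambda>x. D (x, t)) = 0"
        using p[of L] out[of L] pos Dm by (simp add: prim_ge)
      finally show ?case using elim(4,5) by simp
    qed
    then have "(\<integral>t. \<integral>x. W (x, t) * D (x, t) \<partial>seg L \<partial>seg T) = (\<integral>t. \<integral>x. - (V (x, t) * \<phi> (x, t)) \<partial>seg L \<partial>seg T)"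
      by (intro integral_cong_AE) measurable
    then have "(\<integral>z. W z * D z \<partial>rect L T) = - (\<integral>z. V z * \<phi> z \<partial>rect L T)"
      using integrable_rect_slices(6)[OF int[OF W(1) Db(2)]] integrable_rect_slices(6)[OF int[OF V \<phi>c]] by simp
    moreover have "(LINT z:Q L T|lebesgue. W z * D z) = (\<integral>z. W z * D z \<partial>rect L T)" "(LINT z:Q L T|lebesgue. V z * \<phi> z) = (\<integral>z. V z * \<phi> z \<partial>rect L T)"
      by (rule set_integral_Q_eq; measurable)+
    ultimately show "(LINT z:Q L T|lebesgue. W z * frechet_derivative \<phi> (at z) (1, 0)) = - (LINT z:Q L T|lebesgue. V z * \<phi> z)"
      by (simp add: D_def)
  qed
  then show ?thesis by (rule weak_deriv_cong) (use W(2) in \<open>auto elim!: eventually_mono\<close>)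
qed

section \<open>Initial and boundary values\<close>

lemma AE_seg_ex_small:
  assumes "AE s in seg T. P s" "\<tau> > 0" "T > 0"
  obtains s where "0 < s" "s < \<tau>" "s < T" "P s"
proof -
  have "\<exists>s\<in>{0<..<min \<tau> T}. P s"
  proof (rule ccontr)
    assume "\<not> ?thesis"
    then have "AE s in lborel. s \<notin> {0<..<min \<tau> T}"
      using assms(1) unfolding AE_seg by (auto elim!: eventually_mono)
    then have "emeasure lborel {0<..<min \<tau> T} = 0"
      using AE_iff_null_sets[of "{0<..<min \<tau> T}" lborel] by (auto dest: null_setsD1)
    then show False using assms by simp
  qed
  then show ?thesis using that by auto
qed

lemma prim_const_1: "t \<in> {0..T} \<Longrightarrow> prim T (\<lambda>_. 1) t = t"
  using prim_deriv(1)[of T "\<lambda>t. t" "\<lambda>_. 1" t] by (auto intro!: derivative_eq_intros)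

lemma prim_square_le:
  assumes g: "sq_int (seg T) g" and t: "t \<in> {0..T}"
  shows "(prim T g t)\<^sup>2 \<le> t * (\<integral>s. (g s)\<^sup>2 \<partial>seg T)"
proof -
  have i: "sq_int (seg T) (indicator {..t})"
    by (rule sq_int_bound[of _ "\<lambda>_. 1"]) (auto simp: indicator_def)
  have "(\<integral>s. (indicator {..t} s)\<^sup>2 \<partial>seg T) = prim T (\<lambda>_. 1) t"
    unfolding prim_def by (intro Bochner_Integration.integral_cong) (auto simp: indicator_def)
  then show ?thesis
    using Cauchy_Schwarz_sq_int[OF i g] prim_const_1[OF t] by (simp add: prim_def)
qed

lemma sq_int_prim_x:
  assumes g: "sq_int (rect L T) g"
  shows "sq_int (rect L T) (\<lambda>z. prim L (\<lambda>y. g (y, snd z)) (fst z))"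
proof (rule sq_int_bound)
  note [measurable] = sq_int_rect_borel[OF g]
  show "integrable (rect L T) (\<lambda>z. L * (\<integral>y. (g (y, snd z))\<^sup>2 \<partial>seg L))"
    using integrable_rect_snd[OF integrable_rect_slices(4)[OF sq_int_square[OF g]]] by simp
  show "(\<lambda>z. prim L (\<lambda>y. g (y, snd z)) (fst z)) \<in> borel_measurable (rect L T)" by measurable
  have "AE t in seg T. AE x in seg L. (prim L (\<lambda>y. g (y, t)) x)\<^sup>2 \<le> L * (\<integral>y. (g (y, t))\<^sup>2 \<partial>seg L)"
    using sq_int_slices(2)[OF g]
  proof eventually_elim
    case (elim t)
    show ?case
      using AE_seg_mem
    proof eventually_elim
      case (elim x)
      have "(prim L (\<lambda>y. g (y, t)) x)\<^sup>2 \<le> x * (\<integral>y. (g (y, t))\<^sup>2 \<partial>seg L)"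
        by (rule prim_square_le) (use elim \<open>sq_int (seg L) (\<lambda>x. g (x, t))\<close> in auto)
      also have "\<dots> \<le> L * (\<integral>y. (g (y, t))\<^sup>2 \<partial>seg L)" using elim by (intro mult_right_mono) auto
      finally show ?case .
    qed
  qed
  then show "AE z in rect L T. (prim L (\<lambda>y. g (y, snd z)) (fst z))\<^sup>2 \<le> L * (\<integral>y. (g (y, snd z))\<^sup>2 \<partial>seg L)"
    by (intro AE_seg_pairI2) (simp_all add: borel_prod[symmetric])
qed

text \<open>Zero initial value in L^2, phrased with almost every small time, so that it does not
  depend on the representative of \<open>W\<close>.\<close>

definition vanishes_initially :: "real \<Rightarrow> real \<Rightarrow> (real \<times> real \<Rightarrow> real) \<Rightarrow> bool" where
  "vanishes_initially L T W \<longleftrightarrow> (\<forall>\<delta>>0. \<exists>\<tau>>0. AE s in seg T. s < \<tau> \<longrightarrow> (\<integral>x. (W (x, s))\<^sup>2 \<partial>seg L) \<le> \<delta>)"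

text \<open>The initial value d satisfies d^2 \<le> 2 W(.,t)^2 + 2 t m with m the time integral of
  V^2. Integrated in x and evaluated at small good times, this forces \<integral> d^2 = 0.\<close>

lemma hast_trep:
  assumes h: "hast L T W V" and W: "sq_int (rect L T) W" and V: "sq_int (rect L T) V" and T: "T > 0"
    and ini: "vanishes_initially L T W"
  shows "trep L T W V"
proof -
  note [measurable] = sq_int_rect_borel[OF W] sq_int_rect_borel[OF V]
  obtain d where d: "integrable (seg L) d" and rep: "AE z in rect L T. W z = d (fst z) + prim T (\<lambda>s. V (fst z, s)) (snd z)"
    using h unfolding hast_def by blast
  have [measurable]: "d \<in> borel_measurable borel" using d by (rule seg_borel)
  define m where "m x = (\<integral>s. (V (x, s))\<^sup>2 \<partial>seg T)" for x
  have m: "integrable (seg L) m" unfolding m_def[abs_def] by (rule integrable_rect_slices(3)[OF sq_int_square[OF V]])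
  have "AE x in seg L. AE t in seg T. (d x)\<^sup>2 \<le> 2 * (W (x, t))\<^sup>2 + 2 * t * m x"
    using AE_seg_slice1[OF rep] sq_int_slices(1)[OF V]
  proof eventually_elim
    case (elim x)
    show ?case
      using elim(1) AE_seg_mem
    proof eventually_elim
      case (elim t)
      have t: "t \<in> {0..T}" using elim by simp
      have "d x = W (x, t) + (- prim T (\<lambda>s. V (x, s)) t)" using elim(1) by simp
      then have "(d x)\<^sup>2 \<le> 2 * (W (x, t))\<^sup>2 + 2 * (prim T (\<lambda>s. V (x, s)) t)\<^sup>2"
        using sum_squares_bound[of "W (x, t)" "- prim T (\<lambda>s. V (x, s)) t"] by (simp add: power2_diff)
      then show ?case
        using prim_square_le[OF \<open>sq_int (seg T) (\<lambda>t. V (x, t))\<close> t] by (simp add: m_def)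
    qed
  qed
  then have "AE z in rect L T. (d (fst z))\<^sup>2 \<le> 2 * (W z)\<^sup>2 + 2 * snd z * m (fst z)"
    by (intro AE_seg_pairI1) (simp_all add: borel_prod[symmetric] m_def)
  then have sl: "AE t in seg T. AE x in seg L. (d x)\<^sup>2 \<le> 2 * (W (x, t))\<^sup>2 + 2 * t * m x"
    using AE_seg_slice2 by fastforce
  have bound: "AE t in seg T. integrable (seg L) (\<lambda>x. (d x)\<^sup>2) \<and>
      (\<integral>x. (d x)\<^sup>2 \<partial>seg L) \<le> 2 * (\<integral>x. (W (x, t))\<^sup>2 \<partial>seg L) + 2 * t * integral\<^sup>L (seg L) m"
    using sl sq_int_slices(2)[OF W]
  proof eventually_elim
    case (elim t)
    note w2 = sq_int_square[OF elim(2)]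
    have "sq_int (seg L) d"
      by (rule sq_int_bound[OF _ _ elim(1)]) (use w2 m in simp_all)
    then have d2: "integrable (seg L) (\<lambda>x. (d x)\<^sup>2)" by (rule sq_int_square)
    have "(\<integral>x. (d x)\<^sup>2 \<partial>seg L) \<le> (\<integral>x. 2 * (W (x, t))\<^sup>2 + 2 * t * m x \<partial>seg L)"
      by (rule integral_mono_AE[OF d2 _ elim(1)]) (use w2 m in simp)
    then show ?case using d2 w2 m by simp
  qed
  \<comment> \<open>The claim does not involve t, so one good time is enough to make d square
    integrable.\<close>
  obtain t0 where i: "integrable (seg L) (\<lambda>x. (d x)\<^sup>2)"
    by (rule AE_seg_ex_small[OF bound zero_less_one T]) blast
  have M: "integral\<^sup>L (seg L) m \<ge> 0" unfolding m_def by (intro Bochner_Integration.integral_nonneg) auto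
  have "(\<integral>x. (d x)\<^sup>2 \<partial>seg L) \<le> \<delta>" if \<delta>: "\<delta> > 0" for \<delta>
  proof -
    obtain \<tau> where \<tau>: "\<tau> > 0" "AE s in seg T. s < \<tau> \<longrightarrow> (\<integral>x. (W (x, s))\<^sup>2 \<partial>seg L) \<le> \<delta> / 4"
      using ini[unfolded vanishes_initially_def, rule_format, of "\<delta> / 4"] \<delta> by auto
    \<comment> \<open>The second entry keeps 2 s \<integral> m below \<delta> / 2; the + 1 guards
      against a vanishing integral.\<close>
    define \<tau>' where "\<tau>' = min \<tau> (\<delta> / (4 * (integral\<^sup>L (seg L) m + 1)))"
    have "\<tau>' > 0" using \<tau> \<delta> M by (simp add: \<tau>'_def)
    from \<tau>(2) bound have "AE s in seg T. (s < \<tau> \<longrightarrow> (\<integral>x. (W (x, s))\<^sup>2 \<partial>seg L) \<le> \<delta> / 4) \<and>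
      (\<integral>x. (d x)\<^sup>2 \<partial>seg L) \<le> 2 * (\<integral>x. (W (x, s))\<^sup>2 \<partial>seg L) + 2 * s * integral\<^sup>L (seg L) m"
      by eventually_elim simp
    from AE_seg_ex_small[OF this \<open>\<tau>' > 0\<close> T] obtain s where s: "0 < s" "s < \<tau>'"
      "s < \<tau> \<longrightarrow> (\<integral>x. (W (x, s))\<^sup>2 \<partial>seg L) \<le> \<delta> / 4"
      "(\<integral>x. (d x)\<^sup>2 \<partial>seg L) \<le> 2 * (\<integral>x. (W (x, s))\<^sup>2 \<partial>seg L) + 2 * s * integral\<^sup>L (seg L) m" by blast
    have "s * integral\<^sup>L (seg L) m \<le> \<delta> / 4"
    proof -
      have "s * integral\<^sup>L (seg L) m \<le> \<delta> / (4 * (integral\<^sup>L (seg L) m + 1)) * (integral\<^sup>L (seg L) m + 1)"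
        using s M \<delta> by (intro mult_mono) (auto simp: \<tau>'_def)
      also have "\<dots> = \<delta> / 4" using M by (simp add: field_simps)
      finally show ?thesis .
    qed
    moreover have "(\<integral>x. (W (x, s))\<^sup>2 \<partial>seg L) \<le> \<delta> / 4" using s by (simp add: \<tau>'_def)
    ultimately show ?thesis using s(4) by simp
  qed
  then have "(\<integral>x. (d x)\<^sup>2 \<partial>seg L) \<le> 0" by (meson dense_ge)
  then have "(\<integral>x. (d x)\<^sup>2 \<partial>seg L) = 0" by (intro antisym) auto
  then have "AE x in seg L. (d x)\<^sup>2 = 0" using integral_nonneg_eq_0_iff_AE[OF i] by simp
  then have "AE x in seg L. d x = 0" by eventually_elim simp
  then have "AE x in seg L. AE t in seg T. W (x, t) = prim T (\<lambda>s. V (x, s)) t"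
    using AE_seg_slice1[OF rep] by eventually_elim simp
  then show ?thesis
    unfolding trep_def by (intro AE_seg_pairI1) (simp_all add: borel_prod[symmetric])
qed

text \<open>The trace at \<open>x = 0\<close> is differentiable in time because the mixed derivative exists; comparing
  the two representations for fixed \<open>x\<close> separates the variables.\<close>

lemma mixed_representation:
  assumes F: "sq_int (rect L T) F" "sq_int (rect L T) Fx" "sq_int (rect L T) Ft" "sq_int (rect L T) Fxt"
    and x: "xrep L T F c Fx" and c: "integrable (seg T) c" and t: "trep L T F Ft" and xt: "hast L T Fx Fxt"
    and pos: "L > 0" "T > 0"
  obtains p where "sq_int (seg T) p" "AE t in seg T. c t = prim T p t" "trep L T Fx Fxt" "xrep L T Ft p Fxt"
proof -
  note [measurable] = sq_int_rect_borel[OF F(1)] sq_int_rect_borel[OF F(2)] sq_int_rect_borel[OF F(3)] sq_int_rect_borel[OF F(4)]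
    seg_borel[OF c]
  obtain d where d: "integrable (seg L) d" and rep: "AE z in rect L T. Fx z = d (fst z) + prim T (\<lambda>s. Fxt (fst z, s)) (snd z)"
    using xt unfolding hast_def by blast
  have [measurable]: "d \<in> borel_measurable borel" using d by (rule seg_borel)
  \<comment> \<open>\<open>R\<close> is the part of F_t not produced by F_xt. It must be c' and
    hence independent of x, which the rest of the proof establishes.\<close>
  define R where "R z = Ft z - prim L (\<lambda>y. Fxt (y, snd z)) (fst z)" for z
  have Rsq: "sq_int (rect L T) R" unfolding R_def by (rule sq_int_diff[OF F(3) sq_int_prim_x[OF F(4)]])
  note Ri = sq_int_rect_integrable[OF Rsq]
  have [measurable]: "R \<in> borel_measurable (borel \<Otimes>\<^sub>M borel)" by (rule sq_int_rect_borel[OF Rsq])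
  have "AE t in seg T. AE x in seg L. F (x, t) = c t + prim L d x + prim L (\<lambda>y. prim T (\<lambda>s. Fxt (y, s)) t) x"
    using xrep_slice[OF x] AE_seg_slice2[OF rep] sq_int_slices(2)[OF F(2)]
  proof eventually_elim
    case (elim t)
    have Fxi: "integrable (seg L) (\<lambda>x. Fx (x, t))" by (rule sq_int_integrable[OF finite_measure_seg elim(3)])
    have "integrable (seg L) (\<lambda>x. Fx (x, t) - d x)" using Fxi d by simp
    then have i: "integrable (seg L) (\<lambda>y. prim T (\<lambda>s. Fxt (y, s)) t)"
      by (rule integrable_cong_AE_imp) (use elim(2) in \<open>auto elim!: eventually_mono\<close>)
    have "prim L (\<lambda>y. Fx (y, t)) x = prim L d x + prim L (\<lambda>y. prim T (\<lambda>s. Fxt (y, s)) t) x" for x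
      unfolding prim_add[OF d i, symmetric] by (rule prim_cong_AE'[OF Fxi]) (use d i elim(2) in auto)
    then show ?case using elim(1) by (simp add: add.assoc)
  qed
  then have "AE z in rect L T. F z = c (snd z) + prim L d (fst z) + prim L (\<lambda>y. prim T (\<lambda>s. Fxt (y, s)) (snd z)) (fst z)"
    by (intro AE_seg_pairI2) (simp_all add: borel_prod[symmetric])
  then have Fx1: "AE x in seg L. AE t in seg T. F (x, t) = c t + prim L d x + prim L (\<lambda>y. prim T (\<lambda>s. Fxt (y, s)) t) x"
    using AE_seg_slice1 by fastforce
  have swap: "prim L (\<lambda>y. prim T (\<lambda>s. Fxt (y, s)) t) x = prim T (\<lambda>s. prim L (\<lambda>y. Fxt (y, s)) x) t" for x t
  proof -
    have "integrable (rect L T) (\<lambda>z. Fxt z * indicator {..x} (fst z))"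
      by (rule integrable_mult_bounded[OF sq_int_rect_integrable[OF F(4)], where B = 1]) (auto split: split_indicator)
    from integral_prim_swap(1)[OF this, of t] show ?thesis
      by (simp add: prim_def[of L] mult.commute[of "Fxt _"] prim_cmult)
  qed
  have AR: "AE x in seg L. AE t in seg T. prim T (\<lambda>s. R (x, s)) t = c t + prim L d x"
    using Fx1 trep_slice[OF t] sq_int_slices(1)[OF F(3)] sq_int_slices(1)[OF sq_int_prim_x[OF F(4)]]
  proof eventually_elim
    case (elim x)
    have i: "integrable (seg T) (\<lambda>s. Ft (x, s))" "integrable (seg T) (\<lambda>s. prim L (\<lambda>y. Fxt (y, s)) x)"
      using sq_int_integrable[OF finite_measure_seg elim(3)] sq_int_integrable[OF finite_measure_seg elim(4)] by auto
    show ?case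
      using elim(1,2)
    proof eventually_elim
      case (elim t)
      then show ?case unfolding R_def fst_conv snd_conv prim_diff[OF i] swap by simp
    qed
  qed
  \<comment> \<open>Averaging in x gives a candidate for c' that is square integrable in t by
    Cauchy-Schwarz.\<close>
  define p where "p s = (\<integral>x. R (x, s) \<partial>seg L) / L" for s
  have p: "integrable (seg T) p" unfolding p_def[abs_def] using integrable_rect_slices(4)[OF Ri] by simp
  have psq: "sq_int (seg T) p"
  proof (rule sq_int_bound)
    show "integrable (seg T) (\<lambda>s. (\<integral>x. (R (x, s))\<^sup>2 \<partial>seg L) / L)"
      using integrable_rect_slices(4)[OF sq_int_square[OF Rsq]] by simp
    show "p \<in> borel_measurable (seg T)" using p by auto
    show "AE s in seg T. (p s)\<^sup>2 \<le> (\<integral>x. (R (x, s))\<^sup>2 \<partial>seg L) / L"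
      using sq_int_slices(2)[OF Rsq]
    proof eventually_elim
      case (elim s)
      have "(\<integral>x. R (x, s) \<partial>seg L)\<^sup>2 \<le> (\<integral>x. (R (x, s))\<^sup>2 \<partial>seg L) * L"
        using Cauchy_Schwarz_sq_int[OF elim sq_int_const[OF finite_measure_seg], of 1] pos by (simp add: measure_seg)
      then show ?case using pos by (simp add: p_def power_divide power2_eq_square[of L] field_simps)
    qed
  qed
  define K where "K = (\<integral>x. prim L d x \<partial>seg L) / L"
  have pd: "integrable (seg L) (prim L d)" using prim_mult(3)[OF d, of "\<lambda>_. 1"] by simp
  have "AE z in rect L T. prim T (\<lambda>s. R (fst z, s)) (snd z) = c (snd z) + prim L d (fst z)"
    using AR by (intro AE_seg_pairI1) (simp_all add: borel_prod[symmetric])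
  then have "AE t in seg T. AE x in seg L. prim T (\<lambda>s. R (x, s)) t = c t + prim L d x"
    using AE_seg_slice2 by fastforce
  then have cp: "AE t in seg T. c t = prim T p t - K"
  proof eventually_elim
    case (elim t)
    have "(\<integral>x. prim T (\<lambda>s. R (x, s)) t \<partial>seg L) = (\<integral>x. c t + prim L d x \<partial>seg L)"
      by (rule integral_cong_AE) (use elim in measurable)
    also have "\<dots> = L * c t + L * K" using pd pos by (simp add: K_def measure_seg)
    finally have "prim T (\<lambda>s. \<integral>x. R (x, s) \<partial>seg L) t = L * c t + L * K"
      using integral_prim_swap(1)[OF Ri] by simp
    moreover have "prim T p t = prim T (\<lambda>s. \<integral>x. R (x, s) \<partial>seg L) t / L"
      unfolding p_def[abs_def] using prim_cmult[of T "1 / L"] by simp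
    ultimately have "prim T p t = (L * (c t + K)) / L" by (simp add: distrib_left)
    then show ?case using pos by simp
  qed
  \<comment> \<open>For fixed x a constant plus a primitive in t vanishes, so
    \<open>prim_eq_zero\<close> yields both that \<open>prim L d x\<close> is the constant
    \<open>K\<close> and that R(x, .) = p.\<close>
  have sep: "AE x in seg L. prim L d x = K \<and> (AE s in seg T. R (x, s) = p s)"
    using AR sq_int_slices(1)[OF Rsq]
  proof eventually_elim
    case (elim x)
    have Rx: "integrable (seg T) (\<lambda>s. R (x, s))" by (rule sq_int_integrable[OF finite_measure_seg elim(2)])
    have "AE t in seg T. (K - prim L d x) + prim T (\<lambda>s. R (x, s) - p s) t = 0"
      using elim(1) cp by eventually_elim (simp add: prim_diff[OF Rx p])
    from prim_eq_zero[OF _ pos(2) this] Rx p show ?case by (auto elim!: eventually_mono)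
  qed
  \<comment> \<open>\<open>prim L d\<close> is constant and starts from 0, so the constant and
    \<open>d\<close> both vanish: the trace \<open>c\<close> starts from zero.\<close>
  have "AE x in seg L. - K + prim L d x = 0" using sep by eventually_elim simp
  from prim_eq_zero[OF d pos(1) this] have K: "K = 0" and d0: "AE x in seg L. d x = 0" by auto
  show ?thesis
  proof (rule that[OF psq])
    show "AE t in seg T. c t = prim T p t" using cp K by simp
    have "AE x in seg L. AE t in seg T. Fx (x, t) = prim T (\<lambda>s. Fxt (x, s)) t"
      using d0 AE_seg_slice1[OF rep] by eventually_elim simp
    then show "trep L T Fx Fxt" unfolding trep_def by (intro AE_seg_pairI1) (simp_all add: borel_prod[symmetric])
    have [measurable]: "p \<in> borel_measurable borel" using p by (rule seg_borel)
    have "AE x in seg L. AE t in seg T. Ft (x, t) = p t + prim L (\<lambda>y. Fxt (y, t)) x"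
      using sep by eventually_elim (auto simp: R_def elim!: eventually_mono)
    then show "xrep L T Ft p Fxt" unfolding xrep_def by (intro AE_seg_pairI1) (simp_all add: borel_prod[symmetric])
  qed
qed

lemma trace_rep:
  assumes g: "integrable (seg L) g" and rep: "AE x in seg L. w x = c + prim L g x" and L: "L > 0" and a: "a \<in> {0..L}"
  shows "has_trace L w a v \<longleftrightarrow> v = c + prim L g a" "trace L w a = c + prim L g a"
proof -
  have pc: "continuous_on {0..L} (\<lambda>x. c + prim L g x)"
    by (intro continuous_intros continuous_on_subset[OF continuous_prim[OF g]]) auto
  have iff: "has_trace L w a v \<longleftrightarrow> v = c + prim L g a" for v
  proof
    assume "has_trace L w a v"
    then obtain f where f: "continuous_on {0..L} f" "AE x in seg L. f x = w x" "f a = v"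
      unfolding has_trace_def AE_seg'[symmetric] by blast
    have "AE x in seg L. f x = c + prim L g x" using f(2) rep by eventually_elim simp
    from AE_eq_continuous_imp_eq[OF this f(1) pc L a] f(3) show "v = c + prim L g a" by simp
  next
    assume "v = c + prim L g a"
    then show "has_trace L w a v"
      unfolding has_trace_def AE_seg'[symmetric]
      by (intro exI[of _ "\<lambda>x. c + prim L g x"]) (use pc rep in \<open>auto elim!: eventually_mono\<close>)
  qed
  show "has_trace L w a v \<longleftrightarrow> v = c + prim L g a" by (rule iff)
  show "trace L w a = c + prim L g a" unfolding trace_def by (rule the_equality) (simp_all add: iff)
qed

text \<open>Both functions are continuous into L^2 at time 0 and agree there; two errors \<delta> /
  4, doubled by squaring a sum, add up to \<delta>.\<close>

lemma C_L2_vanishes_initially: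
  assumes w: "w1 \<in> C_L2 L T" "w2 \<in> C_L2 L T" and T: "T > 0"
    and ini: "AE x in lebesgue_on {0<..<L}. w1 (x, 0) = w2 (x, 0)"
    and W: "W \<in> borel_measurable (borel \<Otimes>\<^sub>M borel)" "AE z in rect L T. W z = w1 z - w2 z"
  shows "vanishes_initially L T W"
  unfolding vanishes_initially_def
proof (intro allI impI)
  fix \<delta> :: real assume \<delta>: "\<delta> > 0"
  note [measurable] = W(1)
  have 0: "0 \<in> {0..T}" using T by simp
  let ?M = "lebesgue_on {0<..<L}"
  obtain \<tau>1 where \<tau>1: "\<tau>1 > 0" "\<And>s. s \<in> {0..T} \<Longrightarrow> \<bar>s - 0\<bar> < \<tau>1 \<Longrightarrow>
    sq_int ?M (\<lambda>x. w1 (x, s) - w1 (x, 0)) \<and> (LINT x|?M. (w1 (x, s) - w1 (x, 0))\<^sup>2) \<le> \<delta> / 4"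
    using C_L2_near[OF w(1) 0, of "\<delta> / 4"] \<delta> by auto
  obtain \<tau>2 where \<tau>2: "\<tau>2 > 0" "\<And>s. s \<in> {0..T} \<Longrightarrow> \<bar>s - 0\<bar> < \<tau>2 \<Longrightarrow>
    sq_int ?M (\<lambda>x. w2 (x, s) - w2 (x, 0)) \<and> (LINT x|?M. (w2 (x, s) - w2 (x, 0))\<^sup>2) \<le> \<delta> / 4"
    using C_L2_near[OF w(2) 0, of "\<delta> / 4"] \<delta> by auto
  have "AE s in seg T. s < min \<tau>1 \<tau>2 \<longrightarrow> (\<integral>x. (W (x, s))\<^sup>2 \<partial>seg L) \<le> \<delta>"
    using AE_seg_slice2[OF W(2)] AE_seg_mem
  proof eventually_elim
    case (elim s)
    show ?case
    proof
      assume "s < min \<tau>1 \<tau>2"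
      with elim(2) have s: "s \<in> {0..T}" "\<bar>s - 0\<bar> < \<tau>1" "\<bar>s - 0\<bar> < \<tau>2" by auto
      note f1 = \<tau>1(2)[OF s(1,2)] and f2 = \<tau>2(2)[OF s(1,3)]
      let ?f = "\<lambda>x. (w1 (x, s) - w1 (x, 0)) + - (w2 (x, s) - w2 (x, 0))"
      have fsq: "sq_int ?M ?f" using sq_int_add[OF conjunct1[OF f1] sq_int_minus[OF conjunct1[OF f2]]] .
      have m: "(\<lambda>x. (W (x, s))\<^sup>2) \<in> borel_measurable borel" by measurable
      have "AE x in seg L. (?f x)\<^sup>2 = (W (x, s))\<^sup>2"
        using elim(1) ini[folded AE_seg'] by eventually_elim simp
      then have "(LINT x|?M. (?f x)\<^sup>2) = (\<integral>x. (W (x, s))\<^sup>2 \<partial>seg L)"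
        using set_integral_lebesgue_eq(1)[OF m, of "{0<..<L}" "\<lambda>x. (?f x)\<^sup>2"]
        by (simp add: set_integrable_restrict AE_seg integral_seg[OF m])
      moreover have "(LINT x|?M. (?f x)\<^sup>2) \<le> 2 * (\<delta> / 4) + 2 * (\<delta> / 4)"
        using sq_int_diff_bound[OF conjunct1[OF f1] sq_int_minus[OF conjunct1[OF f2]], unfolded power2_minus] f1 f2 by linarith
      ultimately show "(\<integral>x. (W (x, s))\<^sup>2 \<partial>seg L) \<le> \<delta>" by simp
    qed
  qed
  then show "\<exists>\<tau>>0. AE s in seg T. s < \<tau> \<longrightarrow> (\<integral>x. (W (x, s))\<^sup>2 \<partial>seg L) \<le> \<delta>"
    using \<tau>1(1) \<tau>2(1) by (intro exI[of _ "min \<tau>1 \<tau>2"]) simp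
qed

section \<open>Adding the boundary layer to the difference of the solutions\<close>

lemma sq_int_product:
  assumes f: "sq_int (seg L) f" and g: "sq_int (seg T) g"
  shows "sq_int (rect L T) (\<lambda>z. f (fst z) * g (snd z))"
  unfolding sq_int_def
proof
  have [measurable]: "f \<in> borel_measurable borel" "g \<in> borel_measurable borel"
    using sq_int_measurable[OF f] sq_int_measurable[OF g] by (simp_all add: measurable_seg_eq)
  show "(\<lambda>z. f (fst z) * g (snd z)) \<in> borel_measurable (rect L T)" by measurable
  have "integrable (rect L T) (\<lambda>(x, t). (f x * g t)\<^sup>2)"
  proof (rule seg2.Fubini_integrable)
    show "(\<lambda>(x, t). (f x * g t)\<^sup>2) \<in> borel_measurable (rect L T)" unfolding split_beta' by measurable
    show "integrable (seg L) (\<lambda>x. \<integral>t. norm ((\<lambda>(x, t). (f x * g t)\<^sup>2) (x, t)) \<partial>seg T)"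
      using sq_int_square[OF f] by (simp add: power_mult_distrib)
    show "AE x in seg L. integrable (seg T) (\<lambda>t. (\<lambda>(x, t). (f x * g t)\<^sup>2) (x, t))"
      using sq_int_square[OF g] by (simp add: power_mult_distrib)
  qed
  then show "integrable (rect L T) (\<lambda>z. (f (fst z) * g (snd z))\<^sup>2)" by (simp add: split_beta')
qed

lemma sq_int_seg_borel: "sq_int (seg L) f \<Longrightarrow> f \<in> borel_measurable borel"
  using sq_int_measurable[of "seg L" f] by (simp add: measurable_seg_eq)

lemma xrep_add_product:
  assumes rep: "xrep L T W c V" and W: "sq_int (rect L T) W" and V: "sq_int (rect L T) V"
    and f: "sq_int (seg L) f'" "f \<in> borel_measurable borel" "\<And>x. x \<in> {0..L} \<Longrightarrow> f x = f0 + prim L f' x"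
    and g: "g \<in> borel_measurable borel" and c': "c' \<in> borel_measurable borel" "AE t in seg T. c' t = c t + f0 * g t"
  shows "xrep L T (\<lambda>z. W z + f (fst z) * g (snd z)) c' (\<lambda>z. V z + f' (fst z) * g (snd z))"
proof -
  note [measurable] = sq_int_rect_borel[OF W] sq_int_rect_borel[OF V] sq_int_seg_borel[OF f(1)] f(2) g c'(1)
  have f'i: "integrable (seg L) f'" by (rule sq_int_integrable[OF finite_measure_seg f(1)])
  have "AE t in seg T. AE x in seg L. W (x, t) + f x * g t = c' t + prim L (\<lambda>y. V (y, t) + f' y * g t) x"
    using xrep_slice[OF rep] sq_int_slices(2)[OF V] c'(2)
  proof eventually_elim
    case (elim t)
    have Vi: "integrable (seg L) (\<lambda>x. V (x, t))" by (rule sq_int_integrable[OF finite_measure_seg elim(2)])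
    have p: "prim L (\<lambda>y. V (y, t) + f' y * g t) x = prim L (\<lambda>y. V (y, t)) x + g t * prim L f' x" for x
      using f'i by (simp add: prim_add[OF Vi] prim_cmult mult.commute[of _ "g t"])
    show ?case
      using elim(1) AE_seg_mem
    proof eventually_elim
      case (elim x)
      then show ?case using f(3)[of x] \<open>c' t = c t + f0 * g t\<close> by (simp add: p algebra_simps)
    qed
  qed
  then show ?thesis
    unfolding xrep_def by (intro AE_seg_pairI2) (simp_all add: borel_prod[symmetric])
qed

lemma trep_add_product:
  assumes rep: "trep L T W V" and W: "sq_int (rect L T) W" and V: "sq_int (rect L T) V"
    and f: "f \<in> borel_measurable borel" and p: "sq_int (seg T) p" and g: "\<And>t. g t = prim T p t"
  shows "trep L T (\<lambda>z. W z + f (fst z) * g (snd z)) (\<lambda>z. V z + f (fst z) * p (snd z))"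
proof -
  have gm: "g \<in> borel_measurable borel"
    using sq_int_seg_borel[OF p] unfolding g[abs_def] by measurable
  note [measurable] = sq_int_rect_borel[OF W] sq_int_rect_borel[OF V] sq_int_seg_borel[OF p] f gm
  have pi: "integrable (seg T) p" by (rule sq_int_integrable[OF finite_measure_seg p])
  have "AE x in seg L. AE t in seg T. W (x, t) + f x * g t = prim T (\<lambda>s. V (x, s) + f x * p s) t"
    using trep_slice[OF rep] sq_int_slices(1)[OF V]
  proof eventually_elim
    case (elim x)
    have Vi: "integrable (seg T) (\<lambda>t. V (x, t))" by (rule sq_int_integrable[OF finite_measure_seg elim(2)])
    have "prim T (\<lambda>s. V (x, s) + f x * p s) t = prim T (\<lambda>s. V (x, s)) t + f x * prim T p t" for t
      using pi by (simp add: prim_add[OF Vi] prim_cmult)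
    then show ?case using elim(1) by (auto simp: g elim!: eventually_mono)
  qed
  then show ?thesis
    unfolding trep_def by (intro AE_seg_pairI1) (simp_all add: borel_prod[symmetric])
qed

lemma layer_q'_rep:
  assumes "\<epsilon> > 0" "x \<in> {0..L}"
  shows "layer_q' L r \<epsilon> x = layer_q' L r \<epsilon> 0 + prim L (\<lambda>x. - (r / \<epsilon>) * layer_q' L r \<epsilon> x) x"
proof (rule prim_deriv(1)[OF _ _ _ assms(2)])
  define c where "c = inverse (1 - exp (- r * L / \<epsilon>))"
  have q': "layer_q' L r \<epsilon> = (\<lambda>x. - c * (r / \<epsilon> * exp (- r * x / \<epsilon>)))"
    by (simp add: layer_q'_def[abs_def] c_def divide_inverse mult.commute)
  show "(layer_q' L r \<epsilon> has_real_derivative - (r / \<epsilon>) * layer_q' L r \<epsilon> x) (at x within {0..L})" for x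
    unfolding q' using assms by (auto intro!: derivative_eq_intros simp: field_simps)
  have c: "continuous_on UNIV (\<lambda>x. - (r / \<epsilon>) * layer_q' L r \<epsilon> x)"
    unfolding q' using assms by (auto intro!: continuous_intros)
  show "continuous_on {0..L} (\<lambda>x. - (r / \<epsilon>) * layer_q' L r \<epsilon> x)" by (rule continuous_on_subset[OF c]) simp
  show "(\<lambda>x. - (r / \<epsilon>) * layer_q' L r \<epsilon> x) \<in> borel_measurable borel" by (rule borel_measurable_continuous_onI[OF c])
qed

text \<open>W and F are the raw differences, with traces - h and h / (Ub \<mu>) at x = 0, where h =
  Ub \<mu> times the primitive of p. Adding q h and - q h / (Ub \<mu>) cancels these traces and, as
  q vanishes at L, preserves u = 0 there. Hypothesis \<open>r\<close> makes the added layer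
  stationary, so it leaves only terms with h'.\<close>

lemma corrected_evolution:
  assumes pos: "L > 0" "T > 0" "\<mu> > 0" "Ub > 0" "0 < \<epsilon>" "\<epsilon> \<le> 1" "r > 0" and r: "2 * r * (Ub * \<mu>) = 1 - Ub\<^sup>2 * \<mu>"
    and small: "exp (- r * L / \<epsilon>) \<le> 1 / 2"
    and \<gamma>: "\<gamma> > 0" "\<gamma> \<le> \<mu> / 2"
      "\<gamma> * (2 / (Ub * \<mu>) * (1 / L + 8 / (Ub * \<mu>)) + 1 / \<mu> + 1 / 2 + Ub\<^sup>2 / 4) \<le> 1 / 2"
    and sq: "sq_int (rect L T) W" "sq_int (rect L T) Wx" "sq_int (rect L T) Wxx" "sq_int (rect L T) Wt"
      "sq_int (rect L T) F" "sq_int (rect L T) Fx" "sq_int (rect L T) Fxx" "sq_int (rect L T) Ft" "sq_int (rect L T) Fxt"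
      "sq_int (rect L T) k"
    and x: "xrep L T W cW Wx" "hasx L T Wx Wxx" "xrep L T F cF Fx" "hasx L T Fx Fxx"
    and cF: "integrable (seg T) cF"
    and t: "trep L T W Wt" "trep L T F Ft" "hast L T Fx Fxt"
    and bc: "AE t in seg T. cW t = - (Ub * \<mu> * cF t)" "AE t in seg T. (\<integral>x. Wx (x, t) \<partial>seg L) = Ub * \<mu> * cF t"
    and eq1: "AE z in rect L T. Wt z + Ub * Wx z + Fx z - 2 * \<epsilon> * Wxx z = 2 * \<epsilon> * k z"
    and eq2: "AE z in rect L T. \<mu> * Ft z + Ub * \<mu> * Fx z + Wx z = 0"
  obtains p a b where "sq_int (seg T) p" "AE t in seg T. cF t = prim T p t"
    "evolution L T \<mu> Ub \<epsilon> (2 / r + 2 * r + 2 / r ^ 3) \<gamma> (layer_Q L r \<epsilon> 0) (\<lambda>t. Ub * \<mu> * p t) a b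
      (layer_q L r \<epsilon>) (layer_q' L r \<epsilon>) (layer_Q L r \<epsilon>)
      (\<lambda>z. W z + layer_q L r \<epsilon> (fst z) * (Ub * \<mu> * prim T p (snd z)))
      (\<lambda>z. Wx z + layer_q' L r \<epsilon> (fst z) * (Ub * \<mu> * prim T p (snd z)))
      (\<lambda>z. Wxx z + (- (r / \<epsilon>) * layer_q' L r \<epsilon> (fst z)) * (Ub * \<mu> * prim T p (snd z)))
      (\<lambda>z. Wt z + layer_q L r \<epsilon> (fst z) * (Ub * \<mu> * p (snd z)))
      (\<lambda>z. F z + layer_q L r \<epsilon> (fst z) * (- prim T p (snd z)))
      (\<lambda>z. Fx z + layer_q' L r \<epsilon> (fst z) * (- prim T p (snd z)))
      (\<lambda>z. Fxx z + (- (r / \<epsilon>) * layer_q' L r \<epsilon> (fst z)) * (- prim T p (snd z)))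
      (\<lambda>z. Ft z + layer_q L r \<epsilon> (fst z) * (- p (snd z)))
      (\<lambda>z. Fxt z + layer_q' L r \<epsilon> (fst z) * (- p (snd z))) k"
proof -
  obtain p where p: "sq_int (seg T) p" "AE t in seg T. cF t = prim T p t" "trep L T Fx Fxt" "xrep L T Ft p Fxt"
    using mixed_representation[OF sq(5,6,8,9) x(3) cF t(2,3) pos(1,2)] by blast
  obtain a0 where a0: "integrable (seg T) a0" "xrep L T Wx a0 Wxx" using x(2) unfolding hasx_def by blast
  obtain b0 where b0: "integrable (seg T) b0" "xrep L T Fx b0 Fxx" using x(4) unfolding hasx_def by blast
  let ?q = "layer_q L r \<epsilon>" and ?q' = "layer_q' L r \<epsilon>" and ?q'' = "\<lambda>x. - (r / \<epsilon>) * layer_q' L r \<epsilon> x"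
  let ?g = "prim T p" and ?M = "Ub * \<mu>"
  let ?h = "\<lambda>t. ?M * ?g t"
  note lp = pos(1,7,5) small
  note lsq = layer_sq_int[OF lp] and lrep = layer_rep[OF lp] and lb = layer_bounds[OF lp]
  have q''sq: "sq_int (seg L) ?q''" by (rule sq_int_cmult[OF lsq(2)])
  have pi: "integrable (seg T) p" by (rule sq_int_integrable[OF finite_measure_seg p(1)])
  have gsq: "sq_int (seg T) ?g" by (rule sq_int_continuous[OF continuous_prim[OF pi]])
  have hsq: "sq_int (seg T) ?h" by (rule sq_int_cmult[OF gsq])
  have mgsq: "sq_int (seg T) (\<lambda>t. - ?g t)" by (rule sq_int_minus[OF gsq])
  have mpsq: "sq_int (seg T) (\<lambda>t. - p t)" by (rule sq_int_minus[OF p(1)])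
  have Mpsq: "sq_int (seg T) (\<lambda>t. ?M * p t)" by (rule sq_int_cmult[OF p(1)])
  note bm = sq_int_seg_borel
  have h_prim: "?h t = prim T (\<lambda>t. ?M * p t) t" "- ?g t = prim T (\<lambda>t. - p t) t" for t
    using prim_cmult[of T ?M p t] prim_cmult[of T "-1" p t] by simp_all
  define a where "a t = a0 t + ?q' 0 * ?h t" for t
  define b where "b t = b0 t + ?q' 0 * (- ?g t)" for t
  have ai: "integrable (seg T) a" unfolding a_def using a0(1) sq_int_integrable[OF finite_measure_seg hsq] by simp
  have bi: "integrable (seg T) b" unfolding b_def using b0(1) sq_int_integrable[OF finite_measure_seg gsq] by simp
  have Fi: "2 / r + 2 * r + 2 / r ^ 3 \<ge> 0" using pos by simp
  show ?thesis
  proof (rule that[OF p(1,2)], rule evolution.intro)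
    show "xrep L T (\<lambda>z. W z + ?q (fst z) * ?h (snd z)) (\<lambda>_. 0) (\<lambda>z. Wx z + ?q' (fst z) * ?h (snd z))"
      by (rule xrep_add_product[OF x(1) sq(1,2) lsq(2) bm[OF lsq(1)] lrep(1) bm[OF hsq]])
        (use bc(1) p(2) in \<open>auto elim!: eventually_elim2\<close>)
    show "AE t in seg T. (\<integral>x. Wx (x, t) + ?q' (fst (x, t)) * ?h (snd (x, t)) \<partial>seg L) = 0"
      using bc(2) p(2) sq_int_slices(2)[OF sq(2)]
    proof eventually_elim
      case (elim t)
      have "integral\<^sup>L (seg L) ?q' = -1"
        using lrep(1)[of L] lrep(4) pos prim_ge[OF order_refl bm[OF lsq(2)], of L] by simp
      then show ?case
        using elim sq_int_integrable[OF finite_measure_seg elim(3)] sq_int_integrable[OF finite_measure_seg lsq(2)] by simp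
    qed
    show "xrep L T (\<lambda>z. Wx z + ?q' (fst z) * ?h (snd z)) a (\<lambda>z. Wxx z + ?q'' (fst z) * ?h (snd z))"
      by (rule xrep_add_product[OF a0(2) sq(2,3) q''sq bm[OF lsq(2)] layer_q'_rep[OF pos(5)] bm[OF hsq] seg_borel[OF ai]])
        (assumption, rule AE_I2, rule a_def)
    show "xrep L T (\<lambda>z. F z + ?q (fst z) * (- ?g (snd z))) (\<lambda>_. 0) (\<lambda>z. Fx z + ?q' (fst z) * (- ?g (snd z)))"
      by (rule xrep_add_product[OF x(3) sq(5,6) lsq(2) bm[OF lsq(1)] lrep(1) bm[OF mgsq]])
        (use p(2) in \<open>auto elim!: eventually_mono\<close>)
    show "xrep L T (\<lambda>z. Fx z + ?q' (fst z) * (- ?g (snd z))) b (\<lambda>z. Fxx z + ?q'' (fst z) * (- ?g (snd z)))"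
      by (rule xrep_add_product[OF b0(2) sq(6,7) q''sq bm[OF lsq(2)] layer_q'_rep[OF pos(5)] bm[OF mgsq] seg_borel[OF bi]])
        (assumption, rule AE_I2, rule b_def)
    show "xrep L T (\<lambda>z. Ft z + ?q (fst z) * (- p (snd z))) (\<lambda>_. 0) (\<lambda>z. Fxt z + ?q' (fst z) * (- p (snd z)))"
      by (rule xrep_add_product[OF p(4) sq(8,9) lsq(2) bm[OF lsq(1)] lrep(1) bm[OF mpsq]]) auto
    show "trep L T (\<lambda>z. W z + ?q (fst z) * ?h (snd z)) (\<lambda>z. Wt z + ?q (fst z) * (?M * p (snd z)))"
      by (rule trep_add_product[OF t(1) sq(1,4) bm[OF lsq(1)] Mpsq h_prim(1)])
    show "trep L T (\<lambda>z. F z + ?q (fst z) * (- ?g (snd z))) (\<lambda>z. Ft z + ?q (fst z) * (- p (snd z)))"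
      by (rule trep_add_product[OF t(2) sq(5,8) bm[OF lsq(1)] mpsq h_prim(2)])
    show "trep L T (\<lambda>z. Fx z + ?q' (fst z) * (- ?g (snd z))) (\<lambda>z. Fxt z + ?q' (fst z) * (- p (snd z)))"
      by (rule trep_add_product[OF p(3) sq(6,9) bm[OF lsq(2)] mpsq h_prim(2)])
    show "AE x in seg L. ?q x = 1 + prim L ?q' x"
      using AE_seg_mem by eventually_elim (rule lrep(1), simp)
    show "AE x in seg L. layer_Q L r \<epsilon> x = layer_Q L r \<epsilon> 0 + prim L (\<lambda>y. - ?q y) x"
      using AE_seg_mem by eventually_elim (rule lrep(2), simp)
    show "AE z in rect L T. (Wt z + ?q (fst z) * (?M * p (snd z))) + Ub * (Wx z + ?q' (fst z) * ?h (snd z)) + (Fx z + ?q' (fst z) * (- ?g (snd z)))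
        - 2 * \<epsilon> * (Wxx z + ?q'' (fst z) * ?h (snd z)) = 2 * \<epsilon> * k z + ?q (fst z) * (?M * p (snd z))"
      using eq1
    proof eventually_elim
      case (elim z)
      \<comment> \<open>q'' = - (r / \<epsilon>) q' removes \<epsilon> from the viscous term; what
        remains is the algebraic relation \<open>r\<close>.\<close>
      have e: "2 * \<epsilon> * (?q'' (fst z) * ?h (snd z)) = - (2 * r * ?M) * (?q' (fst z) * ?g (snd z))" using pos by simp
      have "Ub * (?q' (fst z) * ?h (snd z)) + ?q' (fst z) * (- ?g (snd z)) - 2 * \<epsilon> * (?q'' (fst z) * ?h (snd z)) = 0"
        unfolding e r by (simp add: algebra_simps power2_eq_square)
      then show ?case using elim by (simp only: distrib_left right_diff_distrib)
    qed
    show "AE z in rect L T. \<mu> * (Ft z + ?q (fst z) * (- p (snd z))) + Ub * \<mu> * (Fx z + ?q' (fst z) * (- ?g (snd z))) + (Wx z + ?q' (fst z) * ?h (snd z))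
      = - (?q (fst z) * (?M * p (snd z)) / Ub)"
      using eq2 by eventually_elim (use pos in \<open>simp add: algebra_simps\<close>)
  qed (rule pos \<gamma> Fi sq lb lrep(3) lsq ai bi Mpsq q''sq hsq mgsq mpsq sq_int_add sq_int_product)+
qed

section \<open>Norms of the corrected difference\<close>

text \<open>\<open>esssup_I\<close> demands measurability of the norm as a function of t. By
  completeness of Lebesgue measure, almost everywhere equality with a Borel function is
  enough.\<close>

lemma measurable_lebesgue_on_AE_ennreal:
  fixes f h :: "real \<Rightarrow> ennreal"
  assumes h: "h \<in> borel_measurable borel" and ae: "AE t in seg T. f t = h t"
  shows "f \<in> borel_measurable (lebesgue_on {0<..<T})"
proof -
  let ?S = "{0<..<T}"
  let ?f = "\<lambda>t. f t * indicator ?S t" and ?h = "\<lambda>t. h t * indicator ?S t"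
  have hm: "?h \<in> borel_measurable lebesgue"
  proof -
    have "?h \<in> borel_measurable borel" using h by measurable
    then show ?thesis by (simp add: measurable_completion)
  qed
  have "AE t in lebesgue. ?f t = ?h t"
    using AE_completion[OF ae[unfolded AE_seg]] by eventually_elim (auto simp: indicator_def)
  then obtain N where N: "N \<in> null_sets lebesgue" "{t. ?f t \<noteq> ?h t} \<subseteq> N"
    unfolding eventually_ae_filter by auto
  have "?f \<in> borel_measurable lebesgue"
  proof (rule measurableI)
    fix A :: "ennreal set" assume A: "A \<in> sets borel"
    have eq: "?f -` A \<inter> space lebesgue = (?h -` A \<inter> space lebesgue - N) \<union> (?f -` A \<inter> N)" using N(2) by auto
    have 1: "?h -` A \<inter> space lebesgue - N \<in> sets lebesgue" by (intro sets.Diff measurable_sets[OF hm A] null_setsD2[OF N(1)])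
    have 2: "?f -` A \<inter> N \<in> sets lebesgue"
      by (rule null_setsD2[OF null_sets_completion_subset[OF _ N(1)]]) simp
    show "?f -` A \<inter> space lebesgue \<in> sets lebesgue" by (subst eq, rule sets.Un[OF 1 2])
  qed simp
  then show ?thesis by (subst borel_measurable_restrict_space_iff_ennreal) auto
qed

lemma Linf_L2_norm_le:
  assumes W: "sq_int (rect L T) W" and ae: "AE z in rect L T. w z = W z"
    and b: "AE t in seg T. (\<integral>x. (W (x, t))\<^sup>2 \<partial>seg L) \<le> B"
  shows "Linf_L2_norm L T w \<le> ennreal (sqrt B)"
proof -
  note [measurable] = sq_int_rect_borel[OF W]
  have eq: "AE t in seg T. L2_norm {0<..<L} (\<lambda>x. w (x, t)) = ennreal (sqrt (\<integral>x. (W (x, t))\<^sup>2 \<partial>seg L))"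
    using AE_seg_slice2[OF ae] sq_int_slices(2)[OF W]
  proof eventually_elim
    case (elim t)
    have "(\<lambda>x. W (x, t)) \<in> borel_measurable borel" by measurable
    from L2_norm_seg[OF this elim(1)] sq_int_square[OF elim(2)] show ?case by simp
  qed
  show ?thesis
    unfolding Linf_L2_norm_def
  proof (rule esssup_I)
    have m: "(\<lambda>t. ennreal (sqrt (\<integral>x. (W (x, t))\<^sup>2 \<partial>seg L))) \<in> borel_measurable borel" by measurable
    show "(\<lambda>t. L2_norm {0<..<L} (\<lambda>x. w (x, t))) \<in> borel_measurable (lebesgue_on {0<..<T})"
      by (rule measurable_lebesgue_on_AE_ennreal[OF m eq])
    show "AE t in lebesgue_on {0<..<T}. L2_norm {0<..<L} (\<lambda>x. w (x, t)) \<le> ennreal (sqrt B)"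
      unfolding AE_seg'[symmetric] using eq b by eventually_elim (simp add: ennreal_leI)
  qed
qed

lemma Linf_Linf_norm_le:
  assumes W: "W \<in> borel_measurable (borel \<Otimes>\<^sub>M borel)" and ae: "AE z in rect L T. w z = W z"
    and b: "AE z in rect L T. \<bar>W z\<bar> \<le> B"
  shows "Linf_Linf_norm L T w \<le> ennreal B"
proof -
  note [measurable] = W
  let ?M = "lebesgue_on {0<..<L}"
  define g where "g t = esssup ?M (\<lambda>x. ennreal \<bar>W (x, t)\<bar>)" for t
  have Wm: "(\<lambda>x. ennreal \<bar>W (x, t)\<bar>) \<in> borel_measurable ?M" for t
  proof -
    have "(\<lambda>x. ennreal \<bar>W (x, t)\<bar>) \<in> borel_measurable borel" by measurable
    then show ?thesis by (rule measurable_lebesgue_on_AE_ennreal) simp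
  qed
  \<comment> \<open>Sublevel sets of the essential supremum are the times at which a section has
    measure zero, and section measures depend measurably on t. Coordinates are swapped because
    \<open>measurable_emeasure_Pair\<close> measures the second one.\<close>
  have g_le: "g t \<le> c \<longleftrightarrow> emeasure (seg L) (Pair t -` {p. \<not> ennreal \<bar>W (snd p, fst p)\<bar> \<le> c}) = 0" for t c
  proof -
    have "g t \<le> c \<longleftrightarrow> (AE x in seg L. ennreal \<bar>W (x, t)\<bar> \<le> c)"
      unfolding g_def AE_seg' using esssup_AE[where M = ?M and f = "\<lambda>x. ennreal \<bar>W (x, t)\<bar>"] esssup_I[OF Wm]
      by (auto elim!: eventually_mono)
    also have "\<dots> \<longleftrightarrow> emeasure (seg L) (Pair t -` {p. \<not> ennreal \<bar>W (snd p, fst p)\<bar> \<le> c}) = 0"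
    proof (rule AE_iff_measurable)
      have "{x \<in> space borel. \<not> ennreal \<bar>W (x, t)\<bar> \<le> c} \<in> sets borel" by measurable
      then show "Pair t -` {p. \<not> ennreal \<bar>W (snd p, fst p)\<bar> \<le> c} \<in> sets (seg L)" by (simp add: vimage_def)
    qed auto
    finally show ?thesis .
  qed
  have gm: "g \<in> borel_measurable borel"
  proof (rule borel_measurableI_le)
    fix c
    have "{p \<in> space (borel \<Otimes>\<^sub>M seg L). \<not> ennreal \<bar>W (snd p, fst p)\<bar> \<le> c} \<in> sets (borel \<Otimes>\<^sub>M seg L)" by measurable
    then have "{p. \<not> ennreal \<bar>W (snd p, fst p)\<bar> \<le> c} \<in> sets (borel \<Otimes>\<^sub>M seg L)" by (simp add: space_pair_measure)
    from seg.measurable_emeasure_Pair[OF this]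
    have "(\<lambda>t. emeasure (seg L) (Pair t -` {p. \<not> ennreal \<bar>W (snd p, fst p)\<bar> \<le> c})) \<in> borel_measurable borel" .
    then have "{t \<in> space borel. emeasure (seg L) (Pair t -` {p. \<not> ennreal \<bar>W (snd p, fst p)\<bar> \<le> c}) = 0} \<in> sets borel"
      by measurable
    then show "{t \<in> space borel. g t \<le> c} \<in> sets borel" by (simp add: g_le)
  qed
  have eq: "AE t in seg T. esssup ?M (\<lambda>x. ennreal \<bar>w (x, t)\<bar>) = g t"
    using AE_seg_slice2[OF ae]
  proof eventually_elim
    case (elim t)
    have "(\<lambda>x. ennreal \<bar>W (x, t)\<bar>) \<in> borel_measurable borel" by measurable
    moreover have "AE x in seg L. ennreal \<bar>w (x, t)\<bar> = ennreal \<bar>W (x, t)\<bar>" using elim by eventually_elim simp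
    ultimately have "(\<lambda>x. ennreal \<bar>w (x, t)\<bar>) \<in> borel_measurable ?M" by (rule measurable_lebesgue_on_AE_ennreal)
    then show ?case
      unfolding g_def by (rule esssup_AE_cong[OF _ Wm]) (use elim in \<open>auto simp: AE_seg'[symmetric] elim!: eventually_mono\<close>)
  qed
  show ?thesis
    unfolding Linf_Linf_norm_def
  proof (rule esssup_I)
    show "(\<lambda>t. esssup ?M (\<lambda>x. ennreal \<bar>w (x, t)\<bar>)) \<in> borel_measurable (lebesgue_on {0<..<T})"
      by (rule measurable_lebesgue_on_AE_ennreal[OF gm eq])
    show "AE t in lebesgue_on {0<..<T}. esssup ?M (\<lambda>x. ennreal \<bar>w (x, t)\<bar>) \<le> ennreal B"
      unfolding AE_seg'[symmetric] using eq AE_seg_slice2[OF b]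
    proof eventually_elim
      case (elim t)
      have "esssup ?M (\<lambda>x. ennreal \<bar>W (x, t)\<bar>) \<le> ennreal B"
        by (rule esssup_I[OF Wm]) (use elim(2) in \<open>auto simp: AE_seg'[symmetric] ennreal_leI elim!: eventually_mono\<close>)
      then show ?case using elim(1) by (simp add: g_def)
    qed
  qed
qed

section \<open>Representatives of the two solutions\<close>

text \<open>Square integrable Borel representatives of a solution and its derivatives, u_xt
  excepted. The closing clauses tie every other choice of weak derivatives, in particular the one
  hidden in the equations, to these.\<close>

definition reps where
  "reps L T u \<psi> U Ux Uxx Ut P Px Pxx Pt Pxt \<longleftrightarrow>
    sq_int (rect L T) U \<and> sq_int (rect L T) Ux \<and> sq_int (rect L T) Uxx \<and> sq_int (rect L T) Ut \<and>
    sq_int (rect L T) P \<and> sq_int (rect L T) Px \<and> sq_int (rect L T) Pxx \<and> sq_int (rect L T) Pt \<and> sq_int (rect L T) Pxt \<and>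
    (AE z in rect L T. u z = U z) \<and> (AE z in rect L T. \<psi> z = P z) \<and>
    hasx L T U Ux \<and> hasx L T Ux Uxx \<and> hast L T U Ut \<and> hasx L T P Px \<and> hasx L T Px Pxx \<and> hast L T P Pt \<and> hast L T Px Pxt \<and>
    (\<forall>v. weak_x L T u v \<longrightarrow> (AE z in rect L T. v z = Ux z)) \<and>
    (\<forall>v w. weak_x L T u v \<longrightarrow> weak_x L T v w \<longrightarrow> (AE z in rect L T. w z = Uxx z)) \<and>
    (\<forall>v. weak_t L T u v \<longrightarrow> (AE z in rect L T. v z = Ut z)) \<and>
    (\<forall>v. weak_x L T \<psi> v \<longrightarrow> (AE z in rect L T. v z = Px z)) \<and>
    (\<forall>v. weak_t L T \<psi> v \<longrightarrow> (AE z in rect L T. v z = Pt z))"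

lemma L2Q_cong: "L2Q L T w \<Longrightarrow> AE z in rect L T. w' z = w z \<Longrightarrow> L2Q L T w'"
proof -
  assume "L2Q L T w" and ae: "AE z in rect L T. w' z = w z"
  then obtain W where W: "sq_int (rect L T) W" "AE z in rect L T. w z = W z" unfolding L2Q_def by blast
  have "AE z in rect L T. w' z = W z" using ae W(2) by eventually_elim simp
  then show "L2Q L T w'" unfolding L2Q_def using W(1) by blast
qed

lemma reps_exist:
  assumes pos: "L > 0" "T > 0"
    and w: "weak_x L T u ux" "weak_x L T ux uxx" "weak_t L T u ut" "weak_x L T \<psi> \<psi>x" "weak_x L T \<psi>x \<psi>xx" "weak_t L T \<psi> \<psi>t" "weak_t L T \<psi>x \<psi>xt"
    and l: "L2Q L T u" "L2Q L T ux" "L2Q L T uxx" "L2Q L T ut" "L2Q L T \<psi>" "L2Q L T \<psi>x" "L2Q L T \<psi>xx" "L2Q L T \<psi>t" "L2Q L T \<psi>xt"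
  shows "\<exists>U Ux Uxx Ut P Px Pxx Pt Pxt. reps L T u \<psi> U Ux Uxx Ut P Px Pxx Pt Pxt"
proof -
  obtain U where U: "sq_int (rect L T) U" "AE z in rect L T. u z = U z" using l(1) unfolding L2Q_def by blast
  obtain Ux where Ux: "sq_int (rect L T) Ux" "AE z in rect L T. ux z = Ux z" using l(2) unfolding L2Q_def by blast
  obtain Uxx where Uxx: "sq_int (rect L T) Uxx" "AE z in rect L T. uxx z = Uxx z" using l(3) unfolding L2Q_def by blast
  obtain Ut where Ut: "sq_int (rect L T) Ut" "AE z in rect L T. ut z = Ut z" using l(4) unfolding L2Q_def by blast
  obtain P where P: "sq_int (rect L T) P" "AE z in rect L T. \<psi> z = P z" using l(5) unfolding L2Q_def by blast
  obtain Px where Px: "sq_int (rect L T) Px" "AE z in rect L T. \<psi>x z = Px z" using l(6) unfolding L2Q_def by blast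
  obtain Pxx where Pxx: "sq_int (rect L T) Pxx" "AE z in rect L T. \<psi>xx z = Pxx z" using l(7) unfolding L2Q_def by blast
  obtain Pt where Pt: "sq_int (rect L T) Pt" "AE z in rect L T. \<psi>t z = Pt z" using l(8) unfolding L2Q_def by blast
  obtain Pxt where Pxt: "sq_int (rect L T) Pxt" "AE z in rect L T. \<psi>xt z = Pxt z" using l(9) unfolding L2Q_def by blast
  have un: "AE z in rect L T. v z = V z" if "has_weak_deriv (Q L T) e f v'" "AE z in rect L T. v' z = V z" "has_weak_deriv (Q L T) e f v" for e f v v' V
    using weak_deriv_unique[OF that(3,1)] that(2) by eventually_elim simp
  \<comment> \<open>The given \<open>y\<close> is a derivative of another version of u_x; it is
    first transferred to \<open>ux\<close>.\<close>
  have un2: "AE z in rect L T. y z = Uxx z" if "weak_x L T u v" "weak_x L T v y" for v y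
  proof -
    have "weak_x L T ux y" by (rule weak_deriv_cong[OF that(2) weak_deriv_unique[OF that(1) w(1)]])
    then show ?thesis by (rule un[OF w(2) Uxx(2)])
  qed
  have "reps L T u \<psi> U Ux Uxx Ut P Px Pxx Pt Pxt"
    unfolding reps_def
    using weak_x_hasx[OF w(1) U Ux pos] weak_x_hasx[OF w(2) Ux Uxx pos] weak_t_hast[OF w(3) U Ut pos]
      weak_x_hasx[OF w(4) P Px pos] weak_x_hasx[OF w(5) Px Pxx pos] weak_t_hast[OF w(6) P Pt pos] weak_t_hast[OF w(7) Px Pxt pos]
      U Ux(1) Uxx(1) Ut(1) P Px(1) Pxx(1) Pt(1) Pxt(1)
      un[OF w(1) Ux(2)] un2 un[OF w(3) Ut(2)] un[OF w(4) Px(2)] un[OF w(6) Pt(2)] by blast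
  then show ?thesis by blast
qed

lemma space_K_reps:
  assumes pos: "L > 0" "T > 0" and K: "(u, \<psi>) \<in> space_K L T"
  shows "\<exists>U Ux Uxx Ut P Px Pxx Pt Pxt. reps L T u \<psi> U Ux Uxx Ut P Px Pxx Pt Pxt" "u \<in> C_L2 L T" "\<psi> \<in> C_L2 L T"
proof -
  show "u \<in> C_L2 L T" "\<psi> \<in> C_L2 L T" using K by (auto simp: space_K_def space_F_def)
  have l: "u \<in> Linf_L2 L T" "\<psi> \<in> Linf_L2 L T" using K by (auto simp: space_K_def space_F_def Linf_DA_def)
  obtain ux \<psi>x uxx where 1: "ux \<in> Linf_L2 L T" "\<psi>x \<in> Linf_L2 L T" "uxx \<in> Linf_L2 L T" "weak_x L T u ux" "weak_x L T \<psi> \<psi>x" "weak_x L T ux uxx"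
    using K unfolding space_K_def space_F_def Linf_DA_def by blast
  obtain \<psi>x' \<psi>xt \<psi>xx where 2: "\<psi>xt \<in> Linf_L2 L T" "\<psi>xx \<in> Linf_L2 L T" "weak_x L T \<psi> \<psi>x'" "weak_t L T \<psi>x' \<psi>xt" "weak_x L T \<psi>x' \<psi>xx"
    using K unfolding space_K_def by blast
  obtain ut \<psi>t where 3: "ut \<in> C_L2 L T" "\<psi>t \<in> C_L2 L T" "weak_t L T u ut" "weak_t L T \<psi> \<psi>t"
    using K unfolding space_K_def by blast
  have "loc_integrable (Q L T) ut" "loc_integrable (Q L T) \<psi>t" using 3 by (auto simp: has_weak_deriv_def)
  then have 4: "L2Q L T ut" "L2Q L T \<psi>t" using C_L2_L2Q 3 by blast+
  \<comment> \<open>The clause on mixed derivatives introduces a version of \<psi>_x of its own; its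
    square integrability is inherited through uniqueness.\<close>
  have 5: "L2Q L T \<psi>x'" by (rule L2Q_cong[OF Linf_L2_L2Q[OF 1(2)] weak_deriv_unique[OF 2(3) 1(5)]])
  show "\<exists>U Ux Uxx Ut P Px Pxx Pt Pxt. reps L T u \<psi> U Ux Uxx Ut P Px Pxx Pt Pxt"
    by (rule reps_exist[OF pos 1(4,6) 3(3) 2(3,5) 3(4) 2(4) Linf_L2_L2Q[OF l(1)] Linf_L2_L2Q[OF 1(1)] Linf_L2_L2Q[OF 1(3)] 4(1)
      Linf_L2_L2Q[OF l(2)] 5 Linf_L2_L2Q[OF 2(2)] 4(2) Linf_L2_L2Q[OF 2(1)]])
qed

lemma space_K0_reps:
  assumes pos: "L > 0" "T > 0" and K: "(u, \<psi>) \<in> space_K0 L T lam Ub"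
  shows "\<exists>U Ux Uxx Ut P Px Pxx Pt Pxt. reps L T u \<psi> U Ux Uxx Ut P Px Pxx Pt Pxt" "u \<in> C_L2 L T" "\<psi> \<in> C_L2 L T"
proof -
  show "u \<in> C_L2 L T" "\<psi> \<in> C_L2 L T" using K by (auto simp: space_K0_def space_F0_def)
  have l: "u \<in> Linf_L2 L T" "\<psi> \<in> Linf_L2 L T" using K by (auto simp: space_K0_def space_F0_def Linf_DA0_def)
  obtain ux \<psi>x where 1: "ux \<in> Linf_L2 L T" "\<psi>x \<in> Linf_L2 L T" "weak_x L T u ux" "weak_x L T \<psi> \<psi>x"
    using K unfolding space_K0_def space_F0_def Linf_DA0_def by blast
  obtain ux' \<psi>x' \<psi>xt uxx \<psi>xx where 2: "\<psi>xt \<in> Linf_L2 L T" "uxx \<in> Linf_L2 L T" "\<psi>xx \<in> Linf_L2 L T" "weak_x L T u ux'" "weak_x L T \<psi> \<psi>x'"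
    "weak_t L T \<psi>x' \<psi>xt" "weak_x L T ux' uxx" "weak_x L T \<psi>x' \<psi>xx"
    using K unfolding space_K0_def by blast
  obtain ut \<psi>t where 3: "ut \<in> C_L2 L T" "\<psi>t \<in> C_L2 L T" "weak_t L T u ut" "weak_t L T \<psi> \<psi>t"
    using K unfolding space_K0_def by blast
  have "loc_integrable (Q L T) ut" "loc_integrable (Q L T) \<psi>t" using 3 by (auto simp: has_weak_deriv_def)
  then have 4: "L2Q L T ut" "L2Q L T \<psi>t" using C_L2_L2Q 3 by blast+
  have 5: "L2Q L T \<psi>x'" "L2Q L T ux'"
    by (rule L2Q_cong[OF Linf_L2_L2Q[OF 1(2)] weak_deriv_unique[OF 2(5) 1(4)]],
        rule L2Q_cong[OF Linf_L2_L2Q[OF 1(1)] weak_deriv_unique[OF 2(4) 1(3)]])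
  show "\<exists>U Ux Uxx Ut P Px Pxx Pt Pxt. reps L T u \<psi> U Ux Uxx Ut P Px Pxx Pt Pxt"
    by (rule reps_exist[OF pos 2(4,7) 3(3) 2(5,8) 3(4) 2(6) Linf_L2_L2Q[OF l(1)] 5(2) Linf_L2_L2Q[OF 2(2)] 4(1)
      Linf_L2_L2Q[OF l(2)] 5(1) Linf_L2_L2Q[OF 2(3)] 4(2) Linf_L2_L2Q[OF 2(1)]])
qed

lemma xrep_diff:
  assumes 1: "xrep L T F c G" "sq_int (rect L T) F" "sq_int (rect L T) G" "integrable (seg T) c"
    and 2: "xrep L T F' c' G'" "sq_int (rect L T) F'" "sq_int (rect L T) G'" "integrable (seg T) c'"
  shows "xrep L T (\<lambda>z. F z - F' z) (\<lambda>t. c t - c' t) (\<lambda>z. G z - G' z)"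
proof -
  note [measurable] = sq_int_rect_borel[OF 1(2)] sq_int_rect_borel[OF 1(3)] sq_int_rect_borel[OF 2(2)] sq_int_rect_borel[OF 2(3)]
    seg_borel[OF 1(4)] seg_borel[OF 2(4)]
  have "AE t in seg T. AE x in seg L. F (x, t) - F' (x, t) = (c t - c' t) + prim L (\<lambda>y. G (y, t) - G' (y, t)) x"
    using xrep_slice[OF 1(1)] xrep_slice[OF 2(1)] sq_int_slices(2)[OF 1(3)] sq_int_slices(2)[OF 2(3)]
  proof eventually_elim
    case (elim t)
    note i = sq_int_integrable[OF finite_measure_seg elim(3)] sq_int_integrable[OF finite_measure_seg elim(4)]
    show ?case using elim(1,2) by eventually_elim (simp add: prim_diff[OF i])
  qed
  then show ?thesis unfolding xrep_def by (intro AE_seg_pairI2) (simp_all add: borel_prod[symmetric])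
qed

lemma hasx_diff:
  assumes "hasx L T F G" "sq_int (rect L T) F" "sq_int (rect L T) G" "hasx L T F' G'" "sq_int (rect L T) F'" "sq_int (rect L T) G'"
  shows "hasx L T (\<lambda>z. F z - F' z) (\<lambda>z. G z - G' z)"
proof -
  obtain c c' where "integrable (seg T) c" "xrep L T F c G" "integrable (seg T) c'" "xrep L T F' c' G'"
    using assms unfolding hasx_def by blast
  then show ?thesis unfolding hasx_def
    using xrep_diff[of L T F c G F' c' G'] assms Bochner_Integration.integrable_diff[of "seg T" c c'] by blast
qed

lemma hast_diff:
  assumes "hast L T F G" "sq_int (rect L T) F" "sq_int (rect L T) G" "hast L T F' G'" "sq_int (rect L T) F'" "sq_int (rect L T) G'"
  shows "hast L T (\<lambda>z. F z - F' z) (\<lambda>z. G z - G' z)"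
proof -
  obtain d d' where d: "integrable (seg L) d" "AE z in rect L T. F z = d (fst z) + prim T (\<lambda>s. G (fst z, s)) (snd z)"
    "integrable (seg L) d'" "AE z in rect L T. F' z = d' (fst z) + prim T (\<lambda>s. G' (fst z, s)) (snd z)"
    using assms unfolding hast_def by blast
  note [measurable] = sq_int_rect_borel[OF assms(2)] sq_int_rect_borel[OF assms(3)] sq_int_rect_borel[OF assms(5)] sq_int_rect_borel[OF assms(6)]
    seg_borel[OF d(1)] seg_borel[OF d(3)]
  have "AE x in seg L. AE t in seg T. F (x, t) - F' (x, t) = (d x - d' x) + prim T (\<lambda>s. G (x, s) - G' (x, s)) t"
    using AE_seg_slice1[OF d(2)] AE_seg_slice1[OF d(4)] sq_int_slices(1)[OF assms(3)] sq_int_slices(1)[OF assms(6)]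
  proof eventually_elim
    case (elim x)
    note i = sq_int_integrable[OF finite_measure_seg elim(3)] sq_int_integrable[OF finite_measure_seg elim(4)]
    show ?case using elim(1,2) by eventually_elim (simp add: prim_diff[OF i])
  qed
  then have "AE z in rect L T. F z - F' z = (d (fst z) - d' (fst z)) + prim T (\<lambda>s. G (fst z, s) - G' (fst z, s)) (snd z)"
    by (intro AE_seg_pairI1) (simp_all add: borel_prod[symmetric])
  then show ?thesis unfolding hast_def using Bochner_Integration.integrable_diff[OF d(1,3)] by blast
qed

lemma xrep_trace:
  assumes rep: "xrep L T U c Ux" and Ux: "sq_int (rect L T) Ux" and u: "AE z in rect L T. u z = U z" and L: "L > 0"
  shows "AE t in seg T. \<forall>v. has_trace L (\<lambda>x. u (x, t)) 0 v \<longleftrightarrow> v = c t"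
    "AE t in seg T. \<forall>v. has_trace L (\<lambda>x. u (x, t)) L v \<longleftrightarrow> v = c t + (\<integral>x. Ux (x, t) \<partial>seg L)"
    "AE t in seg T. trace L (\<lambda>x. u (x, t)) 0 = c t"
proof -
  have ae: "AE t in seg T. integrable (seg L) (\<lambda>x. Ux (x, t)) \<and> (AE x in seg L. u (x, t) = c t + prim L (\<lambda>y. Ux (y, t)) x)"
    using xrep_slice[OF rep] sq_int_slices(2)[OF Ux] AE_seg_slice2[OF u]
    by eventually_elim (auto intro: sq_int_integrable[OF finite_measure_seg] elim!: eventually_elim2)
  have 0: "0 \<in> {0..L}" "L \<in> {0..L}" using L by auto
  show "AE t in seg T. \<forall>v. has_trace L (\<lambda>x. u (x, t)) 0 v \<longleftrightarrow> v = c t"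
    using ae by eventually_elim (auto simp: trace_rep(1)[OF _ _ L 0(1)] prim_nonpos dest: seg_borel)
  show "AE t in seg T. \<forall>v. has_trace L (\<lambda>x. u (x, t)) L v \<longleftrightarrow> v = c t + (\<integral>x. Ux (x, t) \<partial>seg L)"
    using ae by eventually_elim (auto simp: trace_rep(1)[OF _ _ L 0(2)] prim_ge dest: seg_borel)
  show "AE t in seg T. trace L (\<lambda>x. u (x, t)) 0 = c t"
    using ae by eventually_elim (auto simp: trace_rep(2)[OF _ _ L 0(1)] prim_nonpos dest: seg_borel)
qed

section \<open>Convergence of the corrected solution\<close>

lemma AE_rect_snd:
  assumes "AE t in seg T. P t" shows "AE z in rect L T. P (snd z)"
proof -
  obtain N where N: "{t \<in> space (seg T). \<not> P t} \<subseteq> N" "emeasure (seg T) N = 0" "N \<in> sets (seg T)"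
    using assms by (auto elim: AE_E)
  have [measurable]: "N \<in> sets borel" using N(3) by simp
  have "AE t in seg T. t \<notin> N" using N by (intro AE_not_in) auto
  then have "AE t in seg T. AE x in seg L. snd (x, t) \<notin> N" by eventually_elim simp
  then have "AE z in rect L T. snd z \<notin> N" by (intro AE_seg_pairI2) (simp_all add: borel_prod[symmetric])
  then show ?thesis by eventually_elim (use N(1) in auto)
qed

text \<open>The coefficients A and C collapse to one multiple of the normalised profile, with sign
  opposite to the boundary value; subtracting the corrector therefore adds q h.\<close>

lemma theta_u_layer: "theta_u L lam Ub u0 \<epsilon> (x, t) = - (layer_q L (layer_rate lam Ub) \<epsilon> x * trace L (\<lambda>y. u0 (y, t)) 0)"
  by (simp add: theta_u_def corr_A_def corr_C_def layer_q_def Let_def divide_inverse algebra_simps)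

lemma theta_psi_layer: "theta_psi L lam Ub u0 \<epsilon> (x, t) =
    inverse Ub * inverse (lam\<^sup>2) * (layer_q L (layer_rate lam Ub) \<epsilon> x * trace L (\<lambda>y. u0 (y, t)) 0)"
  by (simp add: theta_psi_def corr_B_def corr_D_def layer_q_def Let_def divide_inverse algebra_simps)

text \<open>The square roots of the six constants in \<open>estimates\<close>, with the factor
  \<epsilon>^2 of \<open>R\<close> taken out. Their sum serves in both final inequalities.\<close>

definition rate_const :: "real \<Rightarrow> real \<Rightarrow> real \<Rightarrow> real" where
  "rate_const \<mu> \<gamma> R = 4 * sqrt R + sqrt (8 * R / \<mu>) + sqrt (4 * R) + sqrt (32 * R / \<gamma>)
    + sqrt (2 * (8 * R + 16 * R / \<gamma>)) + sqrt (2 * (4 * R / \<mu> + 4 * R / (\<gamma> * \<mu>)))"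

text \<open>For fixed \<epsilon> the function \<open>p\<close> is obtained from the solution at that
  \<epsilon>. Its characterisation through \<open>d0\<close>, a trace of the limit solution, is part
  of the conclusion so that the constant can be recognised as uniform.\<close>

lemma single_estimate:
  fixes lam Ub :: real
  defines "\<mu> \<equiv> lam\<^sup>2" and "r \<equiv> layer_rate lam Ub"
  assumes pos: "L > 0" "T > 0" "lam > 0" "Ub > 0" "r > 0" and r: "2 * r * (Ub * \<mu>) = 1 - Ub\<^sup>2 * \<mu>"
    and \<epsilon>: "0 < \<epsilon>" "\<epsilon> \<le> 1" and small: "exp (- r * L / \<epsilon>) \<le> 1 / 2"
    and \<gamma>: "\<gamma> > 0" "\<gamma> \<le> \<mu> / 2"
      "\<gamma> * (2 / (Ub * \<mu>) * (1 / L + 8 / (Ub * \<mu>)) + 1 / \<mu> + 1 / 2 + Ub\<^sup>2 / 4) \<le> 1 / 2"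
    and reps0: "reps L T u0 \<psi>0 U0 U0x U0xx U0t P0 P0x P0xx P0t P0xt"
    and C0: "u0 \<in> C_L2 L T" "\<psi>0 \<in> C_L2 L T"
    and lim: "limit_solution L T lam Ub f g u_init \<psi>_init u0 \<psi>0"
    and x0: "xrep L T U0 c0 U0x" "integrable (seg T) c0" "xrep L T P0 d0 P0x" "integrable (seg T) d0"
    and K: "(u, \<psi>) \<in> space_K L T" and visc: "viscous_solution L T lam Ub f g u_init \<psi>_init \<epsilon> u \<psi>"
    and w: "\<And>z. w z = u z - u0 z - theta_u L lam Ub u0 \<epsilon> z" and y: "\<And>z. y z = \<psi> z - \<psi>0 z - theta_psi L lam Ub u0 \<epsilon> z"
  obtains p R where "sq_int (seg T) p" "AE t in seg T. - d0 t = prim T p t"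
    "R = energy_const \<mu> Ub (2 / r + 2 * r + 2 / r ^ 3) \<gamma> * (\<integral>t. (Ub * \<mu> * p t)\<^sup>2 \<partial>seg T) + (5 * \<gamma> + 8 * T) * (\<integral>z. (U0xx z)\<^sup>2 \<partial>rect L T)"
    "\<exists>wx yx. weak_x L T w wx \<and> weak_x L T y yx \<and>
      Linf_L2_norm L T w + Linf_L2_norm L T y + ennreal (sqrt \<epsilon>) * (L2_norm (Q L T) wx + L2_norm (Q L T) yx) \<le> ennreal (rate_const \<mu> \<gamma> R * \<epsilon>)"
    "Linf_Linf_norm L T w + Linf_Linf_norm L T y \<le> ennreal (rate_const \<mu> \<gamma> R * sqrt \<epsilon>)"
proof -
  have \<mu>: "\<mu> > 0" using pos by (simp add: \<mu>_def)
  obtain U1 U1x U1xx U1t P1 P1x P1xx P1t P1xt where reps1: "reps L T u \<psi> U1 U1x U1xx U1t P1 P1x P1xx P1t P1xt"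
    using space_K_reps(1)[OF pos(1,2) K] by blast
  note C1 = space_K_reps(2,3)[OF pos(1,2) K]
  have s0: "sq_int (rect L T) U0" "sq_int (rect L T) U0x" "sq_int (rect L T) U0xx" "sq_int (rect L T) U0t"
      "sq_int (rect L T) P0" "sq_int (rect L T) P0x" "sq_int (rect L T) P0xx" "sq_int (rect L T) P0t" "sq_int (rect L T) P0xt"
    and e0: "AE z in rect L T. u0 z = U0 z" "AE z in rect L T. \<psi>0 z = P0 z"
    and h0: "hasx L T U0x U0xx" "hast L T U0 U0t" "hasx L T P0x P0xx" "hast L T P0 P0t" "hast L T P0x P0xt"
    using reps0 unfolding reps_def by blast+
  have s1: "sq_int (rect L T) U1" "sq_int (rect L T) U1x" "sq_int (rect L T) U1xx" "sq_int (rect L T) U1t"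
      "sq_int (rect L T) P1" "sq_int (rect L T) P1x" "sq_int (rect L T) P1xx" "sq_int (rect L T) P1t" "sq_int (rect L T) P1xt"
    and e1: "AE z in rect L T. u z = U1 z" "AE z in rect L T. \<psi> z = P1 z"
    and h1: "hasx L T U1x U1xx" "hast L T U1 U1t" "hasx L T P1x P1xx" "hast L T P1 P1t" "hast L T P1x P1xt"
    and hx1: "hasx L T U1 U1x" "hasx L T P1 P1x"
    using reps1 unfolding reps_def by blast+
  obtain c1 where c1: "integrable (seg T) c1" "xrep L T U1 c1 U1x" using hx1(1) unfolding hasx_def by blast
  obtain d1 where d1: "integrable (seg T) d1" "xrep L T P1 d1 P1x" using hx1(2) unfolding hasx_def by blast
  note tr0 = xrep_trace[OF x0(1) s0(2) e0(1) pos(1)] and trp0 = xrep_trace[OF x0(3) s0(6) e0(2) pos(1)]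
  note tr1 = xrep_trace[OF c1(2) s1(2) e1(1) pos(1)] and trp1 = xrep_trace[OF d1(2) s1(6) e1(2) pos(1)]
  have ini: "AE x in lebesgue_on {0<..<L}. u (x, 0) = u0 (x, 0)" "AE x in lebesgue_on {0<..<L}. \<psi> (x, 0) = \<psi>0 (x, 0)"
    using visc lim unfolding viscous_solution_def limit_solution_def by (auto elim!: eventually_elim2)
  have bc0: "AE t in seg T. c0 t + (\<integral>x. U0x (x, t) \<partial>seg L) = 0 \<and> c0 t = - (Ub * \<mu> * d0 t)"
  proof -
    have "AE t in seg T. (\<exists>a b. has_trace L (\<lambda>x. u0 (x, t)) 0 a \<and> has_trace L (\<lambda>x. \<psi>0 (x, t)) 0 b \<and> a + Ub * lam\<^sup>2 * b = 0) \<and>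
        has_trace L (\<lambda>x. u0 (x, t)) L 0"
      using lim unfolding limit_solution_def AE_seg' by blast
    then show ?thesis using tr0(1,2) trp0(1) by eventually_elim (auto simp: \<mu>_def)
  qed
  have bc1: "AE t in seg T. c1 t = 0 \<and> (\<integral>x. U1x (x, t) \<partial>seg L) = 0 \<and> d1 t = 0"
  proof -
    have "AE t in seg T. has_trace L (\<lambda>x. u (x, t)) 0 0 \<and> has_trace L (\<lambda>x. u (x, t)) L 0 \<and> has_trace L (\<lambda>x. \<psi> (x, t)) 0 0"
      using visc unfolding viscous_solution_def AE_seg' by blast
    then show ?thesis using tr1(1,2) trp1(1) by eventually_elim auto
  qed
  have eqs0: "AE z in rect L T. U0t z + Ub * U0x z + P0x z = f z" "AE z in rect L T. P0t z + Ub * P0x z + inverse (lam\<^sup>2) * U0x z = g z"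
  proof -
    obtain ut ux \<psi>t \<psi>x where wk: "weak_t L T u0 ut" "weak_x L T u0 ux" "weak_t L T \<psi>0 \<psi>t" "weak_x L T \<psi>0 \<psi>x"
      and eq: "AE z in rect L T. ut z + Ub * ux z + \<psi>x z = f z" "AE z in rect L T. \<psi>t z + Ub * \<psi>x z + inverse (lam\<^sup>2) * ux z = g z"
      using lim unfolding limit_solution_def AE_seg_pair' by blast
    have "AE z in rect L T. ut z = U0t z" "AE z in rect L T. ux z = U0x z" "AE z in rect L T. \<psi>t z = P0t z" "AE z in rect L T. \<psi>x z = P0x z"
      using reps0 wk unfolding reps_def by blast+
    then show "AE z in rect L T. U0t z + Ub * U0x z + P0x z = f z" "AE z in rect L T. P0t z + Ub * P0x z + inverse (lam\<^sup>2) * U0x z = g z"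
      using eq by (eventually_elim, simp)+
  qed
  have eqs1: "AE z in rect L T. U1t z + Ub * U1x z + P1x z - 2 * \<epsilon> * U1xx z = f z" "AE z in rect L T. P1t z + Ub * P1x z + inverse (lam\<^sup>2) * U1x z = g z"
  proof -
    obtain ut ux uxx \<psi>t \<psi>x where wk: "weak_t L T u ut" "weak_x L T u ux" "weak_x L T ux uxx" "weak_t L T \<psi> \<psi>t" "weak_x L T \<psi> \<psi>x"
      and eq: "AE z in rect L T. ut z + Ub * ux z + \<psi>x z - 2 * \<epsilon> * uxx z = f z" "AE z in rect L T. \<psi>t z + Ub * \<psi>x z + inverse (lam\<^sup>2) * ux z = g z"
      using visc unfolding viscous_solution_def AE_seg_pair' by blast
    have "AE z in rect L T. ut z = U1t z" "AE z in rect L T. ux z = U1x z" "AE z in rect L T. \<psi>t z = P1t z" "AE z in rect L T. \<psi>x z = P1x z"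
      "AE z in rect L T. uxx z = U1xx z"
      using reps1 wk unfolding reps_def by blast+
    then show "AE z in rect L T. U1t z + Ub * U1x z + P1x z - 2 * \<epsilon> * U1xx z = f z" "AE z in rect L T. P1t z + Ub * P1x z + inverse (lam\<^sup>2) * U1x z = g z"
      using eq by (eventually_elim, simp)+
  qed
  define W where "W z = U1 z - U0 z" for z
  define Wx where "Wx z = U1x z - U0x z" for z
  define Wxx where "Wxx z = U1xx z - U0xx z" for z
  define Wt where "Wt z = U1t z - U0t z" for z
  define F where "F z = P1 z - P0 z" for z
  define Fx where "Fx z = P1x z - P0x z" for z
  define Fxx where "Fxx z = P1xx z - P0xx z" for z
  define Ft where "Ft z = P1t z - P0t z" for z
  define Fxt where "Fxt z = P1xt z - P0xt z" for z
  note defs = W_def[abs_def] Wx_def[abs_def] Wxx_def[abs_def] Wt_def[abs_def] F_def[abs_def] Fx_def[abs_def] Fxx_def[abs_def] Ft_def[abs_def] Fxt_def[abs_def]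
  have sq: "sq_int (rect L T) W" "sq_int (rect L T) Wx" "sq_int (rect L T) Wxx" "sq_int (rect L T) Wt"
      "sq_int (rect L T) F" "sq_int (rect L T) Fx" "sq_int (rect L T) Fxx" "sq_int (rect L T) Ft" "sq_int (rect L T) Fxt"
    unfolding defs by (rule sq_int_diff s0 s1)+
  have van: "vanishes_initially L T W" "vanishes_initially L T F"
  proof -
    have "AE z in rect L T. W z = u z - u0 z" "AE z in rect L T. F z = \<psi> z - \<psi>0 z"
      using e0 e1 by (eventually_elim, simp add: W_def F_def)+
    then show "vanishes_initially L T W" "vanishes_initially L T F"
      using C_L2_vanishes_initially[OF C1(1) C0(1) pos(2) ini(1) sq_int_rect_borel[OF sq(1)]]
        C_L2_vanishes_initially[OF C1(2) C0(2) pos(2) ini(2) sq_int_rect_borel[OF sq(5)]] by blast+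
  qed
  have tW: "trep L T W Wt"
    by (rule hast_trep[OF _ sq(1,4) pos(2) van(1)]) (unfold defs, rule hast_diff[OF h1(2) s1(1,4) h0(2) s0(1,4)])
  have tF: "trep L T F Ft"
    by (rule hast_trep[OF _ sq(5,8) pos(2) van(2)]) (unfold defs, rule hast_diff[OF h1(4) s1(5,8) h0(4) s0(5,8)])
  have tFx: "hast L T Fx Fxt" unfolding defs by (rule hast_diff[OF h1(5) s1(6,9) h0(5) s0(6,9)])
  have xW: "xrep L T W (\<lambda>t. c1 t - c0 t) Wx" unfolding defs by (rule xrep_diff[OF c1(2) s1(1,2) c1(1) x0(1) s0(1,2) x0(2)])
  have xF: "xrep L T F (\<lambda>t. d1 t - d0 t) Fx" unfolding defs by (rule xrep_diff[OF d1(2) s1(5,6) d1(1) x0(3) s0(5,6) x0(4)])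
  have xWx: "hasx L T Wx Wxx" unfolding defs by (rule hasx_diff[OF h1(1) s1(2,3) h0(1) s0(2,3)])
  have xFx: "hasx L T Fx Fxx" unfolding defs by (rule hasx_diff[OF h1(3) s1(6,7) h0(3) s0(6,7)])
  have dint: "integrable (seg T) (\<lambda>t. d1 t - d0 t)" using d1(1) x0(4) by simp
  have bcW: "AE t in seg T. c1 t - c0 t = - (Ub * \<mu> * (d1 t - d0 t))" using bc0 bc1 by eventually_elim simp
  have bcWx: "AE t in seg T. (\<integral>x. Wx (x, t) \<partial>seg L) = Ub * \<mu> * (d1 t - d0 t)"
    using bc0 bc1 sq_int_slices(2)[OF s1(2)] sq_int_slices(2)[OF s0(2)]
  proof eventually_elim
    case (elim t)
    then show ?case
      using sq_int_integrable[OF finite_measure_seg elim(3)] sq_int_integrable[OF finite_measure_seg elim(4)] by (simp add: Wx_def)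
  qed
  have E1: "AE z in rect L T. Wt z + Ub * Wx z + Fx z - 2 * \<epsilon> * Wxx z = 2 * \<epsilon> * U0xx z"
    using eqs0(1) eqs1(1) by eventually_elim (simp add: Wt_def Wx_def Fx_def Wxx_def algebra_simps)
  have E2: "AE z in rect L T. \<mu> * Ft z + Ub * \<mu> * Fx z + Wx z = 0"
    using eqs0(2) eqs1(2)
  proof eventually_elim
    case (elim z)
    have "\<mu> * (Ft z + Ub * Fx z + inverse (lam\<^sup>2) * Wx z) = 0"
      using elim by (simp add: Ft_def Wx_def Fx_def algebra_simps)
    moreover have "\<mu> * (inverse (lam\<^sup>2) * Wx z) = Wx z" using pos by (simp add: \<mu>_def)
    ultimately show ?case unfolding distrib_left by (simp only: mult.left_commute[of \<mu> Ub] mult.assoc)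
  qed
  obtain p a b where p: "sq_int (seg T) p" "AE t in seg T. d1 t - d0 t = prim T p t" and
    ev: "evolution L T \<mu> Ub \<epsilon> (2 / r + 2 * r + 2 / r ^ 3) \<gamma> (layer_Q L r \<epsilon> 0) (\<lambda>t. Ub * \<mu> * p t) a b
      (layer_q L r \<epsilon>) (layer_q' L r \<epsilon>) (layer_Q L r \<epsilon>)
      (\<lambda>z. W z + layer_q L r \<epsilon> (fst z) * (Ub * \<mu> * prim T p (snd z)))
      (\<lambda>z. Wx z + layer_q' L r \<epsilon> (fst z) * (Ub * \<mu> * prim T p (snd z)))
      (\<lambda>z. Wxx z + (- (r / \<epsilon>) * layer_q' L r \<epsilon> (fst z)) * (Ub * \<mu> * prim T p (snd z)))
      (\<lambda>z. Wt z + layer_q L r \<epsilon> (fst z) * (Ub * \<mu> * p (snd z)))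
      (\<lambda>z. F z + layer_q L r \<epsilon> (fst z) * (- prim T p (snd z)))
      (\<lambda>z. Fx z + layer_q' L r \<epsilon> (fst z) * (- prim T p (snd z)))
      (\<lambda>z. Fxx z + (- (r / \<epsilon>) * layer_q' L r \<epsilon> (fst z)) * (- prim T p (snd z)))
      (\<lambda>z. Ft z + layer_q L r \<epsilon> (fst z) * (- p (snd z)))
      (\<lambda>z. Fxt z + layer_q' L r \<epsilon> (fst z) * (- p (snd z))) U0xx"
    using corrected_evolution[OF pos(1,2) \<mu> pos(4) \<epsilon> pos(5) r small \<gamma> sq s0(3) xW xWx xF xFx dint tW tF tFx bcW bcWx E1 E2] by blast
  \<comment> \<open>The viscous trace \<open>d1\<close> is zero, so \<open>p\<close> is tied to the
    limit solution only.\<close>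
  have pd: "AE t in seg T. - d0 t = prim T p t" using p(2) bc1 by eventually_elim simp
  define R where "R = energy_const \<mu> Ub (2 / r + 2 * r + 2 / r ^ 3) \<gamma> * (\<integral>t. (Ub * \<mu> * p t)\<^sup>2 \<partial>seg T) + (5 * \<gamma> + 8 * T) * (\<integral>z. (U0xx z)\<^sup>2 \<partial>rect L T)"
  define uc where "uc z = W z + layer_q L r \<epsilon> (fst z) * (Ub * \<mu> * prim T p (snd z))" for z
  define ucx where "ucx z = Wx z + layer_q' L r \<epsilon> (fst z) * (Ub * \<mu> * prim T p (snd z))" for z
  define vc where "vc z = F z + layer_q L r \<epsilon> (fst z) * (- prim T p (snd z))" for z
  define vcx where "vcx z = Fx z + layer_q' L r \<epsilon> (fst z) * (- prim T p (snd z))" for z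
  note cdefs = uc_def[abs_def, symmetric] ucx_def[abs_def, symmetric] vc_def[abs_def, symmetric] vcx_def[abs_def, symmetric]
  note ev = ev[unfolded cdefs]
  have cs: "sq_int (rect L T) uc" "sq_int (rect L T) ucx" "sq_int (rect L T) vc" "sq_int (rect L T) vcx"
    using evolution.sq(1,2,5,6)[OF ev] by auto
  have cx: "xrep L T uc (\<lambda>_. 0) ucx" "xrep L T vc (\<lambda>_. 0) vcx"
    using evolution.rep_u(1)[OF ev] evolution.rep_v[OF ev] by auto
  note est = evolution.estimates[OF ev, unfolded evolution.R_def[OF ev] R_def[symmetric]]
  have R0: "R \<ge> 0" unfolding R_def
    using evolution.energy_const_nonneg[OF ev] \<gamma> pos by (intro add_nonneg_nonneg mult_nonneg_nonneg) auto
  have wae: "AE z in rect L T. w z = uc z" and yae: "AE z in rect L T. y z = vc z"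
  proof -
    \<comment> \<open>The corrector is defined through the trace of u^0; the inflow condition
      rewrites it in terms of the primitive of \<open>p\<close>, as used in \<open>uc\<close> and
      \<open>vc\<close>.\<close>
    have T: "AE z in rect L T. trace L (\<lambda>x. u0 (x, snd z)) 0 = Ub * \<mu> * prim T p (snd z)"
    proof (rule AE_rect_snd)
      show "AE t in seg T. trace L (\<lambda>x. u0 (x, t)) 0 = Ub * \<mu> * prim T p t"
        using tr0(3) bc0 pd
      proof eventually_elim
        case (elim t)
        have "prim T p t = - d0 t" using elim(3) by simp
        then show ?case using elim(1,2) by simp
      qed
    qed
    show "AE z in rect L T. w z = uc z"
      using T e0(1) e1(1)
    proof eventually_elim
      case (elim z)
      then show ?case by (cases z) (simp add: w uc_def W_def theta_u_layer r_def)
    qed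
    show "AE z in rect L T. y z = vc z"
      using T e0(2) e1(2)
    proof eventually_elim
      case (elim z)
      have "inverse Ub * inverse (lam\<^sup>2) * (q * (Ub * \<mu> * s)) = q * s" for q s :: real
        using pos by (simp add: \<mu>_def field_simps)
      with elim show ?case by (cases z) (simp add: y vc_def F_def theta_psi_layer r_def)
    qed
  qed
  have weak: "weak_x L T w ucx" "weak_x L T y vcx"
    by (rule xrep_imp_weak_x[OF cx(1) _ cs(1) wae cs(2) pos(1,2)], simp)
      (rule xrep_imp_weak_x[OF cx(2) _ cs(3) yae cs(4) pos(1,2)], simp)
  have sc: "sqrt (a * (\<epsilon>\<^sup>2 * R)) = \<epsilon> * sqrt (a * R)" for a
    using \<epsilon> by (simp add: real_sqrt_mult)
  have n1: "Linf_L2_norm L T w \<le> ennreal (\<epsilon> * (4 * sqrt R))"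
    using Linf_L2_norm_le[OF cs(1) wae est(1)] \<epsilon> by (simp add: real_sqrt_mult mult_ac)
  have n2: "Linf_L2_norm L T y \<le> ennreal (\<epsilon> * sqrt (8 * R / \<mu>))"
    using Linf_L2_norm_le[OF cs(3) yae est(2)] sc[of "8 / \<mu>"] by simp
  have n3: "ennreal (sqrt \<epsilon>) * L2_norm (Q L T) ucx \<le> ennreal (\<epsilon> * sqrt (4 * R))"
  proof -
    have "sqrt \<epsilon> * sqrt (\<integral>z. (ucx z)\<^sup>2 \<partial>rect L T) \<le> sqrt (4 * (\<epsilon>\<^sup>2 * R))"
      unfolding real_sqrt_mult[symmetric] by (rule real_sqrt_le_mono) (use est(3) in simp)
    then show ?thesis unfolding L2_norm_rect[OF cs(2) AE_I2[OF refl]] sc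
      using \<epsilon> by (simp add: ennreal_mult[symmetric] ennreal_leI)
  qed
  have n4: "ennreal (sqrt \<epsilon>) * L2_norm (Q L T) vcx \<le> ennreal (\<epsilon> * sqrt (32 * R / \<gamma>))"
  proof -
    have "sqrt \<epsilon> * sqrt (\<integral>z. (vcx z)\<^sup>2 \<partial>rect L T) \<le> sqrt (32 / \<gamma> * (\<epsilon>\<^sup>2 * R))"
      unfolding real_sqrt_mult[symmetric] by (rule real_sqrt_le_mono) (use est(4) in simp)
    then show ?thesis unfolding L2_norm_rect[OF cs(4) AE_I2[OF refl]] sc
      using \<epsilon> by (simp add: ennreal_mult[symmetric] ennreal_leI)
  qed
  have sup: "Linf_Linf_norm L T w' \<le> ennreal (sqrt \<epsilon> * sqrt B)"
    if "sq_int (rect L T) f" "AE z in rect L T. w' z = f z" "AE z in rect L T. \<epsilon> * (f z)\<^sup>2 \<le> \<epsilon>\<^sup>2 * B" for f w' B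
  proof (rule Linf_Linf_norm_le[OF sq_int_rect_borel[OF that(1)] that(2)])
    show "AE z in rect L T. \<bar>f z\<bar> \<le> sqrt \<epsilon> * sqrt B"
      using that(3)
    proof eventually_elim
      case (elim z)
      then have "\<epsilon> * (f z)\<^sup>2 \<le> \<epsilon> * (\<epsilon> * B)" by (simp add: power2_eq_square)
      then have "(f z)\<^sup>2 \<le> \<epsilon> * B" using \<epsilon> by simp
      then have "sqrt ((f z)\<^sup>2) \<le> sqrt (\<epsilon> * B)" by (rule real_sqrt_le_mono)
      then show ?case by (simp add: real_sqrt_mult)
    qed
  qed
  have n5: "Linf_Linf_norm L T w \<le> ennreal (sqrt \<epsilon> * sqrt (2 * (8 * R + 16 * R / \<gamma>)))"
    by (rule sup[OF cs(1) wae]) (use est(5) in \<open>simp add: algebra_simps\<close>)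
  have n6: "Linf_Linf_norm L T y \<le> ennreal (sqrt \<epsilon> * sqrt (2 * (4 * R / \<mu> + 4 * R / (\<gamma> * \<mu>))))"
    by (rule sup[OF cs(3) yae]) (use est(6) in \<open>simp add: algebra_simps\<close>)
  have nn: "0 \<le> 8 * R / \<mu>" "0 \<le> 4 * R" "0 \<le> 32 * R / \<gamma>" "0 \<le> 2 * (8 * R + 16 * R / \<gamma>)" "0 \<le> 2 * (4 * R / \<mu> + 4 * R / (\<gamma> * \<mu>))"
    using R0 \<gamma> \<mu> by auto
  have "Linf_L2_norm L T w + Linf_L2_norm L T y + ennreal (sqrt \<epsilon>) * (L2_norm (Q L T) ucx + L2_norm (Q L T) vcx) \<le>
    ennreal (\<epsilon> * (4 * sqrt R)) + ennreal (\<epsilon> * sqrt (8 * R / \<mu>)) + (ennreal (\<epsilon> * sqrt (4 * R)) + ennreal (\<epsilon> * sqrt (32 * R / \<gamma>)))"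
    unfolding distrib_left by (intro add_mono n1 n2 n3 n4)
  also have "\<dots> = ennreal (\<epsilon> * (4 * sqrt R) + \<epsilon> * sqrt (8 * R / \<mu>) + (\<epsilon> * sqrt (4 * R) + \<epsilon> * sqrt (32 * R / \<gamma>)))"
    using \<epsilon> R0 nn by (simp add: ennreal_plus[symmetric] del: ennreal_plus)
  also have "\<dots> \<le> ennreal (rate_const \<mu> \<gamma> R * \<epsilon>)"
  proof (rule ennreal_leI)
    have "0 \<le> \<epsilon> * sqrt (2 * (8 * R + 16 * R / \<gamma>)) + \<epsilon> * sqrt (2 * (4 * R / \<mu> + 4 * R / (\<gamma> * \<mu>)))"
      by (intro add_nonneg_nonneg[OF mult_nonneg_nonneg mult_nonneg_nonneg] real_sqrt_ge_zero nn) (use \<epsilon> in auto)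
    then show "\<epsilon> * (4 * sqrt R) + \<epsilon> * sqrt (8 * R / \<mu>) + (\<epsilon> * sqrt (4 * R) + \<epsilon> * sqrt (32 * R / \<gamma>)) \<le> rate_const \<mu> \<gamma> R * \<epsilon>"
      unfolding rate_const_def by (simp only: mult.commute[of _ \<epsilon>] distrib_left)
  qed
  finally have A: "Linf_L2_norm L T w + Linf_L2_norm L T y + ennreal (sqrt \<epsilon>) * (L2_norm (Q L T) ucx + L2_norm (Q L T) vcx) \<le> ennreal (rate_const \<mu> \<gamma> R * \<epsilon>)" .
  have "Linf_Linf_norm L T w + Linf_Linf_norm L T y \<le>
      ennreal (sqrt \<epsilon> * sqrt (2 * (8 * R + 16 * R / \<gamma>))) + ennreal (sqrt \<epsilon> * sqrt (2 * (4 * R / \<mu> + 4 * R / (\<gamma> * \<mu>))))"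
    by (intro add_mono n5 n6)
  also have "\<dots> = ennreal (sqrt \<epsilon> * sqrt (2 * (8 * R + 16 * R / \<gamma>)) + sqrt \<epsilon> * sqrt (2 * (4 * R / \<mu> + 4 * R / (\<gamma> * \<mu>))))"
    by (intro ennreal_plus[symmetric] mult_nonneg_nonneg real_sqrt_ge_zero nn) (use \<epsilon> in auto)
  also have "\<dots> \<le> ennreal (rate_const \<mu> \<gamma> R * sqrt \<epsilon>)"
  proof (rule ennreal_leI)
    have "0 \<le> sqrt \<epsilon> * (4 * sqrt R) + sqrt \<epsilon> * sqrt (8 * R / \<mu>) + sqrt \<epsilon> * sqrt (4 * R) + sqrt \<epsilon> * sqrt (32 * R / \<gamma>)"
      using \<epsilon> R0 nn by (intro add_nonneg_nonneg mult_nonneg_nonneg real_sqrt_ge_zero) auto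
    then show "sqrt \<epsilon> * sqrt (2 * (8 * R + 16 * R / \<gamma>)) + sqrt \<epsilon> * sqrt (2 * (4 * R / \<mu> + 4 * R / (\<gamma> * \<mu>))) \<le> rate_const \<mu> \<gamma> R * sqrt \<epsilon>"
      unfolding rate_const_def by (simp only: mult.commute[of _ "sqrt \<epsilon>"] distrib_left)
  qed
  finally have B: "Linf_Linf_norm L T w + Linf_Linf_norm L T y \<le> ennreal (rate_const \<mu> \<gamma> R * sqrt \<epsilon>)" .
  show ?thesis
    by (rule that[OF p(1) pd R_def _ B]) (use weak A in blast)
qed

theorem theorem1p1:
  fixes L T lam Ubar :: real
    and f g :: "real \<times> real \<Rightarrow> real"
    and u_init \<psi>_init :: "real \<Rightarrow> real"
    and u \<psi> :: "real \<Rightarrow> real \<times> real \<Rightarrow> real"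
    and u0 \<psi>0 :: "real \<times> real \<Rightarrow> real"
    and U \<Psi> :: "real \<Rightarrow> real \<times> real \<Rightarrow> real"
  assumes "L > 0" "T > 0" "lam > 0" "Ubar > 0" "Ubar < inverse lam"
    and viscous: "\<forall>\<^sub>F \<epsilon> in at_right 0.
      (u \<epsilon>, \<psi> \<epsilon>) \<in> space_K L T \<and>
      viscous_solution L T lam Ubar f g u_init \<psi>_init \<epsilon> (u \<epsilon>) (\<psi> \<epsilon>)"
    and limit: "(u0, \<psi>0) \<in> space_K0 L T lam Ubar"
      "limit_solution L T lam Ubar f g u_init \<psi>_init u0 \<psi>0"
    and U_def: "\<And>\<epsilon> z. U \<epsilon> z = u \<epsilon> z - u0 z - theta_u L lam Ubar u0 \<epsilon> z"
    and Psi_def: "\<And>\<epsilon> z. \<Psi> \<epsilon> z = \<psi> \<epsilon> z - \<psi>0 z - theta_psi L lam Ubar u0 \<epsilon> z"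
  shows "\<exists>\<epsilon>0>0. \<exists>C::real. \<forall>\<epsilon>\<in>{0<..\<epsilon>0}.
    (\<exists>Ux \<Psi>x. weak_x L T (U \<epsilon>) Ux \<and> weak_x L T (\<Psi> \<epsilon>) \<Psi>x \<and>
      Linf_L2_norm L T (U \<epsilon>) + Linf_L2_norm L T (\<Psi> \<epsilon>)
        + ennreal (sqrt \<epsilon>) * (L2_norm (Q L T) Ux + L2_norm (Q L T) \<Psi>x) \<le> ennreal (C * \<epsilon>)) \<and>
    Linf_Linf_norm L T (U \<epsilon>) + Linf_Linf_norm L T (\<Psi> \<epsilon>) \<le> ennreal (C * sqrt \<epsilon>)"
proof -
  note pos = assms(1-4)
  define \<mu> where "\<mu> = lam\<^sup>2"
  define r where "r = layer_rate lam Ubar"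
  have \<mu>: "\<mu> > 0" using pos by (simp add: \<mu>_def)
  have sub: "Ubar\<^sup>2 * \<mu> < 1"
  proof -
    have "Ubar * lam < 1" using assms(3,5) by (simp add: field_simps)
    then have "(Ubar * lam)\<^sup>2 < 1\<^sup>2" using pos by (intro power_strict_mono) auto
    then show ?thesis by (simp add: \<mu>_def power_mult_distrib)
  qed
  have r2: "2 * r * (Ubar * \<mu>) = 1 - Ubar\<^sup>2 * \<mu>"
    using pos \<mu> by (simp add: r_def layer_rate_def \<mu>_def field_simps power2_eq_square)
  have r: "r > 0"
  proof (rule ccontr)
    assume "\<not> r > 0"
    then have "r * (Ubar * \<mu>) \<le> 0" using pos \<mu> by (intro mult_nonpos_nonneg mult_nonneg_nonneg) auto
    then show False using r2 sub by linarith
  qed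
  define c where "c = 2 / (Ubar * \<mu>) * (1 / L + 8 / (Ubar * \<mu>)) + 1 / \<mu> + 1 / 2 + Ubar\<^sup>2 / 4"
  have c: "c > 0" unfolding c_def using pos \<mu> by (intro add_pos_pos mult_pos_pos add_pos_nonneg) auto
  \<comment> \<open>The first bound controls the cross term of the energy, the second the u_x-terms;
    both are independent of \<epsilon>.\<close>
  define \<gamma> where "\<gamma> = min (\<mu> / 2) (1 / (2 * c))"
  have \<gamma>: "\<gamma> > 0" "\<gamma> \<le> \<mu> / 2" "\<gamma> * c \<le> 1 / 2"
  proof -
    show "\<gamma> > 0" "\<gamma> \<le> \<mu> / 2" using \<mu> c by (auto simp: \<gamma>_def)
    have "\<gamma> * c \<le> 1 / (2 * c) * c" using c by (intro mult_right_mono) (auto simp: \<gamma>_def)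
    then show "\<gamma> * c \<le> 1 / 2" using c by simp
  qed
  obtain U0 U0x U0xx U0t P0 P0x P0xx P0t P0xt where reps0: "reps L T u0 \<psi>0 U0 U0x U0xx U0t P0 P0x P0xx P0t P0xt"
    using space_K0_reps(1)[OF pos(1,2) limit(1)] by blast
  note C0 = space_K0_reps(2,3)[OF pos(1,2) limit(1)]
  obtain c0 where c0: "integrable (seg T) c0" "xrep L T U0 c0 U0x" using reps0 unfolding reps_def hasx_def by blast
  obtain d0 where d0: "integrable (seg T) d0" "xrep L T P0 d0 P0x" using reps0 unfolding reps_def hasx_def by blast
  have "((\<lambda>\<epsilon>. exp (- r * L / \<epsilon>)) \<longlongrightarrow> 0) (at_right 0)"
  proof -
    have "filterlim (\<lambda>\<epsilon>. (r * L) * inverse \<epsilon>) at_top (at_right 0)"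
      using filterlim_tendsto_pos_mult_at_top[OF tendsto_const _ filterlim_inverse_at_top_right, of "r * L"] r pos by simp
    then have "filterlim (\<lambda>\<epsilon>. - ((r * L) * inverse \<epsilon>)) at_bot (at_right 0)"
      by (simp add: filterlim_uminus_at_bot)
    from filterlim_compose[OF exp_at_bot this] show ?thesis by (simp add: divide_inverse)
  qed
  then have "\<forall>\<^sub>F \<epsilon> in at_right 0. exp (- r * L / \<epsilon>) < 1 / 2" by (rule order_tendstoD) simp
  moreover have "\<forall>\<^sub>F \<epsilon> in at_right (0::real). \<epsilon> < 1" unfolding eventually_at_right_field by (intro exI[of _ 1]) auto
  ultimately have "\<forall>\<^sub>F \<epsilon> in at_right 0. ((u \<epsilon>, \<psi> \<epsilon>) \<in> space_K L T \<and> viscous_solution L T lam Ubar f g u_init \<psi>_init \<epsilon> (u \<epsilon>) (\<psi> \<epsilon>)) \<and>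
      exp (- r * L / \<epsilon>) < 1 / 2 \<and> \<epsilon> < 1"
    using viscous by eventually_elim simp
  then obtain e where e: "e > 0" "\<And>\<epsilon>. 0 < \<epsilon> \<Longrightarrow> \<epsilon> < e \<Longrightarrow>
      ((u \<epsilon>, \<psi> \<epsilon>) \<in> space_K L T \<and> viscous_solution L T lam Ubar f g u_init \<psi>_init \<epsilon> (u \<epsilon>) (\<psi> \<epsilon>)) \<and>
      exp (- r * L / \<epsilon>) < 1 / 2 \<and> \<epsilon> < 1"
    unfolding eventually_at_right_field by auto
  define R where "R p = energy_const \<mu> Ubar (2 / r + 2 * r + 2 / r ^ 3) \<gamma> * (\<integral>t. (Ubar * \<mu> * p t)\<^sup>2 \<partial>seg T)
    + (5 * \<gamma> + 8 * T) * (\<integral>z. (U0xx z)\<^sup>2 \<partial>rect L T)" for p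
  have main: "\<exists>p. sq_int (seg T) p \<and> (AE t in seg T. - d0 t = prim T p t) \<and>
     (\<exists>Ux \<Psi>x. weak_x L T (U \<epsilon>) Ux \<and> weak_x L T (\<Psi> \<epsilon>) \<Psi>x \<and>
      Linf_L2_norm L T (U \<epsilon>) + Linf_L2_norm L T (\<Psi> \<epsilon>)
        + ennreal (sqrt \<epsilon>) * (L2_norm (Q L T) Ux + L2_norm (Q L T) \<Psi>x) \<le> ennreal (rate_const \<mu> \<gamma> (R p) * \<epsilon>)) \<and>
    Linf_Linf_norm L T (U \<epsilon>) + Linf_Linf_norm L T (\<Psi> \<epsilon>) \<le> ennreal (rate_const \<mu> \<gamma> (R p) * sqrt \<epsilon>)"
    if \<epsilon>: "0 < \<epsilon>" "\<epsilon> < e" for \<epsilon>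
  proof -
    note E = e(2)[OF \<epsilon>]
    show ?thesis
      by (rule single_estimate[OF pos r[unfolded r_def] r2[unfolded r_def \<mu>_def] \<epsilon>(1) _ _ \<gamma>(1) \<gamma>(2)[unfolded \<mu>_def] \<gamma>(3)[unfolded c_def \<mu>_def]
        reps0 C0 limit(2) c0(2,1) d0(2,1) conjunct1[OF conjunct1[OF E]] conjunct2[OF conjunct1[OF E]] U_def Psi_def])
        (use E in \<open>auto simp: R_def r_def \<mu>_def\<close>)
  qed
  obtain p1 where p1: "sq_int (seg T) p1" "AE t in seg T. - d0 t = prim T p1 t"
    using main[of "e / 2"] e(1) by auto
  \<comment> \<open>The function \<open>p\<close> is the time derivative of the trace of \<open>- \<psi>\<^sup>0\<close>, hence does not depend on \<open>\<epsilon>\<close>.\<close>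
  have same: "R p = R p1" if p: "sq_int (seg T) p" "AE t in seg T. - d0 t = prim T p t" for p
  proof -
    note i = sq_int_integrable[OF finite_measure_seg p(1)] sq_int_integrable[OF finite_measure_seg p1(1)]
    have "AE t in seg T. 0 + prim T (\<lambda>t. p t - p1 t) t = 0"
      using p(2) p1(2) by eventually_elim (simp add: prim_diff[OF i])
    from prim_eq_zero(2)[OF _ pos(2) this] i have "AE t in seg T. p t = p1 t" by (auto elim!: eventually_mono)
    then have "(\<integral>t. (Ubar * \<mu> * p t)\<^sup>2 \<partial>seg T) = (\<integral>t. (Ubar * \<mu> * p1 t)\<^sup>2 \<partial>seg T)"
      using sq_int_seg_borel[OF p(1)] sq_int_seg_borel[OF p1(1)] by (intro integral_cong_AE) auto
    then show ?thesis by (simp add: R_def)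
  qed
  \<comment> \<open>The assumptions hold on the open interval (0, e), whereas a closed right end is
    required; hence e / 2.\<close>
  show ?thesis
  proof (rule exI[of _ "e / 2"], rule conjI, use e in simp, rule exI[of _ "rate_const \<mu> \<gamma> (R p1)"], rule ballI, rule conjI)
    fix \<epsilon> assume "\<epsilon> \<in> {0<..e / 2}"
    then have \<epsilon>: "0 < \<epsilon>" "\<epsilon> < e" by auto
    obtain p where p: "sq_int (seg T) p" "AE t in seg T. - d0 t = prim T p t" and
      est: "\<exists>Ux \<Psi>x. weak_x L T (U \<epsilon>) Ux \<and> weak_x L T (\<Psi> \<epsilon>) \<Psi>x \<and>
        Linf_L2_norm L T (U \<epsilon>) + Linf_L2_norm L T (\<Psi> \<epsilon>)
          + ennreal (sqrt \<epsilon>) * (L2_norm (Q L T) Ux + L2_norm (Q L T) \<Psi>x) \<le> ennreal (rate_const \<mu> \<gamma> (R p) * \<epsilon>)"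
      "Linf_Linf_norm L T (U \<epsilon>) + Linf_Linf_norm L T (\<Psi> \<epsilon>) \<le> ennreal (rate_const \<mu> \<gamma> (R p) * sqrt \<epsilon>)"
      using main[OF \<epsilon>] by blast
    note est = est[unfolded same[OF p]]
    show "\<exists>Ux \<Psi>x. weak_x L T (U \<epsilon>) Ux \<and> weak_x L T (\<Psi> \<epsilon>) \<Psi>x \<and>
        Linf_L2_norm L T (U \<epsilon>) + Linf_L2_norm L T (\<Psi> \<epsilon>)
          + ennreal (sqrt \<epsilon>) * (L2_norm (Q L T) Ux + L2_norm (Q L T) \<Psi>x) \<le> ennreal (rate_const \<mu> \<gamma> (R p1) * \<epsilon>)"
      by (rule est(1))
    show "Linf_Linf_norm L T (U \<epsilon>) + Linf_Linf_norm L T (\<Psi> \<epsilon>) \<le> ennreal (rate_const \<mu> \<gamma> (R p1) * sqrt \<epsilon>)"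
      by (rule est(2))
  qed
qed

end
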